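(* Provided $h$ is sufficiently small, the problem $$\text{find } u_h\in W_h \text{ such that } a_h(u_h,v)=F_h(v)\quad\forall v\in V_h$$ has a unique solution. Moreover there exists a constant $\alpha>0$ independent of $h$ such that $$\forall w\in W_h\setminus\{0\},\qquad \sup_{v\in V_h\setminus\{0\}}\frac{a_h(w,v)}{\|\mathbf{grad}\,w\|_{0,h}\,\|\mathbf{grad}\,v\|_{0,h}}\ \ge\ \alpha .$$
   Context: Setting. $k\ge 2$ is an integer. $\Omega\subset\mathbb R^2$ is a smooth domain with boundary $\Gamma$. The continuous problem being approximated is the convection-diffusion equation $-\nu\Delta u+\mathbf b\cdot\mathbf{grad}\,u=f$ in $\Omega$, $u=0$ on $\Gamma$, where $\nu>0$ is the (constant) diffusion coefficient, $\mathbf b\in[L^\infty(\Omega)]^2$ is a given convective velocity assumed to be divergence free, and $f\in H^{k-1}(\Omega)$. Both $\mathbf b$ and $\Gamma$ are required to be sufficiently smooth, at least of the $C^{k-1}$-class. $f$ is extended to $\Omega_h\setminus\Omega$ (with $\Omega_h$ defined below), and the resulting function defined in $\Omega\cup\Omega_h$ is still denoted by $f$. Meshes. $\mathcal T_h$ is a mesh consisting of closed straight-edged triangles satisfying the usual compatibility conditions and fitting $\Omega$ in such a way that all the vertexes of the polygon $\Omega_h:=\bigcup_{T\in\mathcal T_h}T$ lying on its boundary $\Gamma_h$ belong to $\Gamma$. $\mathcal T_h$ belongs to a uniformly regular family of partitions (in the usual sense of finite element theory). $h_T$ is the diameter of $T\in\mathcal T_h$ and $h:=\max_{T\in\mathcal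 T_h}h_T$. No element of $\mathcal T_h$ has more than one edge on $\Gamma_h$. The mesh is constructed so that convex and concave portions of $\Gamma$ correspond to convex and concave portions of $\Gamma_h$ (which is guaranteed if the points separating such portions of $\Gamma$ are vertexes of $\Omega_h$). $\mathcal S_h\subset\mathcal T_h$ is the subset of triangles having one edge on $\Gamma_h$; for $T\in\mathcal S_h$, $e_T$ is this edge (its end-points belong to $\Gamma$), $O_T$ is the vertex of $T$ opposite to $e_T$ (not belonging to $\Gamma$), and $\Delta_T$ is the closed set delimited by $\Gamma$ and $e_T$. Spaces. $V_h$ is the standard Lagrange finite element space of continuous functions $v$ defined in $\Omega_h$ that vanish on $\Gamma_h$ and whose restriction to every $T\in\mathcal T_h$ is a polynomial of degree at most $k$; each $v\in V_h$ is extended by zero to $\Omega\setminus\Omega_h$. $W_h$ is the space of functions $w$ defined in $\Omega_h$ such that: (1) the restriction of $w$ to every $T\in\mathcal T_h$ is a polynomial of degree at most $k$; (2) $w$ is continuous in $\Omega_h$ and vanishes at the vertexes of $\Gamma_h$; (3) $w$ is extended to $\Omega\setminus\Omega_h$ in such a way that its polynomial expression in $T\in\mathcal S_h$ also applies to points in $\Delta_T$; (4) for all $T\in\mathcal S_h$, $w(P)=0$ for every $P$ among the $k-1$ nearest intersections with $\Gamma$ of the line passing through $O_T$ and the points $M$, different from vertexes of $T$, subdividing $e_T$ into $k$ segments of equal length (one point $P$ for each of the $k-1$ points $M$). Forms and norm. $a_h(w,v):=\int_{\Omega_h}[\nu\,\mathbf{grad}\,w\cdot\mathbf{grad}\,v+(\mathbf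 b\cdot\mathbf{grad}\,w)\,v]$ and $F_h(v):=\int_{\Omega_h}f v$. $\|\cdot\|_{0,h}$ is the standard norm of $L^2(\Omega_h)$. *)

theory Defs
  imports "HOL-Analysis.Analysis"
begin

section \<open>Regularity classes\<close>

text \<open>Intended for open \<open>S\<close>.\<close>

primrec Ck_on :: "nat \<Rightarrow> ('a::euclidean_space \<Rightarrow> 'b::real_normed_vector) \<Rightarrow> 'a set \<Rightarrow> bool" where
  "Ck_on 0 f S \<longleftrightarrow> continuous_on S f"
| "Ck_on (Suc m) f S \<longleftrightarrow>
     (\<forall>x\<in>S. f differentiable (at x)) \<and>
     (\<forall>i\<in>Basis. Ck_on m (\<lambda>x. frechet_derivative f (at x) i) S)"

text \<open>
  For a continuous, piecewise polynomial function the classical gradient exists off the mesh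
  skeleton, a null set, and represents the weak gradient.
\<close>

definition grad :: "(real^2 \<Rightarrow> real) \<Rightarrow> real^2 \<Rightarrow> real^2" where
  "grad w x = (\<chi> i. frechet_derivative w (at x) (axis i 1))"

definition divergence :: "(real^2 \<Rightarrow> real^2) \<Rightarrow> real^2 \<Rightarrow> real" where
  "divergence b x = (\<Sum>i\<in>UNIV. frechet_derivative b (at x) (axis i 1) $ i)"

text \<open>
  A bounded domain whose boundary is, near each of its points, a regular level set of a
  \<open>C\<^sup>m\<close> function with the domain on one side (meaningful for \<open>m \<ge> 1\<close>).
\<close>

definition smooth_domain :: "nat \<Rightarrow> (real^2) set \<Rightarrow> bool" where
  "smooth_domain m \<Omega> \<longleftrightarrow>
     open \<Omega> \<and> connected \<Omega> \<and> bounded \<Omega> \<and> \<Omega> \<noteq> {} \<and>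
     (\<forall>p\<in>frontier \<Omega>. \<exists>U \<phi>. open U \<and> p \<in> U \<and> Ck_on m \<phi> U \<and> (\<forall>x\<in>U. grad \<phi> x \<noteq> 0) \<and>
        \<Omega> \<inter> U = {x\<in>U. \<phi> x < 0} \<and> frontier \<Omega> \<inter> U = {x\<in>U. \<phi> x = 0})"

definition Linf_on :: "(real^2) set \<Rightarrow> (real^2 \<Rightarrow> real^2) \<Rightarrow> bool" where
  "Linf_on S b \<longleftrightarrow>
     b \<in> borel_measurable (lebesgue_on S) \<and> (\<exists>B. AE x in lebesgue_on S. norm (b x) \<le> B)"

definition L2_on :: "(real^2) set \<Rightarrow> (real^2 \<Rightarrow> real) \<Rightarrow> bool" where
  "L2_on S f \<longleftrightarrow>
     f \<in> borel_measurable (lebesgue_on S) \<and> integrable (lebesgue_on S) (\<lambda>x. (f x)\<^sup>2)"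

definition test_function :: "(real^2) set \<Rightarrow> (real^2 \<Rightarrow> real) \<Rightarrow> bool" where
  "test_function S \<phi> \<longleftrightarrow>
     (\<forall>m. Ck_on m \<phi> UNIV) \<and> (\<exists>K. compact K \<and> K \<subseteq> S \<and> (\<forall>x. x \<notin> K \<longrightarrow> \<phi> x = 0))"

definition weak_partial ::
  "(real^2) set \<Rightarrow> 2 \<Rightarrow> (real^2 \<Rightarrow> real) \<Rightarrow> (real^2 \<Rightarrow> real) \<Rightarrow> bool" where
  "weak_partial S i f g \<longleftrightarrow>
     (\<forall>\<phi>. test_function S \<phi> \<longrightarrow>
        (LINT x|lebesgue_on S. f x * grad \<phi> x $ i) = - (LINT x|lebesgue_on S. g x * \<phi> x))"

text \<open>The Sobolev space \<open>H\<^sup>m(S) = W\<^sup>m\<^sup>,\<^sup>2(S)\<close>, for open \<open>S\<close>.\<close>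

primrec Hm_on :: "nat \<Rightarrow> (real^2) set \<Rightarrow> (real^2 \<Rightarrow> real) \<Rightarrow> bool" where
  "Hm_on 0 S f \<longleftrightarrow> L2_on S f"
| "Hm_on (Suc m) S f \<longleftrightarrow> L2_on S f \<and> (\<forall>i. \<exists>g. weak_partial S i f g \<and> Hm_on m S g)"


section \<open>Meshes\<close>

text \<open>
  A mesh is a set \<open>\<T>\<close> of closed triangles.  The polygon \<open>\<Omega>\<^sub>h\<close> is \<open>\<Union>\<T>\<close> and its boundary \<open>\<Gamma>\<^sub>h\<close> is
  \<open>frontier (\<Union>\<T>)\<close>; similarly \<open>\<Gamma> = frontier \<Omega>\<close>.
\<close>

definition mesh_size :: "(real^2) set set \<Rightarrow> real" where
  "mesh_size \<T> = Max (diameter ` \<T>)"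

definition mesh_vertices :: "(real^2) set set \<Rightarrow> (real^2) set" where
  "mesh_vertices \<T> = {v. \<exists>T\<in>\<T>. v extreme_point_of T}"

definition boundary_edge :: "(real^2) set set \<Rightarrow> (real^2) set \<Rightarrow> (real^2) set \<Rightarrow> bool" where
  "boundary_edge \<T> T e \<longleftrightarrow> e edge_of T \<and> e \<subseteq> frontier (\<Union>\<T>)"

text \<open>\<open>\<S>\<^sub>h\<close>, \<open>e\<^sub>T\<close> and \<open>O\<^sub>T\<close>; the last two are used for \<open>T \<in> \<S>\<^sub>h\<close> only.\<close>

definition boundary_triangles :: "(real^2) set set \<Rightarrow> (real^2) set set" where
  "boundary_triangles \<T> = {T\<in>\<T>. \<exists>e. boundary_edge \<T> T e}"

definition edge_e :: "(real^2) set set \<Rightarrow> (real^2) set \<Rightarrow> (real^2) set" where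
  "edge_e \<T> T = (THE e. boundary_edge \<T> T e)"

definition vertex_O :: "(real^2) set set \<Rightarrow> (real^2) set \<Rightarrow> real^2" where
  "vertex_O \<T> T = (THE v. v extreme_point_of T \<and> v \<notin> edge_e \<T> T)"

text \<open>
  The end-points of \<open>e\<close> are in general joined by two arcs of the same closed curve of \<open>\<Gamma>\<close>;
  the one that delimits the skin region is the smaller one.
\<close>

definition joining_arc :: "(real^2) set \<Rightarrow> (real^2) set \<Rightarrow> (real^2) set \<Rightarrow> bool" where
  "joining_arc \<Gamma> e A \<longleftrightarrow>
     (\<exists>g. arc g \<and> path_image g = A \<and> A \<subseteq> \<Gamma> \<and>
        {pathstart g, pathfinish g} = {x. x extreme_point_of e})"

definition cut_off_arc :: "(real^2) set \<Rightarrow> (real^2) set \<Rightarrow> (real^2) set \<Rightarrow> bool" where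
  "cut_off_arc \<Gamma> e A \<longleftrightarrow>
     joining_arc \<Gamma> e A \<and> (\<forall>B. joining_arc \<Gamma> e B \<longrightarrow> diameter A \<le> diameter B)"

text \<open>\<open>\<Delta>\<^sub>T\<close>; the union has a single member once the mesh is fine enough.\<close>

definition skin :: "(real^2) set \<Rightarrow> (real^2) set set \<Rightarrow> (real^2) set \<Rightarrow> (real^2) set" where
  "skin \<Omega> \<T> T =
     (let e = edge_e \<T> T in \<Union>{e \<union> A \<union> inside (e \<union> A) | A. cut_off_arc (frontier \<Omega>) e A})"

text \<open>
  The last clause expresses the matching of convex and concave portions of \<open>\<Gamma>\<close> and \<open>\<Gamma>\<^sub>h\<close>: the
  arc of \<open>\<Gamma>\<close> cut off by a boundary edge bulges in one direction, out of the polygon (convex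
  portion, \<open>\<Delta>\<^sub>T\<close> in the closure of \<open>\<Omega>\<close>) or into it (concave portion, \<open>\<Delta>\<^sub>T\<close> disjoint from \<open>\<Omega>\<close>).
\<close>

definition fitted_mesh :: "(real^2) set \<Rightarrow> (real^2) set set \<Rightarrow> bool" where
  "fitted_mesh \<Omega> \<T> \<longleftrightarrow>
     triangulation \<T> \<and> \<T> \<noteq> {} \<and> (\<forall>T\<in>\<T>. 2 simplex T) \<and>
     (\<forall>v\<in>mesh_vertices \<T>. v \<in> frontier (\<Union>\<T>) \<longrightarrow> v \<in> frontier \<Omega>) \<and>
     (\<forall>v\<in>mesh_vertices \<T>. v \<notin> frontier (\<Union>\<T>) \<longrightarrow> v \<in> \<Omega>) \<and>
     (\<forall>T\<in>\<T>. \<forall>e e'. boundary_edge \<T> T e \<and> boundary_edge \<T> T e' \<longrightarrow> e = e') \<and>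
     (\<forall>T\<in>boundary_triangles \<T>. vertex_O \<T> T \<notin> frontier \<Omega>) \<and>
     (\<forall>T\<in>boundary_triangles \<T>. convex (skin \<Omega> \<T> T) \<and>
        (skin \<Omega> \<T> T \<subseteq> closure \<Omega> \<or> skin \<Omega> \<T> T \<inter> \<Omega> = {}))"

definition inscribed_diameter :: "(real^2) set \<Rightarrow> real" where
  "inscribed_diameter T = Sup {2 * r | r. 0 \<le> r \<and> (\<exists>c. cball c r \<subseteq> T)}"

definition uniformly_regular :: "(real^2) set set set \<Rightarrow> bool" where
  "uniformly_regular \<F> \<longleftrightarrow>
     (\<exists>\<sigma>>0. \<forall>\<T>\<in>\<F>. \<forall>T\<in>\<T>. diameter T \<le> \<sigma> * inscribed_diameter T)"


section \<open>Finite element spaces\<close>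

definition Pk :: "nat \<Rightarrow> (real^2 \<Rightarrow> real) set" where
  "Pk k = {p. \<exists>c::nat \<Rightarrow> nat \<Rightarrow> real. \<forall>x. p x = (\<Sum>i\<le>k. \<Sum>j\<le>k - i. c i j * (x $ 1) ^ i * (x $ 2) ^ j)}"

text \<open>
  Elements of \<open>V\<^sub>h\<close> and \<open>W\<^sub>h\<close> are represented by total functions; to make the representative
  unique they are zero wherever the function is not otherwise defined.
\<close>

definition Vh :: "nat \<Rightarrow> (real^2) set set \<Rightarrow> (real^2 \<Rightarrow> real) set" where
  "Vh k \<T> = {v. continuous_on (\<Union>\<T>) v \<and> (\<forall>x\<in>frontier (\<Union>\<T>). v x = 0) \<and>
     (\<forall>T\<in>\<T>. \<exists>p\<in>Pk k. \<forall>x\<in>T. v x = p x) \<and>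
     (\<forall>x. x \<notin> \<Union>\<T> \<longrightarrow> v x = 0)}"

definition division_points :: "nat \<Rightarrow> (real^2) set \<Rightarrow> (real^2) set" where
  "division_points k e =
     {a + (real j / real k) *\<^sub>R (b - a) | a b j. e = closed_segment a b \<and> 1 \<le> j \<and> j \<le> k - 1}"

text \<open>The intersections of \<open>\<Gamma>\<close> with the line through \<open>O\<close> and \<open>M\<close> that are nearest to \<open>M\<close>.\<close>

definition nearest_intersection :: "(real^2) set \<Rightarrow> real^2 \<Rightarrow> real^2 \<Rightarrow> real^2 \<Rightarrow> bool" where
  "nearest_intersection \<Gamma> O\<^sub>T M P \<longleftrightarrow>
     P \<in> \<Gamma> \<inter> affine hull {O\<^sub>T, M} \<and>
     (\<forall>Q \<in> \<Gamma> \<inter> affine hull {O\<^sub>T, M}. dist M P \<le> dist M Q)"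

definition Wh :: "nat \<Rightarrow> (real^2) set \<Rightarrow> (real^2) set set \<Rightarrow> (real^2 \<Rightarrow> real) set" where
  "Wh k \<Omega> \<T> = {w.
     (\<forall>T\<in>\<T>. \<exists>p\<in>Pk k. (\<forall>x\<in>T. w x = p x) \<and>
        (T \<in> boundary_triangles \<T> \<longrightarrow> (\<forall>x\<in>skin \<Omega> \<T> T. w x = p x))) \<and>
     continuous_on (\<Union>\<T>) w \<and>
     (\<forall>v\<in>mesh_vertices \<T>. v \<in> frontier (\<Union>\<T>) \<longrightarrow> w v = 0) \<and>
     (\<forall>T\<in>boundary_triangles \<T>. \<forall>M\<in>division_points k (edge_e \<T> T). \<forall>P.
        nearest_intersection (frontier \<Omega>) (vertex_O \<T> T) M P \<longrightarrow> w P = 0) \<and>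
     (\<forall>x. x \<notin> \<Union>\<T> \<longrightarrow> x \<notin> (\<Union>T\<in>boundary_triangles \<T>. skin \<Omega> \<T> T) \<longrightarrow> w x = 0)}"


section \<open>Forms and norm\<close>

definition a_h :: "real \<Rightarrow> (real^2 \<Rightarrow> real^2) \<Rightarrow> (real^2) set set \<Rightarrow>
    (real^2 \<Rightarrow> real) \<Rightarrow> (real^2 \<Rightarrow> real) \<Rightarrow> real" where
  "a_h \<nu> b \<T> w v =
     (LINT x|lebesgue_on (\<Union>\<T>). \<nu> * (grad w x \<bullet> grad v x) + (b x \<bullet> grad w x) * v x)"

definition F_h :: "(real^2 \<Rightarrow> real) \<Rightarrow> (real^2) set set \<Rightarrow> (real^2 \<Rightarrow> real) \<Rightarrow> real" where
  "F_h f \<T> v = (LINT x|lebesgue_on (\<Union>\<T>). f x * v x)"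

definition norm_0h :: "(real^2) set set \<Rightarrow> (real^2 \<Rightarrow> real^2) \<Rightarrow> real" where
  "norm_0h \<T> g = sqrt (LINT x|lebesgue_on (\<Union>\<T>). (norm (g x))\<^sup>2)"

end

theory Submission
  imports Defs
begin

text \<open>
  On \<open>V\<^sub>h\<close> the form \<open>a\<^sub>h\<close> is coercive once \<open>h\<close> is small.  Indeed \<open>(b \<cdot> grad v, v)\<close> would vanish for a
  divergence-free \<open>b\<close> on \<open>\<Omega>\<close>; the velocity is not controlled near \<open>\<Gamma>\<close> or outside \<open>\<Omega>\<close>, but \<open>v\<close>
  vanishes outside an \<open>h\<close>-neighbourhood of \<open>\<Omega>\<close>, so a cut-off at distance \<open>d\<close> from \<open>\<Gamma>\<close> together
  with a Poincare inequality in the boundary strip of width \<open>d\<close> leaves a remainder \<open>O(d)\<close> times the energy.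

  Given \<open>w \<in> W\<^sub>h\<close>, take \<open>v \<in> V\<^sub>h\<close> equal to \<open>w\<close> minus, on every boundary triangle, the combination of
  the edge bubbles that coincides with \<open>w\<close> on \<open>e\<^sub>T\<close>.  Since \<open>w\<close> vanishes at points \<open>P\<close> at distance
  \<open>\<eta> h\<^sub>T\<close> of the division points \<open>M\<close>, with \<open>\<eta>\<close> small together with \<open>h\<close>, inverse inequalities bound the
  energy of the correction by \<open>C \<eta>\<^sup>2\<close> times that of \<open>w\<close>.  Hence \<open>a\<^sub>h(w, v)\<close> is close to \<open>a\<^sub>h(v, v)\<close>,
  which yields the inf-sup condition with \<open>\<alpha> = \<nu> / 4\<close>.

  The inf-sup condition gives uniqueness.  For existence, functions of \<open>V\<^sub>h\<close> plus bubbles are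
  subjected to \<open>a\<^sub>h(u, v) = t F\<^sub>h(v)\<close> for \<open>v\<close> in a basis of \<open>V\<^sub>h\<close> and to \<open>u(P) = 0\<close>: there is one unknown,
  \<open>t\<close>, more than there are equations, and a non-trivial solution must have \<open>t \<noteq> 0\<close>.
\<close>

section \<open>Lipschitz functions with bounded support\<close>

text \<open>Hence all geometry is drawn from charts in which the level function is affine up to an
  arbitrarily small relative error \<epsilon>. Every perturbation is made small through \<epsilon>,
  which is fixed first; the mesh size is then taken small compared with the chart radius. For the
  same reason the correction from \<open>Wh\<close> to \<open>Vh\<close> is measured against the
  energy of \<open>w\<close> itself and not against powers of h. The skins are defined through
  \<open>inside\<close>, so it has to be shown that they stay in a chart, meet the mesh only in
  their own triangle and do not overlap outside the mesh. Otherwise the conditions imposed on a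
  trial function by different triangles could conflict, and a solution found on the mesh could not
  be extended to a member of \<open>Wh\<close>. Unknowns and equations match in number because each
  boundary triangle carries as many edge bubbles as nodes, namely \<open>k - 1\<close>.\<close>

lemma integral_lebesgue_translation:
  fixes f :: "'a::euclidean_space \<Rightarrow> real"
  assumes f: "f \<in> borel_measurable borel"
  shows "(LINT x|lebesgue. f (x + a)) = (LINT x|lebesgue. f x)"
    and "integrable lebesgue f \<Longrightarrow> integrable lebesgue (\<lambda>x. f (x + a))"
proof -
  have m: "(\<lambda>x. a + x) \<in> measurable lborel borel" by simp
  have eq: "lborel = distr lborel borel (\<lambda>x. a + x)" using lborel_distr_plus[of a] by simp
  have fa: "(\<lambda>x. f (x + a)) \<in> borel_measurable lborel" using f by measurable
  have "(LINT x|lborel. f x) = (LINT x|lborel. f (a + x))"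
    by (subst eq) (simp add: integral_distr[OF m] f)
  then show "(LINT x|lebesgue. f (x + a)) = (LINT x|lebesgue. f x)"
    using fa f by (simp add: integral_completion add.commute)
  assume "integrable lebesgue f"
  then have "integrable lborel f" using f by (simp add: integrable_completion)
  then have "integrable (distr lborel borel (\<lambda>x. a + x)) f" using eq by simp
  then have "integrable lborel (\<lambda>x. f (a + x))" by (simp add: integrable_distr_eq[OF m] f)
  then show "integrable lebesgue (\<lambda>x. f (x + a))" using fa by (simp add: integrable_completion add.commute)
qed

text \<open>The regularity class in which all integrations by parts take place: closed under
  products, containing \<open>Vh\<close>, and strong enough for difference quotients to be uniformly
  bounded, to have a common bounded support and to converge almost everywhere.\<close>

definition tame :: "('a::euclidean_space \<Rightarrow> real) \<Rightarrow> bool" where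
  "tame f \<longleftrightarrow> (\<exists>L. L-lipschitz_on UNIV f) \<and> bounded {x. f x \<noteq> 0} \<and> (AE x in lebesgue. f differentiable (at x))"

lemma tame_continuous: "tame f \<Longrightarrow> continuous_on UNIV f"
  unfolding tame_def using lipschitz_on_continuous_on by blast

lemma tame_measurable: "tame f \<Longrightarrow> f \<in> borel_measurable borel"
  using tame_continuous borel_measurable_continuous_onI by blast

lemma difference_quotient_LIMSEQ:
  fixes f :: "'a::real_normed_vector \<Rightarrow> real"
  assumes "f differentiable (at x)"
  shows "(\<lambda>m. real (Suc m) * (f (x + (1 / real (Suc m)) *\<^sub>R y) - f x)) \<longlonglongrightarrow> frechet_derivative f (at x) y"
proof -
  let ?D = "frechet_derivative f (at x)"
  have "(f has_derivative ?D) (at x)" using assms by (simp add: frechet_derivative_works)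
  moreover have "((\<lambda>t. x + t *\<^sub>R y) has_derivative (\<lambda>t. t *\<^sub>R y)) (at (0::real))"
    by (auto intro!: derivative_eq_intros)
  ultimately have "((\<lambda>t. f (x + t *\<^sub>R y)) has_derivative (\<lambda>t. ?D (t *\<^sub>R y))) (at (0::real))"
    using diff_chain_at[of "\<lambda>t. x + t *\<^sub>R y" "\<lambda>t. t *\<^sub>R y" 0 f ?D] by (simp add: o_def)
  moreover have "?D (t *\<^sub>R y) = ?D y * t" for t
    using linear_frechet_derivative[OF assms] by (simp add: linear_cmul)
  ultimately have "((\<lambda>t. f (x + t *\<^sub>R y)) has_field_derivative ?D y) (at 0)"
    by (simp add: has_field_derivative_def)
  then have "((\<lambda>h. (f (x + h *\<^sub>R y) - f x) / h) \<longlongrightarrow> ?D y) (at 0)"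
    by (simp add: DERIV_def)
  moreover have "filterlim (\<lambda>m. 1 / real (Suc m)) (at 0) sequentially"
    using LIMSEQ_Suc[OF lim_1_over_n] by (auto simp: filterlim_at)
  ultimately have "(\<lambda>m. (f (x + (1 / real (Suc m)) *\<^sub>R y) - f x) / (1 / real (Suc m))) \<longlonglongrightarrow> ?D y"
    using filterlim_compose[of "\<lambda>h. (f (x + h *\<^sub>R y) - f x) / h"] by blast
  then show ?thesis by (simp add: field_simps)
qed

text \<open>Dominated convergence: the quotients are bounded by \<open>L * norm y\<close>, and a
  step of length at most \<open>norm y\<close> keeps all their supports in one ball. Measurability
  of the derivative comes along, as it is an almost everywhere limit of measurable
  quotients.\<close>

lemma tame_difference_quotient:
  fixes f :: "'a::euclidean_space \<Rightarrow> real" and y :: 'a and p :: nat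
  assumes f: "tame f"
  defines "q \<equiv> \<lambda>m x. real (Suc m) * (f (x + (1 / real (Suc m)) *\<^sub>R y) - f x)"
  shows "(\<lambda>x. frechet_derivative f (at x) y) \<in> borel_measurable lebesgue"
    and "p > 0 \<Longrightarrow> integrable lebesgue (\<lambda>x. frechet_derivative f (at x) y ^ p)"
    and "p > 0 \<Longrightarrow> (\<lambda>m. LINT x|lebesgue. q m x ^ p) \<longlonglongrightarrow> (LINT x|lebesgue. frechet_derivative f (at x) y ^ p)"
    and "p > 0 \<Longrightarrow> integrable lebesgue (\<lambda>x. q m x ^ p)"
proof -
  let ?D = "\<lambda>x. frechet_derivative f (at x) y"
  obtain L where L: "L-lipschitz_on UNIV f" using f tame_def by blast
  have L0: "L \<ge> 0" using L lipschitz_on_nonneg by blast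
  have AEd: "AE x in lebesgue. f differentiable (at x)" using f tame_def by blast
  have ae: "AE x in lebesgue. (\<lambda>m. q m x) \<longlonglongrightarrow> ?D x"
    unfolding q_def by (rule AE_mp[OF AEd AE_I2]) (intro impI, rule difference_quotient_LIMSEQ)
  have qm: "q m \<in> borel_measurable borel" for m
    unfolding q_def using tame_measurable[OF f] by measurable
  then have qm': "q m \<in> borel_measurable lebesgue" for m
    by (simp add: measurable_completion)
  have "(\<lambda>x. lim (\<lambda>m. q m x)) \<in> borel_measurable lebesgue"
    using qm' by (rule borel_measurable_lim_metric)
  moreover have "AE x in lebesgue. lim (\<lambda>m. q m x) = ?D x"
    using ae by (rule AE_mp) (auto simp: limI)
  ultimately show Dm: "?D \<in> borel_measurable lebesgue" by (rule borel_measurable_AE)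
  obtain R where R: "\<And>x. f x \<noteq> 0 \<Longrightarrow> norm x \<le> R"
    using f unfolding tame_def bounded_iff by auto
  have qb: "\<bar>q m x\<bar> \<le> L * norm y" for m x
  proof -
    have "\<bar>f (x + (1 / real (Suc m)) *\<^sub>R y) - f x\<bar> \<le> L * norm ((1 / real (Suc m)) *\<^sub>R y)"
      using lipschitz_onD[OF L, of "x + (1 / real (Suc m)) *\<^sub>R y" x] by (simp add: dist_norm)
    then have "real (Suc m) * \<bar>f (x + (1 / real (Suc m)) *\<^sub>R y) - f x\<bar> \<le> real (Suc m) * (L * ((1 / real (Suc m)) * norm y))"
      by (intro mult_left_mono) auto
    also have "\<dots> = L * norm y" by (simp add: field_simps)
    finally show ?thesis by (simp add: q_def abs_mult)
  qed
  have qs: "q m x = 0" if "x \<notin> cball 0 (R + norm y)" for m x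
  proof -
    have n: "norm x > R + norm y" using that by (simp add: dist_norm)
    have "norm ((1 / real (Suc m)) *\<^sub>R y) \<le> norm y"
      by (simp add: field_simps mult_left_le)
    then have "norm (x + (1 / real (Suc m)) *\<^sub>R y) > R"
      using n norm_triangle_ineq2[of x "- ((1 / real (Suc m)) *\<^sub>R y)"] by simp
    moreover have "norm x > R" using n norm_ge_zero[of y] by linarith
    ultimately show ?thesis unfolding q_def using R by (metis diff_self linorder_not_le mult_zero_right)
  qed
  assume p: "p > 0"
  let ?w = "\<lambda>x. (L * norm y) ^ p * indicator (cball (0::'a) (R + norm y)) x"
  have wi: "integrable lebesgue ?w"
    by (intro integrable_mult_right integrable_real_indicator) (use emeasure_lborel_cball_finite in auto)
  have bnd: "norm (q m x ^ p) \<le> ?w x" for m x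
  proof (cases "x \<in> cball 0 (R + norm y)")
    case True
    then show ?thesis using power_mono[OF qb[of m x], of p] by (simp add: power_abs)
  next
    case False
    then show ?thesis using qs[OF False] p by (simp add: zero_power)
  qed
  have Dp: "(\<lambda>x. ?D x ^ p) \<in> borel_measurable lebesgue" using Dm by measurable
  have qp: "(\<lambda>x. q m x ^ p) \<in> borel_measurable lebesgue" for m using qm' by measurable
  have lim: "AE x in lebesgue. (\<lambda>m. q m x ^ p) \<longlonglongrightarrow> ?D x ^ p"
    using ae by (rule AE_mp) (auto intro: tendsto_power)
  show "integrable lebesgue (\<lambda>x. ?D x ^ p)"
    by (rule integrable_dominated_convergence[OF Dp qp wi lim]) (rule AE_I2, rule bnd)
  show "(\<lambda>m. LINT x|lebesgue. q m x ^ p) \<longlonglongrightarrow> (LINT x|lebesgue. ?D x ^ p)"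
    by (rule integral_dominated_convergence[OF Dp qp wi lim]) (rule AE_I2, rule bnd)
  show "integrable lebesgue (\<lambda>x. q m x ^ p)"
    by (rule Bochner_Integration.integrable_bound[OF wi qp]) (rule AE_I2, rule order_trans[OF bnd], simp)
qed

lemma tame_integrable:
  assumes f: "tame (f::'a::euclidean_space \<Rightarrow> real)" and p: "p > 0"
  shows "integrable lebesgue (\<lambda>x. f x ^ p)"
proof -
  obtain R where R: "\<And>x. f x \<noteq> 0 \<Longrightarrow> norm x \<le> R"
    using f unfolding tame_def bounded_iff by auto
  have c: "continuous_on (cball 0 R) (\<lambda>x. f x ^ p)"
    by (intro continuous_intros continuous_on_subset[OF tame_continuous[OF f]]) auto
  have eq: "(\<lambda>x. f x ^ p) = (\<lambda>x. indicator (cball 0 R) x *\<^sub>R f x ^ p)"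
    using R p by (auto simp: fun_eq_iff indicator_def)
  show ?thesis
    apply (subst eq)
    using borel_integrable_compact[OF compact_cball c] borel_integrable_compact[OF compact_cball c, THEN borel_measurable_integrable]
    by (simp add: integrable_completion set_integrable_def)
qed

text \<open>Translation invariance makes the integral of every difference quotient vanish, and the
  limit inherits this. It plays the part of the divergence theorem below.\<close>

lemma integral_derivative_tame:
  assumes f: "tame (f::'a::euclidean_space \<Rightarrow> real)"
  shows "(LINT x|lebesgue. frechet_derivative f (at x) y) = 0"
proof -
  have "(LINT x|lebesgue. real (Suc m) * (f (x + (1 / real (Suc m)) *\<^sub>R y) - f x)) = 0" for m
    using integral_lebesgue_translation[OF tame_measurable[OF f]] tame_integrable[OF f, of 1]
    by simp
  then show ?thesis
    using tame_difference_quotient(3)[OF f, of 1 y] by (simp add: LIMSEQ_const_iff)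
qed

text \<open>The translation by \<open>y\<close> is cut into \<open>Suc m\<close> equal steps;
  Cauchy-Schwarz on the telescoping sum and translation invariance give the bound with a difference
  quotient in place of the derivative, and \<open>m\<close> tends to infinity. Arguing through
  quotients matters because \<open>f\<close> is differentiable only almost everywhere, possibly
  nowhere on a given line.\<close>

lemma integral_translation_difference_le:
  assumes f: "tame (f::'a::euclidean_space \<Rightarrow> real)"
  shows "(LINT x|lebesgue. (f (x + y) - f x)\<^sup>2) \<le> (LINT x|lebesgue. (frechet_derivative f (at x) y)\<^sup>2)"
proof -
  have "(LINT x|lebesgue. (f (x + y) - f x)\<^sup>2) \<le> (LINT x|lebesgue. (real (Suc m) * (f (x + (1 / real (Suc m)) *\<^sub>R y) - f x))\<^sup>2)" for m
  proof -
    define z where "z = (1 / real (Suc m)) *\<^sub>R y"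
    define d where "d = (\<lambda>x. (f (x + z) - f x)\<^sup>2)"
    have dm: "d \<in> borel_measurable borel" unfolding d_def using tame_measurable[OF f] by measurable
    have "integrable lebesgue (\<lambda>x. (real (Suc m) * (f (x + z) - f x))\<^sup>2)"
      unfolding z_def using tame_difference_quotient(4)[OF f, of 2] by simp
    then have di: "integrable lebesgue d"
      using integrable_mult_right[of "1 / (real (Suc m))\<^sup>2" lebesgue "\<lambda>x. (real (Suc m) * (f (x + z) - f x))\<^sup>2"]
      unfolding d_def power_mult_distrib by (simp del: of_nat_Suc)
    have di': "integrable lebesgue (\<lambda>x. d (x + of_nat i *\<^sub>R z))" for i :: nat
      using integral_lebesgue_translation(2)[OF dm di] .
    have fy: "f (x + y) - f x = (\<Sum>i<Suc m. f (x + of_nat (Suc i) *\<^sub>R z) - f (x + of_nat i *\<^sub>R z))" for x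
    proof -
      have "of_nat (Suc m) *\<^sub>R z = y" by (simp add: z_def del: of_nat_Suc)
      then show ?thesis using sum_lessThan_telescope[of "\<lambda>i. f (x + of_nat i *\<^sub>R z)" "Suc m"] by simp
    qed
    have pt: "(f (x + y) - f x)\<^sup>2 \<le> real (Suc m) * (\<Sum>i<Suc m. d (x + of_nat i *\<^sub>R z))" for x
    proof -
      have "(\<Sum>i<Suc m. f (x + of_nat (Suc i) *\<^sub>R z) - f (x + of_nat i *\<^sub>R z))\<^sup>2
          \<le> real (Suc m) * (\<Sum>i<Suc m. (f (x + of_nat (Suc i) *\<^sub>R z) - f (x + of_nat i *\<^sub>R z))\<^sup>2)"
        using sum_squared_le_sum_of_squares[where I = "{..<Suc m}" and f = "\<lambda>i. f (x + of_nat (Suc i) *\<^sub>R z) - f (x + of_nat i *\<^sub>R z)"]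
        by (simp only: card_lessThan mult.commute)
      also have "(\<Sum>i<Suc m. (f (x + of_nat (Suc i) *\<^sub>R z) - f (x + of_nat i *\<^sub>R z))\<^sup>2) = (\<Sum>i<Suc m. d (x + of_nat i *\<^sub>R z))"
        by (rule sum.cong) (auto simp: d_def scaleR_add_left add.assoc add.commute add.left_commute)
      finally show ?thesis by (simp only: fy)
    qed
    have "(LINT x|lebesgue. (f (x + y) - f x)\<^sup>2) \<le> (LINT x|lebesgue. real (Suc m) * (\<Sum>i<Suc m. d (x + of_nat i *\<^sub>R z)))"
    proof (rule integral_mono)
      show "integrable lebesgue (\<lambda>x. (f (x + y) - f x)\<^sup>2)"
        using tame_difference_quotient(4)[OF f, of 2 0 y] by simp
      show "integrable lebesgue (\<lambda>x. real (Suc m) * (\<Sum>i<Suc m. d (x + of_nat i *\<^sub>R z)))"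
        using di' by (intro integrable_mult_right Bochner_Integration.integrable_sum) auto
    qed (rule pt)
    also have "\<dots> = real (Suc m) * (\<Sum>i<Suc m. LINT x|lebesgue. d (x + of_nat i *\<^sub>R z))"
      using di' by (simp add: Bochner_Integration.integral_sum del: sum.lessThan_Suc)
    also have "\<dots> = real (Suc m) * (real (Suc m) * (LINT x|lebesgue. d x))"
      using integral_lebesgue_translation(1)[OF dm] by (simp del: sum.lessThan_Suc)
    also have "\<dots> = (LINT x|lebesgue. (real (Suc m))\<^sup>2 * d x)" by (simp add: power2_eq_square)
    also have "\<dots> = (LINT x|lebesgue. (real (Suc m) * (f (x + z) - f x))\<^sup>2)"
      by (simp add: d_def power_mult_distrib)
    finally show ?thesis by (simp add: z_def)
  qed
  then show ?thesis
    by (intro LIMSEQ_le_const[OF tame_difference_quotient(3)[OF f, of 2 y]]) auto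
qed

section \<open>Gradients, integration by parts and boundary charts\<close>

lemma C1_directional_bound:
  fixes f :: "'a::euclidean_space \<Rightarrow> 'b::real_normed_vector"
  assumes K: "compact K" "K \<subseteq> \<Omega>"
    and df: "\<And>x. x \<in> \<Omega> \<Longrightarrow> f differentiable (at x)"
    and cf: "\<And>i. i \<in> Basis \<Longrightarrow> continuous_on \<Omega> (\<lambda>x. frechet_derivative f (at x) i)"
  obtains D where "D \<ge> 0" "\<And>x y. x \<in> K \<Longrightarrow> norm (frechet_derivative f (at x) y) \<le> D * norm y"
proof -
  have "\<exists>B\<ge>0. \<forall>x\<in>K. norm (frechet_derivative f (at x) i) \<le> B" if i: "i \<in> Basis" for i
  proof -
    have "bounded ((\<lambda>x. frechet_derivative f (at x) i) ` K)"
      by (intro compact_imp_bounded compact_continuous_image continuous_on_subset[OF cf[OF i]] K)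
    then obtain B where "\<forall>z\<in>(\<lambda>x. frechet_derivative f (at x) i) ` K. norm z \<le> B" using bounded_iff by blast
    then show ?thesis by (intro exI[of _ "max B 0"]) force
  qed
  then obtain B where B: "\<And>i. i \<in> Basis \<Longrightarrow> B i \<ge> 0"
    "\<And>i x. i \<in> Basis \<Longrightarrow> x \<in> K \<Longrightarrow> norm (frechet_derivative f (at x) i) \<le> B i" by metis
  show ?thesis
  proof (rule that[of "\<Sum>i\<in>Basis. B i"])
    show "(\<Sum>i\<in>Basis. B i) \<ge> 0" using B(1) by (simp add: sum_nonneg)
    fix x y assume x: "x \<in> K"
    have lin: "linear (frechet_derivative f (at x))" using df x K linear_frechet_derivative by blast
    have "frechet_derivative f (at x) y = (\<Sum>i\<in>Basis. (y \<bullet> i) *\<^sub>R frechet_derivative f (at x) i)"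
      by (subst euclidean_representation[of y, symmetric]) (simp add: linear_sum[OF lin] linear_cmul[OF lin])
    also have "norm \<dots> \<le> (\<Sum>i\<in>Basis. norm ((y \<bullet> i) *\<^sub>R frechet_derivative f (at x) i))" by (rule norm_sum)
    also have "\<dots> \<le> (\<Sum>i\<in>Basis. norm y * B i)"
      using B x by (intro sum_mono) (auto intro!: mult_mono simp: Basis_le_norm)
    finally show "norm (frechet_derivative f (at x) y) \<le> (\<Sum>i\<in>Basis. B i) * norm y"
      by (simp add: sum_distrib_left mult.commute)
  qed
qed

text \<open>Pairs at distance at least \<open>e\<close> are covered by the sup bound, which costs
  the extra slope \<open>2 * M / e\<close>.\<close>

lemma local_Lipschitz_bounded_imp_Lipschitz:
  fixes g :: "'a::metric_space \<Rightarrow> real"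
  assumes e: "e > 0" and M: "\<And>x. \<bar>g x\<bar> \<le> M" and L0: "L \<ge> 0"
    and L: "\<And>x y. dist x y < e \<Longrightarrow> \<bar>g x - g y\<bar> \<le> L * dist x y"
  shows "\<exists>L. L-lipschitz_on UNIV g"
proof -
  have M0: "M \<ge> 0" using M[of undefined] by linarith
  have "(L + 2 * M / e)-lipschitz_on UNIV g"
  proof (rule lipschitz_onI)
    show "0 \<le> L + 2 * M / e" using e M0 L0 by simp
    fix x y :: 'a
    have n1: "2 * M / e * dist x y \<ge> 0" "L * dist x y \<ge> 0" using e M0 L0 by simp_all
    show "dist (g x) (g y) \<le> (L + 2 * M / e) * dist x y"
    proof (cases "dist x y < e")
      case True
      then show ?thesis using L[OF True] n1 by (simp add: dist_real_def distrib_right)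
    next
      case False
      then have "2 * M / e * e \<le> 2 * M / e * dist x y" using e M0 by (intro mult_left_mono) auto
      then show ?thesis using M[of x] M[of y] n1 e by (simp add: dist_real_def distrib_right)
    qed
  qed
  then show ?thesis by blast
qed

lemma tame_bounded:
  assumes f: "tame (f::'a::euclidean_space \<Rightarrow> real)"
  obtains M where "\<And>x. \<bar>f x\<bar> \<le> M"
proof -
  obtain R where R: "\<And>x. f x \<noteq> 0 \<Longrightarrow> norm x \<le> R"
    using f unfolding tame_def bounded_iff by auto
  have "bounded (f ` cball 0 R)"
    by (intro compact_imp_bounded compact_continuous_image continuous_on_subset[OF tame_continuous[OF f]]) auto
  then obtain M where "\<forall>z\<in>f ` cball 0 R. norm z \<le> M" using bounded_iff by blast
  then have "\<bar>f x\<bar> \<le> max M 0" for x using R[of x] by (cases "f x = 0") force+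
  then show ?thesis using that by blast
qed

text \<open>Meant for a component of the velocity, which is C^1 only inside \<Omega> and may have
  unbounded derivatives near the boundary; the factor \<psi> confines the product to a compact
  subset.\<close>

lemma tame_C1_mult:
  fixes f :: "'a::euclidean_space \<Rightarrow> real"
  assumes \<psi>: "tame \<psi>" and \<Omega>: "open \<Omega>" and K: "compact K" "K \<subseteq> \<Omega>"
    and zero: "\<And>x. x \<notin> K \<Longrightarrow> \<psi> x = 0"
    and df: "\<And>x. x \<in> \<Omega> \<Longrightarrow> f differentiable (at x)"
    and cf: "\<And>i. i \<in> Basis \<Longrightarrow> continuous_on \<Omega> (\<lambda>x. frechet_derivative f (at x) i)"
  shows "tame (\<lambda>x. f x * \<psi> x)"
proof -
  let ?g = "\<lambda>x. f x * \<psi> x"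
  obtain L where L: "L-lipschitz_on UNIV \<psi>" using \<psi> tame_def by blast
  have L0: "L \<ge> 0" using L lipschitz_on_nonneg by blast
  obtain M where M: "\<And>x. \<bar>\<psi> x\<bar> \<le> M" using tame_bounded[OF \<psi>] by blast
  have M0: "M \<ge> 0" using M[of undefined] by linarith
  \<comment> \<open>Fattening \<open>K\<close> to \<open>K'\<close> puts a whole ball around each
    point of \<open>K\<close> into a compact subset of \<Omega>, so that the mean value inequality
    applies to \<open>f\<close> between a point of \<open>K\<close> and its
    \<open>e\<close>-neighbours.\<close>
  obtain e where e: "e > 0" and sub: "(\<Union>x\<in>K. cball x e) \<subseteq> \<Omega>"
    using compact_subset_open_imp_cball_epsilon_subset[OF K(1) \<Omega> K(2)] by blast
  define K' where "K' = (\<Union>x\<in>K. cball x e)"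
  have K'c: "compact K'" unfolding K'_def
    using compact_minkowski_sum_cball[OF K(1)] .
  have K's: "K' \<subseteq> \<Omega>" using sub K'_def by simp
  obtain D where D: "D \<ge> 0" "\<And>x y. x \<in> K' \<Longrightarrow> norm (frechet_derivative f (at x) y) \<le> D * norm y"
    using C1_directional_bound[OF K'c K's df cf] by blast
  have contf: "continuous_on K' f"
    using df K's by (meson continuous_at_imp_continuous_on differentiable_imp_continuous_within subsetD)
  then have "bounded (f ` K')" using K'c compact_continuous_image compact_imp_bounded by blast
  then obtain F where F: "\<And>x. x \<in> K' \<Longrightarrow> \<bar>f x\<bar> \<le> F" unfolding bounded_iff by (auto simp del: abs_le_iff)
  have KK': "K \<subseteq> K'" unfolding K'_def using e by force
  have main: "\<bar>?g x - ?g y\<bar> \<le> (D * M + \<bar>F\<bar> * L) * dist x y" if x: "x \<in> K" and d: "dist x y < e" for x y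
  proof -
    have s: "cball x e \<subseteq> K'" unfolding K'_def using x by blast
    have y: "y \<in> cball x e" using d by simp
    have "norm (f x - f y) \<le> D * norm (x - y)"
    proof (rule differentiable_bound[where S="cball x e" and f' = "\<lambda>z. frechet_derivative f (at z)"])
      fix z assume z: "z \<in> cball x e"
      then show "(f has_derivative frechet_derivative f (at z)) (at z within cball x e)"
        using df s K's by (meson frechet_derivative_works has_derivative_at_withinI subset_iff)
      show "onorm (frechet_derivative f (at z)) \<le> D"
        by (rule onorm_le) (use D s z in auto)
    qed (use y e in auto)
    then have 1: "\<bar>f x - f y\<bar> \<le> D * dist x y" by (simp add: dist_norm)
    have 2: "\<bar>\<psi> x - \<psi> y\<bar> \<le> L * dist x y" using lipschitz_onD[OF L] by (simp add: dist_real_def)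
    have "\<bar>?g x - ?g y\<bar> = \<bar>(f x - f y) * \<psi> x + f y * (\<psi> x - \<psi> y)\<bar>" by (simp add: algebra_simps)
    also have "\<dots> \<le> \<bar>f x - f y\<bar> * \<bar>\<psi> x\<bar> + \<bar>f y\<bar> * \<bar>\<psi> x - \<psi> y\<bar>"
      by (metis abs_mult abs_triangle_ineq)
    also have "\<dots> \<le> (D * dist x y) * M + \<bar>F\<bar> * (L * dist x y)"
      using 1 2 M F[of y] y s D(1) by (intro add_mono mult_mono) auto
    finally show ?thesis by (simp add: algebra_simps)
  qed
  have "\<bar>?g x - ?g y\<bar> \<le> (D * M + \<bar>F\<bar> * L) * dist x y" if d: "dist x y < e" for x y
  proof (cases "x \<in> K \<or> y \<in> K")
    case True
    then show ?thesis using main[of x y] main[of y x] d by (auto simp: dist_commute abs_minus_commute)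
  next
    case False
    then show ?thesis using zero D(1) M0 L0 by simp
  qed
  moreover have "\<bar>?g x\<bar> \<le> \<bar>F\<bar> * M" for x
  proof (cases "x \<in> K")
    case True
    then show ?thesis using F[of x] KK' M[of x] M0 by (auto simp: abs_mult intro!: mult_mono)
  next
    case False
    then show ?thesis using zero M0 by simp
  qed
  ultimately have 1: "\<exists>L. L-lipschitz_on UNIV ?g"
    using D(1) M0 L0 e
    by (intro local_Lipschitz_bounded_imp_Lipschitz[where e=e and M="\<bar>F\<bar> * M" and L="D * M + \<bar>F\<bar> * L"]) auto
  have 2: "bounded {x. ?g x \<noteq> 0}"
    using \<psi> unfolding tame_def by (auto elim!: bounded_subset)
  have diff: "?g differentiable (at x)" if "\<psi> differentiable (at x)" for x
  proof (cases "x \<in> \<Omega>")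
    case True
    then show ?thesis using that df by (intro differentiable_mult) auto
  next
    case False
    have op: "open (- K)" using K(1) compact_imp_closed by blast
    have "(?g has_derivative (\<lambda>_. 0)) (at x)"
      by (rule has_derivative_transform_within_open[OF has_derivative_const op])
        (use False K zero in auto)
    then show ?thesis using differentiableI by blast
  qed
  have 3: "AE x in lebesgue. ?g differentiable (at x)"
    using \<psi> diff unfolding tame_def by (auto elim!: eventually_mono)
  show ?thesis using 1 2 3 unfolding tame_def by blast
qed

lemma tame_Lipschitz_mult:
  fixes f :: "'a::euclidean_space \<Rightarrow> real"
  assumes L: "L-lipschitz_on UNIV f" and M: "\<And>x. \<bar>f x\<bar> \<le> M"
    and df: "AE x in lebesgue. f differentiable (at x)" and g: "tame g"
  shows "tame (\<lambda>x. f x * g x)"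
proof -
  obtain L' where L': "L'-lipschitz_on UNIV g" using g tame_def by blast
  obtain M' where M': "\<And>x. \<bar>g x\<bar> \<le> M'" using tame_bounded[OF g] by blast
  have nn: "L \<ge> 0" "L' \<ge> 0" "M \<ge> 0" "M' \<ge> 0"
    using L L' M[of undefined] M'[of undefined] lipschitz_on_nonneg by auto
  have "(L * M' + M * L')-lipschitz_on UNIV (\<lambda>x. f x * g x)"
  proof (rule lipschitz_onI)
    fix x y :: 'a
    have 1: "\<bar>f x - f y\<bar> \<le> L * dist x y" using lipschitz_onD[OF L] by (simp add: dist_real_def)
    have 2: "\<bar>g x - g y\<bar> \<le> L' * dist x y" using lipschitz_onD[OF L'] by (simp add: dist_real_def)
    have "\<bar>f x * g x - f y * g y\<bar> = \<bar>(f x - f y) * g x + f y * (g x - g y)\<bar>" by (simp add: algebra_simps)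
    also have "\<dots> \<le> \<bar>f x - f y\<bar> * \<bar>g x\<bar> + \<bar>f y\<bar> * \<bar>g x - g y\<bar>"
      by (metis abs_mult abs_triangle_ineq)
    also have "\<dots> \<le> (L * dist x y) * M' + M * (L' * dist x y)"
      using 1 2 M M' nn by (intro add_mono mult_mono) auto
    finally show "dist (f x * g x) (f y * g y) \<le> (L * M' + M * L') * dist x y"
      by (simp add: dist_real_def algebra_simps)
  qed (use nn in simp)
  moreover have "bounded {x. f x * g x \<noteq> 0}"
    using g unfolding tame_def by (auto elim!: bounded_subset)
  moreover have "AE x in lebesgue. (\<lambda>x. f x * g x) differentiable (at x)"
  proof -
    have "AE x in lebesgue. g differentiable (at x)" using g tame_def by blast
    with df show ?thesis by eventually_elim (rule differentiable_mult)
  qed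
  ultimately show ?thesis unfolding tame_def by blast
qed

lemma tame_mult:
  assumes f: "tame (f::'a::euclidean_space \<Rightarrow> real)" and g: "tame g"
  shows "tame (\<lambda>x. f x * g x)"
proof -
  obtain L where L: "L-lipschitz_on UNIV f" using f tame_def by blast
  obtain M where M: "\<And>x. \<bar>f x\<bar> \<le> M" using tame_bounded[OF f] by blast
  show ?thesis using tame_Lipschitz_mult[OF L M _ g] f tame_def by blast
qed

lemma frechet_derivative_eq_grad:
  assumes "w differentiable (at x)"
  shows "frechet_derivative w (at x) y = grad w x \<bullet> y"
proof -
  have lin: "linear (frechet_derivative w (at x))" using assms linear_frechet_derivative by blast
  have y: "y = (\<Sum>i\<in>UNIV. y $ i *\<^sub>R axis i 1)"
    by (simp add: basis_expansion scalar_mult_eq_scaleR[symmetric])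
  have "frechet_derivative w (at x) y = (\<Sum>i\<in>UNIV. y $ i * frechet_derivative w (at x) (axis i 1))"
    by (subst y) (simp add: linear_sum[OF lin] linear_cmul[OF lin])
  then show ?thesis by (simp add: inner_vec_def grad_def mult.commute)
qed

lemma grad_eq:
  assumes "(w has_derivative (\<lambda>y. g \<bullet> y)) (at x)"
  shows "grad w x = g"
  unfolding grad_def frechet_derivative_at[OF assms, symmetric]
  by (simp add: vec_eq_iff inner_axis)

lemma has_derivative_grad:
  assumes "w differentiable (at x)"
  shows "(w has_derivative (\<lambda>y. grad w x \<bullet> y)) (at x)"
  using frechet_derivative_eq_grad[OF assms] frechet_derivative_works[of w "at x"] assms
  by (metis (no_types, lifting) ext)

lemma grad_mult:
  assumes "f differentiable (at x)" "g differentiable (at x)"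
  shows "grad (\<lambda>x. f x * g x) x = f x *\<^sub>R grad g x + g x *\<^sub>R grad f x"
  by (rule grad_eq, rule has_derivative_eq_rhs[OF has_derivative_mult[OF has_derivative_grad[OF assms(1)] has_derivative_grad[OF assms(2)]]])
    (simp add: fun_eq_iff inner_add_left mult.commute)

text \<open>Since \<open>divergence b\<close> vanishes, the product rule makes
  \<open>b \<bullet> grad \<psi>\<close> the divergence of \<psi> times \<open>b\<close>. The
  components of that product are \<open>tame\<close>, so their partial derivatives integrate to
  zero.\<close>

lemma integral_divergence_free_grad:
  fixes b :: "real^2 \<Rightarrow> real^2"
  assumes \<psi>: "tame \<psi>" and \<Omega>: "open \<Omega>" and K: "compact K" "K \<subseteq> \<Omega>"
    and zero: "\<And>x. x \<notin> K \<Longrightarrow> \<psi> x = 0"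
    and db: "\<And>x. x \<in> \<Omega> \<Longrightarrow> b differentiable (at x)"
    and cb: "\<And>i. i \<in> Basis \<Longrightarrow> continuous_on \<Omega> (\<lambda>x. frechet_derivative b (at x) i)"
    and div: "\<And>x. x \<in> \<Omega> \<Longrightarrow> divergence b x = 0"
  shows "(LINT x|lebesgue. b x \<bullet> grad \<psi> x) = 0" "integrable lebesgue (\<lambda>x. b x \<bullet> grad \<psi> x)"
proof -
  let ?g = "\<lambda>i x. b x $ i * \<psi> x"
  have bi: "((\<lambda>x. b x $ i) has_derivative (\<lambda>y. frechet_derivative b (at x) y $ i)) (at x)" if "x \<in> \<Omega>" for x i
  proof -
    have "(b has_derivative frechet_derivative b (at x)) (at x)" using db[OF that] by (simp add: frechet_derivative_works)
    then show ?thesis by (rule bounded_linear.has_derivative[OF bounded_linear_vec_nth])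
  qed
  have fbi: "frechet_derivative (\<lambda>x. b x $ i) (at x) = (\<lambda>y. frechet_derivative b (at x) y $ i)" if "x \<in> \<Omega>" for x i
    using frechet_derivative_at[OF bi[OF that]] by simp
  have t: "tame (?g i)" for i
  proof (rule tame_C1_mult[OF \<psi> \<Omega> K])
    show "\<And>x. x \<notin> K \<Longrightarrow> \<psi> x = 0" by (rule zero)
    show "(\<lambda>x. b x $ i) differentiable (at x)" if "x \<in> \<Omega>" for x using bi[OF that] differentiableI by blast
    fix j :: "real^2" assume j: "j \<in> Basis"
    show "continuous_on \<Omega> (\<lambda>x. frechet_derivative (\<lambda>x. b x $ i) (at x) j)"
      by (subst continuous_on_cong[OF refl, of \<Omega> _ "\<lambda>x. frechet_derivative b (at x) j $ i"])
        (use fbi cb[OF j] in \<open>auto intro: continuous_on_component\<close>)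
  qed
  let ?h = "\<lambda>x. \<Sum>i\<in>UNIV. frechet_derivative (?g i) (at x) (axis i 1)"
  have hi: "integrable lebesgue ?h"
    using tame_difference_quotient(2)[OF t, of 1] by (intro Bochner_Integration.integrable_sum) simp
  have h0: "integral\<^sup>L lebesgue ?h = 0"
    using tame_difference_quotient(2)[OF t, of 1] by (simp add: integral_derivative_tame[OF t])
  have pt: "?h x = b x \<bullet> grad \<psi> x" if d: "\<psi> differentiable (at x)" for x
  proof (cases "x \<in> \<Omega>")
    case True
    have dpsi: "(\<psi> has_derivative frechet_derivative \<psi> (at x)) (at x)" using d by (simp add: frechet_derivative_works)
    have "frechet_derivative (?g i) (at x) = (\<lambda>y. b x $ i * frechet_derivative \<psi> (at x) y + frechet_derivative b (at x) y $ i * \<psi> x)" for i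
      using frechet_derivative_at[OF has_derivative_mult[OF bi[OF True] dpsi]] by simp
    then have "?h x = (\<Sum>i\<in>UNIV. b x $ i * frechet_derivative \<psi> (at x) (axis i 1)) + divergence b x * \<psi> x"
      by (simp add: sum.distrib divergence_def sum_distrib_right)
    then show ?thesis using div[OF True] by (simp add: grad_def inner_vec_def)
  next
    \<comment> \<open>Off \<Omega> nothing is known about \<open>b\<close>, but \<psi> vanishes on
      the open set \<open>- K\<close>, so both sides are zero.\<close>
    case False
    have op: "open (- K)" using K(1) compact_imp_closed by blast
    have d0: "(h has_derivative (\<lambda>_. 0)) (at x)" if "\<And>x. x \<notin> K \<Longrightarrow> h x = 0" for h :: "real^2 \<Rightarrow> real"
      by (rule has_derivative_transform_within_open[OF has_derivative_const op])
        (use False K that in auto)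
    have "frechet_derivative (?g i) (at x) = (\<lambda>_. 0)" for i
      using frechet_derivative_at[OF d0[of "?g i"]] zero by simp
    moreover have "frechet_derivative \<psi> (at x) = (\<lambda>_. 0)"
      using frechet_derivative_at[OF d0[of \<psi>]] zero by simp
    ultimately show ?thesis by (simp add: grad_def inner_vec_def)
  qed
  have ae: "AE x in lebesgue. ?h x = b x \<bullet> grad \<psi> x"
    using \<psi> pt unfolding tame_def by (auto elim!: eventually_mono)
  have hm: "?h \<in> borel_measurable lebesgue" using hi by simp
  have bm: "(\<lambda>x. b x \<bullet> grad \<psi> x) \<in> borel_measurable lebesgue"
    by (rule borel_measurable_AE[OF hm ae])
  show "(LINT x|lebesgue. b x \<bullet> grad \<psi> x) = 0" using integral_cong_AE[OF hm bm ae] h0 by simp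
  show "integrable lebesgue (\<lambda>x. b x \<bullet> grad \<psi> x)" using integrable_cong_AE[OF hm bm ae] hi by simp
qed

section \<open>C^1 regularity and boundary charts\<close>

lemma Ck_on_imp_continuous_on: "Ck_on m f S \<Longrightarrow> continuous_on S f"
  by (cases m) (auto intro!: continuous_at_imp_continuous_on differentiable_imp_continuous_within)

lemma Ck_on_C1:
  assumes "Ck_on m f S" "m \<ge> 1"
  shows "\<And>x. x \<in> S \<Longrightarrow> f differentiable (at x)"
    and "\<And>i. i \<in> Basis \<Longrightarrow> continuous_on S (\<lambda>x. frechet_derivative f (at x) i)"
  using assms by (cases m; auto intro: Ck_on_imp_continuous_on)+

text \<open>Near-affinity with relative error \<epsilon> is what is kept of the C^1 level function
  in \<open>smooth_domain\<close>, rescaled to slope about 1. It stands in for a local graph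
  representation: secants of the boundary are almost orthogonal to \<open>n\<close>, and moving
  along \<open>n\<close> changes \<phi> at a rate close to 1.\<close>

definition chart :: "(real^2) set \<Rightarrow> real \<Rightarrow> real \<Rightarrow> real^2 \<Rightarrow> real^2 \<Rightarrow> (real^2 \<Rightarrow> real) \<Rightarrow> bool" where
  "chart \<Omega> \<epsilon> r p n \<phi> \<longleftrightarrow> norm n = 1 \<and>
     (\<forall>x\<in>ball p r. \<forall>y\<in>ball p r. \<bar>\<phi> x - \<phi> y - n \<bullet> (x - y)\<bar> \<le> \<epsilon> * norm (x - y)) \<and>
     (\<forall>x\<in>ball p r. x \<in> \<Omega> \<longleftrightarrow> \<phi> x < 0) \<and> (\<forall>x\<in>ball p r. x \<in> frontier \<Omega> \<longleftrightarrow> \<phi> x = 0)"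

text \<open>Mean value inequality for \<open>\<phi> x / norm g - n \<bullet> x\<close>, whose
  gradient is small near \<open>p\<close> by continuity of \<open>grad \<phi>\<close>.\<close>

lemma smooth_domain_chart_at:
  assumes sd: "smooth_domain m \<Omega>" and m: "m \<ge> 1" and e: "\<epsilon> > 0" and p: "p \<in> frontier \<Omega>"
  shows "\<exists>r>0. \<exists>n \<phi>. chart \<Omega> \<epsilon> r p n \<phi>"
proof -
  obtain U \<phi> where U: "open U" "p \<in> U" "Ck_on m \<phi> U" "\<And>x. x \<in> U \<Longrightarrow> grad \<phi> x \<noteq> 0"
    "\<Omega> \<inter> U = {x\<in>U. \<phi> x < 0}" "frontier \<Omega> \<inter> U = {x\<in>U. \<phi> x = 0}"
  proof -
    have "\<forall>p\<in>frontier \<Omega>. \<exists>U \<phi>. open U \<and> p \<in> U \<and> Ck_on m \<phi> U \<and> (\<forall>x\<in>U. grad \<phi> x \<noteq> 0) \<and>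
        \<Omega> \<inter> U = {x\<in>U. \<phi> x < 0} \<and> frontier \<Omega> \<inter> U = {x\<in>U. \<phi> x = 0}"
      using sd unfolding smooth_domain_def by (elim conjE) assumption
    from bspec[OF this p] show ?thesis by (elim exE conjE) (rule that, auto)
  qed
  define g where "g = grad \<phi> p"
  define n where "n = (1 / norm g) *\<^sub>R g"
  have g0: "norm g > 0" using U(2,4) g_def by simp
  have dphi: "\<And>x. x \<in> U \<Longrightarrow> \<phi> differentiable (at x)" using Ck_on_C1[OF U(3) m] by blast
  have "continuous_on U (\<lambda>x. frechet_derivative \<phi> (at x) (axis i 1))" for i
    using Ck_on_C1(2)[OF U(3) m, of "axis i 1"] by (simp add: axis_in_Basis_iff)
  then have "continuous_on U (grad \<phi>)"
    unfolding grad_def[abs_def] by (intro continuous_on_vec_lambda)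
  then have "isCont (grad \<phi>) p" using U(1,2) continuous_on_eq_continuous_at by blast
  then obtain d where d: "d > 0" "\<And>x. dist x p < d \<Longrightarrow> dist (grad \<phi> x) g < \<epsilon> * norm g"
    using g0 e unfolding continuous_at_eps_delta g_def by (metis mult_pos_pos)
  obtain r0 where r0: "r0 > 0" "ball p r0 \<subseteq> U" using U(1,2) open_contains_ball by blast
  define r where "r = min d r0"
  have r: "r > 0" "ball p r \<subseteq> U" using d r0 r_def by auto
  have b: "\<bar>\<phi> x / norm g - \<phi> y / norm g - n \<bullet> (x - y)\<bar> \<le> \<epsilon> * norm (x - y)" if x: "x \<in> ball p r" and y: "y \<in> ball p r" for x y
  proof -
    let ?h = "\<lambda>x. \<phi> x / norm g - n \<bullet> x"
    have "norm (?h x - ?h y) \<le> \<epsilon> * norm (x - y)"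
    proof (rule differentiable_bound[where S="ball p r" and f' = "\<lambda>z y. ((1 / norm g) *\<^sub>R (grad \<phi> z - g)) \<bullet> y"])
      fix z assume z: "z \<in> ball p r"
      have "(\<phi> has_derivative (\<lambda>y. grad \<phi> z \<bullet> y)) (at z within ball p r)"
        using has_derivative_grad[OF dphi] z r(2) has_derivative_at_withinI by blast
      then have "(?h has_derivative (\<lambda>y. grad \<phi> z \<bullet> y / norm g - n \<bullet> y)) (at z within ball p r)"
        using g0 by (auto intro!: derivative_eq_intros)
      then show "(?h has_derivative (\<lambda>y. ((1 / norm g) *\<^sub>R (grad \<phi> z - g)) \<bullet> y)) (at z within ball p r)"
        by (rule has_derivative_eq_rhs) (simp add: fun_eq_iff n_def inner_diff_left field_simps)
      have nn: "norm ((1 / norm g) *\<^sub>R (grad \<phi> z - g)) \<le> \<epsilon>"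
      proof -
        have "norm (grad \<phi> z - g) \<le> \<epsilon> * norm g"
          using d(2)[of z] z by (simp add: r_def dist_norm norm_minus_commute)
        then show ?thesis using g0 unfolding norm_scaleR by (simp add: field_simps)
      qed
      show "onorm (\<lambda>y. ((1 / norm g) *\<^sub>R (grad \<phi> z - g)) \<bullet> y) \<le> \<epsilon>"
      proof (rule onorm_le)
        fix y
        show "norm (((1 / norm g) *\<^sub>R (grad \<phi> z - g)) \<bullet> y) \<le> \<epsilon> * norm y"
          using Cauchy_Schwarz_ineq2[of "(1 / norm g) *\<^sub>R (grad \<phi> z - g)" y] mult_right_mono[OF nn norm_ge_zero[of y]]
          by (simp only: real_norm_def)
      qed
    qed (use x y in auto)
    then show ?thesis by (simp add: inner_diff_right algebra_simps)
  qed
  have "chart \<Omega> \<epsilon> r p n (\<lambda>x. \<phi> x / norm g)"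
    unfolding chart_def
  proof (intro conjI ballI)
    show "norm n = 1" using g0 by (simp add: n_def)
    fix x assume x: "x \<in> ball p r"
    show "(x \<in> \<Omega>) = (\<phi> x / norm g < 0)" using x r(2) U(5) g0 by (auto simp: divide_less_0_iff)
    show "(x \<in> frontier \<Omega>) = (\<phi> x / norm g = 0)" using x r(2) U(6) g0 by auto
  qed (use b in blast)
  then show ?thesis using r by blast
qed

text \<open>A Lebesgue number of the cover of the compact boundary by chart balls gives one radius
  for all boundary points. A chart restricts to any ball inside its own, so the new centre may
  differ from the point at which \<open>n\<close> was computed.\<close>

lemma smooth_domain_chart:
  assumes sd: "smooth_domain m \<Omega>" and m: "m \<ge> 1" and e: "\<epsilon> > 0"
  shows "\<exists>r>0. \<forall>p\<in>frontier \<Omega>. \<exists>n \<phi>. chart \<Omega> \<epsilon> r p n \<phi>"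
proof -
  have c: "compact (frontier \<Omega>)" using sd unfolding smooth_domain_def
    by (simp add: compact_frontier_bounded)
  obtain R N P where R: "\<And>p. p \<in> frontier \<Omega> \<Longrightarrow> R p > 0 \<and> chart \<Omega> \<epsilon> (R p) p (N p) (P p)"
    using smooth_domain_chart_at[OF sd m e] by metis
  let ?C = "(\<lambda>p. ball p (R p)) ` frontier \<Omega>"
  have "frontier \<Omega> \<subseteq> \<Union> ?C" using R by force
  then obtain r where r: "r > 0" "\<And>x. x \<in> frontier \<Omega> \<Longrightarrow> \<exists>G\<in>?C. ball x r \<subseteq> G"
    using Heine_Borel_lemma[OF c, of ?C] by (metis (no_types, lifting) imageE open_ball)
  have "\<exists>n \<phi>. chart \<Omega> \<epsilon> r q n \<phi>" if q: "q \<in> frontier \<Omega>" for q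
  proof -
    obtain p where "p \<in> frontier \<Omega>" "ball q r \<subseteq> ball p (R p)" using r(2)[OF q] by blast
    then have "chart \<Omega> \<epsilon> r q (N p) (P p)" using R[of p] unfolding chart_def by blast
    then show ?thesis by blast
  qed
  then show ?thesis using r by blast
qed

section \<open>Cut-off functions\<close>

definition possq :: "real \<Rightarrow> real" where "possq t = (max 0 t)\<^sup>2"

lemma possq_deriv: "(possq has_real_derivative 2 * max 0 t) (at t)"
proof (cases t "0::real" rule: linorder_cases)
  case less
  have "(possq has_real_derivative 0) (at t)"
    by (rule has_field_derivative_transform_within_open[where f="\<lambda>_. 0" and S="{..<0}"])
      (use less in \<open>auto simp: possq_def max_def\<close>)
  then show ?thesis using less by simp
next
  case greater
  have "((\<lambda>t. t\<^sup>2) has_real_derivative 2 * t) (at t)" by (auto intro!: derivative_eq_intros)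
  then have "(possq has_real_derivative 2 * t) (at t)"
    by (rule has_field_derivative_transform_within_open[where S="{0<..}"])
      (use greater in \<open>auto simp: possq_def max_def\<close>)
  then show ?thesis using greater by simp
next
  case equal
  have lim: "((\<lambda>h::real. max 0 h) \<longlongrightarrow> 0) (at 0)"
    by (rule tendsto_eq_intros refl | simp)+
  have "((\<lambda>h::real. (possq (0 + h) - possq 0) / h) \<longlongrightarrow> 0) (at 0)"
    by (rule Lim_transform_eventually[OF lim])
      (auto simp: eventually_at_filter possq_def max_def power2_eq_square)
  then show ?thesis using equal by (simp add: DERIV_def)
qed

text \<open>A \<open>C\<^sup>1\<close> step from 1 on \<open>s \<le> 0\<close> to 0 on \<open>s \<ge> 1\<close>.\<close>

definition step1 :: "real \<Rightarrow> real" where "step1 s = possq (1 - possq s)"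

lemma step1_deriv: "(step1 has_real_derivative - (2 * max 0 (1 - possq s)) * (2 * max 0 s)) (at s)"
proof -
  have 1: "((\<lambda>s. 1 - possq s) has_real_derivative - (2 * max 0 s)) (at s)"
    using possq_deriv[of s] by (auto intro!: derivative_eq_intros)
  show ?thesis unfolding step1_def[abs_def]
    using DERIV_chain2[OF possq_deriv 1] by simp
qed

lemma step1_props:
  "0 \<le> step1 s" "step1 s \<le> 1" "s \<le> 0 \<Longrightarrow> step1 s = 1" "s \<ge> 1 \<Longrightarrow> step1 s = 0"
  "\<bar>(2 * max 0 (1 - possq s)) * (2 * max 0 s)\<bar> \<le> 4"
  "s \<ge> 1 \<Longrightarrow> (2 * max 0 (1 - possq s)) * (2 * max 0 s) = 0"
proof -
  have p0: "possq s \<ge> 0" by (simp add: possq_def)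
  show "0 \<le> step1 s" by (simp add: step1_def possq_def)
  show "step1 s \<le> 1" using p0 by (auto simp: step1_def possq_def[of "1 - _"] max_def intro: power_le_one)
  show "s \<le> 0 \<Longrightarrow> step1 s = 1" by (simp add: step1_def possq_def)
  have g: "possq s \<ge> 1" if "s \<ge> 1" using that by (simp add: possq_def)
  then show "s \<ge> 1 \<Longrightarrow> step1 s = 0" by (simp add: step1_def possq_def[of "1 - _"])
  show z: "s \<ge> 1 \<Longrightarrow> (2 * max 0 (1 - possq s)) * (2 * max 0 s) = 0" using g by simp
  show "\<bar>(2 * max 0 (1 - possq s)) * (2 * max 0 s)\<bar> \<le> 4"
  proof (cases "s \<ge> 1")
    case True then show ?thesis using z by simp
  next
    case False
    then have "max 0 (1 - possq s) * max 0 s \<le> 1 * 1" using p0 by (intro mult_mono) auto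
    moreover have "max 0 (1 - possq s) * max 0 s \<ge> 0" by simp
    ultimately show ?thesis by simp
  qed
qed

text \<open>A closed interval of length 10 contains at most 11 integers; used in both coordinates to
  count the grid points within \<open>5 * \<delta>\<close> of a point.\<close>

lemma card_int_window: "card {i::int. \<bar>real_of_int i - a\<bar> \<le> 5} \<le> 11" "finite {i::int. \<bar>real_of_int i - a\<bar> \<le> 5}"
proof -
  have eq: "{i::int. \<bar>real_of_int i - a\<bar> \<le> 5} = {\<lceil>a - 5\<rceil>..\<lfloor>a + 5\<rfloor>}"
    by (auto simp: abs_le_iff) linarith+
  show "finite {i::int. \<bar>real_of_int i - a\<bar> \<le> 5}" unfolding eq by simp
  show "card {i::int. \<bar>real_of_int i - a\<bar> \<le> 5} \<le> 11" unfolding eq by simp linarith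
qed

text \<open>A function of the distance to \<open>F\<close> would be merely Lipschitz. Here radial
  C^1 factors centred at the points of a \<delta>-grid close to \<open>F\<close> are multiplied; at
  each point only boundedly many of them have a nonzero derivative, which gives a gradient of order
  1/\<delta> whatever the shape of \<open>F\<close>.\<close>

lemma cutoff_function:
  fixes F :: "(real^2) set"
  assumes F: "bounded F" and \<delta>: "\<delta> > 0"
  obtains X :: "real^2 \<Rightarrow> real" where
    "\<And>x. 0 \<le> X x" "\<And>x. X x \<le> 1" "\<And>x. X differentiable (at x)" "\<And>x. norm (grad X x) \<le> 605 / \<delta>"
    "\<And>x f. f \<in> F \<Longrightarrow> dist x f < 2 * \<delta> \<Longrightarrow> X x = 0"
    "\<And>x. (\<And>f. f \<in> F \<Longrightarrow> dist x f \<ge> 9 * \<delta>) \<Longrightarrow> X x = 1 \<and> grad X x = 0"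
proof -
  define z :: "int \<times> int \<Rightarrow> real^2" where "z = (\<lambda>(i, j). \<chi> l. \<delta> * real_of_int (if l = 1 then i else j))"
  have z1: "z (i,j) $ 1 = \<delta> * real_of_int i" and z2: "z (i,j) $ 2 = \<delta> * real_of_int j" for i j
    by (simp_all add: z_def)
  have comp: "\<bar>x $ 1\<bar> \<le> norm x" "\<bar>x $ 2\<bar> \<le> norm x" for x :: "real^2" using component_le_norm_cart by auto
  define J where "J = {q. \<exists>f\<in>F. dist (z q) f < 4 * \<delta>}"
  obtain R where R: "\<And>f. f \<in> F \<Longrightarrow> norm f \<le> R" using F bounded_iff by blast
  have "J \<subseteq> {i::int. \<bar>i\<bar> \<le> \<lceil>(R + 4 * \<delta>) / \<delta>\<rceil>} \<times> {i::int. \<bar>i\<bar> \<le> \<lceil>(R + 4 * \<delta>) / \<delta>\<rceil>}"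
  proof
    fix q assume q: "q \<in> J"
    obtain i j where ij: "q = (i, j)" by fastforce
    obtain f where f: "f \<in> F" "dist (z q) f < 4 * \<delta>" using q J_def by blast
    have "norm (z q) \<le> R + 4 * \<delta>" using f R[OF f(1)] norm_triangle_sub[of "z q" f] by (simp add: dist_norm)
    then have "\<bar>\<delta> * real_of_int i\<bar> \<le> R + 4 * \<delta>" "\<bar>\<delta> * real_of_int j\<bar> \<le> R + 4 * \<delta>"
      using comp[of "z q"] z1[of i j] z2[of i j] by (auto simp: ij)
    then have "\<bar>real_of_int i\<bar> \<le> (R + 4 * \<delta>) / \<delta>" "\<bar>real_of_int j\<bar> \<le> (R + 4 * \<delta>) / \<delta>"
      using \<delta> by (auto simp: field_simps abs_mult)
    then show "q \<in> {i::int. \<bar>i\<bar> \<le> \<lceil>(R + 4 * \<delta>) / \<delta>\<rceil>} \<times> {i::int. \<bar>i\<bar> \<le> \<lceil>(R + 4 * \<delta>) / \<delta>\<rceil>}"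
      by (simp add: ij) linarith
  qed
  moreover have "finite {i::int. \<bar>i\<bar> \<le> c}" for c
    by (rule finite_subset[of _ "{-c..c}"]) auto
  ultimately have finJ: "finite J" by (meson finite_SigmaI finite_subset)
  \<comment> \<open>With t the distance to the grid point in units of \<delta>, this is (t^2 - 16) /
    9: nonpositive for t \<le> 4 and at least 1 for t \<ge> 5.\<close>
  define S where "S = (\<lambda>q x. ((x - z q) \<bullet> (x - z q) / \<delta>\<^sup>2 - 16) / 9)"
  define K where "K = (\<lambda>q x. - (2 * max 0 (1 - possq (S q x))) * (2 * max 0 (S q x)))"
  define f where "f = (\<lambda>q x. 1 - step1 (S q x))"
  define f' where "f' = (\<lambda>q x y. - K q x * (2 * ((x - z q) \<bullet> y) / (9 * \<delta>\<^sup>2)))"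
  have fd: "(f q has_derivative f' q x) (at x)" for q x
  proof -
    have s: "(S q has_derivative (\<lambda>y. 2 * ((x - z q) \<bullet> y) / (9 * \<delta>\<^sup>2))) (at x)"
      unfolding S_def using \<delta> by (auto intro!: derivative_eq_intros simp: inner_commute field_simps)
    have "(step1 has_derivative (\<lambda>t. K q x * t)) (at (S q x))"
      using step1_deriv[of "S q x"] unfolding has_field_derivative_def K_def .
    from has_derivative_compose[OF s this]
    have "((\<lambda>x. step1 (S q x)) has_derivative (\<lambda>y. K q x * (2 * ((x - z q) \<bullet> y) / (9 * \<delta>\<^sup>2)))) (at x)" .
    from has_derivative_diff[OF has_derivative_const[of 1] this]
    show ?thesis unfolding f_def f'_def by (rule has_derivative_eq_rhs) (simp add: fun_eq_iff)
  qed
  have far: "S q x \<ge> 1" if "norm (x - z q) \<ge> 5 * \<delta>" for q x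
  proof -
    have "(norm (x - z q))\<^sup>2 \<ge> (5 * \<delta>)\<^sup>2" using that \<delta> by (intro power_mono) auto
    then have "(x - z q) \<bullet> (x - z q) \<ge> 25 * \<delta>\<^sup>2" by (simp add: power2_norm_eq_inner power_mult_distrib)
    then have "(x - z q) \<bullet> (x - z q) / \<delta>\<^sup>2 \<ge> 25" using \<delta> by (simp add: field_simps)
    then show ?thesis by (simp add: S_def)
  qed
  have near: "S q x \<le> 0" if "norm (x - z q) \<le> 4 * \<delta>" for q x
  proof -
    have "(norm (x - z q))\<^sup>2 \<le> (4 * \<delta>)\<^sup>2" using that \<delta> by (intro power_mono) auto
    then have "(x - z q) \<bullet> (x - z q) \<le> 16 * \<delta>\<^sup>2" by (simp add: power2_norm_eq_inner power_mult_distrib)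
    then have "(x - z q) \<bullet> (x - z q) / \<delta>\<^sup>2 \<le> 16" using \<delta> by (simp add: field_simps)
    then show ?thesis by (simp add: S_def)
  qed
  have f'far: "f' q x y = 0" if "norm (x - z q) \<ge> 5 * \<delta>" for q x y
  proof -
    have "K q x = 0" unfolding K_def using step1_props(6)[OF far[OF that]] by auto
    then show ?thesis by (simp add: f'_def)
  qed
  have f01: "0 \<le> f q x" "f q x \<le> 1" for q x using step1_props(1,2) by (simp_all add: f_def)
  have f'b: "\<bar>f' q x y\<bar> \<le> (5 / \<delta>) * norm y" for q x y
  proof (cases "norm (x - z q) \<ge> 5 * \<delta>")
    case True then show ?thesis using f'far \<delta> by simp
  next
    case False
    have k: "\<bar>K q x\<bar> \<le> 4" using step1_props(5)[of "S q x"] by (simp add: K_def)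
    have "\<bar>(x - z q) \<bullet> y\<bar> \<le> (5 * \<delta>) * norm y"
      using Cauchy_Schwarz_ineq2[of "x - z q" y] mult_right_mono[of "norm (x - z q)" "5 * \<delta>" "norm y"] False by simp
    then have "\<bar>2 * ((x - z q) \<bullet> y) / (9 * \<delta>\<^sup>2)\<bar> \<le> (2 * (5 * \<delta> * norm y)) / (9 * \<delta>\<^sup>2)"
      using \<delta> by (simp add: abs_mult divide_right_mono)
    also have "\<dots> = (10 / 9) * norm y / \<delta>" using \<delta> by (simp add: power2_eq_square)
    finally have "\<bar>f' q x y\<bar> \<le> 4 * ((10 / 9) * norm y / \<delta>)"
      unfolding f'_def abs_mult using k by (intro mult_mono) auto
    also have "\<dots> \<le> (5 / \<delta>) * norm y" using \<delta> by (simp add: field_simps)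
    finally show ?thesis .
  qed
  define X where "X = (\<lambda>x. \<Prod>q\<in>J. f q x)"
  define X' where "X' = (\<lambda>x y. \<Sum>q\<in>J. f' q x y * (\<Prod>q'\<in>J - {q}. f q' x))"
  have Xd: "(X has_derivative X' x) (at x)" for x
    unfolding X_def X'_def by (rule has_derivative_prod) (rule fd)
  have Xdiff: "X differentiable (at x)" for x using Xd differentiableI by blast
  have X'g: "X' x y = grad X x \<bullet> y" for x y
    using has_derivative_unique[OF Xd has_derivative_grad[OF Xdiff]] by (simp add: fun_eq_iff)
  have gX: "norm (grad X x) \<le> 605 / \<delta>" for x
  proof -
    \<comment> \<open>Only the factors in \<open>W\<close> have a nonzero derivative at
      \<open>x\<close>. There are at most 11 times 11 = 121 of them, each with derivative at most
      5/\<delta>, hence the constant 605.\<close>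
    define W where "W = {q\<in>J. norm (x - z q) < 5 * \<delta>}"
    have "W \<subseteq> {i. \<bar>real_of_int i - x $ 1 / \<delta>\<bar> \<le> 5} \<times> {i. \<bar>real_of_int i - x $ 2 / \<delta>\<bar> \<le> 5}"
    proof
      fix q assume q: "q \<in> W"
      obtain i j where ij: "q = (i, j)" by fastforce
      have "norm (x - z q) \<le> 5 * \<delta>" using q W_def by simp
      then have "\<bar>x $ 1 - \<delta> * real_of_int i\<bar> \<le> 5 * \<delta>" "\<bar>x $ 2 - \<delta> * real_of_int j\<bar> \<le> 5 * \<delta>"
        using comp[of "x - z q"] z1[of i j] z2[of i j] by (auto simp: ij)
      then show "q \<in> {i. \<bar>real_of_int i - x $ 1 / \<delta>\<bar> \<le> 5} \<times> {i. \<bar>real_of_int i - x $ 2 / \<delta>\<bar> \<le> 5}"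
        using \<delta> by (auto simp: ij abs_le_iff field_simps)
    qed
    then have "card W \<le> card ({i. \<bar>real_of_int i - x $ 1 / \<delta>\<bar> \<le> 5} \<times> {i. \<bar>real_of_int i - x $ 2 / \<delta>\<bar> \<le> 5})"
      by (intro card_mono finite_cartesian_product card_int_window)
    also have "\<dots> \<le> 11 * 11" unfolding card_cartesian_product by (intro mult_le_mono card_int_window)
    finally have cW: "card W \<le> 121" by simp
    have "\<bar>X' x y\<bar> \<le> (605 / \<delta>) * norm y" for y
    proof -
      have pr: "\<bar>\<Prod>q'\<in>J - {q}. f q' x\<bar> \<le> 1" for q
        using f01 by (simp add: abs_prod) (intro prod_le_1, auto)
      have "X' x y = (\<Sum>q\<in>W. f' q x y * (\<Prod>q'\<in>J - {q}. f q' x))"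
        unfolding X'_def by (rule sum.mono_neutral_right) (use finJ f'far in \<open>auto simp: W_def not_less\<close>)
      also have "\<bar>\<dots>\<bar> \<le> (\<Sum>q\<in>W. \<bar>f' q x y * (\<Prod>q'\<in>J - {q}. f q' x)\<bar>)" by (rule sum_abs)
      also have "\<dots> \<le> (\<Sum>q\<in>W. (5 / \<delta>) * norm y)"
      proof (rule sum_mono)
        fix q
        have "\<bar>f' q x y\<bar> * \<bar>\<Prod>q'\<in>J - {q}. f q' x\<bar> \<le> ((5 / \<delta>) * norm y) * 1"
          using f'b pr \<delta> by (intro mult_mono) auto
        then show "\<bar>f' q x y * (\<Prod>q'\<in>J - {q}. f q' x)\<bar> \<le> (5 / \<delta>) * norm y" by (simp add: abs_mult)
      qed
      also have "\<dots> = real (card W) * ((5 / \<delta>) * norm y)" by simp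
      also have "\<dots> \<le> 121 * ((5 / \<delta>) * norm y)" using cW \<delta> by (intro mult_right_mono) auto
      finally show ?thesis by simp
    qed
    from this[of "grad X x"] have "norm (grad X x) * norm (grad X x) \<le> 605 / \<delta> * norm (grad X x)"
      by (simp add: X'g power2_norm_eq_inner[symmetric] power2_eq_square)
    then show ?thesis using \<delta> mult_right_le_imp_le[of "norm (grad X x)" "norm (grad X x)" "605 / \<delta>"]
      by (cases "grad X x = 0") auto
  qed
  have zero: "X x = 0" if "g \<in> F" "dist x g < 2 * \<delta>" for x g
  proof -
    \<comment> \<open>A corner of the grid cell of \<open>x\<close>. It is within
      \<open>2 * \<delta>\<close> of \<open>x\<close>, hence within \<open>4 * \<delta>\<close> of
      \<open>g\<close>, so its factor is present in the product and vanishes at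
      \<open>x\<close>.\<close>
    define q where "q = (\<lfloor>x $ 1 / \<delta>\<rfloor>, \<lfloor>x $ 2 / \<delta>\<rfloor>)"
    have fl: "\<bar>t - \<delta> * real_of_int \<lfloor>t / \<delta>\<rfloor>\<bar> \<le> \<delta>" for t
    proof -
      have "\<delta> * real_of_int \<lfloor>t / \<delta>\<rfloor> \<le> \<delta> * (t / \<delta>)" "\<delta> * (t / \<delta>) \<le> \<delta> * (real_of_int \<lfloor>t / \<delta>\<rfloor> + 1)"
        using \<delta> by (intro mult_left_mono; linarith)+
      then show ?thesis using \<delta> by (auto simp: abs_le_iff distrib_left)
    qed
    have s2: "norm (x - z q) \<le> 2 * \<delta>"
      using norm_le_l1_cart[of "x - z q"] fl[of "x $ 1"] fl[of "x $ 2"] by (simp add: sum_2 q_def z1 z2)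
    have "dist (z q) g < 4 * \<delta>"
      using s2 that(2) dist_triangle[of "z q" g x] by (simp add: dist_norm norm_minus_commute)
    then have qJ: "q \<in> J" using that(1) J_def by blast
    have "f q x = 0" using step1_props(3) near[of x q] s2 \<delta> by (simp add: f_def)
    then show ?thesis unfolding X_def using qJ by (intro prod_zero[OF finJ]) (rule bexI)
  qed
  show ?thesis
  proof (rule that[of X])
    show "0 \<le> X x" for x unfolding X_def using f01 by (intro prod_nonneg) auto
    show "X x \<le> 1" for x unfolding X_def using f01 by (intro prod_le_1) auto
    show "X differentiable (at x)" for x by (rule Xdiff)
    show "norm (grad X x) \<le> 605 / \<delta>" for x by (rule gX)
    show "\<And>x f. f \<in> F \<Longrightarrow> dist x f < 2 * \<delta> \<Longrightarrow> X x = 0" by (rule zero)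
    fix x assume x: "\<And>f. f \<in> F \<Longrightarrow> dist x f \<ge> 9 * \<delta>"
    have fa: "norm (x - z q) \<ge> 5 * \<delta>" if q: "q \<in> J" for q
    proof -
      obtain g where "g \<in> F" "dist (z q) g < 4 * \<delta>" using q J_def by blast
      then show ?thesis using x[of g] dist_triangle[of x g "z q"] by (simp add: dist_norm)
    qed
    have "X x = 1" unfolding X_def
      by (rule prod.neutral) (use step1_props(4) far fa in \<open>auto simp: f_def\<close>)
    moreover have "grad X x = 0"
    proof -
      have "X' x (grad X x) = 0" unfolding X'_def
        by (rule sum.neutral) (use fa f'far in auto)
      then show ?thesis by (simp add: X'g)
    qed
    ultimately show "X x = 1 \<and> grad X x = 0" ..
  qed
qed

section \<open>Poincare inequalities and the convection form near the boundary\<close>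

lemma tame_norm_grad:
  assumes v: "tame (v::real^2 \<Rightarrow> real)"
  shows "integrable lebesgue (\<lambda>x. (norm (grad v x))\<^sup>2)"
    and "grad v \<in> borel_measurable lebesgue"
proof -
  have eq: "(norm (grad v x))\<^sup>2 = (\<Sum>i\<in>UNIV. (frechet_derivative v (at x) (axis i 1))^2)" for x
    unfolding power2_norm_eq_inner inner_vec_def grad_def by (simp add: power2_eq_square)
  show "integrable lebesgue (\<lambda>x. (norm (grad v x))\<^sup>2)"
    unfolding eq by (intro Bochner_Integration.integrable_sum tame_difference_quotient(2)[OF v]) simp
  show "grad v \<in> borel_measurable lebesgue"
    unfolding borel_measurable_euclidean_space[of "grad v"]
    using tame_difference_quotient(1)[OF v] by (auto simp: Basis_vec_def inner_axis grad_def)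
qed

lemma translation_difference_le_grad:
  assumes v: "tame (v::real^2 \<Rightarrow> real)"
  shows "(LINT x|lebesgue. (v (x + y) - v x)\<^sup>2) \<le> (norm y)\<^sup>2 * (LINT x|lebesgue. (norm (grad v x))\<^sup>2)"
    and "integrable lebesgue (\<lambda>x. (v (x + y) - v x)\<^sup>2)"
proof -
  have "(LINT x|lebesgue. (frechet_derivative v (at x) y)\<^sup>2) \<le> (LINT x|lebesgue. (norm y)\<^sup>2 * (norm (grad v x))\<^sup>2)"
  proof (rule integral_mono_AE)
    show "integrable lebesgue (\<lambda>x. (frechet_derivative v (at x) y)\<^sup>2)"
      using tame_difference_quotient(2)[OF v] by simp
    show "integrable lebesgue (\<lambda>x. (norm y)\<^sup>2 * (norm (grad v x))\<^sup>2)"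
      using tame_norm_grad(1)[OF v] by simp
    have "AE x in lebesgue. v differentiable (at x)" using v tame_def by blast
    then show "AE x in lebesgue. (frechet_derivative v (at x) y)\<^sup>2 \<le> (norm y)\<^sup>2 * (norm (grad v x))\<^sup>2"
    proof eventually_elim
      case (elim x)
      have "\<bar>frechet_derivative v (at x) y\<bar> \<le> norm y * norm (grad v x)"
        using Cauchy_Schwarz_ineq2[of "grad v x" y] frechet_derivative_eq_grad[OF elim] by (simp add: mult.commute)
      then have "\<bar>frechet_derivative v (at x) y\<bar>\<^sup>2 \<le> (norm y * norm (grad v x))\<^sup>2" by (rule power_mono) simp
      then show ?case by (simp add: power_mult_distrib)
    qed
  qed
  then show "(LINT x|lebesgue. (v (x + y) - v x)\<^sup>2) \<le> (norm y)\<^sup>2 * (LINT x|lebesgue. (norm (grad v x))\<^sup>2)"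
    using integral_translation_difference_le[OF v, of y] by simp
  show "integrable lebesgue (\<lambda>x. (v (x + y) - v x)\<^sup>2)"
    using tame_difference_quotient(4)[OF v, of 2 0 y] by simp
qed

text \<open>A translation by \<open>3 * R\<close> moves the ball of radius \<open>R\<close> off
  itself, so on that ball one of the two terms of the difference vanishes. The constant is the
  square of the length of the translation.\<close>

lemma Poincare:
  assumes v: "tame (v::real^2 \<Rightarrow> real)" and R: "R > 0" "\<And>x. norm x > R \<Longrightarrow> v x = 0"
  shows "(LINT x|lebesgue. (v x)\<^sup>2) \<le> (3 * R)\<^sup>2 * (LINT x|lebesgue. (norm (grad v x))\<^sup>2)"
proof -
  define y :: "real^2" where "y = (3 * R) *\<^sub>R axis 1 1"
  have ny: "norm y = 3 * R" using R by (simp add: y_def norm_axis_1)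
  have "(LINT x|lebesgue. (v x)\<^sup>2) \<le> (LINT x|lebesgue. (v (x + y) - v x)\<^sup>2)"
  proof (rule integral_mono)
    show "integrable lebesgue (\<lambda>x. (v x)\<^sup>2)" using tame_integrable[OF v] by simp
    show "integrable lebesgue (\<lambda>x. (v (x + y) - v x)\<^sup>2)" by (rule translation_difference_le_grad[OF v])
    fix x
    show "(v x)\<^sup>2 \<le> (v (x + y) - v x)\<^sup>2"
    proof (cases "norm x > R")
      case True then show ?thesis using R by simp
    next
      case False
      then have "norm (x + y) > R" using norm_diff_triangle_ineq[of y 0 0 "-x"] norm_triangle_ineq2[of y "-x"] ny R(1)
        by (simp add: add.commute)
      then show ?thesis using R by simp
    qed
  qed
  then show ?thesis using translation_difference_le_grad(1)[OF v, of y] by (simp add: ny)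
qed

text \<open>Near the boundary, moving a distance \<open>8 d\<close> along the chart direction leaves the
  \<open>d\<close>-neighbourhood of \<open>\<Omega>\<close>, so \<open>v\<close> agrees there with a translation difference.\<close>

lemma strip_Poincare:
  assumes sd: "smooth_domain m \<Omega>" and m: "m \<ge> 1"
  shows "\<exists>N::nat. \<exists>d0>0. \<forall>d v. 0 < d \<and> d < d0 \<and> tame v \<and>
      (\<forall>x. v x \<noteq> 0 \<longrightarrow> (\<exists>y\<in>closure \<Omega>. dist x y \<le> d)) \<longrightarrow>
      (LINT x|lebesgue. indicator {x. infdist x (frontier \<Omega>) \<le> d} x * (v x)\<^sup>2)
        \<le> N * (8 * d)\<^sup>2 * (LINT x|lebesgue. (norm (grad v x))\<^sup>2)"
proof -
  let ?F = "frontier \<Omega>"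
  have c: "compact ?F" using sd unfolding smooth_domain_def by (simp add: compact_frontier_bounded)
  have Fne: "?F \<noteq> {}" using sd unfolding smooth_domain_def frontier_eq_empty
    by (auto simp: not_bounded_UNIV)
  obtain r where r: "r > 0" "\<forall>p\<in>?F. \<exists>n \<phi>. chart \<Omega> (1/2) r p n \<phi>"
    using smooth_domain_chart[OF sd m, of "1/2"] by auto
  then obtain n \<phi> where ch: "\<And>p. p \<in> ?F \<Longrightarrow> chart \<Omega> (1/2) r p (n p) (\<phi> p)" by metis
  \<comment> \<open>Quarter radii leave room: all points considered below stay within r/4 + 10 d <
    r/2 of a centre, because d < r/40.\<close>
  obtain P where P: "finite P" "P \<subseteq> ?F" "?F \<subseteq> (\<Union>p\<in>P. ball p (r/4))"
  proof (rule compactE_image[OF c, of ?F "\<lambda>p. ball p (r/4)"])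
    show "?F \<subseteq> (\<Union>p\<in>?F. ball p (r/4))" using r(1) by force
  qed auto
  show ?thesis
  proof (intro exI[of _ "card P"] exI[of _ "r / 40"] conjI allI impI)
    show "r / 40 > 0" using r by simp
    fix d v
    assume A: "0 < d \<and> d < r / 40 \<and> tame v \<and> (\<forall>x. v x \<noteq> 0 \<longrightarrow> (\<exists>y\<in>closure \<Omega>. dist x y \<le> d))"
    then have d: "0 < d" "d < r / 40" and v: "tame v"
      and vs: "\<And>x. v x \<noteq> 0 \<Longrightarrow> \<exists>y\<in>closure \<Omega>. dist x y \<le> d" by auto
    let ?S = "{x. infdist x ?F \<le> d}"
    have pt: "indicator ?S x * (v x)\<^sup>2 \<le> (\<Sum>p\<in>P. (v (x + (8 * d) *\<^sub>R n p) - v x)\<^sup>2)" for x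
    proof (cases "x \<in> ?S")
      case False then show ?thesis by (simp add: sum_nonneg)
    next
      case True
      obtain f where f: "f \<in> ?F" "infdist x ?F = dist x f"
        using infdist_attains_inf[of ?F x] c Fne compact_imp_closed by metis
      obtain p where p: "p \<in> P" "f \<in> ball p (r/4)" using P(3) f(1) by blast
      define x' where "x' = x + (8 * d) *\<^sub>R n p"
      have chp: "chart \<Omega> (1/2) r p (n p) (\<phi> p)" using ch p(1) P(2) by blast
      have n1: "norm (n p) = 1" using chp unfolding chart_def by blast
      have est: "\<bar>\<phi> p a - \<phi> p b - n p \<bullet> (a - b)\<bar> \<le> 1/2 * norm (a - b)" if "a \<in> ball p r" "b \<in> ball p r" for a b
        using chp that unfolding chart_def by blast
      have np: "\<bar>n p \<bullet> a\<bar> \<le> norm a" for a using Cauchy_Schwarz_ineq2[of "n p" a] n1 by simp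
      have df: "dist x f \<le> d" using True f(2) by simp
      have pf: "dist p f < r/4" using p(2) by simp
      have fb: "f \<in> ball p r" using pf r(1) by simp
      have px: "dist p x < r/4 + d" using dist_triangle[of p x f] df pf by (simp add: dist_commute)
      have xb: "x \<in> ball p r" using px d r(1) by simp
      have xx': "dist x x' = 8 * d" using n1 d by (simp add: x'_def dist_norm)
      have px': "dist p x' < r/4 + 9 * d" using dist_triangle[of p x' x] px xx' by linarith
      have x'b: "x' \<in> ball p r" using px' d r(1) by simp
      have f0: "\<phi> p f = 0" using chp fb f(1) unfolding chart_def by blast
      have 1: "\<phi> p x \<ge> - (3/2 * d)"
        using est[OF xb fb] np[of "x - f"] df f0 unfolding dist_norm abs_le_iff by linarith
      have "n p \<bullet> (x' - x) = 8 * d" by (simp add: x'_def n1 power2_norm_eq_inner[symmetric])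
      then have 2: "\<phi> p x' \<ge> \<phi> p x + 4 * d" using est[OF x'b xb] xx' by (simp add: dist_norm norm_minus_commute)
      \<comment> \<open>The step along \<open>n p\<close> raises \<phi> by at least half its length
        8 d, from a value of at least -3d/2 at \<open>x\<close> to one of at least 5d/2 at
        \<open>x'\<close>. A point of the closure within d of \<open>x'\<close> has \<phi> \<le> 0,
        which would force a value of at most 3d/2 at \<open>x'\<close>.\<close>
      have "v x' = 0"
      proof (rule ccontr)
        assume "v x' \<noteq> 0"
        then obtain y where y: "y \<in> closure \<Omega>" "dist x' y \<le> d" using vs by blast
        have yb: "y \<in> ball p r" using dist_triangle[of p y x'] px' y(2) d r(1) by simp
        have "y \<in> \<Omega> \<or> y \<in> ?F" using y(1) sd unfolding smooth_domain_def by (auto simp: frontier_def interior_open)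
        then have "\<phi> p y \<le> 0" using chp yb unfolding chart_def by fastforce
        then show False using 1 2 est[OF x'b yb] np[of "x' - y"] y(2) d by (simp add: dist_norm)
      qed
      then have "(v x)\<^sup>2 = (v (x + (8 * d) *\<^sub>R n p) - v x)\<^sup>2" by (simp add: x'_def)
      also have "\<dots> \<le> (\<Sum>p\<in>P. (v (x + (8 * d) *\<^sub>R n p) - v x)\<^sup>2)"
        by (rule member_le_sum) (use p P in auto)
      finally show ?thesis using True by simp
    qed
    have nP: "norm (n p) = 1" if "p \<in> P" for p using ch[of p] that P(2) unfolding chart_def by blast
    let ?G = "LINT x|lebesgue. (norm (grad v x))\<^sup>2"
    have "(LINT x|lebesgue. indicator ?S x * (v x)\<^sup>2) \<le> (LINT x|lebesgue. (\<Sum>p\<in>P. (v (x + (8 * d) *\<^sub>R n p) - v x)\<^sup>2))"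
    proof (rule integral_mono[OF _ _ pt])
      have cl: "closed ?S" by (intro closed_Collect_le continuous_intros)
      then show "integrable lebesgue (\<lambda>x. indicator ?S x * (v x)\<^sup>2)"
        using tame_integrable[OF v, of 2] integrable_mult_indicator[of ?S lebesgue "\<lambda>x. (v x)\<^sup>2"] by simp
    qed (intro Bochner_Integration.integrable_sum translation_difference_le_grad[OF v])
    also have "\<dots> = (\<Sum>p\<in>P. LINT x|lebesgue. (v (x + (8 * d) *\<^sub>R n p) - v x)\<^sup>2)"
      by (intro Bochner_Integration.integral_sum translation_difference_le_grad[OF v])
    also have "\<dots> \<le> (\<Sum>p\<in>P. (8 * d)\<^sup>2 * ?G)"
    proof (rule sum_mono)
      fix p assume "p \<in> P"
      then show "(LINT x|lebesgue. (v (x + (8 * d) *\<^sub>R n p) - v x)\<^sup>2) \<le> (8 * d)\<^sup>2 * ?G"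
        using translation_difference_le_grad(1)[OF v, of "(8 * d) *\<^sub>R n p"] nP by (simp add: power_mult_distrib)
    qed
    finally show "(LINT x|lebesgue. indicator ?S x * (v x)\<^sup>2) \<le> real (card P) * (8 * d)\<^sup>2 * ?G" by simp
  qed
qed

text \<open>Twice the integrand is \<open>b \<bullet> grad\<close> of v^2. The part cut off by
  \<open>X\<close> integrates to zero by \<open>integral_divergence_free_grad\<close>; the remainder
  lives in the strip of width d around the boundary, where \<open>strip_Poincare\<close> makes v^2
  cost d^2 times the energy.\<close>

lemma convection_form_small:
  fixes b :: "real^2 \<Rightarrow> real^2"
  assumes sd: "smooth_domain m \<Omega>" and m: "m \<ge> 1"
    and bC: "Ck_on m b \<Omega>" and div: "\<forall>x\<in>\<Omega>. divergence b x = 0"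
    and bm: "b \<in> borel_measurable lebesgue" and bB: "AE x in lebesgue. norm (b x) \<le> B"
    and \<eta>: "\<eta> > 0"
  shows "\<exists>h0>0. \<forall>v. tame v \<and> (\<forall>x. v x \<noteq> 0 \<longrightarrow> (\<exists>y\<in>closure \<Omega>. dist x y \<le> h0)) \<longrightarrow>
      \<bar>LINT x|lebesgue. (b x \<bullet> grad v x) * v x\<bar> \<le> \<eta> * (LINT x|lebesgue. (norm (grad v x))\<^sup>2)"
proof -
  let ?F = "frontier \<Omega>"
  have \<Omega>: "open \<Omega>" "bounded \<Omega>" using sd unfolding smooth_domain_def by auto
  have c: "compact ?F" using \<Omega> by (simp add: compact_frontier_bounded)
  have Fne: "?F \<noteq> {}" using sd unfolding smooth_domain_def frontier_eq_empty
    by (auto simp: not_bounded_UNIV)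
  obtain N d0 where N: "d0 > 0" "\<And>d v. 0 < d \<Longrightarrow> d < d0 \<Longrightarrow> tame v \<Longrightarrow>
      (\<And>x. v x \<noteq> 0 \<Longrightarrow> \<exists>y\<in>closure \<Omega>. dist x y \<le> d) \<Longrightarrow>
      (LINT x|lebesgue. indicator {x. infdist x ?F \<le> d} x * (v x)\<^sup>2)
        \<le> real N * (8 * d)\<^sup>2 * (LINT x|lebesgue. (norm (grad v x))\<^sup>2)"
    using strip_Poincare[OF sd m] by (elim exE conjE) (rule that, assumption, blast)
  define B' where "B' = max B 0"
  have B'0: "B' \<ge> 0" by (simp add: B'_def)
  \<comment> \<open>The strip term carries 1/d from Young's inequality and 605/\<delta> = 5445/d
    from the cut-off, together 5446/d; multiplied by the 64 N d^2 of \<open>strip_Poincare\<close>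
    this leaves a multiple of d.\<close>
  define C where "C = B' * (1 + 5446 * 64 * real N)"
  have C0: "C \<ge> 0" using B'0 by (simp add: C_def)
  define d where "d = min (d0 / 2) (\<eta> / (C + 1))"
  have d: "d > 0" "d < d0" "C * d \<le> \<eta>"
  proof -
    show "d > 0" "d < d0" using N(1) \<eta> C0 by (auto simp: d_def)
    have "C * d \<le> C * (\<eta> / (C + 1))" using C0 by (intro mult_left_mono) (auto simp: d_def)
    also have "\<dots> \<le> \<eta>" using C0 \<eta> by (simp add: field_simps)
    finally show "C * d \<le> \<eta>" .
  qed
  \<comment> \<open>The cut-off reaches 1 at distance \<open>9 * \<delta>\<close>, which is thus
    made the width \<open>d\<close> of the strip.\<close>
  define \<delta> where "\<delta> = d / 9"
  have \<delta>: "\<delta> > 0" "d = 9 * \<delta>" using d by (auto simp: \<delta>_def)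
  obtain X :: "real^2 \<Rightarrow> real" where X: "\<And>x. 0 \<le> X x" "\<And>x. X x \<le> 1" "\<And>x. X differentiable (at x)" "\<And>x. norm (grad X x) \<le> 605 / \<delta>"
    "\<And>x f. f \<in> ?F \<Longrightarrow> dist x f < 2 * \<delta> \<Longrightarrow> X x = 0"
    "\<And>x. (\<And>f. f \<in> ?F \<Longrightarrow> dist x f \<ge> 9 * \<delta>) \<Longrightarrow> X x = 1 \<and> grad X x = 0"
  proof (rule cutoff_function[OF compact_imp_bounded[OF c] \<delta>(1)], goal_cases)
    case (1 X)
    show ?case by (rule 1(1)[of X]) (fact 1)+
  qed
  have XL: "(605 / \<delta>)-lipschitz_on UNIV X"
  proof (rule lipschitz_onI)
    fix x y
    have "norm (X x - X y) \<le> 605 / \<delta> * norm (x - y)"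
    proof (rule differentiable_bound[where S=UNIV and f' = "\<lambda>z y. grad X z \<bullet> y"])
      fix z
      show "(X has_derivative (\<lambda>y. grad X z \<bullet> y)) (at z within UNIV)" by (simp add: has_derivative_grad X)
      show "onorm (\<lambda>y. grad X z \<bullet> y) \<le> 605 / \<delta>"
      proof (rule onorm_le)
        fix y
        show "norm (grad X z \<bullet> y) \<le> 605 / \<delta> * norm y"
          using Cauchy_Schwarz_ineq2[of "grad X z" y] mult_right_mono[OF X(4)[of z] norm_ge_zero[of y]]
          by (simp only: real_norm_def)
      qed
    qed auto
    then show "dist (X x) (X y) \<le> 605 / \<delta> * dist x y" by (simp add: dist_norm)
  qed (use \<delta> in simp)
  let ?S = "{x. infdist x ?F \<le> d}"
  show ?thesis
  \<comment> \<open>The support condition is imposed with \<delta>, not with \<open>d\<close>: a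
    point outside the closure of \<Omega> at which \<open>v\<close> is nonzero is then within
    \<delta> of the boundary, where \<open>X\<close> vanishes.\<close>
  proof (intro exI[of _ \<delta>] conjI allI impI)
    show "\<delta> > 0" by (rule \<delta>)
    fix v :: "real^2 \<Rightarrow> real"
    assume A: "tame v \<and> (\<forall>x. v x \<noteq> 0 \<longrightarrow> (\<exists>y\<in>closure \<Omega>. dist x y \<le> \<delta>))"
    then have v: "tame v" and vs: "\<And>x. v x \<noteq> 0 \<Longrightarrow> \<exists>y\<in>closure \<Omega>. dist x y \<le> \<delta>" by auto
    let ?G = "LINT x|lebesgue. (norm (grad v x))\<^sup>2"
    have vs': "\<exists>y\<in>closure \<Omega>. dist x y \<le> d" if "v x \<noteq> 0" for x using vs[OF that] \<delta> by force
    have strip: "(LINT x|lebesgue. indicator ?S x * (v x)\<^sup>2) \<le> real N * (8 * d)\<^sup>2 * ?G"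
      using N(2)[OF d(1,2) v vs'] .
    have si: "integrable lebesgue (\<lambda>x. indicator ?S x * (v x)\<^sup>2)"
    proof -
      have "closed ?S" by (intro closed_Collect_le continuous_intros)
      then show ?thesis
        using tame_integrable[OF v, of 2] integrable_mult_indicator[of ?S lebesgue "\<lambda>x. (v x)\<^sup>2"] by simp
    qed
    have cO: "closure \<Omega> = \<Omega> \<union> ?F" using \<Omega>(1) by (auto simp: frontier_def interior_open closure_subset[THEN subsetD])
    have vv: "tame (\<lambda>x. v x * v x)" by (rule tame_mult[OF v v])
    define \<psi> where "\<psi> = (\<lambda>x. X x * (v x * v x))"
    have \<psi>t: "tame \<psi>" unfolding \<psi>_def
      by (rule tame_Lipschitz_mult[OF XL _ _ vv, of 1]) (use X in \<open>auto simp: abs_le_iff intro: order_trans[of _ 0]\<close>)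
    define K where "K = closure \<Omega> \<inter> {x. infdist x ?F \<ge> 2 * \<delta>}"
    have Kc: "compact K" unfolding K_def
      using \<Omega>(2) by (intro compact_Int_closed closed_Collect_le continuous_intros) auto
    have Ks: "K \<subseteq> \<Omega>" unfolding K_def cO using \<delta>(1) by auto
    have K0: "\<psi> x = 0" if x: "x \<notin> K" for x
    proof (rule ccontr)
      assume n: "\<psi> x \<noteq> 0"
      then have vx: "v x \<noteq> 0" and Xx: "X x \<noteq> 0" by (auto simp: \<psi>_def)
      have far: "dist x f \<ge> 2 * \<delta>" if "f \<in> ?F" for f using X(5)[OF that, of x] Xx by force
      have "infdist x ?F \<ge> 2 * \<delta>"
        using infdist_attains_inf[of ?F x] c Fne compact_imp_closed far by metis
      moreover have "x \<in> closure \<Omega>"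
      proof (rule ccontr)
        assume nx: "x \<notin> closure \<Omega>"
        obtain y where y: "y \<in> closure \<Omega>" "dist x y \<le> \<delta>" using vs[OF vx] by blast
        \<comment> \<open>A segment from outside into the closure crosses the boundary, at a
          distance of at most \<delta> from \<open>x\<close>.\<close>
        have "closed_segment x y \<inter> frontier (closure \<Omega>) \<noteq> {}"
          by (rule connected_Int_frontier) (use nx y in auto)
        then obtain f where f: "f \<in> closed_segment x y" "f \<in> frontier (closure \<Omega>)" by blast
        then have "f \<in> ?F" using \<Omega>(1) interior_mono[OF closure_subset[of \<Omega>]] by (auto simp: frontier_def interior_open)
        moreover have "dist x f \<le> dist x y" using f(1) by (metis dist_commute dist_in_closed_segment)
        ultimately show False using far[of f] y(2) \<delta>(1) by linarith
      qed
      ultimately show False using x K_def by blast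
    qed
    have I0: "(LINT x|lebesgue. b x \<bullet> grad \<psi> x) = 0" and Ii: "integrable lebesgue (\<lambda>x. b x \<bullet> grad \<psi> x)"
      using integral_divergence_free_grad[OF \<psi>t \<Omega>(1) Kc Ks K0 Ck_on_C1[OF bC m]] div by blast+
    let ?I = "\<lambda>x. (b x \<bullet> grad v x) * v x"
    let ?R = "\<lambda>x. B' * (d * (norm (grad v x))\<^sup>2 + (1 / d + 605 / \<delta>) * (indicator ?S x * (v x)\<^sup>2))"
    have ae: "AE x in lebesgue. \<bar>2 * ?I x - b x \<bullet> grad \<psi> x\<bar> \<le> ?R x"
    proof -
      have "AE x in lebesgue. v differentiable (at x)" using v tame_def by blast
      then show ?thesis using bB
      proof eventually_elim
        case (elim x)
        have dv: "v differentiable (at x)" by (rule elim)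
        have bx: "norm (b x) \<le> B'" using elim by (simp add: B'_def)
        have g: "grad \<psi> x = X x *\<^sub>R (2 * v x) *\<^sub>R grad v x + (v x * v x) *\<^sub>R grad X x"
          unfolding \<psi>_def grad_mult[OF X(3) differentiable_mult[OF dv dv]] grad_mult[OF dv dv]
          by (simp add: scaleR_add_left[symmetric])
        have e: "2 * ?I x - b x \<bullet> grad \<psi> x = (1 - X x) * (2 * v x) * (b x \<bullet> grad v x) - (v x * v x) * (b x \<bullet> grad X x)"
          unfolding g by (simp add: inner_add_right algebra_simps)
        show ?case
        proof (cases "x \<in> ?S")
          case False
          then have f: "dist x f \<ge> 9 * \<delta>" if "f \<in> ?F" for f using infdist_le[OF that, of x] \<delta>(2) by simp
          have "X x = 1 \<and> grad X x = 0" by (rule X(6)) (rule f)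
          then show ?thesis unfolding e using B'0 d(1) False by simp
        next
          case True
          have 1: "\<bar>b x \<bullet> grad v x\<bar> \<le> B' * norm (grad v x)"
            using Cauchy_Schwarz_ineq2[of "b x" "grad v x"] mult_right_mono[OF bx norm_ge_zero[of "grad v x"]] by linarith
          have 2: "\<bar>b x \<bullet> grad X x\<bar> \<le> B' * (605 / \<delta>)"
            using Cauchy_Schwarz_ineq2[of "b x" "grad X x"] mult_mono[OF bx X(4)[of x] B'0 norm_ge_zero] by linarith
          \<comment> \<open>Young's inequality with weight \<open>d\<close>: the gradient term
            becomes small, and the factor 1/d on v^2 is compensated by the d^2 of the strip
            estimate.\<close>
          have y: "2 * \<bar>v x\<bar> * norm (grad v x) \<le> d * (norm (grad v x))\<^sup>2 + 1 / d * (v x)\<^sup>2"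
          proof -
            have "0 \<le> (d * norm (grad v x) - \<bar>v x\<bar>)\<^sup>2" by simp
            then have "2 * \<bar>v x\<bar> * norm (grad v x) * d \<le> d * d * (norm (grad v x))\<^sup>2 + (v x)\<^sup>2"
              by (simp add: power2_diff power_mult_distrib power2_eq_square algebra_simps)
            then show ?thesis using d(1) by (simp add: field_simps power2_eq_square)
          qed
          have "\<bar>(1 - X x) * (2 * v x) * (b x \<bullet> grad v x)\<bar> \<le> 1 * (2 * \<bar>v x\<bar>) * (B' * norm (grad v x))"
            unfolding abs_mult using 1 X(1,2)[of x] by (intro mult_mono) auto
          also have "\<dots> = B' * (2 * \<bar>v x\<bar> * norm (grad v x))" by simp
          also have "\<dots> \<le> B' * (d * (norm (grad v x))\<^sup>2 + 1 / d * (v x)\<^sup>2)" using y B'0 by (rule mult_left_mono)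
          finally have 3: "\<bar>(1 - X x) * (2 * v x) * (b x \<bullet> grad v x)\<bar> \<le> B' * (d * (norm (grad v x))\<^sup>2 + 1 / d * (v x)\<^sup>2)" .
          have "\<bar>(v x * v x) * (b x \<bullet> grad X x)\<bar> \<le> (v x)\<^sup>2 * (B' * (605 / \<delta>))"
            using mult_left_mono[OF 2, of "(v x)\<^sup>2"] by (simp add: abs_mult power2_eq_square)
          then show ?thesis unfolding e using 3 True by (simp add: algebra_simps)
        qed
      qed
    qed
    have Ri: "integrable lebesgue ?R"
      using tame_norm_grad(1)[OF v] si by (intro integrable_mult_right Bochner_Integration.integrable_add) auto
    have Im: "?I \<in> borel_measurable lebesgue"
    proof -
      have "v \<in> borel_measurable lebesgue" using tame_measurable[OF v] by (simp add: measurable_completion)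
      then show ?thesis using bm tame_norm_grad(2)[OF v] by measurable
    qed
    have Di: "integrable lebesgue (\<lambda>x. 2 * ?I x - b x \<bullet> grad \<psi> x)"
    proof (rule Bochner_Integration.integrable_bound[OF Ri])
      show "(\<lambda>x. 2 * ?I x - b x \<bullet> grad \<psi> x) \<in> borel_measurable lebesgue" using Im Ii by measurable
      show "AE x in lebesgue. norm (2 * ?I x - b x \<bullet> grad \<psi> x) \<le> norm (?R x)"
        using ae by eventually_elim (unfold real_norm_def, erule order_trans, rule abs_ge_self)
    qed
    have "integrable lebesgue (\<lambda>x. (2 * ?I x - b x \<bullet> grad \<psi> x) + b x \<bullet> grad \<psi> x)"
      by (rule Bochner_Integration.integrable_add[OF Di Ii])
    then have I2: "integrable lebesgue ?I" by simp
    have "2 * (LINT x|lebesgue. ?I x) = (LINT x|lebesgue. 2 * ?I x - b x \<bullet> grad \<psi> x)"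
      using I2 Ii I0 by simp
    then have "2 * \<bar>LINT x|lebesgue. ?I x\<bar> = \<bar>LINT x|lebesgue. 2 * ?I x - b x \<bullet> grad \<psi> x\<bar>" by linarith
    also have "\<dots> \<le> (LINT x|lebesgue. \<bar>2 * ?I x - b x \<bullet> grad \<psi> x\<bar>)"
      using integral_abs_bound by blast
    also have "\<dots> \<le> (LINT x|lebesgue. ?R x)"
      by (rule integral_mono_AE[OF _ Ri ae]) (use Di in simp)
    also have "\<dots> = B' * (d * ?G + (1 / d + 605 / \<delta>) * (LINT x|lebesgue. indicator ?S x * (v x)\<^sup>2))"
      using tame_norm_grad(1)[OF v] si by simp
    also have "\<dots> \<le> B' * (d * ?G + (1 / d + 605 / \<delta>) * (real N * (8 * d)\<^sup>2 * ?G))"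
      using strip B'0 d(1) \<delta>(1) by (intro mult_left_mono add_left_mono) auto
    also have "\<dots> = C * d * ?G"
    proof -
      have "(1 / d + 605 / \<delta>) = 5446 / d" using d(1) by (simp add: \<delta>_def)
      then show ?thesis using d(1) by (simp add: C_def power2_eq_square field_simps)
    qed
    also have "\<dots> \<le> \<eta> * ?G" using d(3) by (intro mult_right_mono) auto
    finally show "\<bar>LINT x|lebesgue. ?I x\<bar> \<le> \<eta> * ?G" by linarith
  qed
qed

section \<open>Triangles and triangulations\<close>

text \<open>\<open>p\<close> and \<open>q\<close> are the gradients of the barycentric coordinates belonging to \<open>B\<close> and \<open>C\<close>.\<close>

definition tri :: "real^2 \<Rightarrow> real^2 \<Rightarrow> real^2 \<Rightarrow> real^2 \<Rightarrow> real^2 \<Rightarrow> (real^2) set \<Rightarrow> bool" where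
  "tri A B C p q T \<longleftrightarrow> T = convex hull {A, B, C} \<and>
     p \<bullet> (B - A) = 1 \<and> p \<bullet> (C - A) = 0 \<and> q \<bullet> (B - A) = 0 \<and> q \<bullet> (C - A) = 1 \<and>
     (\<forall>x. x - A = (p \<bullet> (x - A)) *\<^sub>R (B - A) + (q \<bullet> (x - A)) *\<^sub>R (C - A))"

text \<open>Cramer's rule: \<open>p\<close> and \<open>q\<close> form the basis dual to the edge
  vectors \<open>u\<close> and \<open>v\<close>, whose determinant is \<open>D\<close>.\<close>

lemma tri_exists:
  assumes "\<not> collinear {A, B, C :: real^2}"
  shows "\<exists>p q. tri A B C p q (convex hull {A, B, C})"
proof -
  define u where "u = B - A"
  define v where "v = C - A"
  define D where "D = u$1 * v$2 - u$2 * v$1"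
  have nc: "\<not> collinear {0, u, v}"
    using assms collinear_3[of B A C] by (simp add: insert_commute u_def v_def)
  have D0: "D \<noteq> 0"
  proof
    assume D: "D = 0"
    have u0: "u \<noteq> 0" using nc by (auto simp: insert_commute)
    have "\<exists>c. v = c *\<^sub>R u"
    proof (cases "u$1 = 0")
      case True
      then have "u$2 \<noteq> 0" using u0 by (auto simp: vec_eq_iff forall_2)
      then show ?thesis using D True by (intro exI[of _ "v$2 / u$2"]) (auto simp: D_def vec_eq_iff forall_2)
    next
      case False
      then show ?thesis using D by (intro exI[of _ "v$1 / u$1"]) (auto simp: D_def vec_eq_iff forall_2 field_simps)
    qed
    then show False using nc collinear_lemma by blast
  qed
  define p :: "real^2" where "p = vector [v$2 / D, - v$1 / D]"
  define q :: "real^2" where "q = vector [- u$2 / D, u$1 / D]"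
  have pq: "p \<bullet> w = (w$1 * v$2 - w$2 * v$1) / D" "q \<bullet> w = (u$1 * w$2 - u$2 * w$1) / D" for w
    by (simp_all add: p_def q_def inner_vec_def sum_2 diff_divide_distrib algebra_simps)
  have 1: "w = (p \<bullet> w) *\<^sub>R u + (q \<bullet> w) *\<^sub>R v" for w
  proof -
    have "D *\<^sub>R w = D *\<^sub>R ((p \<bullet> w) *\<^sub>R u + (q \<bullet> w) *\<^sub>R v)"
      using D0 by (simp add: pq scaleR_add_right vec_eq_iff forall_2) (simp add: D_def algebra_simps)
    then show ?thesis using D0 by simp
  qed
  have 2: "p \<bullet> u = 1" "p \<bullet> v = 0" "q \<bullet> u = 0" "q \<bullet> v = 1"
    using D0 by (simp_all add: pq) (simp_all add: D_def algebra_simps)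
  show ?thesis unfolding tri_def
    by (intro exI[of _ p] exI[of _ q] conjI allI refl 2[unfolded u_def v_def] 1[unfolded u_def v_def])
qed

lemma triD:
  assumes "tri A B C p q T"
  shows "p \<bullet> (B - A) = 1" "p \<bullet> (C - A) = 0" "q \<bullet> (B - A) = 0" "q \<bullet> (C - A) = 1"
    "\<And>x. x = A + (p \<bullet> (x - A)) *\<^sub>R (B - A) + (q \<bullet> (x - A)) *\<^sub>R (C - A)"
    "T = convex hull {A, B, C}"
proof -
  have 1: "x - A = (p \<bullet> (x - A)) *\<^sub>R (B - A) + (q \<bullet> (x - A)) *\<^sub>R (C - A)" for x
    using assms unfolding tri_def by blast
  show "x = A + (p \<bullet> (x - A)) *\<^sub>R (B - A) + (q \<bullet> (x - A)) *\<^sub>R (C - A)" for x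
    unfolding add.assoc 1[symmetric] by simp
qed (use assms in \<open>unfold tri_def, blast+\<close>)

lemma tri_mem:
  assumes t: "tri A B C p q T"
  shows "x \<in> T \<longleftrightarrow> 0 \<le> p \<bullet> (x - A) \<and> 0 \<le> q \<bullet> (x - A) \<and> p \<bullet> (x - A) + q \<bullet> (x - A) \<le> 1"
proof
  note d = triD[OF t]
  assume "x \<in> T"
  then obtain u v where uv: "x = A + u *\<^sub>R (B - A) + v *\<^sub>R (C - A)" "0 \<le> u" "0 \<le> v" "u + v \<le> 1"
    unfolding d(6) convex_hull_3_alt by blast
  have "p \<bullet> (x - A) = u" "q \<bullet> (x - A) = v"
    using d(1-4) by (simp_all add: uv(1) inner_add_right)
  then show "0 \<le> p \<bullet> (x - A) \<and> 0 \<le> q \<bullet> (x - A) \<and> p \<bullet> (x - A) + q \<bullet> (x - A) \<le> 1" using uv by simp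
next
  note d = triD[OF t]
  assume "0 \<le> p \<bullet> (x - A) \<and> 0 \<le> q \<bullet> (x - A) \<and> p \<bullet> (x - A) + q \<bullet> (x - A) \<le> 1"
  then show "x \<in> T" unfolding d(6) convex_hull_3_alt mem_Collect_eq
    by (intro exI[of _ "p \<bullet> (x - A)"] exI[of _ "q \<bullet> (x - A)"] conjI d(5)) simp_all
qed

lemma tri_coords_eq:
  assumes t: "tri A B C p q T" and "p \<bullet> (x - A) = p \<bullet> (y - A)" "q \<bullet> (x - A) = q \<bullet> (y - A)"
  shows "x = y"
proof -
  have "x - A = y - A"
    using t assms(2,3) unfolding tri_def by metis
  then show ?thesis by simp
qed

lemma tri_swap: "tri A B C p q T \<Longrightarrow> tri A C B q p T"
  unfolding tri_def insert_commute[of B C "{}"] by (elim conjE, intro conjI allI; simp only: add.commute[of "(q \<bullet> _) *\<^sub>R _"])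

text \<open>The third barycentric coordinate has gradient \<open>- p - q\<close>. Together with
  \<open>tri_swap\<close> this produces every labelling, so statements about edges can be made for
  the edge from \<open>A\<close> to \<open>B\<close> only.\<close>

lemma tri_rot:
  assumes t: "tri A B C p q T"
  shows "tri B C A q (- p - q) T"
proof -
  note d = triD[OF t]
  have "x - B = (q \<bullet> (x - B)) *\<^sub>R (C - B) + ((- p - q) \<bullet> (x - B)) *\<^sub>R (A - B)" for x
  proof -
    have 1: "p \<bullet> (x - B) = p \<bullet> (x - A) - 1" "q \<bullet> (x - B) = q \<bullet> (x - A)"
      using d(1,3) by (simp_all add: inner_diff_right)
    define a b where "a = p \<bullet> (x - A)" and "b = q \<bullet> (x - A)"
    have x: "x = A + a *\<^sub>R (B - A) + b *\<^sub>R (C - A)" unfolding a_def b_def by (rule d(5))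
    have 2: "(- p - q) \<bullet> (x - B) = 1 - a - b" "q \<bullet> (x - B) = b"
      using 1 by (simp_all add: inner_diff_left a_def b_def)
    show ?thesis unfolding 2 by (subst x) (simp add: algebra_simps)
  qed
  moreover have "T = convex hull {B, C, A}" by (simp add: d(6) insert_commute)
  moreover have "q \<bullet> (C - B) = 1" "q \<bullet> (A - B) = 0"
    using d(3,4) by (simp_all add: inner_diff_right)
  moreover have "(- p - q) \<bullet> (C - B) = 0" "(- p - q) \<bullet> (A - B) = 1"
    using d(1-4) by (simp_all add: inner_diff_right inner_diff_left)
  ultimately show ?thesis unfolding tri_def by (intro conjI allI)
qed

lemma tri_distinct:
  assumes t: "tri A B C p q T" shows "A \<noteq> B \<and> A \<noteq> C \<and> B \<noteq> C"
  using triD(1-4)[OF t] by auto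

lemma tri_in_interior:
  assumes t: "tri A B C p q T" and x: "0 < p \<bullet> (x - A)" "0 < q \<bullet> (x - A)" "p \<bullet> (x - A) + q \<bullet> (x - A) < 1"
  shows "x \<in> interior T"
proof -
  have "open ({x. 0 < p \<bullet> (x - A)} \<inter> {x. 0 < q \<bullet> (x - A)} \<inter> {x. p \<bullet> (x - A) + q \<bullet> (x - A) < 1})"
    by (intro open_Int open_Collect_less continuous_intros)
  moreover have "{x. 0 < p \<bullet> (x - A)} \<inter> {x. 0 < q \<bullet> (x - A)} \<inter> {x. p \<bullet> (x - A) + q \<bullet> (x - A) < 1} \<subseteq> T"
    by (intro subsetI) (simp add: tri_mem[OF t])
  ultimately show ?thesis using x by (intro interiorI) auto
qed

lemma tri_interior_nonempty:
  assumes t: "tri A B C p q T" shows "interior T \<noteq> {}"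
proof -
  have "A + (1/3) *\<^sub>R (B - A) + (1/3) *\<^sub>R (C - A) \<in> interior T"
    by (rule tri_in_interior[OF t]) (simp_all add: inner_add_right triD(1-4)[OF t])
  then show ?thesis by blast
qed

lemma tri_convex_compact:
  assumes t: "tri A B C p q T" shows "convex T" "compact T" "closed T"
  unfolding triD(6)[OF t] by (auto simp: finite_imp_compact_convex_hull intro: compact_imp_closed)

lemma tri_vertices_mem:
  assumes t: "tri A B C p q T" shows "A \<in> T \<and> B \<in> T \<and> C \<in> T"
  unfolding triD(6)[OF t] by (simp add: hull_inc)

lemma tri_rel_interior:
  assumes t: "tri A B C p q T" shows "rel_interior T = interior T"
  by (rule rel_interior_nonempty_interior[OF tri_interior_nonempty[OF t]])

lemma tri_collinear: "tri A B C p q T \<Longrightarrow> \<not> collinear {A, B, C}"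
proof
  assume t: "tri A B C p q T" and c: "collinear {A, B, C}"
  note d = triD[OF t]
  have "collinear {0, B - A, C - A}" using c collinear_3[of B A C] by (simp add: insert_commute)
  then consider "B = A" | "C = A" | c where "C - A = c *\<^sub>R (B - A)" using collinear_lemma by (metis eq_iff_diff_eq_0)
  then show False using d(1-4) by cases auto
qed

lemma simplex_tri:
  assumes "2 simplex T"
  obtains A B C p q where "tri A B C p q T"
proof -
  obtain S where S: "\<not> affine_dependent S" "int (card S) = 3" "T = convex hull S"
    using assms unfolding simplex_def by auto
  then obtain A B C where ABC: "S = {A, B, C}" "A \<noteq> B" "A \<noteq> C" "B \<noteq> C"
    using card_3_iff[of S] by auto
  then have "\<not> collinear {A, B, C}" using S(1) collinear_3_eq_affine_dependent by blast
  then show ?thesis using tri_exists that ABC S by blast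
qed

lemma tri_affine_independent: "tri A B C p q T \<Longrightarrow> \<not> affine_dependent {A, B, C}"
  using tri_collinear tri_distinct collinear_3_eq_affine_dependent by blast

lemma tri_extreme:
  assumes t: "tri A B C p q T" shows "x extreme_point_of T \<longleftrightarrow> x \<in> {A, B, C}"
  unfolding triD(6)[OF t] by (rule extreme_point_of_convex_hull_affine_independent[OF tri_affine_independent[OF t]])

lemma tri_edge:
  assumes t: "tri A B C p q T" and e: "e edge_of T"
  obtains A' B' C' p' q' where "tri A' B' C' p' q' T" "e = closed_segment A' B'"
proof -
  note d = triD[OF t]
  have ef: "e face_of convex hull {A, B, C}" "aff_dim e = 1" using e unfolding edge_of_def d(6) by auto
  obtain c where c: "c \<subseteq> {A, B, C}" "e = convex hull c"
    using ef(1) face_of_convex_hull_affine_independent[OF tri_affine_independent[OF t]] by blast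
  have ci: "\<not> affine_dependent c" using c(1) tri_affine_independent[OF t] affine_dependent_subset by blast
  have fc: "finite c" using c(1) finite_subset by blast
  have "aff_dim c = 1" using ef(2) c(2) aff_dim_convex_hull by metis
  then have "card c = 2" using aff_dim_affine_independent[OF ci] by simp
  then obtain X Y where XY: "c = {X, Y}" "X \<noteq> Y" by (meson card_2_iff)
  have eXY: "e = closed_segment X Y" using c(2) XY by (simp add: segment_convex_hull)
  note r1 = tri_rot[OF t]
  note r2 = tri_rot[OF r1]
  consider "X = A" "Y = B" | "X = B" "Y = A" | "X = B" "Y = C" | "X = C" "Y = B" | "X = C" "Y = A" | "X = A" "Y = C"
    using XY c(1) by auto
  then show ?thesis
  proof cases
    case 1 then show ?thesis using that[OF t] eXY by simp
  next
    case 2 then show ?thesis using that[OF t] eXY closed_segment_commute by metis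
  next
    case 3 then show ?thesis using that[OF r1] eXY by simp
  next
    case 4 then show ?thesis using that[OF r1] eXY closed_segment_commute by metis
  next
    case 5 then show ?thesis using that[OF r2] eXY by simp
  next
    case 6 then show ?thesis using that[OF r2] eXY closed_segment_commute by metis
  qed
qed

lemma tri_edge_of:
  assumes t: "tri A B C p q T" shows "closed_segment A B edge_of T"
proof -
  have "convex hull {A, B} face_of convex hull {A, B, C}"
    unfolding face_of_convex_hull_affine_independent[OF tri_affine_independent[OF t]]
    by (intro exI[of _ "{A, B}"]) simp
  moreover have "aff_dim {A, B} = 1"
    using tri_distinct[OF t] by (simp add: aff_dim_2)
  ultimately show ?thesis
    unfolding edge_of_def triD(6)[OF t] by (simp add: segment_convex_hull aff_dim_convex_hull)
qed

text \<open>At a point of the triangle that is not interior some barycentric coordinate vanishes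
  and, away from the vertices, only one does. Relabelling makes it the coordinate of the third
  vertex.\<close>

lemma tri_boundary_point:
  assumes t: "tri A B C p q T" and y: "y \<in> T" "y \<notin> interior T" "y \<noteq> A" "y \<noteq> B" "y \<noteq> C"
  obtains A' B' C' p' q' where "tri A' B' C' p' q' T" "q' \<bullet> (y - A') = 0" "0 < p' \<bullet> (y - A')" "p' \<bullet> (y - A') < 1"
proof -
  define a b where "a = p \<bullet> (y - A)" and "b = q \<bullet> (y - A)"
  note d = triD[OF t]
  have m: "0 \<le> a" "0 \<le> b" "a + b \<le> 1" using y(1) tri_mem[OF t] unfolding a_def b_def by auto
  have ne: "\<not> (a = 0 \<and> b = 0)" "\<not> (a = 1 \<and> b = 0)" "\<not> (a = 0 \<and> b = 1)"
    using tri_coords_eq[OF t, of y A] tri_coords_eq[OF t, of y B] tri_coords_eq[OF t, of y C] y(3-5) d(1-4)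
    unfolding a_def b_def by auto
  consider "b = 0" | "a = 0" | "a + b = 1"
    using tri_in_interior[OF t, of y] y(2) m unfolding a_def b_def by linarith
  then show ?thesis
  proof cases
    case 1
    show ?thesis by (rule that[OF t]) (use 1 m ne in \<open>auto simp: a_def b_def\<close>)
  next
    case 2
    show ?thesis by (rule that[OF tri_swap[OF t]]) (use 2 m ne in \<open>auto simp: a_def b_def\<close>)
  next
    case 3
    have b: "q \<bullet> (y - B) = b" using d(3) by (simp add: inner_diff_right b_def)
    have a: "(- p - q) \<bullet> (y - B) = 0" using 3 d(1,3) by (simp add: inner_diff_right inner_diff_left a_def b_def)
    show ?thesis by (rule that[OF tri_rot[OF t] a]) (use 3 m ne b in auto)
  qed
qed

text \<open>A barycentric coordinate varies by at most 1 over the triangle, in particular over the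
  diameter of the inscribed disc parallel to its gradient. The sum \<open>p + q\<close> belongs to
  the coordinate of \<open>A\<close>, up to sign.\<close>

lemma tri_grad_bound:
  assumes t: "tri A B C p q T" and \<rho>: "\<rho> > 0" and c: "cball c \<rho> \<subseteq> T"
  shows "norm p \<le> 1 / (2 * \<rho>)" "norm q \<le> 1 / (2 * \<rho>)" "norm (p + q) \<le> 1 / (2 * \<rho>)"
proof -
  have *: "norm g \<le> 1 / (2 * \<rho>)" if g: "\<And>x. x \<in> T \<Longrightarrow> 0 \<le> g \<bullet> (x - A) \<and> g \<bullet> (x - A) \<le> 1" for g
  proof (cases "g = 0")
    case True then show ?thesis using \<rho> by simp
  next
    case False
    define u where "u = (\<rho> / norm g) *\<^sub>R g"
    have nu: "norm u = \<rho>" using False \<rho> by (simp add: u_def)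
    have "c + u \<in> T" "c - u \<in> T" using c nu by (auto simp: subset_iff dist_norm)
    then have "g \<bullet> (c + u - A) - g \<bullet> (c - u - A) \<le> 1" using g[of "c + u"] g[of "c - u"] by linarith
    then have "2 * (g \<bullet> u) \<le> 1" by (simp add: inner_diff_right inner_add_right)
    moreover have "g \<bullet> u = \<rho> * norm g" using False by (simp add: u_def power2_norm_eq_inner[symmetric] power2_eq_square)
    ultimately show ?thesis using \<rho> by (simp add: field_simps)
  qed
  show "norm p \<le> 1 / (2 * \<rho>)" "norm q \<le> 1 / (2 * \<rho>)" "norm (p + q) \<le> 1 / (2 * \<rho>)"
    by (rule *; use tri_mem[OF t] in \<open>force simp: inner_add_left\<close>)+
qed

section \<open>Triangulations: interior and boundary edges\<close>

definition tmesh :: "(real^2) set set \<Rightarrow> bool" where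
  "tmesh \<T> \<longleftrightarrow> triangulation \<T> \<and> (\<forall>T\<in>\<T>. 2 simplex T)"

lemma tmeshD:
  assumes "tmesh \<T>"
  shows "finite \<T>" "\<And>T. T \<in> \<T> \<Longrightarrow> \<exists>A B C p q. tri A B C p q T" "\<And>T T'. T \<in> \<T> \<Longrightarrow> T' \<in> \<T> \<Longrightarrow> (T \<inter> T') face_of T"
    "\<And>T. T \<in> \<T> \<Longrightarrow> closed T" "compact (\<Union>\<T>)"
proof -
  show f: "finite \<T>" using assms unfolding tmesh_def triangulation_def by blast
  show t: "\<exists>A B C p q. tri A B C p q T" if "T \<in> \<T>" for T
    using that assms simplex_tri unfolding tmesh_def by metis
  show "(T \<inter> T') face_of T" if "T \<in> \<T>" "T' \<in> \<T>" for T T'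
    using that assms unfolding tmesh_def triangulation_def by blast
  show "closed T" if "T \<in> \<T>" for T using t[OF that] tri_convex_compact by blast
  show "compact (\<Union>\<T>)" using f t tri_convex_compact(2) by (intro compact_Union) blast+
qed

text \<open>The intersection is a face of both triangles, and a face that meets the relative
  interior is everything.\<close>

lemma tmesh_interior_disjoint:
  assumes m: "tmesh \<T>" and T: "T \<in> \<T>" "T' \<in> \<T>" and x: "x \<in> interior T" "x \<in> T'"
  shows "T = T'"
proof -
  obtain A B C p q where t: "tri A B C p q T" using tmeshD(2)[OF m T(1)] by blast
  obtain A' B' C' p' q' where t': "tri A' B' C' p' q' T'" using tmeshD(2)[OF m T(2)] by blast
  have "T \<subseteq> T \<inter> T'"
    by (rule subset_of_face_of[OF tmeshD(3)[OF m T]]) (use x interior_subset tri_rel_interior[OF t] in auto)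
  then have s: "T \<subseteq> T'" by blast
  have "T' \<subseteq> T' \<inter> T"
  proof (rule subset_of_face_of[OF tmeshD(3)[OF m T(2,1)]])
    have "x \<in> interior T'" using x(1) s interior_mono by blast
    then show "T' \<inter> T \<inter> rel_interior T' \<noteq> {}" using x(1) interior_subset[of T] interior_subset[of T'] tri_rel_interior[OF t'] by auto
  qed auto
  then show ?thesis using s by blast
qed

lemma tri_edge_point:
  assumes t: "tri A B C p q T" and a: "0 < a" "a < 1"
  shows "A + a *\<^sub>R (B - A) \<in> T" "A + a *\<^sub>R (B - A) \<in> rel_interior (closed_segment A B)"
    "closed_segment A B \<subseteq> T"
proof -
  show 1: "closed_segment A B \<subseteq> T" using closed_segment_subset_convex_hull[of A "{A,B,C}" B] triD(6)[OF t] by (simp add: hull_inc)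
  have "A + a *\<^sub>R (B - A) = (1 - a) *\<^sub>R A + a *\<^sub>R B" by (simp add: algebra_simps)
  then show "A + a *\<^sub>R (B - A) \<in> rel_interior (closed_segment A B)"
    using a tri_distinct[OF t] unfolding rel_interior_closed_segment by (auto simp: in_segment)
  then show "A + a *\<^sub>R (B - A) \<in> T" using 1 rel_interior_subset by blast
qed

text \<open>A face that meets the relative interior of the edge contains the edge.\<close>

lemma tmesh_edge_in_neighbour:
  assumes m: "tmesh \<T>" and T: "T \<in> \<T>" "T' \<in> \<T>" and t: "tri A B C p q T" and a: "0 < a" "a < 1"
    and y: "A + a *\<^sub>R (B - A) \<in> T'"
  shows "closed_segment A B \<subseteq> T'"
proof -
  have "closed_segment A B \<subseteq> T \<inter> T'"
    by (rule subset_of_face_of[OF tmeshD(3)[OF m T]]) (use tri_edge_point[OF t a] y in auto)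
  then show ?thesis by blast
qed

text \<open>A second triangle through the point would contain the whole edge. Lying on the same side
  of it as \<open>T\<close>, it would overlap the interior of \<open>T\<close>; lying on the other
  side, it would together with \<open>T\<close> cover a neighbourhood of the point.\<close>

lemma tmesh_edge_only:
  assumes m: "tmesh \<T>" and T: "T \<in> \<T>" "T' \<in> \<T>" "T' \<noteq> T" and t: "tri A B C p q T" and a: "0 < a" "a < 1"
    and y: "A + a *\<^sub>R (B - A) \<in> frontier (\<Union>\<T>)"
  shows "A + a *\<^sub>R (B - A) \<notin> T'"
proof
  define y where "y = A + a *\<^sub>R (B - A)"
  assume "A + a *\<^sub>R (B - A) \<in> T'"
  then have yT': "y \<in> T'" by (simp add: y_def)
  note d = triD[OF t]
  have py: "p \<bullet> (y - A) = a" "q \<bullet> (y - A) = 0" using d by (simp_all add: y_def)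
  have eT': "closed_segment A B \<subseteq> T'" using tmesh_edge_in_neighbour[OF m T(1,2) t a] yT' y_def by simp
  obtain A' B' C' p' q' where t': "tri A' B' C' p' q' T'" using tmeshD(2)[OF m T(2)] by blast
  have cT': "convex T'" using tri_convex_compact[OF t'] by blast
  have "\<exists>w\<in>T'. q \<bullet> (w - A) \<noteq> 0"
  proof (rule ccontr)
    assume "\<not> ?thesis"
    then have "T' \<subseteq> {w. q \<bullet> w = q \<bullet> A}" by (auto simp: inner_diff_right)
    then have "interior T' \<subseteq> interior {w. q \<bullet> w = q \<bullet> A}" by (rule interior_mono)
    moreover have "q \<noteq> 0" using d(4) by auto
    ultimately show False using tri_interior_nonempty[OF t'] interior_hyperplane by auto
  qed
  then obtain w where w: "w \<in> T'" "q \<bullet> (w - A) \<noteq> 0" by blast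
  show False
  proof (cases "q \<bullet> (w - A) > 0")
    case True
    \<comment> \<open>Moving a little from \<open>y\<close> towards \<open>w\<close> enters the
      interior of \<open>T\<close> without leaving \<open>T'\<close>.\<close>
    define z where "z = (\<lambda>\<theta>::real. y + \<theta> *\<^sub>R (w - y))"
    have zy: "(z \<longlongrightarrow> y) (at_right 0)"
      unfolding z_def by (rule tendsto_eq_intros refl | simp)+
    have z1: "((\<lambda>\<theta>. p \<bullet> (z \<theta> - A)) \<longlongrightarrow> a) (at_right 0)"
      using tendsto_inner[OF tendsto_const[of p] tendsto_diff[OF zy tendsto_const[of A]]] py by simp
    have z2: "((\<lambda>\<theta>. p \<bullet> (z \<theta> - A) + q \<bullet> (z \<theta> - A)) \<longlongrightarrow> a) (at_right 0)"
      using tendsto_add[OF z1 tendsto_inner[OF tendsto_const[of q] tendsto_diff[OF zy tendsto_const[of A]]]] py by simp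
    have "\<forall>\<^sub>F \<theta> in at_right 0. 0 < p \<bullet> (z \<theta> - A) \<and> p \<bullet> (z \<theta> - A) + q \<bullet> (z \<theta> - A) < 1 \<and> 0 < \<theta> \<and> \<theta> < (1::real)"
      using order_tendstoD(1)[OF z1 a(1)] order_tendstoD(2)[OF z2 a(2)] eventually_at_right_real[OF zero_less_one[where 'a=real]]
      by eventually_elim auto
    then obtain \<theta> where \<theta>: "0 < p \<bullet> (z \<theta> - A)" "p \<bullet> (z \<theta> - A) + q \<bullet> (z \<theta> - A) < 1" "0 < \<theta>" "\<theta> < 1"
      using eventually_happens[of _ "at_right (0::real)"] by force
    have "q \<bullet> (z \<theta> - A) = \<theta> * (q \<bullet> (w - A))" using py(2) by (simp add: z_def inner_diff_right inner_add_right algebra_simps)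
    then have "0 < q \<bullet> (z \<theta> - A)" using True \<theta>(3) by simp
    then have "z \<theta> \<in> interior T" using tri_in_interior[OF t] \<theta> by blast
    moreover have "z \<theta> \<in> T'"
    proof -
      have "z \<theta> = (1 - \<theta>) *\<^sub>R y + \<theta> *\<^sub>R w" by (simp add: z_def algebra_simps)
      then show ?thesis using convexD_alt[OF cT' yT' w(1), of \<theta>] \<theta> by simp
    qed
    ultimately show False using tmesh_interior_disjoint[OF m T(1,2)] T(3) by blast
  next
    case False
    define c where "c = q \<bullet> (w - A)"
    have c0: "c < 0" using False w(2) by (simp add: c_def)
    \<comment> \<open>A point \<open>x\<close> beyond the edge is a convex combination of
      \<open>w\<close>, with weight \<open>\<theta> x\<close>, and a point \<open>z\<close> on the
      line through \<open>A\<close> and \<open>B\<close> at parameter \<open>s x\<close>. Near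
      \<open>y\<close> the weight is close to 0 and \<open>s x\<close> is close to \<open>a\<close>,
      so \<open>z\<close> stays on the edge and \<open>x\<close> belongs to
      \<open>T'\<close>.\<close>
    define \<theta> where "\<theta> = (\<lambda>x. q \<bullet> (x - A) / c)"
    define s where "s = (\<lambda>x. (p \<bullet> (x - A) - \<theta> x * (p \<bullet> (w - A))) / (1 - \<theta> x))"
    have \<theta>t: "(\<theta> \<longlongrightarrow> 0) (nhds y)"
    proof -
      have "(\<theta> \<longlongrightarrow> \<theta> y) (nhds y)" unfolding \<theta>_def using c0 by (intro tendsto_intros) (auto intro: filterlim_ident)
      then show ?thesis by (simp add: \<theta>_def py)
    qed
    have pt: "((\<lambda>x. p \<bullet> (x - A)) \<longlongrightarrow> a) (nhds y)"
    proof -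
      have "((\<lambda>x. p \<bullet> (x - A)) \<longlongrightarrow> p \<bullet> (y - A)) (nhds y)" by (intro tendsto_intros) (auto intro: filterlim_ident)
      then show ?thesis by (simp add: py)
    qed
    have qt: "((\<lambda>x. p \<bullet> (x - A) + q \<bullet> (x - A)) \<longlongrightarrow> a) (nhds y)"
    proof -
      have "((\<lambda>x. p \<bullet> (x - A) + q \<bullet> (x - A)) \<longlongrightarrow> p \<bullet> (y - A) + q \<bullet> (y - A)) (nhds y)" by (intro tendsto_intros) (auto intro: filterlim_ident)
      then show ?thesis by (simp add: py)
    qed
    have st: "(s \<longlongrightarrow> a) (nhds y)"
      using tendsto_divide[OF tendsto_diff[OF pt tendsto_mult[OF \<theta>t tendsto_const[of "p \<bullet> (w - A)"]]] tendsto_diff[OF tendsto_const[of 1] \<theta>t]]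
      by (simp add: s_def)
    have ev: "\<forall>\<^sub>F x in nhds y. x \<in> \<Union>\<T>"
      using order_tendstoD(1)[OF pt a(1)] order_tendstoD(2)[OF qt a(2)] order_tendstoD(1)[OF st a(1)] order_tendstoD(2)[OF st a(2)] order_tendstoD(2)[OF \<theta>t zero_less_one]
    proof eventually_elim
      case (elim x)
      show ?case
      proof (cases "q \<bullet> (x - A) \<ge> 0")
        case True
        then have "x \<in> T" using tri_mem[OF t] elim by auto
        then show ?thesis using T(1) by blast
      next
        case False
        then have th: "0 < \<theta> x" "\<theta> x < 1" using c0 elim(5) by (auto simp: \<theta>_def divide_neg_neg)
        define z where "z = A + s x *\<^sub>R (B - A)"
        have "z = (1 - s x) *\<^sub>R A + s x *\<^sub>R B" by (simp add: z_def algebra_simps)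
        then have "z \<in> closed_segment A B" using elim(3,4) unfolding in_segment by (intro exI[of _ "s x"]) auto
        then have zT: "z \<in> T'" using eT' by blast
        have "(1 - \<theta> x) *\<^sub>R z + \<theta> x *\<^sub>R w = x"
        proof -
          let ?y = "(1 - \<theta> x) *\<^sub>R z + \<theta> x *\<^sub>R w"
          have e: "?y - A = (1 - \<theta> x) *\<^sub>R (z - A) + \<theta> x *\<^sub>R (w - A)" by (simp add: algebra_simps)
          have "p \<bullet> (?y - A) = p \<bullet> (x - A)" unfolding e using d(1) th by (simp add: z_def inner_add_right s_def)
          moreover have "q \<bullet> (?y - A) = q \<bullet> (x - A)" unfolding e using d(3) c0 by (simp add: z_def inner_add_right \<theta>_def c_def)
          ultimately show ?thesis by (rule tri_coords_eq[OF t])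
        qed
        moreover have "(1 - \<theta> x) *\<^sub>R z + \<theta> x *\<^sub>R w \<in> T'" using convexD_alt[OF cT' zT w(1), of "\<theta> x"] th by simp
        ultimately show ?thesis using T(2) by auto
      qed
    qed
    then have "y \<in> interior (\<Union>\<T>)" by (simp add: eventually_nhds interior_def) blast
    then show False using y by (simp add: y_def frontier_def)
  qed
qed

text \<open>The other triangles are finitely many closed sets, so they keep a positive distance from
  the point; a small step against \<open>C - A\<close> then leaves the mesh.\<close>

lemma tmesh_edge_only_frontier:
  assumes m: "tmesh \<T>" and T: "T \<in> \<T>" and t: "tri A B C p q T" and a: "0 < a" "a < 1"
    and y: "\<And>T'. T' \<in> \<T> \<Longrightarrow> T' \<noteq> T \<Longrightarrow> A + a *\<^sub>R (B - A) \<notin> T'"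
  shows "\<exists>e>0. \<forall>x. dist x (A + a *\<^sub>R (B - A)) < e \<longrightarrow> x \<in> \<Union>\<T> \<longrightarrow> x \<in> T"
    "A + a *\<^sub>R (B - A) \<in> frontier (\<Union>\<T>)"
proof -
  define y where "y = A + a *\<^sub>R (B - A)"
  have "closed (\<Union>(\<T> - {T}))" using tmeshD(1,4)[OF m] by (intro closed_Union) auto
  moreover have "y \<in> - \<Union>(\<T> - {T})" using assms(6) y_def by auto
  ultimately obtain e where e: "e > 0" "ball y e \<subseteq> - \<Union>(\<T> - {T})" by (meson open_Compl open_contains_ball)
  have *: "x \<in> T" if "dist x y < e" "x \<in> \<Union>\<T>" for x
    using that e(2) by (auto simp: subset_iff dist_commute)
  then show "\<exists>e>0. \<forall>x. dist x (A + a *\<^sub>R (B - A)) < e \<longrightarrow> x \<in> \<Union>\<T> \<longrightarrow> x \<in> T" using e(1) y_def by blast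
  note d = triD[OF t]
  have yU: "y \<in> \<Union>\<T>" using tri_edge_point(1)[OF t a] T y_def by blast
  have "y \<notin> interior (\<Union>\<T>)"
  proof
    assume "y \<in> interior (\<Union>\<T>)"
    then obtain e' where e': "e' > 0" "ball y e' \<subseteq> \<Union>\<T>" by (meson mem_interior)
    define f where "f = min e e' / (2 * (norm (C - A) + 1))"
    have n2: "2 * (norm (C - A) + 1) > 0" by (simp add: add_nonneg_pos)
    have f0: "f > 0" unfolding f_def using e(1) e'(1) n2 by (intro divide_pos_pos) auto
    define x where "x = y - f *\<^sub>R (C - A)"
    have "dist x y = f * norm (C - A)" using f0 by (simp add: x_def dist_norm)
    also have "\<dots> < f * (2 * (norm (C - A) + 1))" using f0 by (intro mult_strict_left_mono) (auto simp: add_nonneg_pos)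
    also have "\<dots> = min e e'" using n2 unfolding f_def by (intro nonzero_eq_divide_eq[THEN iffD1, rotated]) auto
    finally have "x \<in> T" using * e'(2) by (auto simp: dist_commute subset_iff)
    moreover have "q \<bullet> (x - A) = - f" using d by (simp add: x_def y_def inner_diff_right inner_add_right)
    ultimately show False using tri_mem[OF t] f0 by auto
  qed
  then show "A + a *\<^sub>R (B - A) \<in> frontier (\<Union>\<T>)"
    using yU closure_subset[of "\<Union>\<T>"] by (auto simp: frontier_def y_def)
qed

text \<open>Along the open edge, lying on the boundary is equivalent to lying in no other triangle,
  and a neighbour that contains one point of the open edge contains them all.\<close>

lemma tmesh_edge_frontier_whole:
  assumes m: "tmesh \<T>" and T: "T \<in> \<T>" and t: "tri A B C p q T" and a: "0 < a" "a < 1"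
    and y: "A + a *\<^sub>R (B - A) \<in> frontier (\<Union>\<T>)"
  shows "closed_segment A B \<subseteq> frontier (\<Union>\<T>)"
proof -
  have "open_segment A B \<subseteq> frontier (\<Union>\<T>)"
  proof
    fix z assume "z \<in> open_segment A B"
    then obtain a' where a': "0 < a'" "a' < 1" "z = A + a' *\<^sub>R (B - A)" by (auto simp: in_segment algebra_simps)
    show "z \<in> frontier (\<Union>\<T>)" unfolding a'(3)
    proof (rule tmesh_edge_only_frontier(2)[OF m T t a'(1,2)])
      fix T' assume T': "T' \<in> \<T>" "T' \<noteq> T"
      show "A + a' *\<^sub>R (B - A) \<notin> T'"
      proof
        assume "A + a' *\<^sub>R (B - A) \<in> T'"
        then have "closed_segment A B \<subseteq> T'" using tmesh_edge_in_neighbour[OF m T T'(1) t a'(1,2)] by blast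
        then have "A + a *\<^sub>R (B - A) \<in> T'" using tri_edge_point(2)[OF t a] rel_interior_subset by blast
        then show False using tmesh_edge_only[OF m T T' t a y] by blast
      qed
    qed
  qed
  then have "closure (open_segment A B) \<subseteq> frontier (\<Union>\<T>)" by (rule closure_minimal) simp
  then show ?thesis using tri_distinct[OF t] closure_open_segment[of A B] by metis
qed

section \<open>Geometry of the boundary triangles\<close>

text \<open>What the geometric arguments use of a fitted, regular mesh. \<open>bdry\<close> is
  stated for all labellings, so that it applies to any boundary edge met on the way.\<close>

locale mesh_geom =
  fixes \<Omega> :: "(real^2) set" and \<T> :: "(real^2) set set" and \<kappa> h :: real
  assumes tm: "tmesh \<T>" and \<Omega>_open: "open \<Omega>"
    and \<kappa>0: "\<kappa> > 0"
    and bdry: "\<And>T A B C p q. T \<in> \<T> \<Longrightarrow> tri A B C p q T \<Longrightarrow> closed_segment A B \<subseteq> frontier (\<Union>\<T>) \<Longrightarrow>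
      A \<in> frontier \<Omega> \<and> B \<in> frontier \<Omega> \<and> C \<in> \<Omega>"
    and shape: "\<And>T. T \<in> \<T> \<Longrightarrow> \<exists>c. cball c (\<kappa> * diameter T) \<subseteq> T"
    and size: "\<And>T. T \<in> \<T> \<Longrightarrow> diameter T \<le> h"
begin

lemma diam_pos: assumes "T \<in> \<T>" shows "diameter T > 0"
proof -
  obtain A B C p q where t: "tri A B C p q T" using tmeshD(2)[OF tm assms] by blast
  have "dist A B \<le> diameter T"
    using diameter_bounded_bound[OF compact_imp_bounded[OF tri_convex_compact(2)[OF t]]] tri_vertices_mem[OF t] by blast
  moreover have "dist A B > 0" using tri_distinct[OF t] by simp
  ultimately show ?thesis by linarith
qed

lemma diam_dist: assumes "T \<in> \<T>" "x \<in> T" "y \<in> T" shows "norm (x - y) \<le> diameter T"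
proof -
  obtain A B C p q where t: "tri A B C p q T" using tmeshD(2)[OF tm assms(1)] by blast
  show ?thesis using diameter_bounded_bound[OF compact_imp_bounded[OF tri_convex_compact(2)[OF t]] assms(2,3)] by (simp add: dist_norm)
qed

lemma grads:
  assumes "T \<in> \<T>" "tri A B C p q T"
  shows "norm p \<le> 1 / (2 * (\<kappa> * diameter T))" "norm q \<le> 1 / (2 * (\<kappa> * diameter T))" "norm (p + q) \<le> 1 / (2 * (\<kappa> * diameter T))"
proof -
  obtain c where "cball c (\<kappa> * diameter T) \<subseteq> T" using shape assms by blast
  then show "norm p \<le> 1 / (2 * (\<kappa> * diameter T))" "norm q \<le> 1 / (2 * (\<kappa> * diameter T))" "norm (p + q) \<le> 1 / (2 * (\<kappa> * diameter T))"
    using tri_grad_bound[OF assms(2)] \<kappa>0 diam_pos[OF assms(1)] by simp_all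
qed

text \<open>\<open>A\<close> and \<open>B\<close> lie on the zero level of \<phi> and
  \<open>C\<close> lies below it. If \<open>C\<close> were less than
  \<open>\<kappa> * diameter T\<close> below the chord, the triangle would fit into a slab normal to
  \<open>n\<close> of width 3/2 times that length, too thin for the inscribed disc. The sign of
  \<open>q \<bullet> n\<close> says that the triangle is on the lower side of its boundary
  edge.\<close>

lemma chart_heights:
  assumes ch: "chart \<Omega> \<epsilon> r P n \<phi>" and e: "0 \<le> \<epsilon>" "\<epsilon> \<le> \<kappa> / 2"
    and T: "T \<in> \<T>" "T \<subseteq> ball P r" and t: "tri A B C p q T" and fr: "closed_segment A B \<subseteq> frontier (\<Union>\<T>)"
  shows "\<bar>n \<bullet> (B - A)\<bar> \<le> \<epsilon> * norm (B - A)" "n \<bullet> (C - A) \<le> - \<kappa> * diameter T" "q \<bullet> n < 0"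
proof -
  let ?d = "diameter T"
  have d0: "?d > 0" by (rule diam_pos[OF T(1)])
  have mem: "A \<in> T" "B \<in> T" "C \<in> T" using tri_vertices_mem[OF t] by auto
  have n1: "norm n = 1" using ch chart_def by blast
  have est: "\<bar>\<phi> a - \<phi> b - n \<bullet> (a - b)\<bar> \<le> \<epsilon> * norm (a - b)" if "a \<in> T" "b \<in> T" for a b
    using ch that T(2) unfolding chart_def by blast
  have z: "\<phi> A = 0" "\<phi> B = 0" "\<phi> C < 0"
    using bdry[OF T(1) t fr] ch mem T(2) unfolding chart_def by blast+
  show 1: "\<bar>n \<bullet> (B - A)\<bar> \<le> \<epsilon> * norm (B - A)" using est[OF mem(2,1)] z by simp
  have edl: "\<epsilon> * norm (a - b) \<le> \<epsilon> * ?d" if "a \<in> T" "b \<in> T" for a b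
    using diam_dist[OF T(1) that] e(1) by (rule mult_left_mono)
  have eK: "\<epsilon> * ?d \<le> \<kappa> / 2 * ?d" using e(2) d0 by (intro mult_right_mono) auto
  have 2: "\<bar>n \<bullet> (B - A)\<bar> \<le> \<kappa> / 2 * ?d" using 1 edl[OF mem(2,1)] eK by linarith
  have 3: "n \<bullet> (C - A) \<le> \<kappa> / 2 * ?d" using est[OF mem(3,1)] z edl[OF mem(3,1)] eK by linarith
  show 4: "n \<bullet> (C - A) \<le> - \<kappa> * ?d"
  proof (rule ccontr)
    assume "\<not> ?thesis"
    then have g: "n \<bullet> (C - A) > - (\<kappa> * ?d)" by simp
    have bnd: "- (\<kappa> * ?d) \<le> n \<bullet> (x - A) \<and> n \<bullet> (x - A) \<le> \<kappa> / 2 * ?d" if x: "x \<in> T" for x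
    proof -
      define s u where "s = p \<bullet> (x - A)" and "u = q \<bullet> (x - A)"
      have su: "0 \<le> s" "0 \<le> u" "s + u \<le> 1" using x tri_mem[OF t] by (auto simp: s_def u_def)
      have "x = A + s *\<^sub>R (B - A) + u *\<^sub>R (C - A)" unfolding s_def u_def by (rule triD(5)[OF t])
      then have eq: "n \<bullet> (x - A) = s * (n \<bullet> (B - A)) + u * (n \<bullet> (C - A))" by (simp add: inner_add_right)
      have kd: "0 \<le> \<kappa> / 2 * ?d" "0 \<le> \<kappa> * ?d" using \<kappa>0 d0 by auto
      have "s * (n \<bullet> (B - A)) \<le> s * (\<kappa> / 2 * ?d)" "u * (n \<bullet> (C - A)) \<le> u * (\<kappa> / 2 * ?d)"
        by (rule mult_left_mono; use 2 3 su in linarith)+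
      moreover have "s * (\<kappa> / 2 * ?d) + u * (\<kappa> / 2 * ?d) \<le> \<kappa> / 2 * ?d"
        using mult_right_mono[OF su(3) kd(1)] by (simp add: algebra_simps)
      moreover have "s * (n \<bullet> (B - A)) \<ge> s * (- (\<kappa> * ?d))" "u * (n \<bullet> (C - A)) \<ge> u * (- (\<kappa> * ?d))"
        by (rule mult_left_mono; use 2 g su kd in linarith)+
      moreover have "s * (\<kappa> * ?d) + u * (\<kappa> * ?d) \<le> \<kappa> * ?d"
        using mult_right_mono[OF su(3) kd(2)] by (simp add: algebra_simps)
      ultimately show ?thesis unfolding eq by simp
    qed
    obtain c where c: "cball c (\<kappa> * ?d) \<subseteq> T" using shape[OF T(1)] by blast
    define v where "v = (\<kappa> * ?d) *\<^sub>R n"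
    have "norm v = \<kappa> * ?d" using n1 \<kappa>0 d0 by (simp add: v_def)
    then have "c + v \<in> T" "c - v \<in> T" using c by (auto simp: subset_iff dist_norm)
    then have "n \<bullet> (c + v - A) - n \<bullet> (c - v - A) \<le> \<kappa> / 2 * ?d + \<kappa> * ?d"
      using bnd[of "c + v"] bnd[of "c - v"] by linarith
    moreover have "n \<bullet> (c + v - A) - n \<bullet> (c - v - A) = 2 * (\<kappa> * ?d)"
      using n1 by (simp add: inner_diff_right inner_add_right v_def power2_norm_eq_inner[symmetric])
    moreover have "\<kappa> * ?d > 0" using \<kappa>0 d0 by simp
    ultimately show False by simp
  qed
  \<comment> \<open>The inner product of this decomposition with \<open>n\<close> equals 1. The
    \<open>B - A\<close> part contributes at most 1/4, so the \<open>C - A\<close> part is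
    positive.\<close>
  have dec: "n = (p \<bullet> n) *\<^sub>R (B - A) + (q \<bullet> n) *\<^sub>R (C - A)"
    using triD(5)[OF t, of "A + n"] by simp
  have "n \<bullet> n = n \<bullet> ((p \<bullet> n) *\<^sub>R (B - A) + (q \<bullet> n) *\<^sub>R (C - A))" using dec by metis
  then have e1: "1 = (p \<bullet> n) * (n \<bullet> (B - A)) + (q \<bullet> n) * (n \<bullet> (C - A))"
    using n1 by (simp add: inner_add_right power2_norm_eq_inner[symmetric])
  have "\<bar>p \<bullet> n\<bar> \<le> 1 / (2 * (\<kappa> * ?d))"
    using Cauchy_Schwarz_ineq2[of p n] grads(1)[OF T(1) t] n1 by simp
  then have "\<bar>p \<bullet> n\<bar> * \<bar>n \<bullet> (B - A)\<bar> \<le> (1 / (2 * (\<kappa> * ?d))) * (\<kappa> / 2 * ?d)"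
    using 2 by (intro mult_mono) auto
  also have "\<dots> = 1/4" using \<kappa>0 d0 by simp
  finally have "(p \<bullet> n) * (n \<bullet> (B - A)) \<le> 1/4" by (simp add: abs_mult[symmetric] abs_le_iff)
  then have "(q \<bullet> n) * (n \<bullet> (C - A)) > 0" using e1 by linarith
  moreover have "n \<bullet> (C - A) < 0" using 4 \<kappa>0 d0 mult_pos_pos[of \<kappa> ?d] by linarith
  ultimately show "q \<bullet> n < 0" by (simp add: zero_less_mult_iff)
qed

lemma finite_vertices: "finite (mesh_vertices \<T>)"
proof -
  have "mesh_vertices \<T> = (\<Union>T\<in>\<T>. {v. v extreme_point_of T})" unfolding mesh_vertices_def by blast
  moreover have "finite {v. v extreme_point_of T}" if T: "T \<in> \<T>" for T
  proof -
    obtain A B C p q where t: "tri A B C p q T" using tmeshD(2)[OF tm T] by blast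
    have "{v. v extreme_point_of T} = {A, B, C}" using tri_extreme[OF t] by blast
    then show ?thesis by simp
  qed
  ultimately show ?thesis using tmeshD(1)[OF tm] by simp
qed

text \<open>Going up along \<open>n\<close> from the chord, the mesh is left at once. It could be
  entered again only from below through another boundary edge, but by \<open>chart_heights\<close>
  every boundary edge in the chart has its triangle on the lower side.\<close>

lemma no_mesh_above_chord:
  assumes ch: "chart \<Omega> \<epsilon> r P n \<phi>" and e: "0 \<le> \<epsilon>" "\<epsilon> \<le> \<kappa> / 2" and h: "h < r / 4"
    and T: "T \<in> \<T>" "T \<subseteq> ball P (r / 4)" and t: "tri A B C p q T" and fr: "closed_segment A B \<subseteq> frontier (\<Union>\<T>)"
    and a0: "0 < a0" "a0 < 1" and \<mu>0: "\<mu>0 > 0" and xP: "A + a0 *\<^sub>R (B - A) + \<mu>0 *\<^sub>R n \<in> ball P (r / 4)"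
  shows "A + a0 *\<^sub>R (B - A) + \<mu>0 *\<^sub>R n \<notin> \<Union>\<T>"
proof
  define x where "x = A + a0 *\<^sub>R (B - A) + \<mu>0 *\<^sub>R n"
  note d = triD[OF t]
  assume "A + a0 *\<^sub>R (B - A) + \<mu>0 *\<^sub>R n \<in> \<Union>\<T>"
  then obtain T' where T': "T' \<in> \<T>" "x \<in> T'" by (auto simp: x_def)
  obtain A' B' C' p' q' where t': "tri A' B' C' p' q' T'" using tmeshD(2)[OF tm T'(1)] by blast
  have "dist P A < r / 4" using T(2) tri_vertices_mem[OF t] by auto
  then have r0: "r > 0" using zero_le_dist[of P A] by linarith
  have n1: "norm n = 1" using ch chart_def by blast
  have "T \<subseteq> ball P r" using T(2) r0 by (auto simp: subset_iff)
  then have qn: "q \<bullet> n < 0" using chart_heights(3)[OF ch e T(1) _ t fr] by blast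
  \<comment> \<open>Oblique coordinates for the directions \<open>B - A\<close> and
    \<open>n\<close>: \<open>M z\<close> is the \<open>n\<close>-component of \<open>z - A\<close>,
    and \<open>p \<bullet> (z - A) - M z * (p \<bullet> n)\<close> is the other one.\<close>
  define M where "M = (\<lambda>z. q \<bullet> (z - A) / (q \<bullet> n))"
  define W where "W = interior T' \<inter> ball P (r / 4) \<inter> {z. 0 < M z} \<inter>
      {z. 0 < p \<bullet> (z - A) - M z * (p \<bullet> n)} \<inter> {z. p \<bullet> (z - A) - M z * (p \<bullet> n) < 1}"
  have Mx: "M x = \<mu>0" "p \<bullet> (x - A) - M x * (p \<bullet> n) = a0"
    using qn d(1-4) by (simp_all add: M_def x_def inner_add_right)
  define W' where "W' = ball P (r / 4) \<inter> {z. 0 < M z} \<inter>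
      {z. 0 < p \<bullet> (z - A) - M z * (p \<bullet> n)} \<inter> {z. p \<bullet> (z - A) - M z * (p \<bullet> n) < 1}"
  have oW': "open W'" unfolding W'_def M_def
    using qn by (intro open_Int open_Collect_less continuous_intros open_ball) auto
  have xW': "x \<in> W'" unfolding W'_def using Mx a0 \<mu>0 xP by (auto simp: x_def)
  have "x \<in> closure (interior T')"
    using T'(2) convex_closure_interior[OF tri_convex_compact(1)[OF t'] tri_interior_nonempty[OF t']] closure_subset by blast
  then have "W' \<inter> interior T' \<noteq> {}" using oW' xW' by (meson closure_iff_nhds_not_empty disjoint_iff inf_commute order_refl)
  moreover have WW': "W = W' \<inter> interior T'" unfolding W_def W'_def by (simp only: Int_ac)
  ultimately have Wne: "W \<noteq> {}" by simp
  have oW: "open W" unfolding WW' using oW' by (intro open_Int) auto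
  define \<tau> :: "real^2" where "\<tau> = vector [- n$2, n$1]"
  have \<tau>0: "\<tau> \<noteq> 0"
  proof
    assume "\<tau> = 0"
    then have "\<tau> $ 1 = 0 \<and> \<tau> $ 2 = 0" by simp
    then have "n = 0" by (simp add: \<tau>_def vec_eq_iff forall_2)
    then show False using n1 by simp
  qed
  have \<tau>n: "\<tau> \<bullet> n = 0" by (simp add: \<tau>_def inner_vec_def sum_2)
  \<comment> \<open>Genericity: the given point is replaced by a nearby interior point of
    \<open>T'\<close> whose line parallel to \<open>n\<close> avoids all mesh vertices, so that
    re-entry happens inside an edge.\<close>
  have "negligible (\<Union>v\<in>mesh_vertices \<T>. {z. \<tau> \<bullet> z = \<tau> \<bullet> v})"
    using finite_vertices \<tau>0 by (intro negligible_Union) (auto intro: negligible_hyperplane)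
  then have "\<not> W \<subseteq> (\<Union>v\<in>mesh_vertices \<T>. {z. \<tau> \<bullet> z = \<tau> \<bullet> v})"
    using open_not_negligible[OF oW Wne] negligible_subset by blast
  then obtain z where zW: "z \<in> W" and zg: "\<And>v. v \<in> mesh_vertices \<T> \<Longrightarrow> \<tau> \<bullet> z \<noteq> \<tau> \<bullet> v" by blast
  define \<mu> a where "\<mu> = M z" and "a = p \<bullet> (z - A) - M z * (p \<bullet> n)"
  have am: "\<mu> > 0" "0 < a" "a < 1" using zW by (auto simp: W_def \<mu>_def a_def)
  define lin where "lin = (\<lambda>t. A + a *\<^sub>R (B - A) + t *\<^sub>R n)"
  have z_line: "z = lin \<mu>"
  proof (rule tri_coords_eq[OF t])
    show "p \<bullet> (z - A) = p \<bullet> (lin \<mu> - A)" using d(1,2) by (simp add: lin_def inner_add_right a_def \<mu>_def)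
    show "q \<bullet> (z - A) = q \<bullet> (lin \<mu> - A)" using d(3,4) qn by (simp add: lin_def inner_add_right M_def \<mu>_def)
  qed
  have c_line: "continuous_on UNIV lin" unfolding lin_def by (intro continuous_intros)
  have ld: "dist (lin s) (lin u) = \<bar>s - u\<bar>" for s u
  proof -
    have "lin s - lin u = (s - u) *\<^sub>R n" by (simp add: lin_def algebra_simps)
    then show ?thesis using n1 by (simp add: dist_norm)
  qed
  have zU: "lin \<mu> \<in> \<Union>\<T>" using zW T'(1) interior_subset z_line unfolding W_def by blast
  have y0: "A + a *\<^sub>R (B - A) \<in> frontier (\<Union>\<T>)"
    using fr tri_edge_point(2)[OF t am(2,3)] rel_interior_subset by blast
  obtain e0 where e0: "e0 > 0" "\<And>x. dist x (A + a *\<^sub>R (B - A)) < e0 \<Longrightarrow> x \<in> \<Union>\<T> \<Longrightarrow> x \<in> T"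
    using tmesh_edge_only_frontier(1)[OF tm T(1) t am(2,3) tmesh_edge_only[OF tm T(1) _ _ t am(2,3) y0]] by blast
  define t' where "t' = min (e0 / 2) (\<mu> / 2)"
  have t'0: "0 < t'" "t' < \<mu>" "t' < e0" using e0 am by (auto simp: t'_def min_def)
  \<comment> \<open>This close to the chord only \<open>T\<close> could contain a mesh point, and
    \<open>T\<close> lies on the other side.\<close>
  have "lin t' \<notin> \<Union>\<T>"
  proof
    assume "lin t' \<in> \<Union>\<T>"
    moreover have "dist (lin t') (A + a *\<^sub>R (B - A)) < e0" using ld[of t' 0] t'0 by (simp add: lin_def)
    ultimately have "lin t' \<in> T" using e0(2) by blast
    then have "0 \<le> q \<bullet> (lin t' - A)" using tri_mem[OF t] by blast
    moreover have "q \<bullet> (lin t' - A) = t' * (q \<bullet> n)" using d(3) by (simp add: lin_def inner_add_right)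
    ultimately show False using qn t'0(1) by (simp add: zero_le_mult_iff)
  qed
  \<comment> \<open>Parameters between the chord and \<open>z\<close> at which the line is off the
    mesh; their supremum \<open>t1\<close> is the last re-entry.\<close>
  define S where "S = {s. t' \<le> s \<and> s \<le> \<mu> \<and> lin s \<notin> \<Union>\<T>}"
  define t1 where "t1 = Sup S"
  have Sne: "t' \<in> S" using \<open>lin t' \<notin> \<Union>\<T>\<close> t'0 by (simp add: S_def)
  have Sb: "bdd_above S" by (rule bdd_aboveI[of _ \<mu>]) (simp add: S_def)
  have Sle: "s \<le> t1" if "s \<in> S" for s unfolding t1_def by (rule cSup_upper[OF that Sb])
  have t1: "t' \<le> t1" "t1 \<le> \<mu>"
  proof -
    show "t' \<le> t1" by (rule Sle[OF Sne])
    have "\<And>s. s \<in> S \<Longrightarrow> s \<le> \<mu>" by (simp add: S_def)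
    then show "t1 \<le> \<mu>" unfolding t1_def using Sne by (intro cSup_least) blast+
  qed
  have Uc: "closed (\<Union>\<T>)" using tmeshD(5)[OF tm] compact_imp_closed by blast
  have y1U: "lin t1 \<in> \<Union>\<T>"
  proof (rule ccontr)
    assume n: "lin t1 \<notin> \<Union>\<T>"
    then obtain e1 where e1: "e1 > 0" "ball (lin t1) e1 \<subseteq> - \<Union>\<T>" using Uc by (meson ComplI open_Compl open_contains_ball)
    have "t1 \<noteq> \<mu>" using n zU by auto
    then have lt: "t1 < \<mu>" using t1 by simp
    define s where "s = min \<mu> (t1 + e1 / 2)"
    have s: "t1 < s" "s \<le> \<mu>" "s - t1 < e1" using lt e1 by (auto simp: s_def min_def)
    have "lin s \<in> ball (lin t1) e1" using ld[of t1 s] s by simp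
    then have "s \<in> S" using e1 s t1 by (auto simp: S_def)
    then show False using Sle[of s] s by linarith
  qed
  have lim: "\<exists>s\<in>S. t1 - e1 < s \<and> s < t1" if "e1 > 0" for e1
  proof -
    have "t1 - e1 < Sup S" using that by (simp add: t1_def)
    then obtain s where s: "s \<in> S" "t1 - e1 < s" using less_cSupD[of S "t1 - e1"] Sne by blast
    note Sle[OF s(1)]
    moreover have "s \<noteq> t1" using s(1) y1U by (auto simp: S_def)
    ultimately show ?thesis using s by force
  qed
  have y1ni: "lin t1 \<notin> interior (\<Union>\<T>)"
  proof
    assume "lin t1 \<in> interior (\<Union>\<T>)"
    then obtain e1 where e1: "e1 > 0" "ball (lin t1) e1 \<subseteq> \<Union>\<T>" by (meson mem_interior)
    obtain s where s: "s \<in> S" "t1 - e1 < s" "s < t1" using lim[OF e1(1)] by blast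
    then have "lin s \<in> ball (lin t1) e1" using ld[of t1 s] by simp
    then show False using e1 s(1) by (auto simp: S_def)
  qed
  then have y1f: "lin t1 \<in> frontier (\<Union>\<T>)" using y1U Uc by (simp add: frontier_def)
  obtain T1 where T1: "T1 \<in> \<T>" "lin t1 \<in> T1" using y1U by blast
  obtain A2 B2 C2 p2 q2 where t2: "tri A2 B2 C2 p2 q2 T1" using tmeshD(2)[OF tm T1(1)] by blast
  have ni: "lin t1 \<notin> interior T1" using y1ni T1(1) interior_mono[of T1 "\<Union>\<T>"] by blast
  have nv: "lin t1 \<noteq> v" if "v \<in> {A2, B2, C2}" for v
  proof
    assume "lin t1 = v"
    moreover have "v \<in> mesh_vertices \<T>" using that tri_extreme[OF t2] T1(1) unfolding mesh_vertices_def by blast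
    moreover have "\<tau> \<bullet> lin t1 = \<tau> \<bullet> z" unfolding z_line lin_def by (simp add: inner_add_right \<tau>n)
    ultimately show False using zg by metis
  qed
  obtain A1 B1 C1 p1 q1 where t1': "tri A1 B1 C1 p1 q1 T1" and y1: "q1 \<bullet> (lin t1 - A1) = 0" "0 < p1 \<bullet> (lin t1 - A1)" "p1 \<bullet> (lin t1 - A1) < 1"
    using tri_boundary_point[OF t2 T1(2) ni] nv by blast
  define a1 where "a1 = p1 \<bullet> (lin t1 - A1)"
  have y1eq: "lin t1 = A1 + a1 *\<^sub>R (B1 - A1)"
    using triD(5)[OF t1', of "lin t1"] y1(1) by (simp add: a1_def)
  have fr1: "closed_segment A1 B1 \<subseteq> frontier (\<Union>\<T>)"
  proof (rule tmesh_edge_frontier_whole[OF tm T1(1) t1'])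
    show "0 < a1" "a1 < 1" unfolding a1_def by (rule y1)+
    show "A1 + a1 *\<^sub>R (B1 - A1) \<in> frontier (\<Union>\<T>)" using y1f unfolding y1eq .
  qed
  \<comment> \<open>The segment of the line stays in \<open>ball P (r / 4)\<close> by convexity and
    a triangle adds less than r/4, so the chart still covers \<open>T1\<close>.\<close>
  have T1b: "T1 \<subseteq> ball P r"
  proof
    fix w assume w: "w \<in> T1"
    have "lin t1 \<in> closed_segment (lin 0) (lin \<mu>)"
    proof -
      have "lin t1 = (1 - t1 / \<mu>) *\<^sub>R lin 0 + (t1 / \<mu>) *\<^sub>R lin \<mu>" using am(1) by (simp add: lin_def algebra_simps)
      then show ?thesis using t1 t'0 am(1) unfolding in_segment by (intro exI[of _ "t1 / \<mu>"]) auto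
    qed
    moreover have "lin 0 \<in> ball P (r / 4)" using tri_edge_point(1)[OF t am(2,3)] T(2) by (auto simp: lin_def)
    moreover have "lin \<mu> \<in> ball P (r / 4)" using zW z_line by (simp add: W_def)
    ultimately have "lin t1 \<in> ball P (r / 4)" using closed_segment_subset[OF _ _ convex_ball] by blast
    moreover have "dist (lin t1) w \<le> h" using diam_dist[OF T1(1,2) w] size[OF T1(1)] by (simp add: dist_norm)
    ultimately have "dist P w < r" using dist_triangle[of P w "lin t1"] h r0 by simp
    then show "w \<in> ball P r" by simp
  qed
  have q1n: "q1 \<bullet> n < 0" using chart_heights(3)[OF ch e T1(1) T1b t1' fr1] .
  \<comment> \<open>As \<open>q1 \<bullet> n\<close> is negative, points just below
    \<open>lin t1\<close> belong to \<open>T1\<close>, whereas \<open>t1\<close> is a limit from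
    below of parameters off the mesh.\<close>
  have "\<forall>\<^sub>F s in at_left t1. lin s \<in> T1"
  proof -
    have l: "((\<lambda>s. lin s) \<longlongrightarrow> lin t1) (at_left t1)" unfolding lin_def by (intro tendsto_intros)
    have l1: "((\<lambda>s. p1 \<bullet> (lin s - A1)) \<longlongrightarrow> a1) (at_left t1)" unfolding a1_def by (intro tendsto_intros l)
    have l2: "((\<lambda>s. p1 \<bullet> (lin s - A1) + q1 \<bullet> (lin s - A1)) \<longlongrightarrow> a1) (at_left t1)"
    proof -
      have "((\<lambda>s. p1 \<bullet> (lin s - A1) + q1 \<bullet> (lin s - A1)) \<longlongrightarrow> a1 + q1 \<bullet> (lin t1 - A1)) (at_left t1)"
        unfolding a1_def by (intro tendsto_intros l)
      then show ?thesis using y1(1) by simp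
    qed
    have a1: "0 < a1" "a1 < 1" using y1 a1_def by auto
    have lt: "\<forall>\<^sub>F s in at_left t1. s < t1" by (auto simp: eventually_at_filter)
    show ?thesis using order_tendstoD(1)[OF l1 a1(1)] order_tendstoD(2)[OF l2 a1(2)] lt
    proof eventually_elim
      case (elim s)
      have "lin s - A1 = (lin t1 - A1) + (s - t1) *\<^sub>R n" by (simp add: lin_def algebra_simps)
      then have "q1 \<bullet> (lin s - A1) = (s - t1) * (q1 \<bullet> n)" using y1(1) by (simp only: inner_add_right) simp
      then have "q1 \<bullet> (lin s - A1) \<ge> 0" using q1n elim(3) by (simp add: mult_nonpos_nonpos)
      then show ?case using tri_mem[OF t1'] elim by simp
    qed
  qed
  then obtain b where b: "b < t1" "\<And>s. b < s \<Longrightarrow> s < t1 \<Longrightarrow> lin s \<in> T1"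
    unfolding eventually_at_left_field by blast
  obtain s where s: "s \<in> S" "t1 - (t1 - b) < s" "s < t1" using lim[of "t1 - b"] b(1) by auto
  then have "lin s \<in> T1" using b(2) by simp
  then show False using s(1) T1(1) by (auto simp: S_def)
qed

end

text \<open>Points up to 8 diameters away from the triangle are considered; since h < r/64 they stay
  in \<open>ball P (r / 4)\<close>. The bounds on \<epsilon> let the chart errors be absorbed in
  estimates along \<open>n\<close> and across the triangle.\<close>

locale chart_tri = mesh_geom +
  fixes \<epsilon> r :: real and P n :: "real^2" and \<phi> :: "real^2 \<Rightarrow> real" and T A B C p q
  assumes ch: "chart \<Omega> \<epsilon> r P n \<phi>" and \<epsilon>0: "0 \<le> \<epsilon>" and \<epsilon>\<kappa>: "\<epsilon> \<le> \<kappa> / 4" and \<epsilon>h: "\<epsilon> \<le> 1 / 2"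
    and hr: "h < r / 64"
    and TT: "T \<in> \<T>" and Tb: "T \<subseteq> ball P (r / 8)" and tt: "tri A B C p q T" and fr: "closed_segment A B \<subseteq> frontier (\<Union>\<T>)"
begin

abbreviation "d \<equiv> diameter T"
abbreviation "\<Gamma> \<equiv> frontier \<Omega>"

lemma basics:
  shows "d > 0" "d \<le> h" "d < r / 64" "r > 0" "norm n = 1" "A \<in> T" "B \<in> T" "C \<in> T" "T \<subseteq> ball P r" "T \<subseteq> ball P (r / 4)"
    "A \<in> \<Gamma>" "B \<in> \<Gamma>" "C \<in> \<Omega>" "norm (B - A) \<le> d" "norm (B - A) > 0"
proof -
  show d: "d > 0" "d \<le> h" using diam_pos[OF TT] size[OF TT] by auto
  show "d < r / 64" using d hr by simp
  show r: "r > 0" using d hr by simp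
  show "norm n = 1" using ch chart_def by blast
  show m: "A \<in> T" "B \<in> T" "C \<in> T" using tri_vertices_mem[OF tt] by auto
  show "T \<subseteq> ball P r" "T \<subseteq> ball P (r / 4)" using Tb r by (auto simp: subset_iff)
  show "A \<in> \<Gamma>" "B \<in> \<Gamma>" "C \<in> \<Omega>" using bdry[OF TT tt fr] by auto
  show "norm (B - A) \<le> d" by (rule diam_dist[OF TT m(2,1)])
  show "norm (B - A) > 0" using tri_distinct[OF tt] by auto
qed

lemma est: "a \<in> ball P r \<Longrightarrow> b \<in> ball P r \<Longrightarrow> \<bar>\<phi> a - \<phi> b - n \<bullet> (a - b)\<bar> \<le> \<epsilon> * norm (a - b)"
  using ch unfolding chart_def by blast

lemma \<Gamma>_iff: "a \<in> ball P r \<Longrightarrow> a \<in> \<Gamma> \<longleftrightarrow> \<phi> a = 0"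
  using ch unfolding chart_def by blast

lemma flat: "a \<in> \<Gamma> \<Longrightarrow> b \<in> \<Gamma> \<Longrightarrow> a \<in> ball P r \<Longrightarrow> b \<in> ball P r \<Longrightarrow> \<bar>n \<bullet> (a - b)\<bar> \<le> \<epsilon> * norm (a - b)"
  using est[of a b] \<Gamma>_iff[of a] \<Gamma>_iff[of b] by simp

definition \<tau> :: "real^2" where "\<tau> = vector [- n$2, n$1]"

lemma n_sq: "n$1 * n$1 + n$2 * n$2 = 1"
  using basics(5) by (simp add: norm_eq_sqrt_inner inner_vec_def sum_2)

lemma n_in: "n \<bullet> n = 1" using n_sq by (simp add: inner_vec_def sum_2)

lemma \<tau>n: "\<tau> \<bullet> n = 0" by (simp add: \<tau>_def inner_vec_def sum_2)

lemma \<tau>_decomp: "x = (\<tau> \<bullet> x) *\<^sub>R \<tau> + (n \<bullet> x) *\<^sub>R n"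
proof -
  have "x$1 = (n$1 * n$1 + n$2 * n$2) * x$1" "x$2 = (n$1 * n$1 + n$2 * n$2) * x$2" using n_sq by simp_all
  then show ?thesis by (simp add: vec_eq_iff forall_2 \<tau>_def inner_vec_def sum_2 algebra_simps)
qed

lemma norm_\<tau>: "norm \<tau> = 1"
  using n_sq by (simp add: norm_eq_sqrt_inner inner_vec_def sum_2 \<tau>_def add.commute)

lemma norm_le_\<tau>: "norm x \<le> \<bar>\<tau> \<bullet> x\<bar> + \<bar>n \<bullet> x\<bar>"
proof -
  have "norm ((\<tau> \<bullet> x) *\<^sub>R \<tau> + (n \<bullet> x) *\<^sub>R n) \<le> \<bar>\<tau> \<bullet> x\<bar> + \<bar>n \<bullet> x\<bar>"
    using norm_triangle_ineq[of "(\<tau> \<bullet> x) *\<^sub>R \<tau>" "(n \<bullet> x) *\<^sub>R n"] norm_\<tau> basics(5) by simp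
  then show ?thesis using \<tau>_decomp[of x] by metis
qed

text \<open>Applied to secants of \<Gamma>, this makes the boundary in the chart a graph over the
  tangential coordinate.\<close>

lemma flat_norm:
  assumes "\<bar>n \<bullet> x\<bar> \<le> \<epsilon> * norm x"
  shows "norm x \<le> 2 * \<bar>\<tau> \<bullet> x\<bar>"
proof -
  have "\<epsilon> * norm x \<le> 1/2 * norm x" using \<epsilon>h by (intro mult_right_mono) auto
  then show ?thesis using assms norm_le_\<tau>[of x] by linarith
qed

lemma \<Gamma>_\<tau>_inj: "a \<in> \<Gamma> \<Longrightarrow> b \<in> \<Gamma> \<Longrightarrow> a \<in> ball P r \<Longrightarrow> b \<in> ball P r \<Longrightarrow> \<tau> \<bullet> a = \<tau> \<bullet> b \<Longrightarrow> a = b"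
  using flat_norm[OF flat[of a b]] by (simp add: inner_diff_right)

lemma \<tau>_BA: "\<tau> \<bullet> (B - A) \<noteq> 0"
  using \<Gamma>_\<tau>_inj[of A B] basics tri_distinct[OF tt] by (auto simp: inner_diff_right subset_iff)

lemma heights: "\<bar>n \<bullet> (B - A)\<bar> \<le> \<epsilon> * norm (B - A)" "n \<bullet> (C - A) \<le> - \<kappa> * d" "q \<bullet> n < 0"
  using chart_heights[OF ch \<epsilon>0 _ TT basics(9) tt fr] \<epsilon>\<kappa> \<kappa>0 by auto

lemma chord_ball: "0 \<le> a \<Longrightarrow> a \<le> 1 \<Longrightarrow> A + a *\<^sub>R (B - A) \<in> T"
  using tri_mem[OF tt, of "A + a *\<^sub>R (B - A)"] triD(1-4)[OF tt] by simp

lemma near_ball: "x \<in> T \<Longrightarrow> dist x y \<le> 8 * d \<Longrightarrow> y \<in> ball P (r / 4)"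
  using Tb basics(3) dist_triangle[of P y x] by fastforce

lemma near_ball': "x \<in> T \<Longrightarrow> dist x y \<le> 8 * d \<Longrightarrow> y \<in> ball P r"
  using near_ball basics(4) by fastforce

lemma chord_\<phi>:
  assumes a: "0 \<le> a" "a \<le> 1"
  shows "\<bar>\<phi> (A + a *\<^sub>R (B - A))\<bar> \<le> 2 * \<epsilon> * d"
proof -
  define c where "c = A + a *\<^sub>R (B - A)"
  have cT: "c \<in> T" using chord_ball[OF a] c_def by simp
  have cb: "c \<in> ball P r" "A \<in> ball P r" using cT basics by auto
  have "\<phi> A = 0" using \<Gamma>_iff[OF cb(2)] basics(11) by simp
  moreover have "\<bar>n \<bullet> (c - A)\<bar> \<le> \<epsilon> * d"
  proof -
    have "\<bar>n \<bullet> (c - A)\<bar> = a * \<bar>n \<bullet> (B - A)\<bar>" using a by (simp add: c_def abs_mult)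
    also have "\<dots> \<le> 1 * (\<epsilon> * norm (B - A))" using heights(1) a by (intro mult_mono) auto
    also have "\<dots> \<le> \<epsilon> * d" using basics(14) \<epsilon>0 by (simp add: mult_left_mono)
    finally show ?thesis .
  qed
  moreover have "\<epsilon> * norm (c - A) \<le> \<epsilon> * d" using diam_dist[OF TT cT basics(6)] \<epsilon>0 by (rule mult_left_mono)
  ultimately have "\<bar>\<phi> c\<bar> \<le> 2 * \<epsilon> * d" using est[OF cb] by linarith
  then show ?thesis by (simp add: c_def)
qed

text \<open>Intermediate values: along \<open>n\<close> the function \<phi> increases at a rate of
  at least 1/2, while on the chord it is at most \<open>2 * \<epsilon> * d\<close> in absolute
  value.\<close>

lemma graph_exists:
  assumes a: "0 \<le> a" "a \<le> 1"
  shows "\<exists>t. \<bar>t\<bar> \<le> 4 * \<epsilon> * d \<and> A + a *\<^sub>R (B - A) + t *\<^sub>R n \<in> \<Gamma>"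
proof -
  define c where "c = A + a *\<^sub>R (B - A)"
  define g where "g = (\<lambda>t. c + t *\<^sub>R n)"
  define D where "D = 4 * \<epsilon> * d"
  have D0: "0 \<le> D" using \<epsilon>0 basics(1) by (simp add: D_def)
  have D8: "D \<le> 8 * d" using \<epsilon>h basics(1) mult_right_mono[of \<epsilon> "1/2" d] by (simp add: D_def)
  have cT: "c \<in> T" using chord_ball[OF a] c_def by simp
  have gb: "g t \<in> ball P r" if "\<bar>t\<bar> \<le> D" for t
    by (rule near_ball'[OF cT]) (use that D8 basics(5) in \<open>simp add: g_def dist_norm\<close>)
  have 1: "\<bar>\<phi> c\<bar> \<le> 2 * \<epsilon> * d" using chord_\<phi>[OF a] c_def by simp
  have gd: "\<bar>\<phi> (g s) - \<phi> (g t) - (s - t)\<bar> \<le> \<epsilon> * \<bar>s - t\<bar>" if "\<bar>s\<bar> \<le> D" "\<bar>t\<bar> \<le> D" for s t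
  proof -
    have "g s - g t = (s - t) *\<^sub>R n" by (simp add: g_def algebra_simps)
    then show ?thesis using est[OF gb[OF that(1)] gb[OF that(2)]] basics(5) n_in by simp
  qed
  have cont: "continuous_on {-D..D} (\<lambda>t. \<phi> (g t))"
  proof (rule lipschitz_on_continuous_on[of 2], rule lipschitz_onI)
    fix s t assume "s \<in> {-D..D}" "t \<in> {-D..D}"
    then have "\<bar>\<phi> (g s) - \<phi> (g t) - (s - t)\<bar> \<le> \<epsilon> * \<bar>s - t\<bar>" by (intro gd) auto
    moreover have "\<epsilon> * \<bar>s - t\<bar> \<le> 1 * \<bar>s - t\<bar>" using \<epsilon>h by (intro mult_right_mono) auto
    ultimately show "dist (\<phi> (g s)) (\<phi> (g t)) \<le> 2 * dist s t" unfolding dist_real_def by (smt (verit))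
  qed simp
  have g0: "g 0 = c" by (simp add: g_def)
  have eD: "\<epsilon> * D \<le> 1/2 * D" using \<epsilon>h D0 by (rule mult_right_mono)
  have "\<phi> (g D) \<ge> 0" "\<phi> (g (-D)) \<le> 0"
    using gd[of D 0] gd[of "-D" 0] D0 g0 1 eD by (auto simp: D_def)
  then obtain t where "-D \<le> t" "t \<le> D" "\<phi> (g t) = 0" using IVT'[of "\<lambda>t. \<phi> (g t)" "-D" 0 D] cont D0 by auto
  then have "\<bar>t\<bar> \<le> D" "g t \<in> \<Gamma>" using \<Gamma>_iff[OF gb[of t]] by auto
  then show ?thesis by (auto simp: g_def c_def D_def)
qed

text \<open>Parametrises the small arc of \<Gamma> over the chord by the chord parameter. The choice
  is unambiguous because \<tau> separates the points of \<Gamma> in the chart.\<close>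

definition G :: "real \<Rightarrow> real^2" where
  "G a = (SOME g. g \<in> \<Gamma> \<and> (\<exists>t. \<bar>t\<bar> \<le> 4 * \<epsilon> * d \<and> g = A + a *\<^sub>R (B - A) + t *\<^sub>R n))"

lemma G_props:
  assumes a: "0 \<le> a" "a \<le> 1"
  shows "G a \<in> \<Gamma>" "\<exists>t. \<bar>t\<bar> \<le> 4 * \<epsilon> * d \<and> G a = A + a *\<^sub>R (B - A) + t *\<^sub>R n" "G a \<in> ball P r" "\<tau> \<bullet> G a = \<tau> \<bullet> A + a * (\<tau> \<bullet> (B - A))"
proof -
  have "G a \<in> \<Gamma> \<and> (\<exists>t. \<bar>t\<bar> \<le> 4 * \<epsilon> * d \<and> G a = A + a *\<^sub>R (B - A) + t *\<^sub>R n)"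
    unfolding G_def by (rule someI_ex) (use graph_exists[OF a] in blast)
  then show 1: "G a \<in> \<Gamma>" "\<exists>t. \<bar>t\<bar> \<le> 4 * \<epsilon> * d \<and> G a = A + a *\<^sub>R (B - A) + t *\<^sub>R n" by auto
  then obtain t where t: "\<bar>t\<bar> \<le> 4 * \<epsilon> * d" "G a = A + a *\<^sub>R (B - A) + t *\<^sub>R n" by blast
  have "4 * \<epsilon> * d \<le> 2 * d" using \<epsilon>h basics(1) by simp
  then have "\<bar>t\<bar> \<le> 8 * d" using t(1) basics(1) by linarith
  then have "dist (A + a *\<^sub>R (B - A)) (G a) \<le> 8 * d" using basics(5) by (simp add: t(2) dist_norm)
  then show "G a \<in> ball P r" using near_ball'[OF chord_ball[OF a]] by blast
  show "\<tau> \<bullet> G a = \<tau> \<bullet> A + a * (\<tau> \<bullet> (B - A))" using \<tau>n by (simp add: t(2) inner_add_right)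
qed

lemma G_ends: "G 0 = A" "G 1 = B"
proof -
  show "G 0 = A" by (rule \<Gamma>_\<tau>_inj) (use G_props[of 0] basics in auto)
  show "G 1 = B" by (rule \<Gamma>_\<tau>_inj) (use G_props[of 1] basics in \<open>auto simp: inner_diff_right\<close>)
qed

lemma G_Lipschitz: assumes "a \<in> {0..1}" "b \<in> {0..1}" shows "dist (G a) (G b) \<le> 2 * d * dist a b"
proof -
  have a: "0 \<le> a" "a \<le> 1" "0 \<le> b" "b \<le> 1" using assms by auto
  have "norm (G a - G b) \<le> 2 * \<bar>\<tau> \<bullet> (G a - G b)\<bar>"
    by (intro flat_norm flat G_props a)
  also have "\<tau> \<bullet> (G a - G b) = (a - b) * (\<tau> \<bullet> (B - A))"
    using G_props(4)[OF a(1,2)] G_props(4)[OF a(3,4)] by (simp add: inner_diff_right algebra_simps)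
  also have "2 * \<bar>(a - b) * (\<tau> \<bullet> (B - A))\<bar> \<le> 2 * (\<bar>a - b\<bar> * d)"
    using Cauchy_Schwarz_ineq2[of \<tau> "B - A"] norm_\<tau> basics(14) unfolding abs_mult
    by (intro mult_left_mono) auto
  finally show ?thesis by (simp add: dist_norm mult.commute mult.left_commute)
qed

lemma G_arc: "arc G"
proof -
  have "continuous_on {0..1} G"
    by (rule lipschitz_on_continuous_on[of "2 * d"], rule lipschitz_onI[OF G_Lipschitz]) (use basics(1) in auto)
  moreover have "inj_on G {0..1}"
  proof (rule inj_onI)
    fix a b :: real assume ab: "a \<in> {0..1}" "b \<in> {0..1}" "G a = G b"
    have "\<tau> \<bullet> A + a * (\<tau> \<bullet> (B - A)) = \<tau> \<bullet> A + b * (\<tau> \<bullet> (B - A))"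
      using G_props(4)[of a] G_props(4)[of b] ab by (metis atLeastAtMost_iff)
    then show "a = b" using \<tau>_BA by simp
  qed
  ultimately show ?thesis by (simp add: arc_def path_def)
qed

lemma ends: "{x. x extreme_point_of closed_segment A B} = {A, B}"
  by (auto simp: extreme_point_of_segment)

lemma G_joining: "joining_arc \<Gamma> (closed_segment A B) (path_image G)"
  unfolding joining_arc_def ends
proof (intro exI[of _ G] conjI G_arc refl)
  show "path_image G \<subseteq> \<Gamma>" using G_props(1) by (auto simp: path_image_def)
  show "{pathstart G, pathfinish G} = {A, B}" using G_ends by (simp add: pathstart_def pathfinish_def)
qed

lemma G_diameter: "diameter (path_image G) \<le> 2 * d"
proof (rule diameter_le)
  show "path_image G \<noteq> {} \<or> 0 \<le> 2 * d" using basics(1) by simp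
  fix x y assume "x \<in> path_image G" "y \<in> path_image G"
  then obtain a b where ab: "a \<in> {0..1}" "b \<in> {0..1}" "x = G a" "y = G b" by (auto simp: path_image_def)
  have "2 * d * dist a b \<le> 2 * d * 1" using ab(1,2) basics(1) by (intro mult_left_mono) (auto simp: dist_real_def)
  then show "norm (x - y) \<le> 2 * d" using G_Lipschitz[OF ab(1,2)] by (simp add: ab dist_norm)
qed

text \<open>The chord parameter of the projection of \<open>x\<close> along \<open>n\<close> onto
  the line through \<open>A\<close> and \<open>B\<close>.\<close>

definition sc :: "real^2 \<Rightarrow> real" where "sc x = \<tau> \<bullet> (x - A) / (\<tau> \<bullet> (B - A))"

lemma sc_G: "0 \<le> a \<Longrightarrow> a \<le> 1 \<Longrightarrow> sc (G a) = a"
  using G_props(4)[of a] \<tau>_BA by (simp add: sc_def inner_diff_right)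

lemma sc_AB: "sc A = 0" "sc B = 1" using \<tau>_BA by (auto simp: sc_def)

lemma sc_inj: "a \<in> \<Gamma> \<Longrightarrow> b \<in> \<Gamma> \<Longrightarrow> a \<in> ball P r \<Longrightarrow> b \<in> ball P r \<Longrightarrow> sc a = sc b \<Longrightarrow> a = b"
  by (rule \<Gamma>_\<tau>_inj) (use \<tau>_BA in \<open>auto simp: sc_def inner_diff_right\<close>)

lemma sc_rep: "\<exists>t. x = A + sc x *\<^sub>R (B - A) + t *\<^sub>R n"
proof -
  let ?y = "x - A - sc x *\<^sub>R (B - A)"
  have "\<tau> \<bullet> ?y = 0" using \<tau>_BA by (simp add: sc_def inner_diff_right)
  then have "?y = (n \<bullet> ?y) *\<^sub>R n" using \<tau>_decomp[of ?y] by simp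
  then have "x = A + sc x *\<^sub>R (B - A) + (n \<bullet> ?y) *\<^sub>R n" by (metis add.commute diff_add_cancel diff_diff_add)
  then show ?thesis by blast
qed

lemma sc_chord: "sc (A + a *\<^sub>R (B - A) + t *\<^sub>R n) = a"
  using \<tau>_BA \<tau>n by (simp add: sc_def inner_add_right)

text \<open>Along such an arc \<open>sc\<close> is continuous and injective, hence monotone between
  its end values 0 and 1. So all joining arcs inside the chart have the same points, those of
  \<open>G\<close>.\<close>

lemma joining_local:
  assumes J: "joining_arc \<Gamma> (closed_segment A B) Y" and Y: "Y \<subseteq> ball P r"
  shows "\<And>y. y \<in> Y \<Longrightarrow> 0 \<le> sc y \<and> sc y \<le> 1"
    and "\<And>y. y \<in> \<Gamma> \<Longrightarrow> y \<in> ball P r \<Longrightarrow> 0 \<le> sc y \<Longrightarrow> sc y \<le> 1 \<Longrightarrow> y \<in> Y"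
proof -
  obtain g where g: "arc g" "path_image g = Y" "Y \<subseteq> \<Gamma>" "{pathstart g, pathfinish g} = {A, B}"
    using J unfolding joining_arc_def ends by blast
  let ?f = "\<lambda>u. sc (g u)"
  have cg: "continuous_on {0..1} g" and ig: "inj_on g {0..1}" using g(1) by (auto simp: arc_def path_def)
  have cf: "continuous_on {0..1} ?f" unfolding sc_def using \<tau>_BA by (intro continuous_intros cg) auto
  have gY: "g u \<in> \<Gamma>" "g u \<in> ball P r" if "u \<in> {0..1}" for u
  proof -
    have "g u \<in> Y" using that g(2) by (auto simp: path_image_def)
    then show "g u \<in> \<Gamma>" "g u \<in> ball P r" using g(3) Y by blast+
  qed
  have "inj_on ?f {0..1}"
    by (rule inj_onI) (use sc_inj gY ig in \<open>meson inj_onD\<close>)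
  then have mono: "(?f 0 < ?f u \<and> ?f u < ?f 1) \<or> (?f 1 < ?f u \<and> ?f u < ?f 0)" if "0 < u" "u < 1" for u
    using continuous_inj_imp_mono[OF that cf] by blast
  have ends: "(?f 0 = 0 \<and> ?f 1 = 1) \<or> (?f 0 = 1 \<and> ?f 1 = 0)"
    using g(4) sc_AB tri_distinct[OF tt] unfolding pathstart_def pathfinish_def by (auto simp: doubleton_eq_iff)
  show "0 \<le> sc y \<and> sc y \<le> 1" if "y \<in> Y" for y
  proof -
    obtain u where u: "u \<in> {0..1}" "y = g u" using \<open>y \<in> Y\<close> g(2) by (auto simp: path_image_def)
    show ?thesis
    proof (cases "u = 0 \<or> u = 1")
      case True then show ?thesis using ends u by auto
    next
      case False
      then have "0 < u" "u < 1" using u by auto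
      then show ?thesis using mono[of u] ends u by auto
    qed
  qed
  show "y \<in> Y" if y: "y \<in> \<Gamma>" "y \<in> ball P r" "0 \<le> sc y" "sc y \<le> 1" for y
  proof -
    have "\<exists>u\<in>{0..1}. ?f u = sc y"
      using ends
    proof
      assume "?f 0 = 0 \<and> ?f 1 = 1"
      then show ?thesis using IVT'[of ?f 0 "sc y" 1] cf y(3,4) by auto
    next
      assume "?f 0 = 1 \<and> ?f 1 = 0"
      then show ?thesis using IVT2'[of ?f 1 "sc y" 0] cf y(3,4) by auto
    qed
    then obtain u where u: "u \<in> {0..1}" "sc (g u) = sc y" by blast
    then have "g u = y" using sc_inj gY[OF u(1)] y by blast
    then show ?thesis using u(1) g(2) by (auto simp: path_image_def)
  qed
qed

lemma G_image_subset: "path_image G \<subseteq> ball P r" "y \<in> path_image G \<Longrightarrow> 0 \<le> sc y \<and> sc y \<le> 1"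
  using G_props(3) sc_G by (auto simp: path_image_def)

text \<open>The arc \<open>G\<close> has diameter at most \<open>2 * d\<close>; a joining arc of
  minimal diameter is no larger and therefore cannot run around \<Gamma> the other way.\<close>

lemma cut_off_ball:
  assumes J: "cut_off_arc \<Gamma> (closed_segment A B) Y"
  shows "Y \<subseteq> ball P r" "Y \<subseteq> cball A (2 * d)" "joining_arc \<Gamma> (closed_segment A B) Y"
proof -
  show j: "joining_arc \<Gamma> (closed_segment A B) Y" using J cut_off_arc_def by blast
  obtain g where g: "arc g" "path_image g = Y" "{pathstart g, pathfinish g} = {A, B}"
    using j unfolding joining_arc_def ends by blast
  have AY: "A \<in> Y" using g(2,3) pathstart_in_path_image[of g] pathfinish_in_path_image[of g] by (auto simp: doubleton_eq_iff)
  have b: "bounded Y" using g(1,2) bounded_arc_image by blast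
  have "diameter Y \<le> 2 * d" using J G_joining G_diameter unfolding cut_off_arc_def by fastforce
  then show c: "Y \<subseteq> cball A (2 * d)" using diameter_bounded_bound[OF b AY] by fastforce
  then show "Y \<subseteq> ball P r" using near_ball'[OF basics(6)] basics(1) by (auto simp: subset_iff)
qed

text \<open>A joining arc of smaller diameter would stay in the chart and hence contain the image of
  \<open>G\<close>, so its diameter would not be smaller after all.\<close>

lemma G_cut_off: "cut_off_arc \<Gamma> (closed_segment A B) (path_image G)"
  unfolding cut_off_arc_def
proof (intro conjI G_joining allI impI)
  fix Y assume J: "joining_arc \<Gamma> (closed_segment A B) Y"
  show "diameter (path_image G) \<le> diameter Y"
  proof (rule ccontr)
    assume n: "\<not> ?thesis"
    obtain g where g: "arc g" "path_image g = Y" "{pathstart g, pathfinish g} = {A, B}"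
      using J unfolding joining_arc_def ends by blast
    have AY: "A \<in> Y" using g(2,3) pathstart_in_path_image[of g] pathfinish_in_path_image[of g] by (auto simp: doubleton_eq_iff)
    have b: "bounded Y" using g(1,2) bounded_arc_image by blast
    have "diameter Y \<le> 2 * d" using n G_diameter by linarith
    then have "Y \<subseteq> cball A (2 * d)" using diameter_bounded_bound[OF b AY] by fastforce
    then have "Y \<subseteq> ball P r" using near_ball'[OF basics(6)] basics(1) by (auto simp: subset_iff)
    then have "path_image G \<subseteq> Y" using joining_local(2)[OF J] G_image_subset G_joining unfolding joining_arc_def by blast
    then show False using n diameter_subset[OF _ b] by blast
  qed
qed

text \<open>From a point that is not between chord and arc, one of the two rays parallel to
  \<open>n\<close> avoids the closed curve and escapes to infinity, so the point is not in
  \<open>inside\<close>.\<close>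

lemma inside_between:
  assumes J: "cut_off_arc \<Gamma> (closed_segment A B) Y" and x: "x \<in> closed_segment A B \<union> Y \<union> inside (closed_segment A B \<union> Y)"
  shows "\<exists>a t s. 0 \<le> a \<and> a \<le> 1 \<and> x = A + a *\<^sub>R (B - A) + t *\<^sub>R n \<and> G a = A + a *\<^sub>R (B - A) + s *\<^sub>R n \<and> \<bar>t\<bar> \<le> \<bar>s\<bar>"
proof -
  note cb = cut_off_ball[OF J]
  have Y\<Gamma>: "Y \<subseteq> \<Gamma>" using cb(3) unfolding joining_arc_def by blast
  define a where "a = sc x"
  obtain t where t: "x = A + a *\<^sub>R (B - A) + t *\<^sub>R n" using sc_rep a_def by blast
  have segm: "\<exists>b. 0 \<le> b \<and> b \<le> 1 \<and> z = A + b *\<^sub>R (B - A)" if "z \<in> closed_segment A B" for z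
    using that by (auto simp: in_segment algebra_simps)
  have Gs: "\<exists>s. G a = A + a *\<^sub>R (B - A) + s *\<^sub>R n" if "0 \<le> a" "a \<le> 1" using G_props(2)[OF that] by blast
  have YG: "z = G (sc z)" "0 \<le> sc z" "sc z \<le> 1" if "z \<in> Y" for z
  proof -
    show 1: "0 \<le> sc z" "sc z \<le> 1" using joining_local(1)[OF cb(3,1) that] by auto
    show "z = G (sc z)" by (rule sc_inj) (use that Y\<Gamma> cb(1) G_props[OF 1] sc_G[OF 1] in auto)
  qed
  consider (e) "x \<in> closed_segment A B" | (Y) "x \<in> Y" | (I) "x \<in> inside (closed_segment A B \<union> Y)" using x by blast
  then show ?thesis
  proof cases
    case e
    then obtain b where b: "0 \<le> b" "b \<le> 1" "x = A + b *\<^sub>R (B - A) + 0 *\<^sub>R n" using segm by fastforce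
    obtain s where "G b = A + b *\<^sub>R (B - A) + s *\<^sub>R n" using G_props(2)[OF b(1,2)] by blast
    then show ?thesis using b by (intro exI[of _ b] exI[of _ 0] exI[of _ s]) auto
  next
    case Y
    have g: "G a = x" unfolding a_def by (rule YG(1)[OF Y, symmetric])
    have a: "0 \<le> a" "a \<le> 1" unfolding a_def by (rule YG(2,3)[OF Y])+
    have "G a = A + a *\<^sub>R (B - A) + t *\<^sub>R n" unfolding g by (rule t)
    with a t show ?thesis by blast
  next
    case I
    \<comment> \<open>A ray that avoids the curve lies in the component of \<open>x\<close> in the
      complement, which is bounded for a point of \<open>inside\<close>.\<close>
    have ray: False if sg: "u = n \<or> u = - n" and av: "\<And>s. s \<ge> 0 \<Longrightarrow> x + s *\<^sub>R u \<notin> closed_segment A B \<union> Y" for u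
    proof -
      let ?S = "closed_segment A B \<union> Y"
      have u1: "norm u = 1" using sg basics(5) by auto
      let ?R = "(\<lambda>s. x + s *\<^sub>R u) ` {0..}"
      have "connected ?R" by (intro connected_continuous_image continuous_intros) (simp add: convex_connected)
      then have "?R \<subseteq> connected_component_set (- ?S) x"
        using av by (intro connected_component_maximal) (auto intro: image_eqI[of _ _ 0])
      moreover have "bounded (connected_component_set (- ?S) x)" using I by (simp add: inside_def)
      ultimately have "bounded ?R" using bounded_subset by blast
      then obtain K where K: "\<And>s. s \<ge> 0 \<Longrightarrow> norm (x + s *\<^sub>R u) \<le> K" unfolding bounded_iff by auto
      have "norm x \<le> K" using K[of 0] by simp
      then have K0: "K \<ge> 0" by (rule order_trans[OF norm_ge_zero])
      have "norm ((norm x + K + 1) *\<^sub>R u) \<le> norm (x + (norm x + K + 1) *\<^sub>R u) + norm x"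
        using norm_triangle_ineq4[of "x + (norm x + K + 1) *\<^sub>R u" x] by simp
      moreover have "norm ((norm x + K + 1) *\<^sub>R u) = norm x + K + 1" using u1 K0 by simp
      ultimately show False using K[of "norm x + K + 1"] K0 norm_ge_zero[of x] by linarith
    qed
    have sh: "x + s *\<^sub>R n = A + a *\<^sub>R (B - A) + (t + s) *\<^sub>R n" "x + s *\<^sub>R (- n) = A + a *\<^sub>R (B - A) + (t - s) *\<^sub>R n" for s
      unfolding t by (simp_all add: algebra_simps)
    have n0: "n \<noteq> 0" using basics(5) by auto
    have out: "A + a *\<^sub>R (B - A) + s *\<^sub>R n \<notin> closed_segment A B \<union> Y" if "s \<noteq> 0" "0 \<le> a \<Longrightarrow> a \<le> 1 \<Longrightarrow> G a \<noteq> A + a *\<^sub>R (B - A) + s *\<^sub>R n" for s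
    proof
      assume m: "A + a *\<^sub>R (B - A) + s *\<^sub>R n \<in> closed_segment A B \<union> Y" (is "?z \<in> _")
      show False
      proof (cases "?z \<in> Y")
        case True
        show False using YG[OF True] that(2) unfolding sc_chord by metis
      next
        case False
        then obtain b where b: "?z = A + b *\<^sub>R (B - A) + 0 *\<^sub>R n" using m segm by fastforce
        have "a = b" using arg_cong[OF b, of sc] unfolding sc_chord .
        then show False using b that(1) n0 by simp
      qed
    qed
    have a01: "0 \<le> a \<and> a \<le> 1"
    proof (rule ccontr)
      assume na: "\<not> (0 \<le> a \<and> a \<le> 1)"
      have "x + s *\<^sub>R n \<notin> closed_segment A B \<union> Y" for s
      proof (cases "t + s = 0")
        case False then show ?thesis unfolding sh by (intro out) (use na in auto)
      next
        case True
        show ?thesis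
        proof
          assume m: "x + s *\<^sub>R n \<in> closed_segment A B \<union> Y"
          have "sc (x + s *\<^sub>R n) = a" unfolding sh by (rule sc_chord)
          moreover have "0 \<le> sc (x + s *\<^sub>R n) \<and> sc (x + s *\<^sub>R n) \<le> 1"
          proof (cases "x + s *\<^sub>R n \<in> Y")
            case True then show ?thesis using YG(2,3) by blast
          next
            case False
            then obtain b where b: "0 \<le> b" "b \<le> 1" "x + s *\<^sub>R n = A + b *\<^sub>R (B - A)" using m segm by blast
            then show ?thesis using sc_chord[of b 0] by simp
          qed
          ultimately show False using na by simp
        qed
      qed
      then show False using ray[of n] by blast
    qed
    obtain s where s: "G a = A + a *\<^sub>R (B - A) + s *\<^sub>R n" using Gs a01 by blast
    have ne: "G a \<noteq> A + a *\<^sub>R (B - A) + s' *\<^sub>R n" if "s' \<noteq> s" for s'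
      using that n0 unfolding s by simp
    have "\<not> (t > 0 \<and> t > s)"
    proof
      assume ts: "t > 0 \<and> t > s"
      show False by (rule ray[of n], simp, unfold sh, rule out) (use ts ne in auto)
    qed
    moreover have "\<not> (t < 0 \<and> t < s)"
    proof
      assume ts: "t < 0 \<and> t < s"
      show False by (rule ray[of "-n"], simp, unfold sh, rule out) (use ts ne in auto)
    qed
    ultimately have "\<bar>t\<bar> \<le> \<bar>s\<bar>" by linarith
    then show ?thesis using a01 by (intro exI[of _ a] exI[of _ t] exI[of _ s] conjI t s) auto
  qed
qed

text \<open>Flatness of the secants to \<open>A\<close> and to \<open>B\<close> bounds the height of
  the arc linearly in the distance to either end. A uniform bound would not keep the arc within the
  angles of the triangle at these vertices.\<close>

lemma G_cone:
  assumes a: "0 \<le> a" "a \<le> 1" and s: "G a = A + a *\<^sub>R (B - A) + s *\<^sub>R n"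
  shows "\<bar>s\<bar> \<le> 4 * \<epsilon> * d * a" "\<bar>s\<bar> \<le> 4 * \<epsilon> * d * (1 - a)"
proof -
  have ab: "A \<in> ball P r" "B \<in> ball P r" using basics by auto
  have main: "\<bar>s\<bar> \<le> 4 * \<epsilon> * d * c" if X: "X \<in> \<Gamma>" "X \<in> ball P r" and eq: "G a - X = w + s *\<^sub>R n" and w: "\<bar>n \<bullet> w\<bar> \<le> \<epsilon> * (c * d)" "norm w \<le> c * d" and c: "0 \<le> c" for X w c
  proof -
    have "\<bar>n \<bullet> (G a - X)\<bar> \<le> \<epsilon> * norm (G a - X)" by (intro flat X G_props a)
    moreover have "n \<bullet> (G a - X) = n \<bullet> w + s" unfolding eq by (simp add: inner_add_right n_in)
    moreover have "norm (G a - X) \<le> c * d + \<bar>s\<bar>" unfolding eq using norm_triangle_ineq[of w "s *\<^sub>R n"] w(2) basics(5) by simp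
    ultimately have "\<bar>s\<bar> \<le> \<epsilon> * (c * d) + \<epsilon> * (c * d + \<bar>s\<bar>)"
      using w(1) mult_left_mono[OF _ \<epsilon>0, of "norm (G a - X)" "c * d + \<bar>s\<bar>"] by linarith
    moreover have "\<epsilon> * \<bar>s\<bar> \<le> 1/2 * \<bar>s\<bar>" using \<epsilon>h by (intro mult_right_mono) auto
    ultimately show ?thesis by (simp add: algebra_simps)
  qed
  have hb: "\<bar>n \<bullet> (c *\<^sub>R (B - A))\<bar> \<le> \<epsilon> * (\<bar>c\<bar> * d)" "norm (c *\<^sub>R (B - A)) \<le> \<bar>c\<bar> * d" for c
  proof -
    have "\<bar>n \<bullet> (B - A)\<bar> \<le> \<epsilon> * d" using heights(1) mult_left_mono[OF basics(14) \<epsilon>0] by linarith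
    from mult_left_mono[OF this abs_ge_zero[of c]]
    show "\<bar>n \<bullet> (c *\<^sub>R (B - A))\<bar> \<le> \<epsilon> * (\<bar>c\<bar> * d)" by (simp add: abs_mult mult.left_commute)
    show "norm (c *\<^sub>R (B - A)) \<le> \<bar>c\<bar> * d" using basics(14) by (simp add: mult_left_mono)
  qed
  show "\<bar>s\<bar> \<le> 4 * \<epsilon> * d * a"
    by (rule main[of A "a *\<^sub>R (B - A)"]) (use basics(11) ab a hb[of a] s in auto)
  have "G a - B = (a - 1) *\<^sub>R (B - A) + s *\<^sub>R n" unfolding s by (simp add: algebra_simps)
  then show "\<bar>s\<bar> \<le> 4 * \<epsilon> * d * (1 - a)"
    by (rule main[OF basics(12) ab(2)]) (use a hb[of "a - 1"] in auto)
qed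

lemma skin_local:
  assumes ed: "edge_e \<T> T = closed_segment A B" and x: "x \<in> skin \<Omega> \<T> T"
  obtains a t where "0 \<le> a" "a \<le> 1" "x = A + a *\<^sub>R (B - A) + t *\<^sub>R n" "\<bar>t\<bar> \<le> 4 * \<epsilon> * d * a" "\<bar>t\<bar> \<le> 4 * \<epsilon> * d * (1 - a)"
proof -
  obtain Y where Y: "cut_off_arc \<Gamma> (closed_segment A B) Y" "x \<in> closed_segment A B \<union> Y \<union> inside (closed_segment A B \<union> Y)"
    using x unfolding skin_def ed Let_def by blast
  obtain a t s where "0 \<le> a" "a \<le> 1" "x = A + a *\<^sub>R (B - A) + t *\<^sub>R n" "G a = A + a *\<^sub>R (B - A) + s *\<^sub>R n" "\<bar>t\<bar> \<le> \<bar>s\<bar>"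
    using inside_between[OF Y] by blast
  then show ?thesis using that[of a t] G_cone[of a s] by linarith
qed

text \<open>The cone bounds fit the barycentric conditions: a height of
  \<open>4 * \<epsilon> * d * a\<close> changes a barycentric coordinate by at most
  \<open>(2 * \<epsilon> / \<kappa>) * a\<close>, which does not exceed \<open>a\<close>; likewise
  with \<open>1 - a\<close>.\<close>

lemma below_chord_mem:
  assumes a: "0 \<le> a" "a \<le> 1" and t: "t \<le> 0" "\<bar>t\<bar> \<le> 4 * \<epsilon> * d * a" "\<bar>t\<bar> \<le> 4 * \<epsilon> * d * (1 - a)"
  shows "A + a *\<^sub>R (B - A) + t *\<^sub>R n \<in> T"
proof -
  have bnd: "\<bar>t * (g \<bullet> n)\<bar> \<le> c" if g: "norm g \<le> 1 / (2 * (\<kappa> * d))" and c: "\<bar>t\<bar> \<le> 4 * \<epsilon> * d * c" "0 \<le> c" for g c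
  proof -
    have "\<bar>g \<bullet> n\<bar> \<le> 1 / (2 * (\<kappa> * d))" using Cauchy_Schwarz_ineq2[of g n] g basics(5) by simp
    then have "\<bar>t * (g \<bullet> n)\<bar> \<le> (4 * \<epsilon> * d * c) * (1 / (2 * (\<kappa> * d)))"
      unfolding abs_mult using c \<epsilon>0 basics(1) by (intro mult_mono) auto
    also have "\<dots> = (2 * \<epsilon> / \<kappa>) * c" using basics(1) \<kappa>0 by simp
    also have "\<dots> \<le> 1 * c" using \<epsilon>\<kappa> \<kappa>0 c(2) by (intro mult_right_mono) auto
    finally show ?thesis by simp
  qed
  have "\<bar>t * (p \<bullet> n)\<bar> \<le> a" "\<bar>t * ((p + q) \<bullet> n)\<bar> \<le> 1 - a"
    using bnd[OF grads(1)[OF TT tt] t(2)] bnd[OF grads(3)[OF TT tt] t(3)] a by auto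
  moreover have "t * (q \<bullet> n) \<ge> 0" using t(1) heights(3) by (simp add: mult_nonpos_nonpos)
  ultimately show ?thesis
    unfolding tri_mem[OF tt] abs_le_iff using triD(1-4)[OF tt]
    by (simp add: inner_add_right inner_add_left distrib_left)
qed

lemma skin_near:
  assumes ed: "edge_e \<T> T = closed_segment A B" and x: "x \<in> skin \<Omega> \<T> T"
  shows "dist A x \<le> 3 * d"
proof -
  obtain a t where at: "0 \<le> a" "a \<le> 1" "x = A + a *\<^sub>R (B - A) + t *\<^sub>R n" "\<bar>t\<bar> \<le> 4 * \<epsilon> * d * a"
    using skin_local[OF ed x] by metis
  have "4 * \<epsilon> * d * a \<le> 4 * \<epsilon> * d * 1" using at(2) \<epsilon>0 basics(1) by (intro mult_left_mono) auto
  also have "\<dots> \<le> 2 * d" using \<epsilon>h basics(1) by simp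
  finally have "\<bar>t\<bar> \<le> 2 * d" using at(4) by linarith
  moreover have "a * norm (B - A) \<le> 1 * d" using at(1,2) basics(14) by (intro mult_mono) auto
  moreover have "norm (a *\<^sub>R (B - A) + t *\<^sub>R n) \<le> a * norm (B - A) + \<bar>t\<bar>"
    using norm_triangle_ineq[of "a *\<^sub>R (B - A)" "t *\<^sub>R n"] at(1) basics(5) by simp
  moreover have "dist A x = norm (a *\<^sub>R (B - A) + t *\<^sub>R n)"
    unfolding at(3) dist_norm by (metis add.assoc add_diff_cancel_left' norm_minus_commute)
  ultimately show ?thesis by linarith
qed

lemma above_chord_not_mem:
  assumes "0 < a" "a < 1" "t > 0" "dist A (A + a *\<^sub>R (B - A) + t *\<^sub>R n) \<le> 8 * d"
  shows "A + a *\<^sub>R (B - A) + t *\<^sub>R n \<notin> \<Union>\<T>"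
  by (rule no_mesh_above_chord[OF ch \<epsilon>0 _ _ TT basics(10) tt fr])
    (use assms \<epsilon>\<kappa> \<kappa>0 hr basics(4) near_ball[OF basics(6)] in auto)

text \<open>The two sides of the chord are settled by \<open>below_chord_mem\<close> and
  \<open>above_chord_not_mem\<close>. The outcome lets the polynomial of \<open>T\<close> be
  prescribed on its skin without interfering with other triangles.\<close>

lemma skin_cases:
  assumes ed: "edge_e \<T> T = closed_segment A B" and x: "x \<in> skin \<Omega> \<T> T"
  shows "x \<in> T \<or> (x \<notin> \<Union>\<T> \<and> (\<exists>a t. 0 < a \<and> a < 1 \<and> t > 0 \<and> t \<le> 2 * d \<and> x = A + a *\<^sub>R (B - A) + t *\<^sub>R n))"
proof -
  obtain a t where at: "0 \<le> a" "a \<le> 1" "x = A + a *\<^sub>R (B - A) + t *\<^sub>R n" "\<bar>t\<bar> \<le> 4 * \<epsilon> * d * a" "\<bar>t\<bar> \<le> 4 * \<epsilon> * d * (1 - a)"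
    using skin_local[OF ed x] .
  show ?thesis
  proof (cases "t \<le> 0")
    case True
    then show ?thesis using below_chord_mem[OF at(1,2) True at(4,5)] at(3) by simp
  next
    case False
    then have "a \<noteq> 0" "a \<noteq> 1" using at(4,5) by auto
    then have a: "0 < a" "a < 1" using at(1,2) by auto
    have "x \<notin> \<Union>\<T>" unfolding at(3)
      by (rule above_chord_not_mem[OF a]) (use False skin_near[OF ed x] at(3) basics(1) in auto)
    moreover have "t \<le> 2 * d"
    proof -
      have "4 * \<epsilon> * d * a \<le> 4 * \<epsilon> * d * 1" using at(2) \<epsilon>0 basics(1) by (intro mult_left_mono) auto
      also have "\<dots> \<le> 2 * d" using \<epsilon>h basics(1) by simp
      finally show ?thesis using at(4) by linarith
    qed
    ultimately show ?thesis using a False at(3) by (intro disjI2 conjI exI[of _ a] exI[of _ t]) auto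
  qed
qed

end

section \<open>Nearest intersections with the boundary, and disjointness of skins\<close>

context chart_tri
begin

text \<open>The line through \<open>C\<close> and the division point crosses \<Gamma> transversally:
  the \<open>n\<close>-component of its direction is at least \<open>\<kappa> * d / 2\<close>,
  against which \<epsilon> is small. So there is one crossing in the chart, and its closeness rules
  out a nearest one elsewhere. The hypothesis linking \<epsilon> and \<open>k\<close> keeps the
  crossing over the chord, hence on the arc and in the skin.\<close>

lemma nearest_point:
  assumes ed: "edge_e \<T> T = closed_segment A B" and k: "k > 0" "8 * \<epsilon> / \<kappa>\<^sup>2 \<le> 1 / k"
    and lam: "1 / k \<le> lam" "lam \<le> 1 - 1 / k"
  shows "\<exists>P\<in>skin \<Omega> \<T> T. (\<forall>Q. nearest_intersection \<Gamma> C (A + lam *\<^sub>R (B - A)) Q \<longleftrightarrow> Q = P) \<and>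
    dist (A + lam *\<^sub>R (B - A)) P \<le> (8 * \<epsilon> / \<kappa>) * d"
proof -
  define M where "M = A + lam *\<^sub>R (B - A)"
  define u where "u = M - C"
  \<comment> \<open>Per unit of \<open>u\<close>, \<phi> changes by at least
    \<open>\<kappa> * d / 4\<close>; this range makes up for its value at \<open>M\<close>, which is
    at most \<open>2 * \<epsilon> * d\<close>.\<close>
  define D where "D = 8 * \<epsilon> / \<kappa>"
  have "1 / k > 0" using k by simp
  then have l01: "0 \<le> lam" "lam \<le> 1" using lam by linarith+
  have MT: "M \<in> T" using chord_ball[OF l01] M_def by simp
  have nu: "norm u \<le> d" unfolding u_def by (rule diam_dist[OF TT MT basics(8)])
  have kd: "\<kappa> * d > 0" using \<kappa>0 basics(1) by simp
  have ed4: "\<epsilon> * d \<le> \<kappa> * d / 4" using mult_right_mono[OF \<epsilon>\<kappa>, of d] basics(1) by simp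
  have un: "n \<bullet> u \<ge> \<kappa> * d / 2"
  proof -
    have "n \<bullet> u = lam * (n \<bullet> (B - A)) - n \<bullet> (C - A)"
      by (simp add: u_def M_def inner_diff_right inner_add_right algebra_simps)
    moreover have "\<bar>lam * (n \<bullet> (B - A))\<bar> \<le> 1 * (\<epsilon> * norm (B - A))"
      unfolding abs_mult using heights(1) l01 by (intro mult_mono) auto
    moreover have "\<epsilon> * norm (B - A) \<le> \<epsilon> * d" using basics(14) \<epsilon>0 by (rule mult_left_mono)
    ultimately show ?thesis using heights(2) ed4 by linarith
  qed
  have D2: "0 \<le> D" "D \<le> 2" using \<epsilon>0 \<epsilon>\<kappa> \<kappa>0 by (auto simp: D_def field_simps)
  have gb: "M + t *\<^sub>R u \<in> ball P r" if "\<bar>t\<bar> \<le> D" for t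
  proof (rule near_ball'[OF MT])
    have "\<bar>t\<bar> * norm u \<le> 2 * d" using that D2 nu by (intro mult_mono) auto
    then show "dist M (M + t *\<^sub>R u) \<le> 8 * d" using basics(1) by (simp add: dist_norm)
  qed
  have uniq: "s = t" if s: "M + s *\<^sub>R u \<in> \<Gamma>" "M + s *\<^sub>R u \<in> ball P r" and t: "M + t *\<^sub>R u \<in> \<Gamma>" "M + t *\<^sub>R u \<in> ball P r" for s t
  proof (rule ccontr)
    assume ne: "s \<noteq> t"
    have e: "(M + s *\<^sub>R u) - (M + t *\<^sub>R u) = (s - t) *\<^sub>R u" by (simp add: algebra_simps)
    have "\<bar>s - t\<bar> * \<bar>n \<bullet> u\<bar> \<le> \<epsilon> * (\<bar>s - t\<bar> * norm u)"
      using flat[OF s(1) t(1) s(2) t(2)] unfolding e by (simp add: abs_mult)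
    then have "\<bar>s - t\<bar> * \<bar>n \<bullet> u\<bar> \<le> \<bar>s - t\<bar> * (\<epsilon> * norm u)" by (simp add: mult.left_commute)
    then have "\<bar>n \<bullet> u\<bar> \<le> \<epsilon> * norm u" using ne by (simp add: mult_le_cancel_left)
    also have "\<dots> \<le> \<epsilon> * d" using nu \<epsilon>0 by (rule mult_left_mono)
    finally show False using un ed4 kd by linarith
  qed
  have "\<exists>t0. \<bar>t0\<bar> \<le> D \<and> M + t0 *\<^sub>R u \<in> \<Gamma>"
  proof -
    let ?g = "\<lambda>t. \<phi> (M + t *\<^sub>R u)"
    have gd: "\<bar>?g s - ?g t - (s - t) * (n \<bullet> u)\<bar> \<le> \<bar>s - t\<bar> * (\<epsilon> * d)" if "\<bar>s\<bar> \<le> D" "\<bar>t\<bar> \<le> D" for s t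
    proof -
      have e: "(M + s *\<^sub>R u) - (M + t *\<^sub>R u) = (s - t) *\<^sub>R u" by (simp add: algebra_simps)
      have "\<bar>?g s - ?g t - (s - t) * (n \<bullet> u)\<bar> \<le> \<epsilon> * (\<bar>s - t\<bar> * norm u)"
        using est[OF gb[OF that(1)] gb[OF that(2)]] unfolding e by simp
      also have "\<dots> \<le> \<epsilon> * (\<bar>s - t\<bar> * d)" using nu \<epsilon>0 by (intro mult_left_mono) auto
      finally show ?thesis by (simp add: mult.left_commute)
    qed
    have cont: "continuous_on {-D..D} ?g"
    proof (rule lipschitz_on_continuous_on[of "2 * d"], rule lipschitz_onI)
      fix s t assume "s \<in> {-D..D}" "t \<in> {-D..D}"
      then have "\<bar>?g s - ?g t - (s - t) * (n \<bullet> u)\<bar> \<le> \<bar>s - t\<bar> * (\<epsilon> * d)" by (intro gd) auto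
      moreover have "\<bar>s - t\<bar> * (\<epsilon> * d) \<le> \<bar>s - t\<bar> * d" using \<epsilon>h basics(1) by (intro mult_left_mono) auto
      moreover have "\<bar>(s - t) * (n \<bullet> u)\<bar> \<le> \<bar>s - t\<bar> * d"
        unfolding abs_mult using Cauchy_Schwarz_ineq2[of n u] nu basics(5) by (intro mult_left_mono) auto
      moreover have "\<bar>?g s - ?g t\<bar> \<le> \<bar>?g s - ?g t - (s - t) * (n \<bullet> u)\<bar> + \<bar>(s - t) * (n \<bullet> u)\<bar>"
        by (rule order_trans[OF _ abs_triangle_ineq]) simp
      ultimately have "\<bar>?g s - ?g t\<bar> \<le> \<bar>s - t\<bar> * d + \<bar>s - t\<bar> * d" by (meson add_mono order_trans)
      then show "dist (?g s) (?g t) \<le> 2 * d * dist s t" unfolding dist_real_def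
        by (simp only: mult.commute mult.left_commute mult_2 distrib_left distrib_right)
    qed (use basics(1) in simp)
    have g0: "\<bar>?g 0\<bar> \<le> 2 * \<epsilon> * d" using chord_\<phi>[OF l01] M_def by simp
    have eqs: "D * (\<kappa> * d / 4) = 2 * \<epsilon> * d" "D * (\<kappa> * d / 2) = 4 * \<epsilon> * d" using \<kappa>0 by (simp_all add: D_def)
    have X: "4 * \<epsilon> * d \<le> D * (n \<bullet> u)" using mult_left_mono[OF un D2(1)] unfolding eqs .
    have Y: "D * (\<epsilon> * d) \<le> 2 * \<epsilon> * d" using mult_left_mono[OF ed4 D2(1)] unfolding eqs .
    have aD: "\<bar>D\<bar> \<le> D" "\<bar>-D\<bar> \<le> D" "\<bar>0\<bar> \<le> D" using D2(1) by auto
    have 1: "\<bar>?g D - ?g 0 - D * (n \<bullet> u)\<bar> \<le> D * (\<epsilon> * d)" using gd[OF aD(1,3)] D2(1) by simp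
    have 2: "\<bar>?g (-D) - ?g 0 + D * (n \<bullet> u)\<bar> \<le> D * (\<epsilon> * d)" using gd[OF aD(2,3)] D2(1) by simp
    have "?g D \<ge> 0" "?g (-D) \<le> 0"
      using 1 2 X Y g0 unfolding abs_le_iff by linarith+
    then obtain t where t: "-D \<le> t" "t \<le> D" "?g t = 0" using IVT'[of ?g "-D" 0 D] cont D2(1) by auto
    then have "\<bar>t\<bar> \<le> D" by auto
    then show ?thesis using t(3) \<Gamma>_iff[OF gb] by blast
  qed
  then obtain t0 where t0: "\<bar>t0\<bar> \<le> D" "M + t0 *\<^sub>R u \<in> \<Gamma>" by blast
  have hull: "Q \<in> affine hull {C, M} \<longleftrightarrow> (\<exists>t. Q = M + t *\<^sub>R u)" for Q
  proof -
    have "(\<exists>s. Q = C + s *\<^sub>R (M - C)) \<longleftrightarrow> (\<exists>t. Q = M + t *\<^sub>R u)"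
    proof
      assume "\<exists>s. Q = C + s *\<^sub>R (M - C)"
      then obtain s where "Q = C + s *\<^sub>R (M - C)" by blast
      then show "\<exists>t. Q = M + t *\<^sub>R u" by (intro exI[of _ "s - 1"]) (simp add: u_def algebra_simps)
    next
      assume "\<exists>t. Q = M + t *\<^sub>R u"
      then obtain t where "Q = M + t *\<^sub>R u" by blast
      then show "\<exists>s. Q = C + s *\<^sub>R (M - C)" by (intro exI[of _ "t + 1"]) (simp add: u_def algebra_simps)
    qed
    then show ?thesis unfolding affine_hull_2_alt by auto
  qed
  have near: "\<exists>t. \<bar>t\<bar> * norm u \<le> D * d \<and> Q = M + t *\<^sub>R u \<and> Q \<in> ball P r" if Q: "nearest_intersection \<Gamma> C M Q" for Q
  proof -
    obtain t where t: "Q = M + t *\<^sub>R u" using Q hull unfolding nearest_intersection_def by blast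
    have "dist M Q \<le> dist M (M + t0 *\<^sub>R u)" using Q hull t0(2) unfolding nearest_intersection_def by blast
    moreover have "\<bar>t0\<bar> * norm u \<le> D * d" using t0(1) nu D2 by (intro mult_mono) auto
    ultimately have le: "\<bar>t\<bar> * norm u \<le> D * d" by (simp add: t dist_norm)
    have "D * d \<le> 2 * d" using D2 basics(1) by (intro mult_right_mono) auto
    then have "\<bar>t\<bar> * norm u \<le> 8 * d" using le basics(1) by linarith
    then have "dist M Q \<le> 8 * d" by (simp add: t dist_norm)
    then show ?thesis using near_ball'[OF MT] le t by blast
  qed
  have "closed (\<Gamma> \<inter> affine hull {C, M})" by (intro closed_Int) auto
  moreover have "\<Gamma> \<inter> affine hull {C, M} \<noteq> {}" using t0(2) hull by blast
  ultimately obtain Q0 where "Q0 \<in> \<Gamma> \<inter> affine hull {C, M}" "\<And>y. y \<in> \<Gamma> \<inter> affine hull {C, M} \<Longrightarrow> dist M Q0 \<le> dist M y"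
    using distance_attains_inf[of "\<Gamma> \<inter> affine hull {C, M}" M] by metis
  then have Q0: "nearest_intersection \<Gamma> C M Q0" unfolding nearest_intersection_def by simp
  obtain t where t: "\<bar>t\<bar> * norm u \<le> D * d" "Q0 = M + t *\<^sub>R u" "Q0 \<in> ball P r" using near[OF Q0] by blast
  have Q\<Gamma>: "Q \<in> \<Gamma>" if "nearest_intersection \<Gamma> C M Q" for Q using that unfolding nearest_intersection_def by blast
  have un1: "nearest_intersection \<Gamma> C M Q \<longleftrightarrow> Q = Q0" for Q
  proof
    assume Q: "nearest_intersection \<Gamma> C M Q"
    obtain s where s: "Q = M + s *\<^sub>R u" "Q \<in> ball P r" using near[OF Q] by blast
    have "s = t" by (rule uniq) (use s t Q\<Gamma>[OF Q] Q\<Gamma>[OF Q0] in simp_all)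
    then show "Q = Q0" using s t by simp
  qed (use Q0 in simp)
  have dQ: "dist M Q0 \<le> D * d" using t by (simp add: dist_norm)
  \<comment> \<open>The chord parameter moves by at most
    \<open>8 * \<epsilon> / \<kappa>\<^sup>2\<close>, hence by no more than 1/k, while
    \<open>lam\<close> is at least 1/k away from 0 and 1.\<close>
  have scQ: "\<bar>sc Q0 - lam\<bar> \<le> 1 / k"
  proof -
    have e: "sc Q0 - lam = \<tau> \<bullet> (Q0 - M) / (\<tau> \<bullet> (B - A))"
      unfolding sc_def using \<tau>_BA by (simp add: M_def inner_diff_right inner_add_right field_simps)
    have "1 \<le> norm p * norm (B - A)" using Cauchy_Schwarz_ineq2[of p "B - A"] triD(1)[OF tt] by simp
    also have "\<dots> \<le> (1 / (2 * (\<kappa> * d))) * norm (B - A)" using grads(1)[OF TT tt] by (intro mult_right_mono) auto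
    finally have "2 * (\<kappa> * d) \<le> norm (B - A)" using kd by (simp add: field_simps)
    also have "\<dots> \<le> 2 * \<bar>\<tau> \<bullet> (B - A)\<bar>" by (rule flat_norm[OF heights(1)])
    finally have 1: "\<kappa> * d \<le> \<bar>\<tau> \<bullet> (B - A)\<bar>" by simp
    have 2: "\<bar>\<tau> \<bullet> (Q0 - M)\<bar> \<le> D * d" using Cauchy_Schwarz_ineq2[of \<tau> "Q0 - M"] norm_\<tau> dQ by (simp add: dist_norm norm_minus_commute)
    have "\<bar>sc Q0 - lam\<bar> \<le> (D * d) / (\<kappa> * d)"
      unfolding e abs_divide using 1 2 kd by (intro frac_le) auto
    also have "\<dots> = 8 * \<epsilon> / \<kappa>\<^sup>2" using basics(1) by (simp add: D_def power2_eq_square)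
    finally show ?thesis using k(2) by simp
  qed
  have "Q0 \<in> path_image G"
    by (rule joining_local(2)[OF G_joining G_image_subset(1)]) (use Q\<Gamma>[OF Q0] t(3) scQ lam in \<open>auto simp: abs_le_iff\<close>)
  then have "Q0 \<in> skin \<Omega> \<T> T" unfolding skin_def ed Let_def using G_cut_off by blast
  then show ?thesis unfolding M_def[symmetric] D_def[symmetric] by (intro bexI[of _ Q0] conjI allI un1 dQ)
qed

end

text \<open>A common point outside the mesh lies above both chords along the same \<open>n\<close>,
  because one chart serves both triangles. The foot on the higher chord would be a mesh point above
  the lower chord; with equal heights the two boundary edges would share an interior point.\<close>

lemma (in mesh_geom) two_skins:
  assumes c1: "chart_tri \<Omega> \<T> \<kappa> h \<epsilon> r P n \<phi> T1 A1 B1 C1 p1 q1" and c2: "chart_tri \<Omega> \<T> \<kappa> h \<epsilon> r P n \<phi> T2 A2 B2 C2 p2 q2"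
    and e1: "edge_e \<T> T1 = closed_segment A1 B1" and e2: "edge_e \<T> T2 = closed_segment A2 B2"
    and ne: "T1 \<noteq> T2" and x: "x \<in> skin \<Omega> \<T> T1" "x \<in> skin \<Omega> \<T> T2"
  shows "x \<in> \<Union>\<T>"
proof (rule ccontr)
  assume nx: "x \<notin> \<Union>\<T>"
  interpret c1: chart_tri \<Omega> \<T> \<kappa> h \<epsilon> r P n \<phi> T1 A1 B1 C1 p1 q1 by (rule c1)
  interpret c2: chart_tri \<Omega> \<T> \<kappa> h \<epsilon> r P n \<phi> T2 A2 B2 C2 p2 q2 by (rule c2)
  obtain a1 t1 where 1: "0 < a1" "a1 < 1" "t1 > 0" "t1 \<le> 2 * diameter T1" "x = A1 + a1 *\<^sub>R (B1 - A1) + t1 *\<^sub>R n"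
    using c1.skin_cases[OF e1 x(1)] nx c1.TT by blast
  obtain a2 t2 where 2: "0 < a2" "a2 < 1" "t2 > 0" "t2 \<le> 2 * diameter T2" "x = A2 + a2 *\<^sub>R (B2 - A2) + t2 *\<^sub>R n"
    using c2.skin_cases[OF e2 x(2)] nx c2.TT by blast
  have less: False
    if c: "chart_tri \<Omega> \<T> \<kappa> h \<epsilon> r P n \<phi> T A B C p q" and c': "A' + a' *\<^sub>R (B' - A') \<in> \<Union>\<T>"
      and a: "0 < a" "a < 1" "t \<le> 2 * diameter T" "0 < t'" "t' < t" and e: "A + a *\<^sub>R (B - A) + t *\<^sub>R n = A' + a' *\<^sub>R (B' - A') + t' *\<^sub>R n"
    for T A B C p q a t A' B' a' t'
  proof -
    interpret c: chart_tri \<Omega> \<T> \<kappa> h \<epsilon> r P n \<phi> T A B C p q by (rule c)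
    have "A' + a' *\<^sub>R (B' - A') = (A + a *\<^sub>R (B - A) + t *\<^sub>R n) - t' *\<^sub>R n" unfolding e by simp
    then have e': "A' + a' *\<^sub>R (B' - A') = A + a *\<^sub>R (B - A) + (t - t') *\<^sub>R n" by (simp add: algebra_simps)
    have "A + a *\<^sub>R (B - A) + (t - t') *\<^sub>R n \<notin> \<Union>\<T>"
    proof (rule c.above_chord_not_mem)
      have "dist A (A + a *\<^sub>R (B - A) + (t - t') *\<^sub>R n) = norm (a *\<^sub>R (B - A) + (t - t') *\<^sub>R n)"
        unfolding dist_norm by (metis add.assoc add_diff_cancel_left' norm_minus_commute)
      also have "\<dots> \<le> a * norm (B - A) + (t - t')"
        using norm_triangle_ineq[of "a *\<^sub>R (B - A)" "(t - t') *\<^sub>R n"] a c.basics(5) by simp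
      also have "\<dots> \<le> 1 * diameter T + 2 * diameter T"
        using a c.basics(14) by (intro add_mono mult_mono) auto
      also have "\<dots> \<le> 8 * diameter T" using c.basics(1) by simp
      finally show "dist A (A + a *\<^sub>R (B - A) + (t - t') *\<^sub>R n) \<le> 8 * diameter T" .
    qed (use a in auto)
    then show False using c' e' by simp
  qed
  have m1: "A1 + a1 *\<^sub>R (B1 - A1) \<in> T1" using c1.chord_ball[of a1] 1 by simp
  have m2: "A2 + a2 *\<^sub>R (B2 - A2) \<in> T2" using c2.chord_ball[of a2] 2 by simp
  have e: "A1 + a1 *\<^sub>R (B1 - A1) + t1 *\<^sub>R n = A2 + a2 *\<^sub>R (B2 - A2) + t2 *\<^sub>R n"
    by (rule trans[OF 1(5)[symmetric] 2(5)])
  consider "t1 < t2" | "t2 < t1" | "t1 = t2" by linarith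
  then show False
  proof cases
    assume "t1 < t2"
    then show False using less[OF c2 _ 2(1,2,4) 1(3) _ e[symmetric]] m1 c1.TT by blast
  next
    assume "t2 < t1"
    then show False using less[OF c1 _ 1(1,2,4) 2(3) _ e] m2 c2.TT by blast
  next
    assume "t1 = t2"
    then have "A1 + a1 *\<^sub>R (B1 - A1) \<in> T2" using e m2 by simp
    moreover have "A1 + a1 *\<^sub>R (B1 - A1) \<in> frontier (\<Union>\<T>)"
      using c1.fr tri_edge_point(2)[OF c1.tt 1(1,2)] rel_interior_subset by blast
    ultimately show False using tmesh_edge_only[OF tm c1.TT c2.TT _ c1.tt 1(1,2)] ne by blast
  qed
qed

section \<open>From fitted meshes to the geometric locale\<close>

definition labelled :: "(real^2) set set \<Rightarrow> (real^2) set \<Rightarrow> real^2 \<Rightarrow> real^2 \<Rightarrow> real^2 \<Rightarrow> real^2 \<Rightarrow> real^2 \<Rightarrow> bool" where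
  "labelled \<T> T A B C p q \<longleftrightarrow> T \<in> \<T> \<and> tri A B C p q T \<and> closed_segment A B \<subseteq> frontier (\<Union>\<T>) \<and>
     edge_e \<T> T = closed_segment A B \<and> vertex_O \<T> T = C"

lemma fitted_meshD:
  assumes fm: "fitted_mesh \<Omega> \<T>"
  shows "triangulation \<T>" "\<T> \<noteq> {}" "\<And>T. T \<in> \<T> \<Longrightarrow> 2 simplex T"
    "\<And>v. v \<in> mesh_vertices \<T> \<Longrightarrow> v \<in> frontier (\<Union>\<T>) \<Longrightarrow> v \<in> frontier \<Omega>"
    "\<And>v. v \<in> mesh_vertices \<T> \<Longrightarrow> v \<notin> frontier (\<Union>\<T>) \<Longrightarrow> v \<in> \<Omega>"
    "\<And>T e e'. T \<in> \<T> \<Longrightarrow> boundary_edge \<T> T e \<Longrightarrow> boundary_edge \<T> T e' \<Longrightarrow> e = e'"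
    "\<And>T. T \<in> boundary_triangles \<T> \<Longrightarrow> vertex_O \<T> T \<notin> frontier \<Omega>"
proof -
  note c = fm[unfolded fitted_mesh_def]
  show "triangulation \<T>" "\<T> \<noteq> {}" using c by simp_all
  note c2 = c[THEN conjunct2, THEN conjunct2]
  show "2 simplex T" if "T \<in> \<T>" for T by (rule bspec[OF conjunct1[OF c2] that])
  note c3 = conjunct2[OF c2]
  show "v \<in> frontier \<Omega>" if "v \<in> mesh_vertices \<T>" "v \<in> frontier (\<Union>\<T>)" for v
    by (rule mp[OF bspec[OF conjunct1[OF c3] that(1)] that(2)])
  note c4 = conjunct2[OF c3]
  show "v \<in> \<Omega>" if "v \<in> mesh_vertices \<T>" "v \<notin> frontier (\<Union>\<T>)" for v
    by (rule mp[OF bspec[OF conjunct1[OF c4] that(1)] that(2)])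
  note c5 = conjunct2[OF c4]
  show "e = e'" if "T \<in> \<T>" "boundary_edge \<T> T e" "boundary_edge \<T> T e'" for T e e'
    by (rule mp[OF spec[OF spec[OF bspec[OF conjunct1[OF c5] that(1)]]] conjI[OF that(2,3)]])
  note c6 = conjunct2[OF c5]
  show "vertex_O \<T> T \<notin> frontier \<Omega>" if "T \<in> boundary_triangles \<T>" for T
    by (rule bspec[OF conjunct1[OF c6] that])
qed

text \<open>Uniqueness of the boundary edge resolves the definite descriptions in
  \<open>edge_e\<close> and \<open>vertex_O\<close>.\<close>

lemma fitted_labelled:
  assumes fm: "fitted_mesh \<Omega> \<T>" and T: "T \<in> boundary_triangles \<T>"
  shows "\<exists>A B C p q. labelled \<T> T A B C p q"
proof -
  obtain e where e: "boundary_edge \<T> T e" and TT: "T \<in> \<T>" using T unfolding boundary_triangles_def by blast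
  have s2: "2 simplex T" by (rule fitted_meshD(3)[OF fm TT])
  obtain A0 B0 C0 p0 q0 where t0: "tri A0 B0 C0 p0 q0 T" using simplex_tri[OF s2] .
  obtain A B C p q where t: "tri A B C p q T" and eAB: "e = closed_segment A B"
    using tri_edge[OF t0] e unfolding boundary_edge_def by metis
  have uni: "e' = e" if "boundary_edge \<T> T e'" for e' by (rule fitted_meshD(6)[OF fm TT that e])
  have ed: "edge_e \<T> T = closed_segment A B" unfolding edge_e_def eAB[symmetric] by (rule the_equality, rule e, erule uni)
  have qseg: "q \<bullet> (x - A) = 0" if xs: "x \<in> closed_segment A B" for x
  proof -
    obtain u where "x = (1 - u) *\<^sub>R A + u *\<^sub>R B" using xs unfolding in_segment by blast
    then have "x - A = u *\<^sub>R (B - A)" by (simp add: algebra_simps)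
    then show ?thesis using triD(3)[OF t] by simp
  qed
  have "vertex_O \<T> T = C" unfolding vertex_O_def ed
  proof (rule the_equality)
    show "C extreme_point_of T \<and> C \<notin> closed_segment A B"
      using qseg[of C] triD(4)[OF t] tri_extreme[OF t] by auto
    fix v assume "v extreme_point_of T \<and> v \<notin> closed_segment A B"
    then show "v = C" using tri_extreme[OF t] by auto
  qed
  then show ?thesis using t ed TT e eAB unfolding labelled_def boundary_edge_def by blast
qed

text \<open>Regularity bounds a supremum of inscribed diameters; giving away a factor 2 yields an
  actual disc of radius at least \<open>diameter T / (4 * \<sigma>)\<close>, whence the shape
  constant.\<close>

lemma fitted_mesh_geom:
  assumes fm: "fitted_mesh \<Omega> \<T>" and op: "open \<Omega>" and \<sigma>: "\<sigma> > 0" and sh: "\<And>T. T \<in> \<T> \<Longrightarrow> diameter T \<le> \<sigma> * inscribed_diameter T"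
  shows "mesh_geom \<Omega> \<T> (1 / (4 * \<sigma>)) (mesh_size \<T>)"
proof
  show tm: "tmesh \<T>" using fitted_meshD(1,3)[OF fm] unfolding tmesh_def by blast
  show "open \<Omega>" by (rule op)
  show "1 / (4 * \<sigma>) > 0" using \<sigma> by simp
  have fin: "finite \<T>" by (rule tmeshD(1)[OF tm])
  show "diameter T \<le> mesh_size \<T>" if "T \<in> \<T>" for T unfolding mesh_size_def using fin that by simp
  show "A \<in> frontier \<Omega> \<and> B \<in> frontier \<Omega> \<and> C \<in> \<Omega>"
    if T: "T \<in> \<T>" and t: "tri A B C p q T" and fr: "closed_segment A B \<subseteq> frontier (\<Union>\<T>)" for T A B C p q
  proof -
    have be: "boundary_edge \<T> T (closed_segment A B)" using tri_edge_of[OF t] fr unfolding boundary_edge_def by blast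
    then have bt: "T \<in> boundary_triangles \<T>" using T unfolding boundary_triangles_def by blast
    obtain A' B' C' p' q' where l: "labelled \<T> T A' B' C' p' q'" using fitted_labelled[OF fm bt] by blast
    have v: "v \<in> mesh_vertices \<T>" if "v \<in> {A, B, C}" for v using that tri_extreme[OF t] T unfolding mesh_vertices_def by blast
    have c: "v \<in> frontier \<Omega> \<or> v \<in> \<Omega>" "v \<in> frontier (\<Union>\<T>) \<Longrightarrow> v \<in> frontier \<Omega>" if "v \<in> mesh_vertices \<T>" for v
      using fitted_meshD(4,5)[OF fm that] by blast+
    \<comment> \<open>Both labellings have the boundary edge as first two vertices, since it is
      unique, so the third vertices agree as well.\<close>
    have ABC: "vertex_O \<T> T = C"
    proof -
      have be': "boundary_edge \<T> T (closed_segment A' B')"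
        using l tri_edge_of[of A' B' C' p' q' T] unfolding labelled_def boundary_edge_def by blast
      have eq: "closed_segment A B = closed_segment A' B'" by (rule fitted_meshD(6)[OF fm T be be'])
      have ex: "{x. x extreme_point_of closed_segment X Y} = {X, Y}" for X Y :: "real^2"
        by (auto simp: extreme_point_of_segment)
      have AB: "{A, B} = {A', B'}" using ex[of A B] ex[of A' B'] unfolding eq by simp
      have t': "tri A' B' C' p' q' T" using l unfolding labelled_def by (elim conjE)
      have "C \<in> {A', B', C'}" using tri_extreme[OF t, of C] tri_extreme[OF t', of C] by simp
      moreover have "C \<notin> {A', B'}" unfolding AB[symmetric] using tri_distinct[OF t] by auto
      ultimately have "C = C'" by simp
      then show ?thesis using l unfolding labelled_def by blast
    qed
    have "vertex_O \<T> T \<notin> frontier \<Omega>" by (rule fitted_meshD(7)[OF fm bt])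
    then show ?thesis using c v ABC fr by (auto simp: subset_iff)
  qed
  show "\<exists>c. cball c (1 / (4 * \<sigma>) * diameter T) \<subseteq> T" if T: "T \<in> \<T>" for T
  proof -
    obtain A B C p q where t: "tri A B C p q T" using tmeshD(2)[OF tm T] by blast
    have b: "bounded T" using tri_convex_compact(2)[OF t] compact_imp_bounded by blast
    have "dist A B \<le> diameter T" using diameter_bounded_bound[OF b] tri_vertices_mem[OF t] by blast
    then have d0: "diameter T > 0" using tri_distinct[OF t] zero_less_dist_iff[of A B] by linarith
    define S where "S = {2 * r | r. 0 \<le> r \<and> (\<exists>c. cball c r \<subseteq> T)}"
    have "diameter T \<le> \<sigma> * Sup S" using sh[OF T] unfolding inscribed_diameter_def S_def .
    then have "diameter T / (2 * \<sigma>) < Sup S" using \<sigma> d0 by (simp add: field_simps)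
    moreover have "S \<noteq> {}"
    proof -
      have "cball A 0 \<subseteq> T" using tri_vertices_mem[OF t] by simp
      then have "2 * 0 \<in> S" unfolding S_def by blast
      then show ?thesis by blast
    qed
    ultimately obtain s where s: "s \<in> S" "diameter T / (2 * \<sigma>) < s" using less_cSupD by blast
    then obtain r c where r: "s = 2 * r" "cball c r \<subseteq> T" unfolding S_def by blast
    have "cball c (1 / (4 * \<sigma>) * diameter T) \<subseteq> cball c r" using s(2) r(1) \<sigma> by (intro subset_cball) (simp add: field_simps)
    then show ?thesis using r(2) by blast
  qed
qed

text \<open>Order of choices: \<epsilon> from \<kappa>, \<open>k\<close> and \<eta>, then the chart
  radius from \<epsilon>, then \<open>h0\<close> from that radius. The relative displacement \<eta>
  of the nodes can thus be prescribed in advance.\<close>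

lemma boundary_geometry:
  assumes sd: "smooth_domain m \<Omega>" and m: "m \<ge> 1" and \<kappa>: "\<kappa> > 0" and k: "k > 0" and \<eta>: "\<eta> > 0"
  shows "\<exists>h0>0. \<forall>\<T>. fitted_mesh \<Omega> \<T> \<and> mesh_geom \<Omega> \<T> \<kappa> (mesh_size \<T>) \<and> mesh_size \<T> < h0 \<longrightarrow>
    (\<forall>T\<in>boundary_triangles \<T>. skin \<Omega> \<T> T \<inter> \<Union>\<T> \<subseteq> T) \<and>
    (\<forall>T\<in>boundary_triangles \<T>. \<forall>T'\<in>boundary_triangles \<T>. T \<noteq> T' \<longrightarrow> skin \<Omega> \<T> T \<inter> skin \<Omega> \<T> T' \<subseteq> \<Union>\<T>) \<and>
    (\<forall>T A B C p q lam. labelled \<T> T A B C p q \<and> 1 / k \<le> lam \<and> lam \<le> 1 - 1 / k \<longrightarrow>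
      (\<exists>P\<in>skin \<Omega> \<T> T. (\<forall>Q. nearest_intersection (frontier \<Omega>) C (A + lam *\<^sub>R (B - A)) Q \<longleftrightarrow> Q = P) \<and>
         dist (A + lam *\<^sub>R (B - A)) P \<le> \<eta> * diameter T))"
proof -
  \<comment> \<open>The four entries serve, in order, the position of the triangle in the chart, the
    absorption of chart errors, the location of the nodes over the chord, and the distance
    \<eta>.\<close>
  define \<epsilon> where "\<epsilon> = min (min (\<kappa> / 4) (1 / 2)) (min (\<kappa>\<^sup>2 / (8 * k)) (\<eta> * \<kappa> / 8))"
  have \<epsilon>: "\<epsilon> > 0" "\<epsilon> \<le> \<kappa> / 4" "\<epsilon> \<le> 1 / 2" "\<epsilon> \<le> \<kappa>\<^sup>2 / (8 * k)" "\<epsilon> \<le> \<eta> * \<kappa> / 8"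
    using \<kappa> k \<eta> by (auto simp: \<epsilon>_def)
  have \<epsilon>k: "8 * \<epsilon> / \<kappa>\<^sup>2 \<le> 1 / k" using \<epsilon>(4) \<kappa> k by (simp add: field_simps)
  have \<epsilon>\<eta>: "8 * \<epsilon> / \<kappa> \<le> \<eta>" using \<epsilon>(5) \<kappa> by (simp add: field_simps)
  obtain r where r: "r > 0" "\<forall>p\<in>frontier \<Omega>. \<exists>n \<phi>. chart \<Omega> \<epsilon> r p n \<phi>"
    using smooth_domain_chart[OF sd m \<epsilon>(1)] by blast
  show ?thesis
  proof (rule exI[of _ "r / 64"], rule conjI, simp add: r(1), rule allI, rule impI)
    fix \<T> assume "fitted_mesh \<Omega> \<T> \<and> mesh_geom \<Omega> \<T> \<kappa> (mesh_size \<T>) \<and> mesh_size \<T> < r / 64"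
    then have fm: "fitted_mesh \<Omega> \<T>" and mg: "mesh_geom \<Omega> \<T> \<kappa> (mesh_size \<T>)" and ms: "mesh_size \<T> < r / 64" by auto
    interpret mg: mesh_geom \<Omega> \<T> \<kappa> "mesh_size \<T>" by (rule mg)
    \<comment> \<open>The centre may be as far as 6 mesh sizes from \<open>A\<close>: when two skins
      meet, each within 3 diameters of its first vertex, the chart at one of these vertices must
      also serve the other triangle.\<close>
    have ct: "chart_tri \<Omega> \<T> \<kappa> (mesh_size \<T>) \<epsilon> r P n \<phi> T A B C p q"
      if l: "labelled \<T> T A B C p q" and ch: "chart \<Omega> \<epsilon> r P n \<phi>" and near: "dist P A \<le> 6 * mesh_size \<T>" for P n \<phi> T A B C p q
    proof
      show "T \<subseteq> ball P (r / 8)"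
      proof
        fix x assume x: "x \<in> T"
        have "dist A x \<le> mesh_size \<T>"
          using mg.diam_dist[of T A x] mg.size[of T] l x tri_vertices_mem unfolding labelled_def dist_norm by fastforce
        then show "x \<in> ball P (r / 8)" using near ms dist_triangle[of P x A] r(1) by simp
      qed
    qed (use l ch \<epsilon> ms in \<open>auto simp: labelled_def\<close>)
    have ctA: "\<exists>n \<phi>. chart \<Omega> \<epsilon> r A n \<phi> \<and> chart_tri \<Omega> \<T> \<kappa> (mesh_size \<T>) \<epsilon> r A n \<phi> T A B C p q"
      if l: "labelled \<T> T A B C p q" for T A B C p q
    proof -
      have "A \<in> frontier \<Omega>" using mg.bdry[of T A B C p q] l unfolding labelled_def by blast
      then obtain n \<phi> where "chart \<Omega> \<epsilon> r A n \<phi>" using r(2) by blast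
      moreover have "dist A A \<le> 6 * mesh_size \<T>"
        using mg.diam_pos[of T] mg.size[of T] l unfolding labelled_def by force
      ultimately show ?thesis using ct[OF l] by blast
    qed
    have g1: "skin \<Omega> \<T> T \<inter> \<Union>\<T> \<subseteq> T" if T: "T \<in> boundary_triangles \<T>" for T
    proof -
      obtain A B C p q where l: "labelled \<T> T A B C p q" using fitted_labelled[OF fm T] by blast
      obtain n \<phi> where c: "chart_tri \<Omega> \<T> \<kappa> (mesh_size \<T>) \<epsilon> r A n \<phi> T A B C p q" using ctA[OF l] by blast
      have "edge_e \<T> T = closed_segment A B" using l labelled_def by blast
      then show ?thesis using chart_tri.skin_cases[OF c] by blast
    qed
    have g2: "skin \<Omega> \<T> T \<inter> skin \<Omega> \<T> T' \<subseteq> \<Union>\<T>" if T: "T \<in> boundary_triangles \<T>" "T' \<in> boundary_triangles \<T>" "T \<noteq> T'" for T T'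
    proof
      fix x assume x: "x \<in> skin \<Omega> \<T> T \<inter> skin \<Omega> \<T> T'"
      obtain A B C p q where l: "labelled \<T> T A B C p q" using fitted_labelled[OF fm T(1)] by blast
      obtain A' B' C' p' q' where l': "labelled \<T> T' A' B' C' p' q'" using fitted_labelled[OF fm T(2)] by blast
      have ed: "edge_e \<T> T = closed_segment A B" "edge_e \<T> T' = closed_segment A' B'" using l l' labelled_def by blast+
      obtain n \<phi> where c: "chart \<Omega> \<epsilon> r A n \<phi>" "chart_tri \<Omega> \<T> \<kappa> (mesh_size \<T>) \<epsilon> r A n \<phi> T A B C p q" using ctA[OF l] by blast
      obtain n' \<phi>' where c': "chart_tri \<Omega> \<T> \<kappa> (mesh_size \<T>) \<epsilon> r A' n' \<phi>' T' A' B' C' p' q'" using ctA[OF l'] by blast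
      have "dist A x \<le> 3 * diameter T" "dist A' x \<le> 3 * diameter T'"
        using chart_tri.skin_near[OF c(2) ed(1)] chart_tri.skin_near[OF c' ed(2)] x by auto
      moreover have "diameter T \<le> mesh_size \<T>" "diameter T' \<le> mesh_size \<T>" using mg.size l l' labelled_def by blast+
      ultimately have "dist A A' \<le> 6 * mesh_size \<T>" using dist_triangle2[of A A' x] by linarith
      then have "chart_tri \<Omega> \<T> \<kappa> (mesh_size \<T>) \<epsilon> r A n \<phi> T' A' B' C' p' q'" by (rule ct[OF l' c(1)])
      then show "x \<in> \<Union>\<T>" using mg.two_skins[OF c(2) _ ed T(3)] x by blast
    qed
    have g3: "\<exists>P\<in>skin \<Omega> \<T> T. (\<forall>Q. nearest_intersection (frontier \<Omega>) C (A + lam *\<^sub>R (B - A)) Q \<longleftrightarrow> Q = P) \<and>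
         dist (A + lam *\<^sub>R (B - A)) P \<le> \<eta> * diameter T"
      if l: "labelled \<T> T A B C p q" and lam: "1 / k \<le> lam" "lam \<le> 1 - 1 / k" for T A B C p q lam
    proof -
      obtain n \<phi> where c: "chart_tri \<Omega> \<T> \<kappa> (mesh_size \<T>) \<epsilon> r A n \<phi> T A B C p q" using ctA[OF l] by blast
      have ed: "edge_e \<T> T = closed_segment A B" using l labelled_def by blast
      have "(8 * \<epsilon> / \<kappa>) * diameter T \<le> \<eta> * diameter T"
        using \<epsilon>\<eta> mg.diam_pos[of T] l unfolding labelled_def by (intro mult_right_mono) auto
      then show ?thesis using chart_tri.nearest_point[OF c ed k \<epsilon>k lam] by force
    qed
    show "(\<forall>T\<in>boundary_triangles \<T>. skin \<Omega> \<T> T \<inter> \<Union>\<T> \<subseteq> T) \<and>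
    (\<forall>T\<in>boundary_triangles \<T>. \<forall>T'\<in>boundary_triangles \<T>. T \<noteq> T' \<longrightarrow> skin \<Omega> \<T> T \<inter> skin \<Omega> \<T> T' \<subseteq> \<Union>\<T>) \<and>
    (\<forall>T A B C p q lam. labelled \<T> T A B C p q \<and> 1 / k \<le> lam \<and> lam \<le> 1 - 1 / k \<longrightarrow>
      (\<exists>P\<in>skin \<Omega> \<T> T. (\<forall>Q. nearest_intersection (frontier \<Omega>) C (A + lam *\<^sub>R (B - A)) Q \<longleftrightarrow> Q = P) \<and>
         dist (A + lam *\<^sub>R (B - A)) P \<le> \<eta> * diameter T))"
      by (intro conjI ballI allI impI; (elim conjE)?; (rule g1 | rule g2 | rule g3); assumption)
  qed
qed

section \<open>Polynomials in the plane\<close>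

text \<open>Coefficients are kept on an array that vanishes beyond total degree \<open>k\<close>, so
  that sums over different index ranges can be exchanged in the closure properties that
  follow.\<close>

lemma poly_sum_trunc:
  fixes c :: "nat \<Rightarrow> nat \<Rightarrow> real"
  assumes c: "\<And>i j. i + j > k \<Longrightarrow> c i j = 0" and "k \<le> N" "k \<le> M"
  shows "(\<Sum>i\<le>N. \<Sum>j\<le>M. c i j * a ^ i * b ^ j) = (\<Sum>i\<le>k. \<Sum>j\<le>k - i. c i j * a ^ i * b ^ j)"
proof -
  have "(\<Sum>i\<le>N. \<Sum>j\<le>M. c i j * a ^ i * b ^ j) = (\<Sum>i\<le>k. \<Sum>j\<le>M. c i j * a ^ i * b ^ j)"
    by (rule sum.mono_neutral_right) (use assms in \<open>auto intro!: sum.neutral\<close>)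
  also have "\<dots> = (\<Sum>i\<le>k. \<Sum>j\<le>k - i. c i j * a ^ i * b ^ j)"
    by (rule sum.cong[OF refl], rule sum.mono_neutral_right) (use assms in auto)
  finally show ?thesis .
qed

lemma PkI:
  fixes c :: "nat \<Rightarrow> nat \<Rightarrow> real"
  assumes "\<And>i j. i + j > k \<Longrightarrow> c i j = 0" "k \<le> N" "k \<le> M" "\<And>x. f x = (\<Sum>i\<le>N. \<Sum>j\<le>M. c i j * (x$1) ^ i * (x$2) ^ j)"
  shows "f \<in> Pk k"
  unfolding Pk_def using assms(4) poly_sum_trunc[OF assms(1-3)] by auto

lemma PkE:
  assumes "f \<in> Pk k"
  obtains c where "\<And>i j. i + j > k \<Longrightarrow> c i j = 0" "\<And>N M x. k \<le> N \<Longrightarrow> k \<le> M \<Longrightarrow> f x = (\<Sum>i\<le>N. \<Sum>j\<le>M. c i j * (x$1) ^ i * (x$2) ^ j)"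
proof -
  obtain c where c: "\<And>x. f x = (\<Sum>i\<le>k. \<Sum>j\<le>k - i. c i j * (x $ 1) ^ i * (x $ 2) ^ j)" using assms unfolding Pk_def by blast
  define c' where "c' = (\<lambda>i j. if i + j > k then 0 else c i j)"
  have z: "\<And>i j. i + j > k \<Longrightarrow> c' i j = 0" by (simp add: c'_def)
  show ?thesis
  proof (rule that[of c', OF z])
    fix N M :: nat and x :: "real^2" assume "k \<le> N" "k \<le> M"
    have "f x = (\<Sum>i\<le>k. \<Sum>j\<le>k - i. c' i j * (x $ 1) ^ i * (x $ 2) ^ j)"
      unfolding c by (intro sum.cong refl) (auto simp: c'_def)
    then show "f x = (\<Sum>i\<le>N. \<Sum>j\<le>M. c' i j * (x$1) ^ i * (x$2) ^ j)"
      using poly_sum_trunc[of k c' N M, OF z] \<open>k \<le> N\<close> \<open>k \<le> M\<close> by simp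
  qed
qed

lemma Pk_add: assumes "f \<in> Pk k" "g \<in> Pk k" shows "(\<lambda>x. f x + g x) \<in> Pk k"
proof -
  obtain c where c: "\<And>i j. i + j > k \<Longrightarrow> c i j = 0" "\<And>N M x. k \<le> N \<Longrightarrow> k \<le> M \<Longrightarrow> f x = (\<Sum>i\<le>N. \<Sum>j\<le>M. c i j * (x$1) ^ i * (x$2) ^ j)"
    using PkE[OF assms(1)] by blast
  obtain d where d: "\<And>i j. i + j > k \<Longrightarrow> d i j = 0" "\<And>N M x. k \<le> N \<Longrightarrow> k \<le> M \<Longrightarrow> g x = (\<Sum>i\<le>N. \<Sum>j\<le>M. d i j * (x$1) ^ i * (x$2) ^ j)"
    using PkE[OF assms(2)] by blast
  show ?thesis
    by (rule PkI[of k "\<lambda>i j. c i j + d i j" k k]) (use c(1) d(1) c(2)[OF order_refl order_refl] d(2)[OF order_refl order_refl] in \<open>auto simp: sum.distrib distrib_right\<close>)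
qed

lemma Pk_scale: assumes "f \<in> Pk k" shows "(\<lambda>x. a * f x) \<in> Pk k"
proof -
  obtain c where c: "\<And>i j. i + j > k \<Longrightarrow> c i j = 0" "\<And>N M x. k \<le> N \<Longrightarrow> k \<le> M \<Longrightarrow> f x = (\<Sum>i\<le>N. \<Sum>j\<le>M. c i j * (x$1) ^ i * (x$2) ^ j)"
    using PkE[OF assms(1)] by blast
  show ?thesis
    by (rule PkI[of k "\<lambda>i j. a * c i j" k k]) (use c(1) c(2)[OF order_refl order_refl] in \<open>auto simp: sum_distrib_left mult.assoc\<close>)
qed

lemma Pk_mono: assumes "f \<in> Pk k" "k \<le> l" shows "f \<in> Pk l"
proof -
  obtain c where c: "\<And>i j. i + j > k \<Longrightarrow> c i j = 0" "\<And>N M x. k \<le> N \<Longrightarrow> k \<le> M \<Longrightarrow> f x = (\<Sum>i\<le>N. \<Sum>j\<le>M. c i j * (x$1) ^ i * (x$2) ^ j)"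
    using PkE[OF assms(1)] by blast
  show ?thesis by (rule PkI[of l c l l]) (use c(1) c(2)[OF assms(2) assms(2)] assms(2) in auto)
qed

lemma Pk_mult_x1: assumes "f \<in> Pk k" shows "(\<lambda>x. x$1 * f x) \<in> Pk (Suc k)"
proof -
  obtain c where c: "\<And>i j. i + j > k \<Longrightarrow> c i j = 0" "\<And>N M x. k \<le> N \<Longrightarrow> k \<le> M \<Longrightarrow> f x = (\<Sum>i\<le>N. \<Sum>j\<le>M. c i j * (x$1) ^ i * (x$2) ^ j)"
    using PkE[OF assms(1)] by blast
  show ?thesis
  proof (rule PkI[of "Suc k" "\<lambda>i j. case i of 0 \<Rightarrow> 0 | Suc i' \<Rightarrow> c i' j" "Suc k" "Suc k"])
    show "x$1 * f x = (\<Sum>i\<le>Suc k. \<Sum>j\<le>Suc k. (case i of 0 \<Rightarrow> 0 | Suc i' \<Rightarrow> c i' j) * (x$1) ^ i * (x$2) ^ j)" for x :: "real^2"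
      unfolding c(2)[OF order_refl le_SucI[OF order_refl]]
      by (subst sum.atMost_Suc_shift) (simp add: sum_distrib_left mult_ac del: sum.atMost_Suc)
  qed (use c(1) in \<open>auto split: nat.split\<close>)
qed

lemma Pk_mult_x2: assumes "f \<in> Pk k" shows "(\<lambda>x. x$2 * f x) \<in> Pk (Suc k)"
proof -
  obtain c where c: "\<And>i j. i + j > k \<Longrightarrow> c i j = 0" "\<And>N M x. k \<le> N \<Longrightarrow> k \<le> M \<Longrightarrow> f x = (\<Sum>i\<le>N. \<Sum>j\<le>M. c i j * (x$1) ^ i * (x$2) ^ j)"
    using PkE[OF assms(1)] by blast
  show ?thesis
  proof (rule PkI[of "Suc k" "\<lambda>i j. case j of 0 \<Rightarrow> 0 | Suc j' \<Rightarrow> c i j'" "Suc k" "Suc k"])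
    have sh: "(\<Sum>j\<le>Suc k. (case j of 0 \<Rightarrow> 0 | Suc j' \<Rightarrow> c i j') * a ^ i * b ^ j) = (\<Sum>j\<le>k. b * (c i j * a ^ i * b ^ j))" for i a b
      by (simp only: sum.atMost_Suc_shift[of _ k]) (simp add: mult_ac)
    show "x$2 * f x = (\<Sum>i\<le>Suc k. \<Sum>j\<le>Suc k. (case j of 0 \<Rightarrow> 0 | Suc j' \<Rightarrow> c i j') * (x$1) ^ i * (x$2) ^ j)" for x :: "real^2"
      unfolding sh c(2)[OF le_SucI[OF order_refl] order_refl] by (simp only: sum_distrib_left)
  qed (use c(1) in \<open>auto split: nat.split\<close>)
qed

lemma Pk_const: "(\<lambda>x. a) \<in> Pk k"
  by (rule Pk_mono[of _ 0]) (auto simp: Pk_def intro!: exI[of _ "\<lambda>_ _. a"])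

lemma Pk_sum: "finite I \<Longrightarrow> (\<And>i. i \<in> I \<Longrightarrow> f i \<in> Pk k) \<Longrightarrow> (\<lambda>x. \<Sum>i\<in>I. f i x) \<in> Pk k"
  by (induction I rule: finite_induct) (auto intro: Pk_const Pk_add)

lemma Pk_mult_affine: assumes "f \<in> Pk k" shows "(\<lambda>x. (a + g \<bullet> x) * f x) \<in> Pk (Suc k)"
proof -
  have "(\<lambda>x. (a * f x + g$1 * (x$1 * f x)) + g$2 * (x$2 * f x)) \<in> Pk (Suc k)"
    by (intro Pk_add Pk_scale Pk_mult_x1 Pk_mult_x2 assms) (rule Pk_mono[OF assms], simp)
  then show ?thesis by (simp add: inner_vec_def sum_2 algebra_simps)
qed

lemma Pk_mult_affine_power: assumes "f \<in> Pk k" shows "(\<lambda>x. (a + g \<bullet> x) ^ i * f x) \<in> Pk (i + k)"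
proof (induction i)
  case (Suc i)
  show ?case using Pk_mult_affine[OF Suc, of a g] by (simp add: mult.assoc)
qed (simp add: assms)

lemma Pk_monom: "i + j \<le> k \<Longrightarrow> (\<lambda>x. (x$1) ^ i * (x$2) ^ j) \<in> Pk k"
proof -
  assume ij: "i + j \<le> k"
  have "(\<lambda>x. (0 + axis 1 1 \<bullet> x) ^ i * ((0 + axis 2 1 \<bullet> x) ^ j * 1)) \<in> Pk (i + (j + 0))"
    by (intro Pk_mult_affine_power Pk_const)
  then have "(\<lambda>x::real^2. (x$1) ^ i * (x$2) ^ j) \<in> Pk (i + j)" by (simp add: inner_axis')
  then show ?thesis using ij Pk_mono by blast
qed

lemma Pk_compose_affine:
  assumes "f \<in> Pk k" shows "(\<lambda>y. f (A + (y$1) *\<^sub>R u + (y$2) *\<^sub>R v)) \<in> Pk k"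
proof -
  obtain c where c: "\<And>i j. i + j > k \<Longrightarrow> c i j = 0" "\<And>N M x. k \<le> N \<Longrightarrow> k \<le> M \<Longrightarrow> f x = (\<Sum>i\<le>N. \<Sum>j\<le>M. c i j * (x$1) ^ i * (x$2) ^ j)"
    using PkE[OF assms(1)] by blast
  define g where "g = (\<lambda>l. vector [u$l, v$l] :: real^2)"
  have l: "(A + (y$1) *\<^sub>R u + (y$2) *\<^sub>R v) $ l = A$l + g l \<bullet> y" for y l
    by (simp add: g_def inner_vec_def sum_2 mult.commute)
  have "(\<lambda>y. \<Sum>i\<le>k. \<Sum>j\<le>k. c i j * ((A$1 + g 1 \<bullet> y) ^ i * ((A$2 + g 2 \<bullet> y) ^ j * 1))) \<in> Pk k"
  proof (intro Pk_sum finite_atMost)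
    fix i j
    show "(\<lambda>y. c i j * ((A$1 + g 1 \<bullet> y) ^ i * ((A$2 + g 2 \<bullet> y) ^ j * 1))) \<in> Pk k"
    proof (cases "i + j > k")
      case True then show ?thesis using c(1) Pk_const[of 0 k] by simp
    next
      case False
      have "(\<lambda>y. (A$1 + g 1 \<bullet> y) ^ i * ((A$2 + g 2 \<bullet> y) ^ j * 1)) \<in> Pk (i + (j + 0))"
        by (intro Pk_mult_affine_power Pk_const)
      then show ?thesis using False by (intro Pk_scale) (auto elim: Pk_mono)
    qed
  qed
  then show ?thesis unfolding c(2)[OF order_refl order_refl] l by (simp add: mult.assoc)
qed

lemma Pk_line:
  assumes "f \<in> Pk k" obtains a where "\<And>t. f (A + t *\<^sub>R u) = (\<Sum>i\<le>k. a i * t ^ i)"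
proof -
  define h where "h = (\<lambda>x::real^2. f (A + (x$1) *\<^sub>R u + (x$2) *\<^sub>R 0))"
  have "h \<in> Pk k" unfolding h_def by (rule Pk_compose_affine[OF assms])
  then obtain c where c: "\<And>i j. i + j > k \<Longrightarrow> c i j = 0" "\<And>N M x. k \<le> N \<Longrightarrow> k \<le> M \<Longrightarrow> h x = (\<Sum>i\<le>N. \<Sum>j\<le>M. c i j * (x$1) ^ i * (x$2) ^ j)"
    using PkE by blast
  have "f (A + t *\<^sub>R u) = (\<Sum>i\<le>k. c i 0 * t ^ i)" for t
  proof -
    define x :: "real^2" where "x = vector [t, 0]"
    have x: "x$1 = t" "x$2 = 0" by (simp_all add: x_def)
    have "f (A + t *\<^sub>R u) = (\<Sum>i\<le>k. \<Sum>j\<le>k. c i j * t ^ i * 0 ^ j)"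
      using c(2)[OF order_refl order_refl, of x] unfolding x h_def by simp
    also have "\<dots> = (\<Sum>i\<le>k. c i 0 * t ^ i)"
    proof (rule sum.cong[OF refl])
      fix i
      have "(\<Sum>j\<le>k. c i j * t ^ i * 0 ^ j) = (\<Sum>j\<in>{0}. c i j * t ^ i * 0 ^ j)"
        by (rule sum.mono_neutral_right) auto
      then show "(\<Sum>j\<le>k. c i j * t ^ i * 0 ^ j) = c i 0 * t ^ i" by simp
    qed
    finally show ?thesis .
  qed
  then show ?thesis by (rule that)
qed

text \<open>The partial derivatives are placed in \<open>Pk k\<close>, without counting the drop in
  degree, so that an inverse inequality on \<open>Pk k\<close> applies to gradients
  directly.\<close>

lemma Pk_derivative:
  assumes "f \<in> Pk k"
  obtains g1 g2 where "g1 \<in> Pk k" "g2 \<in> Pk k" "\<And>x. (f has_derivative (\<lambda>y. (vector [g1 x, g2 x] :: real^2) \<bullet> y)) (at x)"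
proof -
  obtain c where c: "\<And>i j. i + j > k \<Longrightarrow> c i j = 0" "\<And>N M x. k \<le> N \<Longrightarrow> k \<le> M \<Longrightarrow> f x = (\<Sum>i\<le>N. \<Sum>j\<le>M. c i j * (x$1) ^ i * (x$2) ^ j)"
    using PkE[OF assms(1)] by blast
  define g1 where "g1 = (\<lambda>x::real^2. \<Sum>i\<le>k. \<Sum>j\<le>k. c i j * (of_nat i * ((x$1) ^ (i - 1) * (x$2) ^ j)))"
  define g2 where "g2 = (\<lambda>x::real^2. \<Sum>i\<le>k. \<Sum>j\<le>k. c i j * (of_nat j * ((x$1) ^ i * (x$2) ^ (j - 1))))"
  have z: "(\<lambda>x. c i j * h x) \<in> Pk k" if "i + j \<le> k \<Longrightarrow> h \<in> Pk k" for h i j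
    using that c(1)[of i j] Pk_const[of 0 k] by (cases "i + j \<le> k") (auto intro: Pk_scale)
  have "g1 \<in> Pk k" "g2 \<in> Pk k" unfolding g1_def g2_def
    by (intro Pk_sum finite_atMost z Pk_scale Pk_monom; simp)+
  moreover have "(f has_derivative (\<lambda>y. (vector [g1 x, g2 x] :: real^2) \<bullet> y)) (at x)" for x
  proof -
    have "((\<lambda>x::real^2. \<Sum>i\<le>k. \<Sum>j\<le>k. c i j * (x$1) ^ i * (x$2) ^ j) has_derivative
      (\<lambda>y. \<Sum>i\<le>k. \<Sum>j\<le>k. c i j * (of_nat i * ((x$1) ^ (i - 1) * (x$2) ^ j)) * (y$1) + c i j * (of_nat j * ((x$1) ^ i * (x$2) ^ (j - 1))) * (y$2))) (at x)"
    proof (intro has_derivative_sum)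
      fix i j
      have x1: "((\<lambda>x::real^2. x$l) has_derivative (\<lambda>y. y$l)) (at x)" for l
        by (rule bounded_linear.has_derivative[OF bounded_linear_vec_nth has_derivative_ident])
      have "((\<lambda>x::real^2. c i j * (x$1) ^ i * (x$2) ^ j) has_derivative
        (\<lambda>y. c i j * (x$1) ^ i * (of_nat j * (y$2) * (x$2) ^ (j - 1)) + c i j * (of_nat i * (y$1) * (x$1) ^ (i - 1)) * (x$2) ^ j)) (at x)"
        by (intro has_derivative_mult has_derivative_mult_right has_derivative_power x1)
      then show "((\<lambda>x::real^2. c i j * (x$1) ^ i * (x$2) ^ j) has_derivative
        (\<lambda>y. c i j * (of_nat i * ((x$1) ^ (i - 1) * (x$2) ^ j)) * (y$1) + c i j * (of_nat j * ((x$1) ^ i * (x$2) ^ (j - 1))) * (y$2))) (at x)"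
        by (rule has_derivative_eq_rhs) (simp add: fun_eq_iff mult_ac)
    qed
    moreover have "(\<lambda>y::real^2. \<Sum>i\<le>k. \<Sum>j\<le>k. c i j * (of_nat i * ((x$1) ^ (i - 1) * (x$2) ^ j)) * (y$1) + c i j * (of_nat j * ((x$1) ^ i * (x$2) ^ (j - 1))) * (y$2))
      = (\<lambda>y. (vector [g1 x, g2 x] :: real^2) \<bullet> y)"
      unfolding g1_def g2_def by (simp add: fun_eq_iff inner_vec_def sum_2 sum.distrib sum_distrib_right)
    moreover have "f = (\<lambda>x::real^2. \<Sum>i\<le>k. \<Sum>j\<le>k. c i j * (x$1) ^ i * (x$2) ^ j)"
      using c(2)[OF order_refl order_refl] by (simp add: fun_eq_iff)
    ultimately show ?thesis by simp
  qed
  ultimately show ?thesis using that by blast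
qed

text \<open>On the line from an interior point of \<open>S\<close> to \<open>x\<close> the
  polynomial has an interval of zeros, hence vanishes identically there.\<close>

lemma Pk_zero:
  assumes f: "f \<in> Pk k" and S: "interior S \<noteq> {}" and z: "\<And>x. x \<in> S \<Longrightarrow> f x = 0"
  shows "f x = 0"
proof -
  obtain s e where s: "e > 0" "ball s e \<subseteq> S" using S mem_interior by blast
  obtain a where a: "\<And>t. f (s + t *\<^sub>R (x - s)) = (\<Sum>i\<le>k. a i * t ^ i)" using Pk_line[OF f] by blast
  define \<delta> where "\<delta> = e / (norm (x - s) + 1)"
  have n1: "norm (x - s) + 1 > 0" by (simp add: add_nonneg_pos)
  have \<delta>0: "\<delta> > 0" unfolding \<delta>_def using s(1) n1 by (rule divide_pos_pos)
  have "{0<..<\<delta>} \<subseteq> {t. (\<Sum>i\<le>k. a i * t ^ i) = 0}"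
  proof
    fix t assume t: "t \<in> {0<..<\<delta>}"
    have "t * norm (x - s) \<le> t * (norm (x - s) + 1)" using t by (intro mult_left_mono) auto
    also have "\<dots> < \<delta> * (norm (x - s) + 1)" using t n1 by (intro mult_strict_right_mono) auto
    also have "\<dots> = e" using n1 by (simp add: \<delta>_def)
    finally have "s + t *\<^sub>R (x - s) \<in> S" using s(2) t by (auto simp: subset_iff dist_norm)
    then have "f (s + t *\<^sub>R (x - s)) = 0" by (rule z)
    then show "t \<in> {t. (\<Sum>i\<le>k. a i * t ^ i) = 0}" using a[of t] by simp
  qed
  then have "infinite {t. (\<Sum>i\<le>k. a i * t ^ i) = 0}" using infinite_Ioo[OF \<delta>0] finite_subset by blast
  then have "\<forall>i\<le>k. a i = 0" using polyfun_finite_roots by blast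
  then show ?thesis using a[of 1] by simp
qed

section \<open>Coercivity on coefficients and inverse inequalities\<close>

lemma Pk_coeff_zero:
  fixes c :: "nat \<Rightarrow> nat \<Rightarrow> real"
  assumes z: "\<And>x::real^2. (\<Sum>i\<le>k. \<Sum>j\<le>k. c i j * (x$1) ^ i * (x$2) ^ j) = 0" and ij: "i \<le> k" "j \<le> k"
  shows "c i j = 0"
proof -
  have "\<forall>b. (\<Sum>j\<le>k. (\<Sum>i\<le>k. c i j * a ^ i) * b ^ j) = 0" for a
  proof
    fix b
    have "(\<Sum>j\<le>k. (\<Sum>i\<le>k. c i j * a ^ i) * b ^ j) = (\<Sum>i\<le>k. \<Sum>j\<le>k. c i j * a ^ i * b ^ j)"
      by (subst sum.swap) (simp add: sum_distrib_right)
    also have "\<dots> = 0" using z[of "vector [a, b]"] by simp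
    finally show "(\<Sum>j\<le>k. (\<Sum>i\<le>k. c i j * a ^ i) * b ^ j) = 0" .
  qed
  then have "\<forall>a. (\<Sum>i\<le>k. c i j * a ^ i) = 0" using ij(2) polyfun_eq_0[of "\<lambda>j. (\<Sum>i\<le>k. c i j * _ ^ i)" k] by blast
  then show ?thesis using ij(1) polyfun_eq_0[of "\<lambda>i. c i j" k] by blast
qed

text \<open>By induction on the number of variables, completing the square in the new one.\<close>

lemma quadratic_form_coercive:
  fixes M :: "'i \<Rightarrow> 'i \<Rightarrow> real"
  assumes "finite I" and "\<And>a b. M a b = M b a"
    and "\<And>c. \<exists>a\<in>I. c a \<noteq> 0 \<Longrightarrow> (\<Sum>a\<in>I. \<Sum>b\<in>I. M a b * c a * c b) > 0"
  shows "\<exists>C\<ge>0. \<forall>c. \<forall>a\<in>I. (c a)\<^sup>2 \<le> C * (\<Sum>a\<in>I. \<Sum>b\<in>I. M a b * c a * c b)"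
  using assms
proof (induction I arbitrary: M rule: finite_induct)
  case empty
  then show ?case by auto
next
  case (insert x J)
  define m where "m = M x x"
  let ?Q = "\<lambda>c. \<Sum>a\<in>insert x J. \<Sum>b\<in>insert x J. M a b * c a * c b"
  define l where "l = (\<lambda>c. \<Sum>b\<in>J. M x b * c b)"
  \<comment> \<open>The Schur complement of the pivot \<open>m\<close>. It stays positive definite
    because the new variable can be chosen so as to make the completed square vanish.\<close>
  define M' where "M' = (\<lambda>a b. M a b - M x a * M x b / m)"
  let ?Q' = "\<lambda>c. \<Sum>a\<in>J. \<Sum>b\<in>J. M' a b * c a * c b"
  have Qx: "?Q c = m * (c x)\<^sup>2 + 2 * c x * l c + (\<Sum>a\<in>J. \<Sum>b\<in>J. M a b * c a * c b)" for c
  proof -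
    have "(\<Sum>a\<in>J. M a x * c a * c x) = c x * l c"
      unfolding l_def sum_distrib_left using insert.prems(1) by (intro sum.cong) (auto simp: mult_ac)
    moreover have "(\<Sum>b\<in>J. M x b * c x * c b) = c x * l c"
      unfolding l_def sum_distrib_left by (intro sum.cong) (auto simp: mult_ac)
    ultimately show ?thesis using insert.hyps
      by (simp add: sum.distrib m_def power2_eq_square algebra_simps)
  qed
  have m0: "m > 0"
  proof -
    have "?Q (\<lambda>a. if a = x then 1 else 0) > 0" by (rule insert.prems(2)) auto
    moreover have "l (\<lambda>a. if a = x then 1 else 0) = 0" unfolding l_def by (rule sum.neutral) (use insert.hyps in auto)
    moreover have "(\<Sum>a\<in>J. \<Sum>b\<in>J. M a b * (if a = x then 1 else 0) * (if b = x then 1 else 0)) = 0"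
      by (intro sum.neutral ballI) (use insert.hyps in auto)
    ultimately show ?thesis unfolding Qx by simp
  qed
  have Q'x: "?Q' c = (\<Sum>a\<in>J. \<Sum>b\<in>J. M a b * c a * c b) - (l c)\<^sup>2 / m" for c
  proof -
    have "(l c)\<^sup>2 = (\<Sum>a\<in>J. \<Sum>b\<in>J. (M x a * c a) * (M x b * c b))"
      unfolding l_def power2_eq_square sum_product ..
    then have "(l c)\<^sup>2 / m = (\<Sum>a\<in>J. \<Sum>b\<in>J. M x a * M x b / m * c a * c b)"
      by (simp add: sum_divide_distrib mult_ac)
    then show ?thesis unfolding M'_def by (simp add: left_diff_distrib sum_subtractf)
  qed
  have sq: "?Q c = m * (c x + l c / m)\<^sup>2 + ?Q' c" for c
    unfolding Qx Q'x using m0 by (simp add: power2_sum power_divide field_simps power2_eq_square)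
  have "\<exists>C\<ge>0. \<forall>c. \<forall>a\<in>J. (c a)\<^sup>2 \<le> C * ?Q' c"
  proof (rule insert.IH)
    show "M' a b = M' b a" for a b using insert.prems(1) by (simp add: M'_def mult.commute)
    fix c :: "'i \<Rightarrow> real" assume c: "\<exists>a\<in>J. c a \<noteq> 0"
    define c' where "c' = c(x := - l c / m)"
    have lc: "l c' = l c" unfolding l_def c'_def by (rule sum.cong) (use insert.hyps in auto)
    have "?Q' c' = ?Q' c" unfolding c'_def by (intro sum.cong refl) (use insert.hyps in auto)
    moreover have "?Q c' > 0" by (rule insert.prems(2)) (use c insert.hyps in \<open>auto simp: c'_def\<close>)
    moreover have "c' x + l c' / m = 0" unfolding lc by (simp add: c'_def)
    ultimately show "?Q' c > 0" using sq[of c'] by simp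
  qed
  then obtain C where C: "C \<ge> 0" "\<And>c a. a \<in> J \<Longrightarrow> (c a)\<^sup>2 \<le> C * ?Q' c" by blast
  have Q'Q: "?Q' c \<le> ?Q c" "m * (c x + l c / m)\<^sup>2 \<le> ?Q c" for c
  proof -
    show "?Q' c \<le> ?Q c" unfolding sq using m0 by simp
    have "?Q' c \<ge> 0"
    proof (cases "\<exists>a\<in>J. c a \<noteq> 0")
      case False then show ?thesis by (intro sum_nonneg) auto
    next
      case True
      then obtain a where a: "a \<in> J" "c a \<noteq> 0" by blast
      then have "0 < C * ?Q' c" using C(2)[OF a(1), of c] by (meson less_le_trans zero_less_power2)
      then show ?thesis using C(1) by (simp add: zero_less_mult_iff)
    qed
    then show "m * (c x + l c / m)\<^sup>2 \<le> ?Q c" unfolding sq by simp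
  qed
  \<comment> \<open>Controls the mixed term \<open>l c\<close>, so that \<open>c x\<close> can be
    recovered from the completed square.\<close>
  define S where "S = (\<Sum>b\<in>J. (M x b)\<^sup>2) * (\<Sum>b\<in>J. C)"
  have S0: "S \<ge> 0" unfolding S_def using C(1) by (intro mult_nonneg_nonneg sum_nonneg) auto
  have l2: "(l c)\<^sup>2 \<le> S * ?Q c" for c
  proof -
    have "(l c)\<^sup>2 \<le> (\<Sum>b\<in>J. (M x b)\<^sup>2) * (\<Sum>b\<in>J. (c b)\<^sup>2)" unfolding l_def by (rule Cauchy_Schwarz_ineq_sum)
    also have "\<dots> \<le> (\<Sum>b\<in>J. (M x b)\<^sup>2) * (\<Sum>b\<in>J. C * ?Q c)"
      by (intro mult_left_mono sum_mono sum_nonneg order_trans[OF C(2) mult_left_mono[OF Q'Q(1) C(1)]]) auto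
    finally show ?thesis unfolding S_def by (simp add: sum_distrib_right[symmetric] mult.assoc)
  qed
  define C' where "C' = C + 2 / m + 2 * S / m\<^sup>2"
  have cx: "(c x)\<^sup>2 \<le> (2 / m + 2 * S / m\<^sup>2) * ?Q c" for c
  proof -
    have "(c x)\<^sup>2 \<le> 2 * (c x + l c / m)\<^sup>2 + 2 * (l c / m)\<^sup>2"
    proof -
      have "a\<^sup>2 \<le> 2 * (a + w)\<^sup>2 + 2 * w\<^sup>2" for a w :: real
        using zero_le_power2[of "a + 2 * w"] by (simp add: power2_sum power_mult_distrib algebra_simps)
      then show ?thesis .
    qed
    moreover have "(c x + l c / m)\<^sup>2 \<le> ?Q c / m" using Q'Q(2)[of c] m0 by (simp add: field_simps)
    moreover have "(l c / m)\<^sup>2 \<le> S * ?Q c / m\<^sup>2" using l2[of c] m0 by (simp add: power_divide divide_right_mono)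
    ultimately have "(c x)\<^sup>2 \<le> 2 * (?Q c / m) + 2 * (S * ?Q c / m\<^sup>2)" by linarith
    also have "\<dots> = (2 / m + 2 * S / m\<^sup>2) * ?Q c" by (simp add: distrib_right)
    finally show ?thesis .
  qed
  have Q0: "?Q c \<ge> 0" for c using Q'Q(2)[of c] m0 by (meson order_trans mult_nonneg_nonneg less_imp_le zero_le_power2)
  show ?case
  proof (intro exI[of _ C'] conjI allI ballI)
    show "C' \<ge> 0" using C(1) m0 S0 by (simp add: C'_def)
    fix c :: "'i \<Rightarrow> real" and a assume a: "a \<in> insert x J"
    have p: "0 \<le> C * ?Q c" "0 \<le> (2 / m + 2 * S / m\<^sup>2) * ?Q c" using C(1) Q0[of c] m0 S0 by (auto intro!: mult_nonneg_nonneg add_nonneg_nonneg)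
    have "(c a)\<^sup>2 \<le> C * ?Q c + (2 / m + 2 * S / m\<^sup>2) * ?Q c"
    proof (cases "a = x")
      case True then show ?thesis using cx[of c] p by simp
    next
      case False
      then have "(c a)\<^sup>2 \<le> C * ?Q' c" using C(2) a by blast
      also have "\<dots> \<le> C * ?Q c" using Q'Q(1) C(1) by (rule mult_left_mono)
      finally show ?thesis using p by simp
    qed
    then show "(c a)\<^sup>2 \<le> C' * ?Q c" by (simp add: C'_def distrib_right)
  qed
qed

lemma Pk_continuous: "f \<in> Pk k \<Longrightarrow> continuous_on S f"
proof -
  assume "f \<in> Pk k"
  then obtain g1 g2 where "\<And>x. (f has_derivative (\<lambda>y. (vector [g1 x, g2 x] :: real^2) \<bullet> y)) (at x)" using Pk_derivative by metis
  then have "\<And>x. isCont f x" using has_derivative_continuous by blast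
  then show ?thesis by (simp add: continuous_at_imp_continuous_on)
qed

lemma Pk_differentiable: "f \<in> Pk k \<Longrightarrow> f differentiable (at x)"
  using Pk_derivative differentiableI by metis

lemma Pk_grad:
  assumes "f \<in> Pk k" shows "(\<lambda>x. grad f x $ i) \<in> Pk k"
proof -
  obtain g1 g2 where g: "g1 \<in> Pk k" "g2 \<in> Pk k" "\<And>x. (f has_derivative (\<lambda>y. (vector [g1 x, g2 x] :: real^2) \<bullet> y)) (at x)"
    using Pk_derivative[OF assms] by blast
  have gr: "grad f x = vector [g1 x, g2 x]" for x by (rule grad_eq[OF g(3)])
  have "i = 1 \<or> i = 2" using UNIV_2 by auto
  then show ?thesis using g(1,2) unfolding gr by (auto simp: vector_2)
qed

lemma integrable_indicator_continuous:
  fixes f :: "real^2 \<Rightarrow> real"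
  assumes "compact S" "continuous_on S f"
  shows "integrable lebesgue (\<lambda>x. indicator S x * f x)"
proof -
  have i: "integrable lborel (\<lambda>x. indicator S x *\<^sub>R f x)" by (rule borel_integrable_compact[OF assms])
  then show ?thesis using borel_measurable_integrable[OF i] by (simp add: integrable_completion)
qed

lemma lborel_scaling:
  fixes f :: "real^2 \<Rightarrow> real"
  assumes f: "f \<in> borel_measurable borel" and \<rho>: "\<rho> > 0"
  shows "(LINT x|lebesgue. f x) = \<rho>\<^sup>2 * (LINT y|lebesgue. f (t + \<rho> *\<^sub>R y))"
proof -
  have m: "(\<lambda>x. t + \<rho> *\<^sub>R x) \<in> measurable lborel borel" by measurable
  have f': "(\<lambda>y. f (t + \<rho> *\<^sub>R y)) \<in> borel_measurable borel" using f by measurable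
  have "(LINT x|lborel. f x) = (LINT x|density (distr lborel borel (\<lambda>x. t + \<rho> *\<^sub>R x)) (\<lambda>_. ennreal (\<bar>\<rho>\<bar>^DIM(real^2))). f x)"
    using lborel_affine[of \<rho> t] \<rho> by simp
  also have "\<dots> = (LINT x|distr lborel borel (\<lambda>x. t + \<rho> *\<^sub>R x). \<rho>\<^sup>2 * f x)"
    by (subst integral_density) (use f \<rho> in auto)
  also have "\<dots> = (LINT x|lborel. \<rho>\<^sup>2 * f (t + \<rho> *\<^sub>R x))"
    by (rule integral_distr[OF m]) (use f in auto)
  finally show ?thesis using f f' by (simp add: integral_completion)
qed

text \<open>On the unit disc the Gram matrix of the monomials is positive definite, so the L^2 norm
  controls the coefficients and these control the value at any point of norm at most
  \<open>R\<close>. Scaling makes the constant independent of centre and radius. Values of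
  \<open>R\<close> above 1 reach points outside the disc, such as the remaining parts of a triangle
  and its skin.\<close>

lemma Pk_inverse:
  shows "\<exists>C\<ge>0. \<forall>g\<in>Pk k. \<forall>t \<rho> x. \<rho> > 0 \<and> dist t x \<le> R * \<rho> \<longrightarrow>
    (g x)\<^sup>2 \<le> C / \<rho>\<^sup>2 * (LINT y|lebesgue. indicator (cball t \<rho>) y * (g y)\<^sup>2)"
proof -
  define I where "I = {..k} \<times> {..k}"
  define m where "m = (\<lambda>\<alpha> (x::real^2). (x$1) ^ fst \<alpha> * (x$2) ^ snd \<alpha>)"
  define B where "B = cball (0::real^2) 1"
  define M where "M = (\<lambda>\<alpha> \<beta>. LINT x|lebesgue. indicator B x * (m \<alpha> x * m \<beta> x))"
  have finI: "finite I" by (simp add: I_def)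
  have mc: "continuous_on S (m \<alpha>)" for S \<alpha> unfolding m_def by (intro continuous_intros)
  have Bc: "compact B" by (simp add: B_def)
  have Q: "(\<Sum>\<alpha>\<in>I. \<Sum>\<beta>\<in>I. M \<alpha> \<beta> * c \<alpha> * c \<beta>) = (LINT x|lebesgue. indicator B x * (\<Sum>\<alpha>\<in>I. c \<alpha> * m \<alpha> x)\<^sup>2)" for c
  proof -
    have i: "integrable lebesgue (\<lambda>x. indicator B x * (m \<alpha> x * m \<beta> x))" for \<alpha> \<beta>
      by (intro integrable_indicator_continuous[OF Bc] continuous_intros mc)
    have "indicator B x * (\<Sum>\<alpha>\<in>I. c \<alpha> * m \<alpha> x)\<^sup>2 = (\<Sum>\<alpha>\<in>I. \<Sum>\<beta>\<in>I. (c \<alpha> * c \<beta>) * (indicator B x * (m \<alpha> x * m \<beta> x)))" for x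
      by (simp add: power2_eq_square sum_product sum_distrib_left mult_ac)
    then have "(LINT x|lebesgue. indicator B x * (\<Sum>\<alpha>\<in>I. c \<alpha> * m \<alpha> x)\<^sup>2)
        = (\<Sum>\<alpha>\<in>I. \<Sum>\<beta>\<in>I. LINT x|lebesgue. (c \<alpha> * c \<beta>) * (indicator B x * (m \<alpha> x * m \<beta> x)))"
      using i by (simp add: Bochner_Integration.integral_sum)
    also have "\<dots> = (\<Sum>\<alpha>\<in>I. \<Sum>\<beta>\<in>I. M \<alpha> \<beta> * c \<alpha> * c \<beta>)" unfolding M_def by (simp add: mult_ac)
    finally show ?thesis ..
  qed
  have dbl: "(\<Sum>\<alpha>\<in>I. c \<alpha> * m \<alpha> x) = (\<Sum>i\<le>k. \<Sum>j\<le>k. c (i, j) * (x$1) ^ i * (x$2) ^ j)" for c x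
    unfolding I_def m_def by (simp add: sum.cartesian_product case_prod_beta mult.assoc)
  have "\<exists>C\<ge>0. \<forall>c. \<forall>a\<in>I. (c a)\<^sup>2 \<le> C * (\<Sum>a\<in>I. \<Sum>b\<in>I. M a b * c a * c b)"
  proof (rule quadratic_form_coercive[OF finI])
    show "M a b = M b a" for a b unfolding M_def by (simp add: mult.commute)
    fix c :: "nat \<times> nat \<Rightarrow> real" assume "\<exists>a\<in>I. c a \<noteq> 0"
    then obtain a where a: "a \<in> I" "c a \<noteq> 0" by blast
    define f where "f = (\<lambda>x. \<Sum>\<alpha>\<in>I. c \<alpha> * m \<alpha> x)"
    have fc: "continuous_on S f" for S unfolding f_def by (intro continuous_intros mc)
    \<comment> \<open>The index set is the full square, so total degrees up to \<open>2 * k\<close>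
      occur.\<close>
    have fP: "f \<in> Pk (k + k)" unfolding f_def m_def
      by (intro Pk_sum finI Pk_scale Pk_monom) (auto simp: I_def)
    have int: "integrable lebesgue (\<lambda>x. indicator B x * (f x)\<^sup>2)"
      by (intro integrable_indicator_continuous[OF Bc] continuous_intros fc)
    have nn: "(LINT x|lebesgue. indicator B x * (f x)\<^sup>2) \<ge> 0" by (intro Bochner_Integration.integral_nonneg) simp
    have "(LINT x|lebesgue. indicator B x * (f x)\<^sup>2) \<noteq> 0"
    proof
      assume "(LINT x|lebesgue. indicator B x * (f x)\<^sup>2) = 0"
      then have ae: "AE x in lebesgue. indicator B x * (f x)\<^sup>2 = 0"
        using integral_nonneg_eq_0_iff_AE[OF int] by simp
      have op: "open (ball 0 1 \<inter> {x. f x \<noteq> 0})"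
      proof -
        have "open {x. f x \<noteq> 0}" by (intro open_Collect_neq fc continuous_intros)
        then show ?thesis by (intro open_Int) auto
      qed
      then obtain N where "negligible N" "{x. \<not> (indicator B x * (f x)\<^sup>2 = 0)} \<subseteq> N"
        using ae[unfolded eventually_ae_filter_negligible] by (elim exE conjE) (rule that)
      then have "negligible {x. \<not> (indicator B x * (f x)\<^sup>2 = 0)}" by (rule negligible_subset)
      then have "negligible (ball 0 1 \<inter> {x. f x \<noteq> 0})"
        by (rule negligible_subset) (auto simp: B_def)
      then have "ball 0 1 \<inter> {x. f x \<noteq> 0} = {}" using open_not_negligible[OF op] by blast
      then have z: "f x = 0" if "x \<in> ball 0 1" for x using that by blast
      have "f x = 0" for x by (rule Pk_zero[OF fP, of "ball 0 1"]) (use z in simp_all)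
      then have "\<And>x::real^2. (\<Sum>i\<le>k. \<Sum>j\<le>k. c (i, j) * (x$1) ^ i * (x$2) ^ j) = 0" unfolding f_def dbl .
      then have "c (fst a, snd a) = 0" by (rule Pk_coeff_zero) (use a(1) in \<open>auto simp: I_def\<close>)
      then show False using a(2) by simp
    qed
    moreover have "(\<Sum>a\<in>I. \<Sum>b\<in>I. M a b * c a * c b) = (LINT x|lebesgue. indicator B x * (f x)\<^sup>2)"
      unfolding Q f_def ..
    ultimately show "(\<Sum>a\<in>I. \<Sum>b\<in>I. M a b * c a * c b) > 0" using nn by linarith
  qed
  then obtain C0 where C0: "C0 \<ge> 0" "\<And>c a. a \<in> I \<Longrightarrow> (c a)\<^sup>2 \<le> C0 * (LINT x|lebesgue. indicator B x * (\<Sum>\<alpha>\<in>I. c \<alpha> * m \<alpha> x)\<^sup>2)"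
    unfolding Q by blast
  define S where "S = (max 1 R) ^ (k + k)"
  have S0: "S \<ge> 0" by (simp add: S_def)
  define C where "C = real (card I) * (\<Sum>a\<in>I. C0 * S\<^sup>2)"
  show ?thesis
  proof (intro exI[of _ C] conjI ballI allI impI)
    show "C \<ge> 0" unfolding C_def using C0(1) by (intro mult_nonneg_nonneg sum_nonneg) auto
    fix g and t x :: "real^2" and \<rho> :: real assume g: "g \<in> Pk k" and A: "\<rho> > 0 \<and> dist t x \<le> R * \<rho>"
    then have \<rho>: "\<rho> > 0" and tx: "dist t x \<le> R * \<rho>" by auto
    define h where "h = (\<lambda>y. g (t + \<rho> *\<^sub>R y))"
    have "(\<lambda>y. g (t + (y$1) *\<^sub>R (\<rho> *\<^sub>R axis 1 1) + (y$2) *\<^sub>R (\<rho> *\<^sub>R axis 2 1))) \<in> Pk k"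
      by (rule Pk_compose_affine[OF g])
    moreover have "t + (y$1) *\<^sub>R (\<rho> *\<^sub>R axis 1 1) + (y$2) *\<^sub>R (\<rho> *\<^sub>R axis 2 1) = t + \<rho> *\<^sub>R y" for y :: "real^2"
      by (simp add: vec_eq_iff forall_2 axis_def)
    ultimately have "h \<in> Pk k" unfolding h_def by (simp only:)
    then obtain c where c0: "\<And>i j. i + j > k \<Longrightarrow> c i j = 0" and c: "\<And>N M x. k \<le> N \<Longrightarrow> k \<le> M \<Longrightarrow> h x = (\<Sum>i\<le>N. \<Sum>j\<le>M. c i j * (x$1) ^ i * (x$2) ^ j)"
      using PkE by blast
    define c' where "c' = (\<lambda>\<alpha>. c (fst \<alpha>) (snd \<alpha>))"
    have hc: "h y = (\<Sum>\<alpha>\<in>I. c' \<alpha> * m \<alpha> y)" for y unfolding dbl c[OF order_refl order_refl] c'_def by simp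
    define q where "q = (LINT y|lebesgue. indicator B y * (h y)\<^sup>2)"
    have q0: "q \<ge> 0" unfolding q_def by (intro Bochner_Integration.integral_nonneg) simp
    have ca: "(c' a)\<^sup>2 \<le> C0 * q" if "a \<in> I" for a using C0(2)[OF that, of c'] unfolding q_def hc .
    define y where "y = (1 / \<rho>) *\<^sub>R (x - t)"
    have xy: "x = t + \<rho> *\<^sub>R y" using \<rho> by (simp add: y_def)
    have "norm y = norm (t - x) / \<rho>" using \<rho> unfolding y_def norm_scaleR by (simp add: norm_minus_commute)
    then have ny: "norm y \<le> R" using tx \<rho> by (simp add: dist_norm pos_divide_le_eq)
    have my: "\<bar>m a y\<bar> \<le> S" if a: "a \<in> I" for a
    proof -
      have yl: "\<bar>y$l\<bar> \<le> max 1 R" for l using component_le_norm_cart[of y l] ny by linarith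
      have "\<bar>m a y\<bar> = \<bar>y$1\<bar> ^ fst a * \<bar>y$2\<bar> ^ snd a" by (simp add: m_def abs_mult power_abs)
      also have "\<dots> \<le> max 1 R ^ fst a * max 1 R ^ snd a" using yl by (intro mult_mono power_mono) auto
      also have "\<dots> = max 1 R ^ (fst a + snd a)" by (simp add: power_add)
      also have "\<dots> \<le> S" unfolding S_def using a by (intro power_increasing) (auto simp: I_def)
      finally show ?thesis .
    qed
    have "(g x)\<^sup>2 = (\<Sum>\<alpha>\<in>I. c' \<alpha> * m \<alpha> y)\<^sup>2" using hc[of y] xy by (simp add: h_def)
    also have "\<dots> \<le> (\<Sum>\<alpha>\<in>I. (c' \<alpha> * m \<alpha> y)\<^sup>2) * card I" by (rule sum_squared_le_sum_of_squares)
    also have "\<dots> \<le> (\<Sum>a\<in>I. C0 * q * S\<^sup>2) * card I"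
    proof (intro mult_right_mono sum_mono)
      fix a assume a: "a \<in> I"
      have "(m a y)\<^sup>2 \<le> S\<^sup>2" using my[OF a] S0 by (simp add: abs_le_square_iff[symmetric])
      then show "(c' a * m a y)\<^sup>2 \<le> C0 * q * S\<^sup>2" unfolding power_mult_distrib
        using ca[OF a] C0(1) q0 by (intro mult_mono) auto
    qed simp
    also have "\<dots> = C * q" unfolding C_def by (simp add: sum_distrib_left[symmetric] mult_ac)
    also have "q = (LINT y|lebesgue. indicator (cball t \<rho>) y * (g y)\<^sup>2) / \<rho>\<^sup>2"
    proof -
      have "(\<lambda>y. indicator (cball t \<rho>) y * (g y)\<^sup>2) \<in> borel_measurable borel"
        by (intro borel_measurable_times borel_measurable_indicator borel_measurable_power
            borel_measurable_continuous_onI[OF Pk_continuous[OF g]]) simp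
      from lborel_scaling[OF this \<rho>, of t]
      have "(LINT y|lebesgue. indicator (cball t \<rho>) y * (g y)\<^sup>2) = \<rho>\<^sup>2 * (LINT y|lebesgue. indicator (cball t \<rho>) (t + \<rho> *\<^sub>R y) * (h y)\<^sup>2)"
        by (simp add: h_def)
      also have "(\<lambda>y. indicator (cball t \<rho>) (t + \<rho> *\<^sub>R y) * (h y)\<^sup>2) = (\<lambda>y. indicator B y * (h y)\<^sup>2)"
        using \<rho> by (auto simp: B_def indicator_def dist_norm fun_eq_iff)
      finally show ?thesis using \<rho> by (simp add: q_def)
    qed
    finally show "(g x)\<^sup>2 \<le> C / \<rho>\<^sup>2 * (LINT y|lebesgue. indicator (cball t \<rho>) y * (g y)\<^sup>2)" by simp
  qed
qed

section \<open>Polynomials on an edge and bubble functions\<close>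

lemma polyfun_factor:
  assumes k: "k \<ge> 2" and z: "(\<Sum>i\<le>k. a i * 0 ^ i) = (0::real)" "(\<Sum>i\<le>k. a i * 1 ^ i) = (0::real)"
  obtains r :: "nat \<Rightarrow> real" where "\<And>s. (\<Sum>i\<le>k. a i * s ^ i) = s * (1 - s) * (\<Sum>i\<le>k - 2. r i * s ^ i)"
proof -
  define P where "P = (\<Sum>i\<le>k. monom (a i) i)"
  have Ps: "poly P s = (\<Sum>i\<le>k. a i * s ^ i)" for s by (simp add: P_def poly_sum poly_monom)
  have dP: "degree P \<le> k" unfolding P_def by (intro degree_sum_le) (auto intro: order_trans[OF degree_monom_le])
  show ?thesis
  proof (cases "P = 0")
    case True
    then show ?thesis using that[of "\<lambda>_. 0"] Ps[symmetric] by simp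
  next
    case False
    have "poly P 0 = 0" using z Ps by simp
    then obtain P1 where P1: "P = [:- 0, 1:] * P1" using poly_eq_0_iff_dvd by (metis dvdE)
    have "poly P 1 = 0" using z Ps by simp
    then have "poly P1 1 = 0" using P1 by simp
    then obtain R where R: "P1 = [:- 1, 1:] * R" using poly_eq_0_iff_dvd by (metis dvdE)
    have R0: "R \<noteq> 0" using False P1 R by auto
    have "degree P = degree [:- 0, 1::real:] + degree P1"
      using False unfolding P1 by (intro degree_mult_eq) auto
    moreover have "degree P1 = degree [:- 1, 1::real:] + degree R"
      using R0 unfolding R by (intro degree_mult_eq) auto
    ultimately have "degree P = 1 + (1 + degree R)" by simp
    then have dR: "degree R \<le> k - 2" using dP by simp
    have "poly P s = s * (1 - s) * (\<Sum>i\<le>k - 2. - coeff R i * s ^ i)" for s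
    proof -
      have "poly R s = (\<Sum>i\<le>k - 2. coeff R i * s ^ i)"
        unfolding poly_altdef using dR by (intro sum.mono_neutral_left) (auto simp: coeff_eq_0)
      then show ?thesis unfolding P1 R by (simp add: sum_negf algebra_simps)
    qed
    then show ?thesis using that Ps by metis
  qed
qed

text \<open>Division by s(1 - s) leaves a polynomial of degree at most \<open>k - 2\<close>. It
  cannot vanish at the \<open>k - 1\<close> inner nodes unless it is zero, so the sum of squared
  nodal values is a positive definite form in its coefficients.\<close>

lemma node_values_coercive:
  assumes k: "k \<ge> 2"
  shows "\<exists>C\<ge>0. \<forall>r::nat \<Rightarrow> real. \<forall>i\<in>{..k - 2}. (r i)\<^sup>2 \<le>
    C * (\<Sum>j\<in>{1..k - 1}. ((real j / real k) * (1 - real j / real k) * (\<Sum>i\<le>k - 2. r i * (real j / real k) ^ i))\<^sup>2)"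
proof -
  define s where "s = (\<lambda>j::nat. real j / real k)"
  define w where "w = (\<lambda>j i. s j * (1 - s j) * s j ^ i)"
  define M where "M = (\<lambda>a b. \<Sum>j\<in>{1..k - 1}. w j a * w j b)"
  have Q: "(\<Sum>a\<in>{..k - 2}. \<Sum>b\<in>{..k - 2}. M a b * r a * r b) = (\<Sum>j\<in>{1..k - 1}. (s j * (1 - s j) * (\<Sum>i\<le>k - 2. r i * s j ^ i))\<^sup>2)" for r
  proof -
    have "(s j * (1 - s j) * (\<Sum>i\<le>k - 2. r i * s j ^ i))\<^sup>2 = (\<Sum>a\<in>{..k - 2}. \<Sum>b\<in>{..k - 2}. w j a * w j b * r a * r b)" for j
    proof -
      have "s j * (1 - s j) * (\<Sum>i\<le>k - 2. r i * s j ^ i) = (\<Sum>i\<le>k - 2. w j i * r i)"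
        by (simp add: w_def sum_distrib_left mult_ac)
      then show ?thesis by (simp add: power2_eq_square sum_product mult_ac)
    qed
    then have "(\<Sum>j\<in>{1..k - 1}. (s j * (1 - s j) * (\<Sum>i\<le>k - 2. r i * s j ^ i))\<^sup>2) = (\<Sum>j\<in>{1..k - 1}. \<Sum>a\<in>{..k - 2}. \<Sum>b\<in>{..k - 2}. w j a * w j b * r a * r b)"
      by simp
    also have "\<dots> = (\<Sum>a\<in>{..k - 2}. \<Sum>j\<in>{1..k - 1}. \<Sum>b\<in>{..k - 2}. w j a * w j b * r a * r b)" by (rule sum.swap)
    also have "\<dots> = (\<Sum>a\<in>{..k - 2}. \<Sum>b\<in>{..k - 2}. \<Sum>j\<in>{1..k - 1}. w j a * w j b * r a * r b)" by (intro sum.cong refl sum.swap)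
    finally show ?thesis by (simp add: M_def sum_distrib_right)
  qed
  have "\<exists>C\<ge>0. \<forall>r. \<forall>a\<in>{..k - 2}. (r a)\<^sup>2 \<le> C * (\<Sum>a\<in>{..k - 2}. \<Sum>b\<in>{..k - 2}. M a b * r a * r b)"
  proof (rule quadratic_form_coercive)
    show "M a b = M b a" for a b unfolding M_def by (simp add: mult.commute)
    fix r :: "nat \<Rightarrow> real" assume r: "\<exists>a\<in>{..k - 2}. r a \<noteq> 0"
    show "(\<Sum>a\<in>{..k - 2}. \<Sum>b\<in>{..k - 2}. M a b * r a * r b) > 0"
    proof (rule ccontr)
      assume "\<not> ?thesis"
      then have "(\<Sum>j\<in>{1..k - 1}. (s j * (1 - s j) * (\<Sum>i\<le>k - 2. r i * s j ^ i))\<^sup>2) \<le> 0" unfolding Q by simp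
      then have "(\<Sum>j\<in>{1..k - 1}. (s j * (1 - s j) * (\<Sum>i\<le>k - 2. r i * s j ^ i))\<^sup>2) = 0" by (intro antisym sum_nonneg) auto
      then have z: "(s j * (1 - s j) * (\<Sum>i\<le>k - 2. r i * s j ^ i))\<^sup>2 = 0" if "j \<in> {1..k - 1}" for j
        using that by (subst (asm) sum_nonneg_eq_0_iff) auto
      have "s ` {1..k - 1} \<subseteq> {x. (\<Sum>i\<le>k - 2. r i * x ^ i) = 0}"
      proof
        fix x assume "x \<in> s ` {1..k - 1}"
        then obtain j where j: "j \<in> {1..k - 1}" "x = s j" by blast
        have "s j \<noteq> 0" "s j \<noteq> 1" using j(1) k by (auto simp: s_def)
        then show "x \<in> {x. (\<Sum>i\<le>k - 2. r i * x ^ i) = 0}" using z[OF j(1)] j(2) by simp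
      qed
      moreover have "finite {x. (\<Sum>i\<le>k - 2. r i * x ^ i) = 0} \<and> card {x. (\<Sum>i\<le>k - 2. r i * x ^ i) = 0} \<le> k - 2"
        using r polyfun_roots_finite[of r _ "k - 2"] polyfun_roots_card[of r _ "k - 2"] by blast
      ultimately have "card (s ` {1..k - 1}) \<le> k - 2" by (meson card_mono order_trans)
      moreover have "inj_on s {1..k - 1}" using k by (auto simp: inj_on_def s_def)
      ultimately show False using k by (simp add: card_image)
    qed
  qed simp
  then show ?thesis unfolding Q s_def .
qed

text \<open>The barycentric coordinate of \<open>A\<close> times a power of that of
  \<open>B\<close>. It vanishes on the other two edges, and the exponent \<open>Suc i\<close> leaves
  s(1 - s) times s^i on the edge from \<open>A\<close> to \<open>B\<close>.\<close>

definition bub :: "real^2 \<Rightarrow> real^2 \<Rightarrow> real^2 \<Rightarrow> nat \<Rightarrow> real^2 \<Rightarrow> real" where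
  "bub A p q i x = (1 - p \<bullet> (x - A) - q \<bullet> (x - A)) * (p \<bullet> (x - A)) ^ Suc i"

lemma bub_Pk: assumes "k \<ge> 2" "i \<le> k - 2" shows "bub A p q i \<in> Pk k"
proof -
  have "(\<lambda>x. (1 + (p + q) \<bullet> A + - (p + q) \<bullet> x) * ((- (p \<bullet> A) + p \<bullet> x) ^ Suc i * 1)) \<in> Pk (Suc (Suc i + 0))"
    by (intro Pk_mult_affine Pk_mult_affine_power Pk_const)
  moreover have "(\<lambda>x. (1 + (p + q) \<bullet> A + - (p + q) \<bullet> x) * ((- (p \<bullet> A) + p \<bullet> x) ^ Suc i * 1)) = bub A p q i"
    by (simp add: bub_def fun_eq_iff inner_diff_right inner_add_left inner_minus_left algebra_simps)
  ultimately show ?thesis using assms by (auto intro: Pk_mono)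
qed

lemma bub_edge:
  assumes "tri A B C p q T"
  shows "bub A p q i (A + s *\<^sub>R (B - A)) = s * (1 - s) * s ^ i"
    "p \<bullet> (x - A) = 0 \<Longrightarrow> bub A p q i x = 0" "p \<bullet> (x - A) + q \<bullet> (x - A) = 1 \<Longrightarrow> bub A p q i x = 0"
  using triD(1-4)[OF assms] by (simp_all add: bub_def algebra_simps)

lemma bub_grad:
  assumes t: "tri A B C p q T" and x: "x \<in> T" and K: "norm p \<le> K" "norm (p + q) \<le> K"
  shows "norm (grad (bub A p q i) x) \<le> real (i + 2) * K"
proof -
  define s u where "s = p \<bullet> (x - A)" and "u = 1 - p \<bullet> (x - A) - q \<bullet> (x - A)"
  have su: "0 \<le> s" "s \<le> 1" "0 \<le> u" "u \<le> 1" using x tri_mem[OF t] by (auto simp: s_def u_def)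
  have K0: "0 \<le> K" using K(1) norm_ge_zero[of p] by linarith
  define g where "g = (u * (real (Suc i) * s ^ i)) *\<^sub>R p - (s ^ Suc i) *\<^sub>R (p + q)"
  have 1: "((\<lambda>x. p \<bullet> (x - A)) has_derivative (\<lambda>y. p \<bullet> y)) (at x)" for p x by (auto intro!: derivative_eq_intros)
  have 2: "((\<lambda>x. 1 - p \<bullet> (x - A) - q \<bullet> (x - A)) has_derivative (\<lambda>y. - ((p + q) \<bullet> y))) (at x)"
    by (rule has_derivative_eq_rhs[OF has_derivative_diff[OF has_derivative_diff[OF has_derivative_const 1] 1]]) (simp add: fun_eq_iff inner_add_left)
  have gy: "g \<bullet> y = u * (real (Suc i) * s ^ i) * (p \<bullet> y) - s ^ Suc i * ((p + q) \<bullet> y)" for y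
    unfolding g_def by (simp only: inner_diff_left inner_scaleR_left)
  have "(bub A p q i has_derivative (\<lambda>y. g \<bullet> y)) (at x)"
    unfolding bub_def[abs_def]
    by (rule has_derivative_eq_rhs[OF has_derivative_mult[OF 2 has_derivative_power[OF 1]]])
      (simp add: fun_eq_iff gy s_def u_def mult_ac)
  then have "grad (bub A p q i) x = g" by (rule grad_eq)
  moreover have "norm g \<le> norm ((u * (real (Suc i) * s ^ i)) *\<^sub>R p) + norm ((s ^ Suc i) *\<^sub>R (p + q))"
    unfolding g_def by (rule norm_triangle_ineq4)
  moreover have "norm ((u * (real (Suc i) * s ^ i)) *\<^sub>R p) \<le> real (Suc i) * K"
  proof -
    have "u * (real (Suc i) * s ^ i) \<le> 1 * (real (Suc i) * 1)" using su by (intro mult_mono power_le_one) auto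
    moreover have "0 \<le> u * (real (Suc i) * s ^ i)" using su by simp
    ultimately have "\<bar>u * (real (Suc i) * s ^ i)\<bar> \<le> real (Suc i)" by (simp only: abs_of_nonneg mult_1_left mult_1_right)
    then show ?thesis unfolding norm_scaleR using K by (intro mult_mono) auto
  qed
  moreover have "norm ((s ^ Suc i) *\<^sub>R (p + q)) \<le> 1 * K"
    unfolding norm_scaleR using su K(2) by (intro mult_mono) (auto simp: power_abs intro: power_le_one mult_le_one)
  ultimately show ?thesis by (simp add: algebra_simps)
qed

section \<open>Bubble correction on a boundary triangle\<close>

lemma grad_sum:
  assumes "\<And>i. i \<in> I \<Longrightarrow> f i differentiable (at x)"
  shows "grad (\<lambda>x. \<Sum>i\<in>I. r i * f i x) x = (\<Sum>i\<in>I. r i *\<^sub>R grad (f i) x)"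
proof (rule grad_eq)
  have "((\<lambda>x. \<Sum>i\<in>I. r i * f i x) has_derivative (\<lambda>y. \<Sum>i\<in>I. r i * (grad (f i) x \<bullet> y))) (at x)"
    by (intro has_derivative_sum has_derivative_mult_right has_derivative_grad assms)
  then show "((\<lambda>x. \<Sum>i\<in>I. r i * f i x) has_derivative (\<lambda>y. (\<Sum>i\<in>I. r i *\<^sub>R grad (f i) x) \<bullet> y)) (at x)"
    by (simp add: inner_sum_left)
qed

lemma norm_sq_vec2: "(norm (v::real^2))\<^sup>2 = (v$1)\<^sup>2 + (v$2)\<^sup>2"
  unfolding power2_norm_eq_inner inner_vec_def sum_2 by (simp add: power2_eq_square)

lemma Pk_grad_continuous: assumes "f \<in> Pk k" shows "continuous_on S (grad f)"
proof -
  have "continuous_on S (\<lambda>x. \<chi> i. grad f x $ i)"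
    by (intro continuous_on_vec_lambda Pk_continuous[OF Pk_grad[OF assms]])
  then show ?thesis by (simp add: vec_lambda_eta)
qed

text \<open>As \<open>f\<close> vanishes at a point within \<eta> d of each division point, its
  nodal values are at most \<eta> d times a gradient, which the inverse inequality bounds by the
  energy on the triangle. The nodal values control the edge polynomial and thereby the bubble
  coefficients. Powers of d cancel, since bubble gradients are of order 1/d and the area is of order
  d^2.\<close>

lemma bubble_correction:
  assumes k: "k \<ge> 2" and \<kappa>: "\<kappa> > 0"
  shows "\<exists>C\<ge>0. \<forall>A B O' p q T d \<eta> f. tri A B O' p q T \<and> d > 0 \<and> (\<exists>c. cball c (\<kappa> * d) \<subseteq> T) \<and>
      (\<forall>x\<in>T. \<forall>y\<in>T. norm (x - y) \<le> d) \<and> f \<in> Pk k \<and> f A = 0 \<and> f B = 0 \<and> 0 \<le> \<eta> \<and> \<eta> \<le> 1 \<and>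
      (\<forall>j\<in>{1..k - 1}. \<exists>P. f P = 0 \<and> dist (A + (real j / real k) *\<^sub>R (B - A)) P \<le> \<eta> * d) \<longrightarrow>
    (\<exists>r. (\<forall>s. f (A + s *\<^sub>R (B - A)) = (\<Sum>i\<le>k - 2. r i * bub A p q i (A + s *\<^sub>R (B - A)))) \<and>
      (LINT x|lebesgue. indicator T x * (norm (grad (\<lambda>x. \<Sum>i\<le>k - 2. r i * bub A p q i x) x))\<^sup>2)
        \<le> C * \<eta>\<^sup>2 * (LINT x|lebesgue. indicator T x * (norm (grad f x))\<^sup>2))"
proof -
  \<comment> \<open>Points up to \<open>2 * d\<close> from the centre of the inscribed disc have to
    be reached, in units of its radius \<open>\<kappa> * d\<close>: d for a division point, and d
    again for the nearby zero of \<open>f\<close>.\<close>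
  define R where "R = 2 / \<kappa>"
  obtain C1 where C1: "C1 \<ge> 0" "\<And>g t \<rho> x. g \<in> Pk k \<Longrightarrow> \<rho> > 0 \<Longrightarrow> dist t x \<le> R * \<rho> \<Longrightarrow>
      (g x)\<^sup>2 \<le> C1 / \<rho>\<^sup>2 * (LINT y|lebesgue. indicator (cball t \<rho>) y * (g y)\<^sup>2)"
    using Pk_inverse[of k R] by (elim exE conjE) (rule that, assumption, blast)
  obtain C2 where C2: "C2 \<ge> 0" "\<And>r i. i \<in> {..k - 2} \<Longrightarrow> (r i)\<^sup>2 \<le>
    C2 * (\<Sum>j\<in>{1..k - 1}. ((real j / real k) * (1 - real j / real k) * (\<Sum>i\<le>k - 2. r i * (real j / real k) ^ i))\<^sup>2)"
    using node_values_coercive[OF k] by (elim exE conjE) (rule that, assumption, blast)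
  define V where "V = unit_ball_vol (real (DIM(real^2)))"
  have V0: "V \<ge> 0" by (simp add: V_def)
  \<comment> \<open>The product of the bounds for the area, for the squared bubble gradients and for
    the squared coefficients, without the factor \<eta>^2 and the energy.\<close>
  define C where "C = V * (real k) ^ 4 / (4 * \<kappa>\<^sup>2) * (C2 * (real k * (2 * C1 / \<kappa>\<^sup>2)))"
  show ?thesis
  proof (intro exI[of _ C] conjI allI impI)
    show "C \<ge> 0" using V0 C1 C2 by (simp add: C_def)
    fix A B O' p q T d \<eta> f
    assume H: "tri A B O' p q T \<and> d > 0 \<and> (\<exists>c. cball c (\<kappa> * d) \<subseteq> T) \<and>
      (\<forall>x\<in>T. \<forall>y\<in>T. norm (x - y) \<le> d) \<and> f \<in> Pk k \<and> f A = 0 \<and> f B = 0 \<and> 0 \<le> \<eta> \<and> \<eta> \<le> 1 \<and>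
      (\<forall>j\<in>{1..k - 1}. \<exists>P. f P = 0 \<and> dist (A + (real j / real k) *\<^sub>R (B - A)) P \<le> \<eta> * d)"
    then have t: "tri A B O' p q T" and d: "d > 0" and dT: "\<And>x y. x \<in> T \<Longrightarrow> y \<in> T \<Longrightarrow> norm (x - y) \<le> d"
      and f: "f \<in> Pk k" and fAB: "f A = 0" "f B = 0" and \<eta>: "0 \<le> \<eta>" "\<eta> \<le> 1"
      and P: "\<And>j. j \<in> {1..k - 1} \<Longrightarrow> \<exists>P. f P = 0 \<and> dist (A + (real j / real k) *\<^sub>R (B - A)) P \<le> \<eta> * d" by auto
    from H obtain c where c: "cball c (\<kappa> * d) \<subseteq> T" by blast
    have kd: "\<kappa> * d > 0" using \<kappa> d by simp
    have cT: "c \<in> T" using c kd by auto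
    have Tc: "compact T" by (rule tri_convex_compact[OF t])
    note gb = tri_grad_bound[OF t kd c]
    define E where "E = (LINT x|lebesgue. indicator T x * (norm (grad f x))\<^sup>2)"
    have E0: "E \<ge> 0" unfolding E_def by (intro Bochner_Integration.integral_nonneg) simp
    have Ei: "integrable lebesgue (\<lambda>x. indicator T x * (norm (grad f x))\<^sup>2)"
      by (intro integrable_indicator_continuous[OF Tc] continuous_intros Pk_grad_continuous[OF f])
    have g1: "(grad f x $ l)\<^sup>2 \<le> C1 / (\<kappa> * d)\<^sup>2 * E" if x: "dist c x \<le> 2 * d" for x l
    proof -
      have "dist c x \<le> R * (\<kappa> * d)" using x \<kappa> by (simp add: R_def)
      then have "(grad f x $ l)\<^sup>2 \<le> C1 / (\<kappa> * d)\<^sup>2 * (LINT y|lebesgue. indicator (cball c (\<kappa> * d)) y * (grad f y $ l)\<^sup>2)"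
        using C1(2)[OF Pk_grad[OF f] kd] by blast
      also have "\<dots> \<le> C1 / (\<kappa> * d)\<^sup>2 * E"
      proof (rule mult_left_mono)
        show "(LINT y|lebesgue. indicator (cball c (\<kappa> * d)) y * (grad f y $ l)\<^sup>2) \<le> E" unfolding E_def
        proof (rule integral_mono[OF _ Ei])
          show "integrable lebesgue (\<lambda>y. indicator (cball c (\<kappa> * d)) y * (grad f y $ l)\<^sup>2)"
            by (intro integrable_indicator_continuous continuous_intros Pk_continuous[OF Pk_grad[OF f]]) simp
          fix y
          have "(grad f y $ l)\<^sup>2 \<le> (norm (grad f y))\<^sup>2"
            using component_le_norm_cart[of "grad f y" l] by (simp add: abs_le_square_iff[symmetric])
          then show "indicator (cball c (\<kappa> * d)) y * (grad f y $ l)\<^sup>2 \<le> indicator T y * (norm (grad f y))\<^sup>2"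
            using c by (auto simp: indicator_def)
        qed
      qed (use C1 in simp)
      finally show ?thesis .
    qed
    define G where "G = sqrt (2 * C1 * E) / (\<kappa> * d)"
    have G0: "G \<ge> 0" using C1 E0 kd by (simp add: G_def)
    have G2: "G\<^sup>2 = 2 * (C1 / (\<kappa> * d)\<^sup>2 * E)" using C1 E0 by (simp add: G_def power_divide)
    have gG: "norm (grad f x) \<le> G" if x: "dist c x \<le> 2 * d" for x
    proof -
      have "(norm (grad f x))\<^sup>2 \<le> G\<^sup>2" unfolding norm_sq_vec2 G2 using g1[OF x, of 1] g1[OF x, of 2] by linarith
      then show ?thesis using G0 by (rule power2_le_imp_le)
    qed
    have fM: "(f (A + (real j / real k) *\<^sub>R (B - A)))\<^sup>2 \<le> 2 * C1 / \<kappa>\<^sup>2 * E * \<eta>\<^sup>2" if j: "j \<in> {1..k - 1}" for j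
    proof -
      define M where "M = A + (real j / real k) *\<^sub>R (B - A)"
      obtain Q where Q: "f Q = 0" "dist M Q \<le> \<eta> * d" using P[OF j] M_def by blast
      have MT: "M \<in> T" unfolding M_def
        by (rule tri_edge_point(1)[OF t]) (use j k in \<open>auto simp: field_simps\<close>)
      have cM: "dist c M \<le> d" using dT[OF cT MT] by (simp add: dist_norm)
      have "\<eta> * d \<le> 1 * d" using \<eta> d by (intro mult_right_mono) auto
      then have cQ: "dist c Q \<le> 2 * d" using Q(2) cM dist_triangle[of c Q M] by linarith
      have "norm (f M - f Q) \<le> G * norm (M - Q)"
      proof (rule differentiable_bound[where S="cball c (2 * d)" and f'="\<lambda>z y. grad f z \<bullet> y"])
        fix z assume z: "z \<in> cball c (2 * d)"
        show "(f has_derivative (\<lambda>y. grad f z \<bullet> y)) (at z within cball c (2 * d))"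
          by (rule has_derivative_at_withinI[OF has_derivative_grad[OF Pk_differentiable[OF f]]])
        show "onorm (\<lambda>y. grad f z \<bullet> y) \<le> G"
        proof (rule onorm_le)
          fix y
          have "norm (grad f z) \<le> G" using gG z by simp
          then show "norm (grad f z \<bullet> y) \<le> G * norm y" unfolding real_norm_def
            by (rule order_trans[OF Cauchy_Schwarz_ineq2 mult_right_mono[OF _ norm_ge_zero]])
        qed
      qed (use cM cQ d in auto)
      also have "\<dots> \<le> G * (\<eta> * d)" using Q(2) G0 by (intro mult_left_mono) (auto simp: dist_norm)
      finally have "\<bar>f M\<bar> \<le> G * (\<eta> * d)" using Q(1) by simp
      then have "(f M)\<^sup>2 \<le> (G * (\<eta> * d))\<^sup>2" using G0 \<eta> d by (simp add: abs_le_square_iff[symmetric])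
      also have "\<dots> = 2 * C1 / \<kappa>\<^sup>2 * E * \<eta>\<^sup>2" unfolding power_mult_distrib G2 using d \<kappa> by (simp add: field_simps)
      finally show ?thesis by (simp add: M_def)
    qed
    obtain a where a: "\<And>s. f (A + s *\<^sub>R (B - A)) = (\<Sum>i\<le>k. a i * s ^ i)" using Pk_line[OF f] by blast
    have z0: "(\<Sum>i\<le>k. a i * 0 ^ i) = 0" using a[of 0] fAB by simp
    have z1: "(\<Sum>i\<le>k. a i * 1 ^ i) = 0" using a[of 1] fAB by simp
    obtain r :: "nat \<Rightarrow> real" where r: "\<And>s. (\<Sum>i\<le>k. a i * s ^ i) = s * (1 - s) * (\<Sum>i\<le>k - 2. r i * s ^ i)"
      using polyfun_factor[OF k z0 z1] by blast
    define Z where "Z = C2 * (real k * (2 * C1 / \<kappa>\<^sup>2 * E * \<eta>\<^sup>2))"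
    have rZ: "(r i)\<^sup>2 \<le> Z" if i: "i \<in> {..k - 2}" for i
    proof -
      have "(r i)\<^sup>2 \<le> C2 * (\<Sum>j\<in>{1..k - 1}. (f (A + (real j / real k) *\<^sub>R (B - A)))\<^sup>2)"
        using C2(2)[OF i, of r] unfolding a r .
      also have "\<dots> \<le> C2 * (\<Sum>j\<in>{1..k - 1}. 2 * C1 / \<kappa>\<^sup>2 * E * \<eta>\<^sup>2)"
        using C2(1) fM by (intro mult_left_mono sum_mono) auto
      also have "\<dots> \<le> Z"
      proof -
        define X where "X = 2 * C1 / \<kappa>\<^sup>2 * E * \<eta>\<^sup>2"
        have X0: "0 \<le> X" using C1(1) E0 by (simp add: X_def)
        have "(\<Sum>j\<in>{1..k - 1}. X) = real (k - 1) * X" by simp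
        also have "\<dots> \<le> real k * X" using X0 by (intro mult_right_mono) auto
        finally have "(\<Sum>j\<in>{1..k - 1}. X) \<le> real k * X" .
        then show ?thesis unfolding Z_def X_def[symmetric] using C2(1) by (rule mult_left_mono)
      qed
      finally show ?thesis .
    qed
    define K where "K = 1 / (2 * (\<kappa> * d))"
    have K0: "K \<ge> 0" using kd by (simp add: K_def)
    have Z0: "Z \<ge> 0" using rZ[of 0] by (meson atMost_iff le0 order_trans zero_le_power2)
    let ?q = "\<lambda>x. \<Sum>i\<le>k - 2. r i * bub A p q i x"
    have qd: "bub A p q i differentiable (at x)" if "i \<in> {..k - 2}" for i x
      using bub_Pk[OF k] that Pk_differentiable by blast
    have qb: "(norm (grad ?q x))\<^sup>2 \<le> (real k) ^ 4 * Z * K\<^sup>2" if x: "x \<in> T" for x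
    proof -
      have gs: "grad ?q x = (\<Sum>i\<le>k - 2. r i *\<^sub>R grad (bub A p q i) x)"
        by (rule grad_sum) (rule qd)
      have "norm (grad ?q x) \<le> (\<Sum>i\<le>k - 2. norm (r i *\<^sub>R grad (bub A p q i) x))"
        unfolding gs by (rule norm_sum)
      also have "\<dots> \<le> (\<Sum>i\<le>k - 2. \<bar>r i\<bar> * (real k * K))"
      proof (rule sum_mono)
        fix i assume i: "i \<in> {..k - 2}"
        have "norm (grad (bub A p q i) x) \<le> real (i + 2) * K"
          using bub_grad[OF t x, of K i] gb(1,3) unfolding K_def by blast
        also have "\<dots> \<le> real k * K" using i k K0 by (intro mult_right_mono) auto
        finally show "norm (r i *\<^sub>R grad (bub A p q i) x) \<le> \<bar>r i\<bar> * (real k * K)" by (simp add: mult_left_mono)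
      qed
      also have "\<dots> = (\<Sum>i\<le>k - 2. \<bar>r i\<bar>) * (real k * K)" by (simp add: sum_distrib_right)
      finally have "(norm (grad ?q x))\<^sup>2 \<le> ((\<Sum>i\<le>k - 2. \<bar>r i\<bar>) * (real k * K))\<^sup>2" by (rule power_mono) simp
      also have "\<dots> = (\<Sum>i\<le>k - 2. \<bar>r i\<bar>)\<^sup>2 * ((real k)\<^sup>2 * K\<^sup>2)" by (simp add: power_mult_distrib)
      also have "\<dots> \<le> ((real k)\<^sup>2 * Z) * ((real k)\<^sup>2 * K\<^sup>2)"
      proof (rule mult_right_mono)
        have "(\<Sum>i\<le>k - 2. \<bar>r i\<bar>)\<^sup>2 \<le> (\<Sum>i\<le>k - 2. \<bar>r i\<bar>\<^sup>2) * card {..k - 2}" by (rule sum_squared_le_sum_of_squares)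
        also have "\<dots> \<le> (\<Sum>i\<in>{..k - 2}. Z) * card {..k - 2}" using rZ by (intro mult_right_mono sum_mono) auto
        also have "\<dots> = (real (card {..k - 2}))\<^sup>2 * Z" by (simp add: power2_eq_square)
        also have "\<dots> \<le> (real k)\<^sup>2 * Z" using Z0 k by (intro mult_right_mono power_mono) auto
        finally show "(\<Sum>i\<le>k - 2. \<bar>r i\<bar>)\<^sup>2 \<le> (real k)\<^sup>2 * Z" .
      qed simp
      also have "\<dots> = (real k) ^ 4 * Z * K\<^sup>2" by (simp add: power2_eq_square power4_eq_xxxx)
      finally show ?thesis .
    qed
    have qP: "?q \<in> Pk k" by (intro Pk_sum finite_atMost Pk_scale bub_Pk[OF k]) auto
    have Tm: "T \<in> sets lebesgue" using Tc by (simp add: lmeasurable_compact fmeasurableD)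
    have AT: "A \<in> T" using tri_vertices_mem[OF t] by blast
    have mT: "measure lebesgue T \<le> V * d\<^sup>2"
    proof -
      have "T \<subseteq> cball A d" using dT[OF AT] by (auto simp: dist_norm)
      then have "measure lebesgue T \<le> measure lebesgue (cball A d)"
        using Tc by (intro measure_mono_fmeasurable Tm) (auto simp: lmeasurable_compact)
      also have "\<dots> = V * d\<^sup>2" using content_cball[of d A] d by (simp add: V_def)
      finally show ?thesis .
    qed
    have "(LINT x|lebesgue. indicator T x * (norm (grad ?q x))\<^sup>2) \<le> (LINT x|lebesgue. ((real k) ^ 4 * Z * K\<^sup>2) * indicator T x)"
    proof (rule integral_mono)
      show "integrable lebesgue (\<lambda>x. indicator T x * (norm (grad ?q x))\<^sup>2)"
        by (intro integrable_indicator_continuous[OF Tc] continuous_intros Pk_grad_continuous[OF qP])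
      show "integrable lebesgue (\<lambda>x. ((real k) ^ 4 * Z * K\<^sup>2) * indicator T x)"
        by (intro integrable_mult_right integrable_real_indicator Tm) (use Tc lmeasurable_compact fmeasurableD2 in \<open>auto simp: top.not_eq_extremum\<close>)
      show "indicator T x * (norm (grad ?q x))\<^sup>2 \<le> ((real k) ^ 4 * Z * K\<^sup>2) * indicator T x" for x
        using qb[of x] by (cases "x \<in> T") auto
    qed
    also have "\<dots> = ((real k) ^ 4 * Z * K\<^sup>2) * measure lebesgue T" by simp
    also have "\<dots> \<le> ((real k) ^ 4 * Z * K\<^sup>2) * (V * d\<^sup>2)" using mT Z0 by (intro mult_left_mono) auto
    also have "\<dots> = C * \<eta>\<^sup>2 * E"
      unfolding C_def Z_def K_def using d \<kappa> by (simp add: power2_eq_square field_simps)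
    finally have fin: "(LINT x|lebesgue. indicator T x * (norm (grad ?q x))\<^sup>2) \<le> C * \<eta>\<^sup>2 * E" .
    have "f (A + s *\<^sub>R (B - A)) = ?q (A + s *\<^sub>R (B - A))" for s
      unfolding a r bub_edge(1)[OF t] by (simp add: sum_distrib_left mult_ac)
    then show "\<exists>r. (\<forall>s. f (A + s *\<^sub>R (B - A)) = (\<Sum>i\<le>k - 2. r i * bub A p q i (A + s *\<^sub>R (B - A)))) \<and>
      (LINT x|lebesgue. indicator T x * (norm (grad (\<lambda>x. \<Sum>i\<le>k - 2. r i * bub A p q i x) x))\<^sup>2)
        \<le> C * \<eta>\<^sup>2 * (LINT x|lebesgue. indicator T x * (norm (grad f x))\<^sup>2)"
      using fin unfolding E_def by blast
  qed
qed

section \<open>Piecewise polynomials on a mesh\<close>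

lemma L2_Cauchy_Schwarz:
  fixes f g :: "real^2 \<Rightarrow> real"
  assumes f: "integrable lebesgue (\<lambda>x. (f x)\<^sup>2)" and g: "integrable lebesgue (\<lambda>x. (g x)\<^sup>2)" and fg: "integrable lebesgue (\<lambda>x. f x * g x)"
  shows "\<bar>LINT x|lebesgue. f x * g x\<bar> \<le> sqrt (LINT x|lebesgue. (f x)\<^sup>2) * sqrt (LINT x|lebesgue. (g x)\<^sup>2)"
proof -
  define a b m where "a = (LINT x|lebesgue. (f x)\<^sup>2)" and "b = (LINT x|lebesgue. (g x)\<^sup>2)" and "m = (LINT x|lebesgue. f x * g x)"
  have ab: "a \<ge> 0" "b \<ge> 0" unfolding a_def b_def by (intro Bochner_Integration.integral_nonneg; simp)+
  have q: "0 \<le> a - 2 * t * m + t\<^sup>2 * b" for t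
  proof -
    have "0 \<le> (LINT x|lebesgue. (f x)\<^sup>2 - 2 * t * (f x * g x) + t\<^sup>2 * (g x)\<^sup>2)"
    proof (intro Bochner_Integration.integral_nonneg)
      fix x
      have "(f x)\<^sup>2 - 2 * t * (f x * g x) + t\<^sup>2 * (g x)\<^sup>2 = (f x - t * g x)\<^sup>2"
        by (simp add: power2_diff power_mult_distrib algebra_simps)
      then show "0 \<le> (f x)\<^sup>2 - 2 * t * (f x * g x) + t\<^sup>2 * (g x)\<^sup>2" by simp
    qed
    also have "\<dots> = a - 2 * t * m + t\<^sup>2 * b" using f g fg by (simp add: a_def b_def m_def)
    finally show ?thesis .
  qed
  have "m\<^sup>2 \<le> a * b"
  proof (cases "b = 0")
    case True
    have "m = 0"
    proof (rule ccontr)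
      assume "m \<noteq> 0"
      then show False using q[of "(a + 1) / (2 * m)"] True by simp
    qed
    then show ?thesis using True by simp
  next
    case False
    then have b0: "b > 0" using ab by simp
    have "0 \<le> a - m\<^sup>2 / b" using q[of "m / b"] b0 by (simp add: power2_eq_square field_simps)
    then show ?thesis using b0 by (simp add: field_simps)
  qed
  then have "\<bar>m\<bar> \<le> sqrt (a * b)" using real_le_rsqrt[of "\<bar>m\<bar>" "a * b"] by simp
  then show ?thesis unfolding a_def b_def m_def by (simp add: real_sqrt_mult)
qed

locale fe_mesh = mesh_geom +
  fixes k :: nat
  assumes fm: "fitted_mesh \<Omega> \<T>" and k2: "k \<ge> 2"
begin

abbreviation "U \<equiv> \<Union>\<T>"

lemma U: "compact U" "closed U" "bounded U" "U \<in> sets lebesgue" "U \<in> lmeasurable" "finite \<T>"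
proof -
  show c: "compact U" by (rule tmeshD(5)[OF tm])
  then show "closed U" "bounded U" by (auto intro: compact_imp_closed compact_imp_bounded)
  show "U \<in> lmeasurable" by (rule lmeasurable_compact[OF c])
  then show "U \<in> sets lebesgue" by (rule fmeasurableD)
  show "finite \<T>" by (rule tmeshD(1)[OF tm])
qed

lemma tri_of: "T \<in> \<T> \<Longrightarrow> \<exists>A B C p q. tri A B C p q T" by (rule tmeshD(2)[OF tm])

lemma T_props: assumes "T \<in> \<T>" shows "compact T" "closed T" "convex T" "interior T \<noteq> {}"
  using tri_of[OF assms] tri_convex_compact tri_interior_nonempty by metis+

definition pw :: "(real^2 \<Rightarrow> real) \<Rightarrow> bool" where "pw w \<longleftrightarrow> (\<forall>T\<in>\<T>. \<exists>p\<in>Pk k. \<forall>x\<in>T. w x = p x)"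
text \<open>The polynomial of \<open>w\<close> on \<open>T\<close> as a function on the whole plane:
  unique because triangles have interior points, and the one that gives the values of a trial
  function on the skin.\<close>

definition pol :: "(real^2 \<Rightarrow> real) \<Rightarrow> (real^2) set \<Rightarrow> real^2 \<Rightarrow> real" where "pol w T = (SOME p. p \<in> Pk k \<and> (\<forall>x\<in>T. w x = p x))"

lemma polD: assumes "pw w" "T \<in> \<T>" shows "pol w T \<in> Pk k" "\<And>x. x \<in> T \<Longrightarrow> w x = pol w T x"
proof -
  have ex: "\<exists>p. p \<in> Pk k \<and> (\<forall>x\<in>T. w x = p x)" using assms unfolding pw_def by blast
  have "pol w T \<in> Pk k \<and> (\<forall>x\<in>T. w x = pol w T x)" unfolding pol_def by (rule someI_ex[OF ex])
  then show "pol w T \<in> Pk k" "\<And>x. x \<in> T \<Longrightarrow> w x = pol w T x" by auto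
qed

lemma pol_unique:
  assumes "pw w" "T \<in> \<T>" "p \<in> Pk k" "\<And>x. x \<in> T \<Longrightarrow> w x = p x"
  shows "pol w T = p"
proof
  fix y
  have "(\<lambda>x. pol w T x + (-1) * p x) \<in> Pk k" by (intro Pk_add Pk_scale polD assms)
  then have "pol w T y + (-1) * p y = 0"
    by (rule Pk_zero[OF _ T_props(4)[OF assms(2)]]) (use polD[OF assms(1,2)] assms(4) in force)
  then show "pol w T y = p y" by simp
qed

text \<open>Frontiers of triangles are null sets, so gradients can be computed with the polynomials,
  one triangle at a time.\<close>

lemma AE_mesh: "AE x in lebesgue. \<forall>T\<in>\<T>. x \<in> T \<longrightarrow> x \<in> interior T"
  unfolding eventually_ae_filter_negligible
proof (intro exI[of _ "\<Union>T\<in>\<T>. frontier T"] conjI)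
  show "negligible (\<Union>T\<in>\<T>. frontier T)"
    by (rule negligible_Union) (use U(6) negligible_convex_frontier[OF T_props(3)] in auto)
  show "{x. \<not> (\<forall>T\<in>\<T>. x \<in> T \<longrightarrow> x \<in> interior T)} \<subseteq> (\<Union>T\<in>\<T>. frontier T)"
    using T_props(2) by (auto simp: frontier_def)
qed

lemma single_sum:
  fixes F :: "(real^2) set \<Rightarrow> 'b::real_vector"
  assumes "T0 \<in> \<T>" "x \<in> interior T0" "S \<subseteq> \<T>"
  shows "(\<Sum>T\<in>S. indicator T x *\<^sub>R F T) = (if T0 \<in> S then F T0 else 0)"
proof -
  have "(\<Sum>T\<in>S. indicator T x *\<^sub>R F T) = (\<Sum>T\<in>S. if T = T0 then F T0 else 0)"
  proof (rule sum.cong[OF refl])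
    fix T assume T: "T \<in> S"
    show "indicator T x *\<^sub>R F T = (if T = T0 then F T0 else 0)"
    proof (cases "T = T0")
      case True
      have "x \<in> T0" by (rule subsetD[OF interior_subset assms(2)])
      then show ?thesis using True by simp
    next
      case False
      have "T \<in> \<T>" by (rule subsetD[OF assms(3) T])
      then have "x \<notin> T" using tmesh_interior_disjoint[OF tm assms(1) _ assms(2)] False by metis
      then show ?thesis using False by simp
    qed
  qed
  also have "\<dots> = (if T0 \<in> S then F T0 else 0)"
    using finite_subset[OF assms(3) U(6)] by (simp add: sum.delta)
  finally show ?thesis .
qed

lemma grad_pol:
  assumes "pw w" "T \<in> \<T>" "x \<in> interior T"
  shows "w differentiable (at x)" "grad w x = grad (pol w T) x"
proof -
  have "(pol w T has_derivative (\<lambda>y. grad (pol w T) x \<bullet> y)) (at x)"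
    by (rule has_derivative_grad[OF Pk_differentiable[OF polD(1)[OF assms(1,2)]]])
  then have d: "(w has_derivative (\<lambda>y. grad (pol w T) x \<bullet> y)) (at x)"
    by (rule has_derivative_transform_within_open[OF _ open_interior assms(3)])
      (use polD(2)[OF assms(1,2)] interior_subset in force)
  show "w differentiable (at x)" using d differentiableI by blast
  show "grad w x = grad (pol w T) x" by (rule grad_eq[OF d])
qed

lemma grad_rep:
  assumes "pw w"
  shows "AE x in lebesgue. indicator U x *\<^sub>R grad w x = (\<Sum>T\<in>\<T>. indicator T x *\<^sub>R grad (pol w T) x)"
  using AE_mesh
proof eventually_elim
  case (elim x)
  show ?case
  proof (cases "x \<in> U")
    case True
    then obtain T0 where T0: "T0 \<in> \<T>" "x \<in> interior T0" using elim by blast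
    have "(\<Sum>T\<in>\<T>. indicator T x *\<^sub>R grad (pol w T) x) = grad (pol w T0) x"
      using single_sum[OF T0 order_refl, of "\<lambda>T. grad (pol w T) x"] T0(1) by simp
    then show ?thesis using True grad_pol(2)[OF assms T0] by simp
  next
    case False
    then have "\<And>T. T \<in> \<T> \<Longrightarrow> x \<notin> T" by blast
    then have "(\<Sum>T\<in>\<T>. indicator T x *\<^sub>R grad (pol w T) x) = 0" by (intro sum.neutral) auto
    then show ?thesis using False by simp
  qed
qed

lemma grad_bound: assumes "pw w" obtains K where "K \<ge> 0" "\<And>T x. T \<in> \<T> \<Longrightarrow> x \<in> T \<Longrightarrow> norm (grad (pol w T) x) \<le> K"
proof -
  have "\<exists>K\<ge>0. \<forall>x\<in>T. norm (grad (pol w T) x) \<le> K" if T: "T \<in> \<T>" for T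
  proof -
    have "bounded (grad (pol w T) ` T)"
      by (intro compact_imp_bounded compact_continuous_image Pk_grad_continuous[OF polD(1)[OF assms T]] T_props[OF T])
    then obtain K where "\<And>x. x \<in> T \<Longrightarrow> norm (grad (pol w T) x) \<le> K" unfolding bounded_iff by blast
    then show ?thesis by (intro exI[of _ "max K 0"]) (auto intro: max.coboundedI1)
  qed
  then obtain K where K: "\<And>T. T \<in> \<T> \<Longrightarrow> K T \<ge> 0" "\<And>T x. T \<in> \<T> \<Longrightarrow> x \<in> T \<Longrightarrow> norm (grad (pol w T) x) \<le> K T" by metis
  show ?thesis
  proof (rule that[of "\<Sum>T\<in>\<T>. K T"])
    show "0 \<le> (\<Sum>T\<in>\<T>. K T)" using K(1) by (rule sum_nonneg)
    fix T x assume T: "T \<in> \<T>" "x \<in> T"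
    have "K T \<le> (\<Sum>T\<in>\<T>. K T)" using K(1) U(6) T(1) by (intro member_le_sum) auto
    then show "norm (grad (pol w T) x) \<le> (\<Sum>T\<in>\<T>. K T)" using K(2)[OF T] by linarith
  qed
qed

lemma gw_measurable: assumes "pw w" shows "(\<lambda>x. indicator U x *\<^sub>R grad w x) \<in> borel_measurable lebesgue"
proof -
  have "(\<lambda>x. \<Sum>T\<in>\<T>. indicator T x *\<^sub>R grad (pol w T) x) \<in> borel_measurable lebesgue"
  proof (intro borel_measurable_sum borel_measurable_scaleR borel_measurable_indicator)
    fix T assume T: "T \<in> \<T>"
    show "T \<in> sets lebesgue" using lmeasurable_compact[OF T_props(1)[OF T]] by (rule fmeasurableD)
    show "grad (pol w T) \<in> borel_measurable lebesgue"
      by (rule measurable_completion) (simp add: borel_measurable_continuous_onI[OF Pk_grad_continuous[OF polD(1)[OF assms T]]])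
  qed
  then show ?thesis by (rule borel_measurable_AE) (use grad_rep[OF assms] in \<open>auto elim: eventually_mono\<close>)
qed

lemma gw_bound: assumes "pw w" obtains K where "K \<ge> 0" "AE x in lebesgue. norm (indicator U x *\<^sub>R grad w x) \<le> K * indicator U x"
proof -
  obtain K where K: "K \<ge> 0" "\<And>T x. T \<in> \<T> \<Longrightarrow> x \<in> T \<Longrightarrow> norm (grad (pol w T) x) \<le> K" using grad_bound[OF assms] by blast
  have "AE x in lebesgue. norm (indicator U x *\<^sub>R grad w x) \<le> K * indicator U x"
    using AE_mesh
  proof eventually_elim
    case (elim x)
    show ?case
    proof (cases "x \<in> U")
      case True
      then obtain T0 where T0: "T0 \<in> \<T>" "x \<in> T0" "x \<in> interior T0" using elim by blast
      show ?thesis using K(2)[OF T0(1,2)] grad_pol(2)[OF assms T0(1,3)] True by simp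
    qed simp
  qed
  then show ?thesis using that K(1) by blast
qed

lemma bounded_integrable:
  fixes f :: "real^2 \<Rightarrow> real"
  assumes "f \<in> borel_measurable lebesgue" "AE x in lebesgue. \<bar>f x\<bar> \<le> K * indicator U x"
  shows "integrable lebesgue f"
proof (rule Bochner_Integration.integrable_bound[OF _ assms(1)])
  show "integrable lebesgue (\<lambda>x. K * indicator U x)"
    using U(5) by (intro integrable_mult_right integrable_real_indicator) (auto simp: fmeasurable_def)
  show "AE x in lebesgue. norm (f x) \<le> norm (K * indicator U x)"
    using assms(2) by eventually_elim (unfold real_norm_def, erule order_trans, rule abs_ge_self)
qed

lemma grad_inner_integrable:
  assumes "pw w" "pw v"
  shows "integrable lebesgue (\<lambda>x. indicator U x * (grad w x \<bullet> grad v x))"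
proof -
  obtain K where K: "K \<ge> 0" "AE x in lebesgue. norm (indicator U x *\<^sub>R grad w x) \<le> K * indicator U x" using gw_bound[OF assms(1)] by blast
  obtain L where L: "L \<ge> 0" "AE x in lebesgue. norm (indicator U x *\<^sub>R grad v x) \<le> L * indicator U x" using gw_bound[OF assms(2)] by blast
  have e: "indicator U x * (grad w x \<bullet> grad v x) = (indicator U x *\<^sub>R grad w x) \<bullet> (indicator U x *\<^sub>R grad v x)" for x
    by (cases "x \<in> U") simp_all
  show ?thesis
  proof (rule bounded_integrable)
    show "(\<lambda>x. indicator U x * (grad w x \<bullet> grad v x)) \<in> borel_measurable lebesgue"
      unfolding e by (intro borel_measurable_inner gw_measurable assms)
    show "AE x in lebesgue. \<bar>indicator U x * (grad w x \<bullet> grad v x)\<bar> \<le> (K * L) * indicator U x"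
      using K(2) L(2)
    proof eventually_elim
      case (elim x)
      show ?case unfolding e
        by (rule order_trans[OF Cauchy_Schwarz_ineq2], rule order_trans[OF mult_mono[OF elim]]) (use K L in \<open>auto simp: indicator_def\<close>)
    qed
  qed
qed

lemma cont_bound: assumes "continuous_on U (v :: real^2 \<Rightarrow> real)"
  obtains M where "M \<ge> 0" "\<And>x. x \<in> U \<Longrightarrow> \<bar>v x\<bar> \<le> M"
proof -
  have "bounded (v ` U)" by (intro compact_imp_bounded compact_continuous_image assms U)
  then obtain M where "\<And>x. x \<in> U \<Longrightarrow> \<bar>v x\<bar> \<le> M" unfolding bounded_iff by auto
  then show ?thesis using that[of "max M 0"] by fastforce
qed

lemma cont_measurable: assumes "continuous_on U (v :: real^2 \<Rightarrow> real)"
  shows "(\<lambda>x. indicator U x * v x) \<in> borel_measurable lebesgue"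
proof -
  have "v \<in> borel_measurable (lebesgue_on U)" by (rule continuous_imp_measurable_on_sets_lebesgue[OF assms U(4)])
  then show ?thesis using U(4) by (simp add: borel_measurable_restrict_space_iff)
qed

definition en :: "(real^2 \<Rightarrow> real) \<Rightarrow> real" where "en w = (LINT x|lebesgue. indicator U x * (norm (grad w x))\<^sup>2)"

lemma en_nonneg: "en w \<ge> 0" unfolding en_def by (intro Bochner_Integration.integral_nonneg) simp

lemma norm_0h_en: "norm_0h \<T> (grad w) = sqrt (en w)"
  unfolding norm_0h_def en_def using U(4) by (simp add: integral_restrict_space)

lemma en_integrable: "pw w \<Longrightarrow> integrable lebesgue (\<lambda>x. indicator U x * (norm (grad w x))\<^sup>2)"
  using grad_inner_integrable[of w w] by (simp add: power2_norm_eq_inner)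

lemma pw_diff_grad:
  assumes "pw w1" "pw w2"
  shows "pw (\<lambda>x. a * w1 x + c * w2 x)"
    "AE x in lebesgue. x \<in> U \<longrightarrow> grad (\<lambda>x. a * w1 x + c * w2 x) x = a *\<^sub>R grad w1 x + c *\<^sub>R grad w2 x"
proof -
  have "\<exists>p\<in>Pk k. \<forall>x\<in>T. a * w1 x + c * w2 x = p x" if T: "T \<in> \<T>" for T
    by (rule bexI[of _ "\<lambda>x. a * pol w1 T x + c * pol w2 T x"])
      (use polD(2)[OF assms(1) T] polD(2)[OF assms(2) T] in \<open>auto intro!: Pk_add Pk_scale polD assms T\<close>)
  then show "pw (\<lambda>x. a * w1 x + c * w2 x)" unfolding pw_def by blast
  show "AE x in lebesgue. x \<in> U \<longrightarrow> grad (\<lambda>x. a * w1 x + c * w2 x) x = a *\<^sub>R grad w1 x + c *\<^sub>R grad w2 x"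
    using AE_mesh
  proof (eventually_elim, intro impI)
    fix x assume e: "\<forall>T\<in>\<T>. x \<in> T \<longrightarrow> x \<in> interior T" and "x \<in> U"
    then obtain T where T: "T \<in> \<T>" "x \<in> interior T" by blast
    note d1 = has_derivative_grad[OF grad_pol(1)[OF assms(1) T]] and d2 = has_derivative_grad[OF grad_pol(1)[OF assms(2) T]]
    show "grad (\<lambda>x. a * w1 x + c * w2 x) x = a *\<^sub>R grad w1 x + c *\<^sub>R grad w2 x"
      by (rule grad_eq, rule has_derivative_eq_rhs[OF has_derivative_add[OF has_derivative_mult_right[OF d1] has_derivative_mult_right[OF d2]]])
        (simp add: fun_eq_iff inner_add_left)
  qed
qed

text \<open>Almost every mesh point is interior to the mesh, where the gradient depends on the
  values in the mesh only.\<close>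

lemma grad_cong_U:
  assumes "\<And>x. x \<in> U \<Longrightarrow> w x = w' x"
  shows "AE x in lebesgue. x \<in> U \<longrightarrow> grad w x = grad w' x"
  using AE_mesh
proof (eventually_elim, intro impI)
  fix x assume e: "\<forall>T\<in>\<T>. x \<in> T \<longrightarrow> x \<in> interior T" and "x \<in> U"
  then obtain T where T: "T \<in> \<T>" "x \<in> interior T" by blast
  have xi: "x \<in> interior U" using T interior_mono[of T U] by blast
  have wi: "w y = w' y" if "y \<in> interior U" for y using assms that interior_subset by blast
  have "(w has_derivative D) (at x) \<longleftrightarrow> (w' has_derivative D) (at x)" for D
    using has_derivative_transform_within_open[OF _ open_interior xi, of w D UNIV w']
      has_derivative_transform_within_open[OF _ open_interior xi, of w' D UNIV w] wi by auto
  then have "frechet_derivative w (at x) = frechet_derivative w' (at x)" unfolding frechet_derivative_def by simp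
  then show "grad w x = grad w' x" unfolding grad_def by simp
qed

lemma Vh_props:
  assumes "v \<in> Vh k \<T>"
  shows "pw v" "continuous_on U v" "\<And>x. x \<in> frontier U \<Longrightarrow> v x = 0" "\<And>x. x \<notin> U \<Longrightarrow> v x = 0"
  using assms unfolding Vh_def pw_def by auto

text \<open>A segment is covered by finitely many closed parameter sets, one for each triangle and
  one for the exterior, on each of which \<open>v\<close> is Lipschitz with the same constant. This
  suffices for the whole segment, in whatever order the triangles are crossed.\<close>

lemma Vh_tame: assumes v: "v \<in> Vh k \<T>" shows "tame v"
proof -
  note vp = Vh_props[OF v]
  obtain K where K: "K \<ge> 0" "\<And>T x. T \<in> \<T> \<Longrightarrow> x \<in> T \<Longrightarrow> norm (grad (pol v T) x) \<le> K" using grad_bound[OF vp(1)] by blast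
  have lip: "\<bar>v x - v y\<bar> \<le> K * norm (x - y)" if T: "T \<in> \<T>" "x \<in> T" "y \<in> T" for T x y
  proof -
    have "norm (pol v T x - pol v T y) \<le> K * norm (x - y)"
    proof (rule differentiable_bound[where S=T and f'="\<lambda>z y. grad (pol v T) z \<bullet> y"])
      show "convex T" by (rule T_props[OF T(1)])
      fix z assume z: "z \<in> T"
      show "(pol v T has_derivative (\<lambda>y. grad (pol v T) z \<bullet> y)) (at z within T)"
        by (rule has_derivative_at_withinI[OF has_derivative_grad[OF Pk_differentiable[OF polD(1)[OF vp(1) T(1)]]]])
      show "onorm (\<lambda>y. grad (pol v T) z \<bullet> y) \<le> K"
      proof (rule onorm_le)
        fix y
        show "norm (grad (pol v T) z \<bullet> y) \<le> K * norm y" unfolding real_norm_def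
          by (rule order_trans[OF Cauchy_Schwarz_ineq2 mult_right_mono[OF K(2)[OF T(1) z] norm_ge_zero]])
      qed
    qed (use T in auto)
    then show ?thesis using polD(2)[OF vp(1) T(1)] T by simp
  qed
  have zero: "v x = 0" if "x \<notin> interior U" for x
    using that vp(3,4) U(2) by (cases "x \<in> U") (auto simp: frontier_def)
  have "K-lipschitz_on UNIV v"
  proof (rule lipschitz_onI[OF _ K(1)])
    fix x y :: "real^2"
    define l where "l = (\<lambda>s::real. x + s *\<^sub>R (y - x))"
    have cl: "continuous_on UNIV l" unfolding l_def by (intro continuous_intros)
    \<comment> \<open>\<open>None\<close> stands for the part of the segment outside the interior of
      the mesh, where \<open>v\<close> is zero.\<close>
    define W where "W = (\<lambda>i. case i of None \<Rightarrow> {s. l s \<in> - interior U} | Some T \<Rightarrow> {s. l s \<in> T})"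
    have lst: "norm (l s - l t) = \<bar>s - t\<bar> * norm (y - x)" for s t
    proof -
      have "l s - l t = (s - t) *\<^sub>R (y - x)" by (simp add: l_def algebra_simps)
      then show ?thesis by simp
    qed
    have "(K * norm (y - x))-lipschitz_on {0..1} (\<lambda>s. v (l s))"
    proof (rule lipschitz_on_closed_Union[of "insert None (Some ` \<T>)" _ W])
      show "finite (insert None (Some ` \<T>))" using U(6) by simp
      show "0 \<le> K * norm (y - x)" using K(1) by simp
      show "closed (W i)" if "i \<in> insert None (Some ` \<T>)" for i
      proof -
        have cp: "closed {s. l s \<in> S}" if "closed S" for S
          using closed_vimage[OF that cl] by (simp add: vimage_def)
        show ?thesis
        proof (cases i)
          case None
          have "closed {s. l s \<in> - interior U}" by (rule cp) (simp add: closed_Compl)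
          then show ?thesis by (simp add: W_def None)
        next
          case (Some T)
          then have "closed T" using that T_props(2) by auto
          then show ?thesis unfolding W_def Some by (simp add: cp)
        qed
      qed
      show "{0..1} \<subseteq> (\<Union>i\<in>insert None (Some ` \<T>). W i)"
        using interior_subset[of U] by (auto simp: W_def)
      fix i assume i: "i \<in> insert None (Some ` \<T>)"
      show "(K * norm (y - x))-lipschitz_on (W i) (\<lambda>s. v (l s))"
      proof (rule lipschitz_onI)
        fix s t assume st: "s \<in> W i" "t \<in> W i"
        have "\<bar>v (l s) - v (l t)\<bar> \<le> K * norm (l s - l t)"
        proof (cases i)
          case None
          then have "v (l s) = 0" "v (l t) = 0" using st zero by (auto simp: W_def)
          then show ?thesis using K(1) by simp
        next
          case (Some T)
          then show ?thesis using lip[of T "l s" "l t"] st i by (auto simp: W_def)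
        qed
        then show "dist (v (l s)) (v (l t)) \<le> K * norm (y - x) * dist s t" unfolding lst by (simp add: dist_real_def mult_ac)
      qed (use K in simp)
    qed
    from lipschitz_onD[OF this, of 0 1] show "dist (v x) (v y) \<le> K * dist x y"
      by (simp add: l_def dist_norm norm_minus_commute)
  qed
  moreover have "bounded {x. v x \<noteq> 0}" by (rule bounded_subset[OF U(3)]) (use vp(4) in blast)
  moreover have "AE x in lebesgue. v differentiable (at x)"
    using AE_mesh
  proof eventually_elim
    case (elim x)
    show ?case
    proof (cases "x \<in> U")
      case True
      then show ?thesis using elim grad_pol(1)[OF vp(1)] by blast
    next
      case False
      have "(v has_derivative (\<lambda>_. 0)) (at x)"
        by (rule has_derivative_transform_within_open[OF has_derivative_const, of "- U"]) (use False vp(4) U(2) in auto)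
      then show ?thesis using differentiableI by blast
    qed
  qed
  ultimately show ?thesis unfolding tame_def by blast
qed

lemma Vh_grad_outside:
  assumes v: "v \<in> Vh k \<T>" and x: "x \<notin> U"
  shows "grad v x = 0"
proof (rule grad_eq)
  have "(v has_derivative (\<lambda>_. 0)) (at x)"
  proof (rule has_derivative_transform_within_open[OF has_derivative_const])
    show "open (- U)" using U(2) by (rule open_Compl)
    show "x \<in> - U" using x by blast
    show "0 = v y" if "y \<in> - U" for y using Vh_props(4)[OF v, of y] that by simp
  qed
  then show "(v has_derivative (\<lambda>y. 0 \<bullet> y)) (at x)" by (simp only: inner_zero_left)
qed

lemma Vh_en: assumes "v \<in> Vh k \<T>" shows "en v = (LINT x|lebesgue. (norm (grad v x))\<^sup>2)"
  unfolding en_def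
proof (rule Bochner_Integration.integral_cong[OF refl])
  fix x
  show "indicator U x * (norm (grad v x))\<^sup>2 = (norm (grad v x))\<^sup>2"
  proof (cases "x \<in> U")
    case False
    have "grad v x = 0" by (rule Vh_grad_outside[OF assms False])
    then show ?thesis by simp
  qed simp
qed

end

section \<open>The bilinear form\<close>

context fe_mesh
begin

definition ET :: "(real^2 \<Rightarrow> real) \<Rightarrow> (real^2) set \<Rightarrow> real" where
  "ET w T = (LINT x|lebesgue. indicator T x * (norm (grad (pol w T) x))\<^sup>2)"

lemma ET_integrable: assumes "pw w" "T \<in> \<T>" shows "integrable lebesgue (\<lambda>x. indicator T x * (norm (grad (pol w T) x))\<^sup>2)"
  by (intro integrable_indicator_continuous T_props(1)[OF assms(2)] continuous_intros Pk_grad_continuous[OF polD(1)[OF assms]])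

lemma ET_nonneg: "ET w T \<ge> 0" unfolding ET_def by (intro Bochner_Integration.integral_nonneg) simp

lemma en_sum: assumes w: "pw w" shows "en w = (\<Sum>T\<in>\<T>. ET w T)"
proof -
  have i: "integrable lebesgue (\<lambda>x. \<Sum>T\<in>\<T>. indicator T x * (norm (grad (pol w T) x))\<^sup>2)"
    by (intro Bochner_Integration.integrable_sum ET_integrable w)
  have "en w = (LINT x|lebesgue. (\<Sum>T\<in>\<T>. indicator T x * (norm (grad (pol w T) x))\<^sup>2))"
    unfolding en_def
  proof (rule integral_cong_AE)
    show "(\<lambda>x. indicator U x * (norm (grad w x))\<^sup>2) \<in> borel_measurable lebesgue" using en_integrable[OF w] by simp
    show "(\<lambda>x. \<Sum>T\<in>\<T>. indicator T x * (norm (grad (pol w T) x))\<^sup>2) \<in> borel_measurable lebesgue" using i by simp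
    show "AE x in lebesgue. indicator U x * (norm (grad w x))\<^sup>2 = (\<Sum>T\<in>\<T>. indicator T x * (norm (grad (pol w T) x))\<^sup>2)"
      using AE_mesh
    proof eventually_elim
      case (elim x)
      show ?case
      proof (cases "x \<in> U")
        case True
        then obtain T0 where T0: "T0 \<in> \<T>" "x \<in> interior T0" using elim by blast
        have "(\<Sum>T\<in>\<T>. indicator T x * (norm (grad (pol w T) x))\<^sup>2) = (norm (grad (pol w T0) x))\<^sup>2"
          using single_sum[OF T0 order_refl, of "\<lambda>T. (norm (grad (pol w T) x))\<^sup>2"] T0(1) by simp
        then show ?thesis using True grad_pol(2)[OF w T0] by simp
      next
        case False
        then have "\<And>T. T \<in> \<T> \<Longrightarrow> x \<notin> T" by blast
        then have "(\<Sum>T\<in>\<T>. indicator T x * (norm (grad (pol w T) x))\<^sup>2) = 0" by (intro sum.neutral) auto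
        then show ?thesis using False by simp
      qed
    qed
  qed
  also have "\<dots> = (\<Sum>T\<in>\<T>. ET w T)" unfolding ET_def by (intro Bochner_Integration.integral_sum ET_integrable w)
  finally show ?thesis .
qed

text \<open>The inverse inequality on the inscribed disc makes the gradient of the polynomial vanish
  at every point of the plane; its constant may depend on the point here.\<close>

lemma ET_zero_const:
  assumes w: "pw w" and T: "T \<in> \<T>" and z: "ET w T = 0"
  shows "pol w T x = pol w T y"
proof -
  obtain c where c: "cball c (\<kappa> * diameter T) \<subseteq> T" using shape[OF T] by blast
  have kd: "\<kappa> * diameter T > 0" using \<kappa>0 diam_pos[OF T] by simp
  note f = polD(1)[OF w T]
  have g0: "grad (pol w T) z $ l = 0" for z l
  proof -
    have "\<exists>R. dist c z \<le> R * (\<kappa> * diameter T)" using \<kappa>0 diam_pos[OF T] by (intro exI[of _ "dist c z / (\<kappa> * diameter T)"]) simp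
    then obtain R where R: "dist c z \<le> R * (\<kappa> * diameter T)" by blast
    obtain C where C: "C \<ge> 0" "\<And>g t \<rho> x. g \<in> Pk k \<Longrightarrow> \<rho> > 0 \<Longrightarrow> dist t x \<le> R * \<rho> \<Longrightarrow>
      (g x)\<^sup>2 \<le> C / \<rho>\<^sup>2 * (LINT y|lebesgue. indicator (cball t \<rho>) y * (g y)\<^sup>2)"
      using Pk_inverse[of k R] by (elim exE conjE) (rule that, assumption, blast)
    have "(LINT y|lebesgue. indicator (cball c (\<kappa> * diameter T)) y * (grad (pol w T) y $ l)\<^sup>2) \<le> ET w T"
      unfolding ET_def
    proof (rule integral_mono[OF _ ET_integrable[OF w T]])
      show "integrable lebesgue (\<lambda>y. indicator (cball c (\<kappa> * diameter T)) y * (grad (pol w T) y $ l)\<^sup>2)"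
        by (intro integrable_indicator_continuous continuous_intros Pk_continuous[OF Pk_grad[OF f]]) simp
      fix y
      have "(grad (pol w T) y $ l)\<^sup>2 \<le> (norm (grad (pol w T) y))\<^sup>2"
        using component_le_norm_cart[of "grad (pol w T) y" l] by (simp add: abs_le_square_iff[symmetric])
      then show "indicator (cball c (\<kappa> * diameter T)) y * (grad (pol w T) y $ l)\<^sup>2 \<le> indicator T y * (norm (grad (pol w T) y))\<^sup>2"
        using c by (auto simp: indicator_def)
    qed
    then have le: "(LINT y|lebesgue. indicator (cball c (\<kappa> * diameter T)) y * (grad (pol w T) y $ l)\<^sup>2) \<le> 0" using z by simp
    have "(grad (pol w T) z $ l)\<^sup>2 \<le> C / (\<kappa> * diameter T)\<^sup>2 * (LINT y|lebesgue. indicator (cball c (\<kappa> * diameter T)) y * (grad (pol w T) y $ l)\<^sup>2)"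
      by (rule C(2)[OF Pk_grad[OF f] kd R])
    also have "\<dots> \<le> 0" using le C(1) by (intro mult_nonneg_nonpos) auto
    finally show ?thesis by simp
  qed
  have "grad (pol w T) z = 0" for z using g0 by (simp add: vec_eq_iff)
  then have d: "(pol w T has_derivative (\<lambda>y. 0)) (at z)" for z
    using has_derivative_grad[OF Pk_differentiable[OF f], of z] by simp
  have "norm (pol w T x - pol w T y) \<le> 0 * norm (x - y)"
    by (rule differentiable_bound[where S=UNIV and f'="\<lambda>z y. 0"]) (use d in \<open>auto simp: onorm_zero\<close>)
  then show ?thesis by simp
qed

lemma labelledD:
  assumes "labelled \<T> T A B C p q"
  shows "T \<in> \<T>" "tri A B C p q T" "closed_segment A B \<subseteq> frontier U" "edge_e \<T> T = closed_segment A B" "vertex_O \<T> T = C"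
  using assms unfolding labelled_def by auto

text \<open>A point shared with another triangle is neither interior to \<open>T\<close> nor inside
  its boundary edge, so it lies on one of the other two edges, where bubbles vanish. Hence bubbles
  continued by zero are continuous on the mesh.\<close>

lemma bub_other:
  assumes l: "labelled \<T> T A B C p q" and T': "T' \<in> \<T>" "T' \<noteq> T" and x: "x \<in> T" "x \<in> T'"
  shows "bub A p q i x = 0"
proof -
  note d = labelledD[OF l]
  define a c where "a = p \<bullet> (x - A)" and "c = q \<bullet> (x - A)"
  have m: "0 \<le> a" "0 \<le> c" "a + c \<le> 1" using x(1) tri_mem[OF d(2)] by (auto simp: a_def c_def)
  have "a = 0 \<or> a + c = 1"
  proof (rule ccontr)
    assume n: "\<not> ?thesis"
    then have a01: "0 < a" "a + c < 1" using m by auto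
    show False
    proof (cases "c > 0")
      case True
      then have "x \<in> interior T" using tri_in_interior[OF d(2)] a01 unfolding a_def c_def by blast
      then show False using tmesh_interior_disjoint[OF tm d(1) T'(1) _ x(2)] T'(2) by blast
    next
      case False
      then have c0: "c = 0" using m by simp
      have a1: "a < 1" using a01 c0 by simp
      have xe: "x = A + a *\<^sub>R (B - A)"
        by (rule tri_coords_eq[OF d(2)]) (use triD(1-4)[OF d(2)] c0 in \<open>auto simp: a_def c_def\<close>)
      have "A + a *\<^sub>R (B - A) \<in> frontier U"
        using d(3) tri_edge_point(2)[OF d(2) a01(1) a1] rel_interior_subset by blast
      then have "A + a *\<^sub>R (B - A) \<notin> T'" using tmesh_edge_only[OF tm d(1) T' d(2) a01(1) a1] by blast
      then show False using x(2) xe by metis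
    qed
  qed
  then show ?thesis using bub_edge(2,3)[OF d(2), of x i] unfolding a_def c_def by blast
qed

end

locale fe_form = fe_mesh +
  fixes \<nu> :: real and b :: "real^2 \<Rightarrow> real^2" and B R :: real
  assumes \<nu>: "\<nu> > 0" and bm: "b \<in> borel_measurable lebesgue" and bB: "AE x in lebesgue. norm (b x) \<le> B" and B0: "B \<ge> 0"
    and R0: "R > 0" and UR: "U \<subseteq> cball 0 R"
begin

definition gf :: "(real^2 \<Rightarrow> real) \<Rightarrow> (real^2 \<Rightarrow> real) \<Rightarrow> real" where
  "gf w v = (LINT x|lebesgue. indicator U x * (grad w x \<bullet> grad v x))"
definition cf :: "(real^2 \<Rightarrow> real) \<Rightarrow> (real^2 \<Rightarrow> real) \<Rightarrow> real" where
  "cf w v = (LINT x|lebesgue. indicator U x * ((b x \<bullet> grad w x) * v x))"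

definition good :: "(real^2 \<Rightarrow> real) \<Rightarrow> bool" where "good w \<longleftrightarrow> pw w \<and> continuous_on U w"

lemma good_lin: "good w1 \<Longrightarrow> good w2 \<Longrightarrow> good (\<lambda>x. a * w1 x + c * w2 x)"
  unfolding good_def by (auto intro!: continuous_intros pw_diff_grad(1))

lemma cf_integrable: assumes "good w" "good v" shows "integrable lebesgue (\<lambda>x. indicator U x * ((b x \<bullet> grad w x) * v x))"
proof -
  have w: "pw w" and v: "continuous_on U v" using assms good_def by auto
  obtain K where K: "K \<ge> 0" "AE x in lebesgue. norm (indicator U x *\<^sub>R grad w x) \<le> K * indicator U x" using gw_bound[OF w] by blast
  obtain M where M: "M \<ge> 0" "\<And>x. x \<in> U \<Longrightarrow> \<bar>v x\<bar> \<le> M" using cont_bound[OF v] by blast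
  have e: "indicator U x * ((b x \<bullet> grad w x) * v x) = (b x \<bullet> (indicator U x *\<^sub>R grad w x)) * (indicator U x * v x)" for x
    by (cases "x \<in> U") simp_all
  show ?thesis
  proof (rule bounded_integrable)
    show "(\<lambda>x. indicator U x * ((b x \<bullet> grad w x) * v x)) \<in> borel_measurable lebesgue"
      unfolding e by (intro borel_measurable_times borel_measurable_inner bm gw_measurable[OF w] cont_measurable[OF v])
    show "AE x in lebesgue. \<bar>indicator U x * ((b x \<bullet> grad w x) * v x)\<bar> \<le> (B * K * M) * indicator U x"
      using K(2) bB
    proof eventually_elim
      case (elim x)
      show ?case
      proof (cases "x \<in> U")
        case True
        then have "\<bar>b x \<bullet> grad w x\<bar> \<le> B * K"
          using order_trans[OF Cauchy_Schwarz_ineq2 mult_mono[OF elim(2) _ B0 norm_ge_zero], of "grad w x" K] elim(1) by simp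
        then have "\<bar>b x \<bullet> grad w x\<bar> * \<bar>v x\<bar> \<le> (B * K) * M" using M True B0 K(1) by (intro mult_mono) auto
        then show ?thesis using True by (simp add: abs_mult)
      qed simp
    qed
  qed
qed

lemma a_h_split: assumes "good w" "good v" shows "a_h \<nu> b \<T> w v = \<nu> * gf w v + cf w v"
proof -
  have i: "integrable lebesgue (\<lambda>x. indicator U x * (grad w x \<bullet> grad v x))" using assms good_def grad_inner_integrable by blast
  have "a_h \<nu> b \<T> w v = (LINT x|lebesgue. \<nu> * (indicator U x * (grad w x \<bullet> grad v x)) + indicator U x * ((b x \<bullet> grad w x) * v x))"
    unfolding a_h_def using U(4) by (simp add: integral_restrict_space algebra_simps)
  also have "\<dots> = \<nu> * gf w v + cf w v" unfolding gf_def cf_def using i cf_integrable[OF assms] by simp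
  finally show ?thesis .
qed

lemma gf_lin: assumes "good w1" "good w2" "good v" shows "gf (\<lambda>x. a * w1 x + c * w2 x) v = a * gf w1 v + c * gf w2 v"
proof -
  have p: "pw w1" "pw w2" "pw v" using assms good_def by auto
  note i1 = grad_inner_integrable[OF p(1,3)] and i2 = grad_inner_integrable[OF p(2,3)] and i = grad_inner_integrable[OF pw_diff_grad(1)[OF p(1,2)] p(3)]
  have "gf (\<lambda>x. a * w1 x + c * w2 x) v = (LINT x|lebesgue. a * (indicator U x * (grad w1 x \<bullet> grad v x)) + c * (indicator U x * (grad w2 x \<bullet> grad v x)))"
    unfolding gf_def
  proof (rule integral_cong_AE)
    show "AE x in lebesgue. indicator U x * (grad (\<lambda>x. a * w1 x + c * w2 x) x \<bullet> grad v x) =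
      a * (indicator U x * (grad w1 x \<bullet> grad v x)) + c * (indicator U x * (grad w2 x \<bullet> grad v x))"
      using pw_diff_grad(2)[OF p(1,2), of a c]
    proof eventually_elim
      case (elim x)
      then show ?case by (cases "x \<in> U") (simp_all add: inner_add_left)
    qed
  qed (use i i1 i2 in auto)
  then show ?thesis unfolding gf_def using i1 i2 by simp
qed

lemma cf_lin1: assumes "good w1" "good w2" "good v" shows "cf (\<lambda>x. a * w1 x + c * w2 x) v = a * cf w1 v + c * cf w2 v"
proof -
  have p: "pw w1" "pw w2" "pw v" using assms good_def by auto
  note i1 = cf_integrable[OF assms(1,3)] and i2 = cf_integrable[OF assms(2,3)] and i = cf_integrable[OF good_lin[OF assms(1,2)] assms(3)]
  have "cf (\<lambda>x. a * w1 x + c * w2 x) v = (LINT x|lebesgue. a * (indicator U x * ((b x \<bullet> grad w1 x) * v x)) + c * (indicator U x * ((b x \<bullet> grad w2 x) * v x)))"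
    unfolding cf_def
  proof (rule integral_cong_AE)
    show "AE x in lebesgue. indicator U x * ((b x \<bullet> grad (\<lambda>x. a * w1 x + c * w2 x) x) * v x) =
      a * (indicator U x * ((b x \<bullet> grad w1 x) * v x)) + c * (indicator U x * ((b x \<bullet> grad w2 x) * v x))"
      using pw_diff_grad(2)[OF p(1,2), of a c]
    proof eventually_elim
      case (elim x)
      then show ?case by (cases "x \<in> U") (simp_all add: inner_add_right algebra_simps)
    qed
  qed (use i i1 i2 in auto)
  then show ?thesis unfolding cf_def using i1 i2 by simp
qed

lemma cf_lin2: assumes "good w" "good v1" "good v2" shows "cf w (\<lambda>x. a * v1 x + c * v2 x) = a * cf w v1 + c * cf w v2"
proof -
  have "cf w (\<lambda>x. a * v1 x + c * v2 x) = (LINT x|lebesgue. a * (indicator U x * ((b x \<bullet> grad w x) * v1 x)) + c * (indicator U x * ((b x \<bullet> grad w x) * v2 x)))"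
    unfolding cf_def by (rule Bochner_Integration.integral_cong) (simp_all add: algebra_simps)
  then show ?thesis unfolding cf_def using cf_integrable assms by simp
qed

lemma gf_sym: "gf w v = gf v w" unfolding gf_def by (simp add: inner_commute)

lemma a_h_lin1: assumes "good w1" "good w2" "good v"
  shows "a_h \<nu> b \<T> (\<lambda>x. a * w1 x + c * w2 x) v = a * a_h \<nu> b \<T> w1 v + c * a_h \<nu> b \<T> w2 v"
  using assms good_lin[OF assms(1,2)] by (simp add: a_h_split gf_lin cf_lin1 algebra_simps)

lemma a_h_lin2: assumes "good w" "good v1" "good v2"
  shows "a_h \<nu> b \<T> w (\<lambda>x. a * v1 x + c * v2 x) = a * a_h \<nu> b \<T> w v1 + c * a_h \<nu> b \<T> w v2"
  using assms good_lin[OF assms(2,3)] by (simp add: a_h_split gf_sym[of w] gf_lin cf_lin2 algebra_simps)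

lemma a_h_cong_U: assumes "good w" "good w'" "good v" "\<And>x. x \<in> U \<Longrightarrow> w x = w' x"
  shows "a_h \<nu> b \<T> w v = a_h \<nu> b \<T> w' v"
proof -
  have p: "pw w" "pw w'" "pw v" using assms good_def by auto
  have gc: "AE x in lebesgue. x \<in> U \<longrightarrow> grad w x = grad w' x" by (rule grad_cong_U) (rule assms(4))
  have "gf w v = gf w' v" unfolding gf_def
  proof (rule integral_cong_AE)
    show "AE x in lebesgue. indicator U x * (grad w x \<bullet> grad v x) = indicator U x * (grad w' x \<bullet> grad v x)"
      using gc by eventually_elim (auto simp: indicator_def)
  qed (use grad_inner_integrable[OF p(1,3)] grad_inner_integrable[OF p(2,3)] in auto)
  moreover have "cf w v = cf w' v" unfolding cf_def
  proof (rule integral_cong_AE)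
    show "AE x in lebesgue. indicator U x * ((b x \<bullet> grad w x) * v x) = indicator U x * ((b x \<bullet> grad w' x) * v x)"
      using gc by eventually_elim (auto simp: indicator_def)
  qed (use cf_integrable assms in auto)
  ultimately show ?thesis using assms by (simp add: a_h_split)
qed

lemma Vh_good: "v \<in> Vh k \<T> \<Longrightarrow> good v" using Vh_props(1,2) good_def by blast

lemma Vh_Poincare: assumes "v \<in> Vh k \<T>"
  shows "integrable lebesgue (\<lambda>x. (v x)\<^sup>2)" "(LINT x|lebesgue. (v x)\<^sup>2) \<le> (3 * R)\<^sup>2 * en v"
proof -
  note t = Vh_tame[OF assms]
  show "integrable lebesgue (\<lambda>x. (v x)\<^sup>2)" using tame_integrable[OF t, of 2] by simp
  have "v x = 0" if "norm x > R" for x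
  proof -
    have "x \<notin> U" using UR that by (auto simp: subset_iff)
    then show ?thesis by (rule Vh_props(4)[OF assms])
  qed
  then show "(LINT x|lebesgue. (v x)\<^sup>2) \<le> (3 * R)\<^sup>2 * en v" unfolding Vh_en[OF assms] using Poincare[OF t R0] by blast
qed

text \<open>By the Poincare inequality \<open>v\<close> vanishes almost everywhere, and by
  continuity the set where it is nonzero is open.\<close>

lemma Vh_en_zero: assumes v: "v \<in> Vh k \<T>" and z: "en v = 0" shows "v x = 0"
proof (rule ccontr)
  assume n: "v x \<noteq> 0"
  have "(LINT x|lebesgue. (v x)\<^sup>2) \<le> 0" using Vh_Poincare(2)[OF v] z by simp
  moreover have "0 \<le> (LINT x|lebesgue. (v x)\<^sup>2)" by (intro Bochner_Integration.integral_nonneg) simp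
  ultimately have "AE x in lebesgue. (v x)\<^sup>2 = 0"
    using integral_nonneg_eq_0_iff_AE[OF Vh_Poincare(1)[OF v]] by simp
  then obtain N where "negligible N" "{x. \<not> (v x)\<^sup>2 = 0} \<subseteq> N"
    unfolding eventually_ae_filter_negligible by (elim exE conjE) (rule that)
  then have "negligible {x. \<not> (v x)\<^sup>2 = 0}" by (rule negligible_subset)
  moreover have "open {x. \<not> (v x)\<^sup>2 = 0}"
    by (intro open_Collect_neq continuous_intros tame_continuous[OF Vh_tame[OF v]])
  ultimately have "{x. \<not> (v x)\<^sup>2 = 0} = {}" using open_not_negligible by blast
  then show False using n by auto
qed

lemma gf_bound: assumes "good w" "good v" shows "\<bar>gf w v\<bar> \<le> sqrt (en w) * sqrt (en v)"
proof -
  have p: "pw w" "pw v" using assms good_def by auto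
  let ?f = "\<lambda>w x. norm (indicator U x *\<^sub>R grad w x)"
  have sq: "(?f w x)\<^sup>2 = indicator U x * (norm (grad w x))\<^sup>2" for w x by (cases "x \<in> U") simp_all
  have e: "en w = (LINT x|lebesgue. (?f w x)\<^sup>2)" for w unfolding en_def sq ..
  obtain K where K: "K \<ge> 0" "AE x in lebesgue. ?f w x \<le> K * indicator U x" using gw_bound[OF p(1)] by blast
  obtain L where L: "L \<ge> 0" "AE x in lebesgue. ?f v x \<le> L * indicator U x" using gw_bound[OF p(2)] by blast
  have fg: "integrable lebesgue (\<lambda>x. ?f w x * ?f v x)"
  proof (rule bounded_integrable)
    show "(\<lambda>x. ?f w x * ?f v x) \<in> borel_measurable lebesgue"
      by (intro borel_measurable_times measurable_compose[OF gw_measurable[OF p(1)] borel_measurable_norm] measurable_compose[OF gw_measurable[OF p(2)] borel_measurable_norm])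
    show "AE x in lebesgue. \<bar>?f w x * ?f v x\<bar> \<le> (K * L) * indicator U x"
      using K(2) L(2)
    proof eventually_elim
      case (elim x)
      have "?f w x * ?f v x \<le> (K * indicator U x) * (L * indicator U x)" using elim K(1) by (intro mult_mono) auto
      then show ?case by (cases "x \<in> U") auto
    qed
  qed
  have "\<bar>gf w v\<bar> \<le> (LINT x|lebesgue. ?f w x * ?f v x)"
    unfolding gf_def
  proof (rule order_trans[OF integral_abs_bound], rule integral_mono[OF _ fg])
    show "integrable lebesgue (\<lambda>x. \<bar>indicator U x * (grad w x \<bullet> grad v x)\<bar>)" using grad_inner_integrable[OF p] by simp
    show "\<bar>indicator U x * (grad w x \<bullet> grad v x)\<bar> \<le> ?f w x * ?f v x" for x
      using Cauchy_Schwarz_ineq2[of "grad w x" "grad v x"] by (cases "x \<in> U") auto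
  qed
  also have "\<dots> \<le> sqrt (en w) * sqrt (en v)"
    unfolding e
    by (rule order_trans[OF abs_ge_self L2_Cauchy_Schwarz]) (use en_integrable[OF p(1)] en_integrable[OF p(2)] fg in \<open>simp_all only: sq\<close>)
  finally show ?thesis .
qed

text \<open>The Poincare inequality is applied to \<open>v\<close>, which vanishes on the boundary
  of the mesh as \<open>w\<close> need not; \<open>3 * R\<close> is its constant for a disc that
  contains the mesh.\<close>

lemma cf_bound: assumes w: "good w" and v: "v \<in> Vh k \<T>" shows "\<bar>cf w v\<bar> \<le> B * (3 * R) * (sqrt (en w) * sqrt (en v))"
proof -
  have p: "pw w" using w good_def by auto
  have vc: "continuous_on U v" by (rule Vh_props(2)[OF v])
  let ?f = "\<lambda>x. norm (indicator U x *\<^sub>R grad w x)"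
  have sq: "(?f x)\<^sup>2 = indicator U x * (norm (grad w x))\<^sup>2" for x by (cases "x \<in> U") simp_all
  have e: "en w = (LINT x|lebesgue. (?f x)\<^sup>2)" unfolding en_def sq ..
  obtain K where K: "K \<ge> 0" "AE x in lebesgue. ?f x \<le> K * indicator U x" using gw_bound[OF p(1)] by blast
  obtain M where M: "M \<ge> 0" "\<And>x. x \<in> U \<Longrightarrow> \<bar>v x\<bar> \<le> M" using cont_bound[OF vc] by blast
  have vm: "v \<in> borel_measurable lebesgue"
    by (rule measurable_completion) (use tame_measurable[OF Vh_tame[OF v]] in simp)
  have fm: "?f \<in> borel_measurable lebesgue" by (rule measurable_compose[OF gw_measurable[OF p] borel_measurable_norm])
  have fg: "integrable lebesgue (\<lambda>x. ?f x * \<bar>v x\<bar>)"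
  proof (rule bounded_integrable)
    show "(\<lambda>x. ?f x * \<bar>v x\<bar>) \<in> borel_measurable lebesgue" by (intro borel_measurable_times fm borel_measurable_abs vm)
    show "AE x in lebesgue. \<bar>?f x * \<bar>v x\<bar>\<bar> \<le> (K * M) * indicator U x"
      using K(2)
    proof eventually_elim
      case (elim x)
      then show ?case using mult_mono[OF elim M(2)[of x]] K(1) by (cases "x \<in> U") auto
    qed
  qed
  have "\<bar>cf w v\<bar> \<le> (LINT x|lebesgue. B * (?f x * \<bar>v x\<bar>))"
    unfolding cf_def
  proof (rule order_trans[OF integral_abs_bound], rule integral_mono_AE)
    show "integrable lebesgue (\<lambda>x. \<bar>indicator U x * ((b x \<bullet> grad w x) * v x)\<bar>)" using cf_integrable[OF w Vh_good[OF v]] by simp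
    show "integrable lebesgue (\<lambda>x. B * (?f x * \<bar>v x\<bar>))" using fg by simp
    show "AE x in lebesgue. \<bar>indicator U x * ((b x \<bullet> grad w x) * v x)\<bar> \<le> B * (?f x * \<bar>v x\<bar>)"
      using bB
    proof eventually_elim
      case (elim x)
      have "\<bar>b x \<bullet> grad w x\<bar> \<le> B * norm (grad w x)"
        by (rule order_trans[OF Cauchy_Schwarz_ineq2 mult_right_mono[OF elim norm_ge_zero]])
      from mult_right_mono[OF this abs_ge_zero[of "v x"]] show ?case by (cases "x \<in> U") (auto simp: abs_mult mult.assoc)
    qed
  qed
  also have "\<dots> = B * (LINT x|lebesgue. ?f x * \<bar>v x\<bar>)" by simp
  also have "\<dots> \<le> B * (sqrt (en w) * sqrt (LINT x|lebesgue. \<bar>v x\<bar>\<^sup>2))"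
    unfolding e
    by (intro mult_left_mono B0, rule order_trans[OF abs_ge_self L2_Cauchy_Schwarz]) (use en_integrable[OF p] Vh_Poincare(1)[OF v] fg in \<open>simp_all only: sq power2_abs\<close>)
  finally have le: "\<bar>cf w v\<bar> \<le> B * (sqrt (en w) * sqrt (LINT x|lebesgue. \<bar>v x\<bar>\<^sup>2))" .
  have "sqrt (LINT x|lebesgue. \<bar>v x\<bar>\<^sup>2) \<le> (3 * R) * sqrt (en v)"
    using real_sqrt_le_mono[OF Vh_Poincare(2)[OF v]] R0 by (simp add: real_sqrt_mult)
  then have "B * (sqrt (en w) * sqrt (LINT x|lebesgue. \<bar>v x\<bar>\<^sup>2)) \<le> B * (sqrt (en w) * ((3 * R) * sqrt (en v)))"
    using B0 en_nonneg[of w] by (intro mult_left_mono) auto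
  with le show ?thesis by (simp add: mult_ac)
qed

end

section \<open>Test functions from trial functions and the inf-sup condition\<close>

lemma division_ratio:
  assumes "k \<ge> 2" "j \<in> {1..k-1}" shows "1 / real k \<le> real j / real k" "real j / real k \<le> 1 - 1 / real k" "0 < real j / real k" "real j / real k < 1"
proof -
  have k: "real k > 0" using assms by simp
  have j: "1 \<le> real j" "real j \<le> real k - 1" using assms by (auto simp: of_nat_diff)
  show "1 / real k \<le> real j / real k" using j k by (simp add: divide_right_mono)
  have "1 - 1 / real k = (real k - 1) / real k" using k by (simp add: field_simps)
  then show "real j / real k \<le> 1 - 1 / real k" using j k by (simp add: divide_right_mono)
  show "0 < real j / real k" "real j / real k < 1" using j k by auto
qed

text \<open>The interface between geometry and analysis on one fine mesh. \<theta> is the relative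
  energy of the bubble correction; its third bound keeps the resulting perturbation of the form
  below an eighth of \<nu>.\<close>

locale fe_geo = fe_form +
  fixes \<theta> :: real
  assumes g1: "\<And>T. T \<in> boundary_triangles \<T> \<Longrightarrow> skin \<Omega> \<T> T \<inter> \<Union>\<T> \<subseteq> T"
    and g2: "\<And>T T'. T \<in> boundary_triangles \<T> \<Longrightarrow> T' \<in> boundary_triangles \<T> \<Longrightarrow> T \<noteq> T' \<Longrightarrow> skin \<Omega> \<T> T \<inter> skin \<Omega> \<T> T' \<subseteq> \<Union>\<T>"
    and g3: "\<And>T A B' C p q j. labelled \<T> T A B' C p q \<Longrightarrow> j \<in> {1..k-1} \<Longrightarrow>
      \<exists>P\<in>skin \<Omega> \<T> T. \<forall>Q. nearest_intersection (frontier \<Omega>) C (A + (real j / real k) *\<^sub>R (B' - A)) Q \<longleftrightarrow> Q = P"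
    and corr: "\<And>T A B' C p q f. labelled \<T> T A B' C p q \<Longrightarrow> f \<in> Pk k \<Longrightarrow> f A = 0 \<Longrightarrow> f B' = 0 \<Longrightarrow>
      (\<And>j P. j \<in> {1..k-1} \<Longrightarrow> P \<in> skin \<Omega> \<T> T \<Longrightarrow> nearest_intersection (frontier \<Omega>) C (A + (real j / real k) *\<^sub>R (B' - A)) P \<Longrightarrow> f P = 0) \<Longrightarrow>
      \<exists>r. (\<forall>s. f (A + s *\<^sub>R (B' - A)) = (\<Sum>i\<le>k-2. r i * bub A p q i (A + s *\<^sub>R (B' - A)))) \<and>
        (LINT x|lebesgue. indicator T x * (norm (grad (\<lambda>x. \<Sum>i\<le>k-2. r i * bub A p q i x) x))\<^sup>2)
          \<le> \<theta> * (LINT x|lebesgue. indicator T x * (norm (grad f x))\<^sup>2)"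
    and \<theta>: "0 \<le> \<theta>" "\<theta> \<le> 1 / 4" "(\<nu> + 3 * R * B) * sqrt \<theta> \<le> \<nu> / 8"
    and conv: "\<And>v. v \<in> Vh k \<T> \<Longrightarrow> \<bar>cf v v\<bar> \<le> \<nu> / 4 * en v"
begin

abbreviation "bt \<equiv> boundary_triangles \<T>"

lemma bt: "T \<in> bt \<Longrightarrow> T \<in> \<T>" "finite bt" using U(6) unfolding boundary_triangles_def by auto

text \<open>A choice of labels for each boundary triangle, with \<open>lA\<close>, \<open>lB\<close> the end-points of the boundary edge.\<close>

definition lab where "lab T = (SOME (A, B', C, p, q). labelled \<T> T A B' C p q)"
definition "lA T = fst (lab T)"
definition "lB T = fst (snd (lab T))"
definition "lC T = fst (snd (snd (lab T)))"
definition "lp T = fst (snd (snd (snd (lab T))))"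
definition "lq T = snd (snd (snd (snd (lab T))))"

lemma lab: assumes "T \<in> bt" shows "labelled \<T> T (lA T) (lB T) (lC T) (lp T) (lq T)"
proof -
  obtain A B' C p q where "labelled \<T> T A B' C p q" using fitted_labelled[OF fm assms] by blast
  then have "(\<lambda>(A, B', C, p, q). labelled \<T> T A B' C p q) (A, B', C, p, q)" by simp
  then have "(\<lambda>(A, B', C, p, q). labelled \<T> T A B' C p q) (lab T)" unfolding lab_def by (rule someI)
  then show ?thesis unfolding lA_def lB_def lC_def lp_def lq_def by (simp add: case_prod_beta)
qed

lemmas labD = labelledD[OF lab]

definition bb :: "(real^2) set \<Rightarrow> nat \<Rightarrow> real^2 \<Rightarrow> real" where "bb T i = bub (lA T) (lp T) (lq T) i"
definition M :: "(real^2) set \<Rightarrow> nat \<Rightarrow> real^2" where "M T j = lA T + (real j / real k) *\<^sub>R (lB T - lA T)"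
definition PP :: "(real^2) set \<Rightarrow> nat \<Rightarrow> real^2" where
  "PP T j = (SOME P. P \<in> skin \<Omega> \<T> T \<and> (\<forall>Q. nearest_intersection (frontier \<Omega>) (lC T) (M T j) Q \<longleftrightarrow> Q = P))"

lemma PP: assumes "T \<in> bt" "j \<in> {1..k-1}"
  shows "PP T j \<in> skin \<Omega> \<T> T" "nearest_intersection (frontier \<Omega>) (lC T) (M T j) Q \<longleftrightarrow> Q = PP T j"
proof -
  have "\<exists>P. P \<in> skin \<Omega> \<T> T \<and> (\<forall>Q. nearest_intersection (frontier \<Omega>) (lC T) (M T j) Q \<longleftrightarrow> Q = P)"
    using g3[OF lab[OF assms(1)] assms(2)] unfolding M_def by blast
  then have "PP T j \<in> skin \<Omega> \<T> T \<and> (\<forall>Q. nearest_intersection (frontier \<Omega>) (lC T) (M T j) Q \<longleftrightarrow> Q = PP T j)"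
    unfolding PP_def by (rule someI_ex)
  then show "PP T j \<in> skin \<Omega> \<T> T" "nearest_intersection (frontier \<Omega>) (lC T) (M T j) Q \<longleftrightarrow> Q = PP T j" by auto
qed

text \<open>\<open>division_points\<close> does not fix the orientation of the edge; reversing it
  sends \<open>j\<close> to \<open>k - j\<close>.\<close>

lemma division_points_eq: assumes "T \<in> bt" shows "division_points k (edge_e \<T> T) = M T ` {1..k-1}"
proof -
  have e: "edge_e \<T> T = closed_segment (lA T) (lB T)" by (rule labD(4)[OF assms])
  show ?thesis
  proof (intro equalityI subsetI)
    fix x assume "x \<in> division_points k (edge_e \<T> T)"
    then obtain a b' j where x: "x = a + (real j / real k) *\<^sub>R (b' - a)" "closed_segment (lA T) (lB T) = closed_segment a b'" "1 \<le> j" "j \<le> k - 1"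
      unfolding division_points_def e by blast
    from x(2) consider "a = lA T" "b' = lB T" | "a = lB T" "b' = lA T"
      unfolding closed_segment_eq by (auto simp: doubleton_eq_iff)
    then show "x \<in> M T ` {1..k-1}"
    proof cases
      case 1 then show ?thesis using x by (auto simp: M_def)
    next
      case 2
      have k: "real k > 0" using k2 by simp
      have "real (k - j) / real k = 1 - real j / real k" using x(3,4) k by (simp add: of_nat_diff field_simps)
      then have "M T (k - j) = lA T + (1 - real j / real k) *\<^sub>R (lB T - lA T)" unfolding M_def by (rule arg_cong)
      also have "\<dots> = x" unfolding x(1) 2 by (simp add: algebra_simps)
      finally have "x = M T (k - j)" by (rule sym)
      moreover have "k - j \<in> {1..k-1}" using x(3,4) by auto
      ultimately show ?thesis by blast
    qed
  next
    fix x assume "x \<in> M T ` {1..k-1}"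
    then obtain j where "x = M T j" "1 \<le> j" "j \<le> k - 1" by auto
    then show "x \<in> division_points k (edge_e \<T> T)" unfolding division_points_def e M_def by blast
  qed
qed

lemma lab_vertex: assumes "T \<in> bt" shows "lA T \<in> T" "lB T \<in> T" "lA T \<in> mesh_vertices \<T>" "lB T \<in> mesh_vertices \<T>" "lA T \<in> frontier U" "lB T \<in> frontier U"
proof -
  note t = labD(2)[OF assms]
  show "lA T \<in> T" "lB T \<in> T" using tri_vertices_mem[OF t] by auto
  show "lA T \<in> mesh_vertices \<T>" "lB T \<in> mesh_vertices \<T>" unfolding mesh_vertices_def using tri_extreme[OF t] bt(1)[OF assms] by auto
  show "lA T \<in> frontier U" "lB T \<in> frontier U" using labD(3)[OF assms] ends_in_segment[of "lA T" "lB T"] by auto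
qed

lemma WhD: assumes w: "w \<in> Wh k \<Omega> \<T>"
  shows "good w" "\<And>T x. T \<in> bt \<Longrightarrow> x \<in> skin \<Omega> \<T> T \<Longrightarrow> w x = pol w T x"
    "\<And>T. T \<in> bt \<Longrightarrow> pol w T (lA T) = 0 \<and> pol w T (lB T) = 0"
    "\<And>T j. T \<in> bt \<Longrightarrow> j \<in> {1..k-1} \<Longrightarrow> pol w T (PP T j) = 0"
    "\<And>x. x \<notin> U \<Longrightarrow> x \<notin> (\<Union>T\<in>bt. skin \<Omega> \<T> T) \<Longrightarrow> w x = 0"
    "\<And>v. v \<in> mesh_vertices \<T> \<Longrightarrow> v \<in> frontier U \<Longrightarrow> w v = 0"
proof -
  have W: "\<forall>T\<in>\<T>. \<exists>p\<in>Pk k. (\<forall>x\<in>T. w x = p x) \<and> (T \<in> bt \<longrightarrow> (\<forall>x\<in>skin \<Omega> \<T> T. w x = p x))" "continuous_on U w"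
    "\<forall>v\<in>mesh_vertices \<T>. v \<in> frontier U \<longrightarrow> w v = 0"
    "\<forall>T\<in>bt. \<forall>M\<in>division_points k (edge_e \<T> T). \<forall>P. nearest_intersection (frontier \<Omega>) (vertex_O \<T> T) M P \<longrightarrow> w P = 0"
    "\<forall>x. x \<notin> U \<longrightarrow> x \<notin> (\<Union>T\<in>bt. skin \<Omega> \<T> T) \<longrightarrow> w x = 0"
    using w unfolding Wh_def by blast+
  have pw: "pw w" unfolding pw_def using W(1) by blast
  then show "good w" unfolding good_def using W(2) by blast
  show sk: "w x = pol w T x" if T: "T \<in> bt" "x \<in> skin \<Omega> \<T> T" for T x
  proof -
    obtain p where p: "p \<in> Pk k" "\<forall>x\<in>T. w x = p x" "\<forall>x\<in>skin \<Omega> \<T> T. w x = p x" using W(1) bt(1)[OF T(1)] T(1) by blast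
    have "pol w T = p" using pol_unique[OF pw bt(1)[OF T(1)] p(1)] p(2) by blast
    then show ?thesis using p(3) T(2) by simp
  qed
  show "pol w T (lA T) = 0 \<and> pol w T (lB T) = 0" if T: "T \<in> bt" for T
    using lab_vertex[OF T] W(3) polD(2)[OF pw bt(1)[OF T]] by metis
  show "pol w T (PP T j) = 0" if T: "T \<in> bt" and j: "j \<in> {1..k-1}" for T j
  proof -
    have "nearest_intersection (frontier \<Omega>) (vertex_O \<T> T) (M T j) (PP T j)" unfolding labD(5)[OF T] using PP(2)[OF T j] by blast
    moreover have "M T j \<in> division_points k (edge_e \<T> T)" unfolding division_points_eq[OF T] using j by blast
    ultimately have "w (PP T j) = 0" using W(4) T by blast
    then show ?thesis using sk[OF T PP(1)[OF T j]] by simp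
  qed
  show "w x = 0" if "x \<notin> U" "x \<notin> (\<Union>T\<in>bt. skin \<Omega> \<T> T)" for x using W(5) that by blast
  show "w v = 0" if "v \<in> mesh_vertices \<T>" "v \<in> frontier U" for v using W(3) that by blast
qed

lemma WhI: assumes "good w" "\<And>T x. T \<in> bt \<Longrightarrow> x \<in> skin \<Omega> \<T> T \<Longrightarrow> w x = pol w T x"
    "\<And>T j. T \<in> bt \<Longrightarrow> j \<in> {1..k-1} \<Longrightarrow> pol w T (PP T j) = 0"
    "\<And>x. x \<notin> U \<Longrightarrow> x \<notin> (\<Union>T\<in>bt. skin \<Omega> \<T> T) \<Longrightarrow> w x = 0"
    "\<And>v. v \<in> mesh_vertices \<T> \<Longrightarrow> v \<in> frontier U \<Longrightarrow> w v = 0"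
  shows "w \<in> Wh k \<Omega> \<T>"
proof -
  have p: "pw w" "continuous_on U w" using assms(1) good_def by auto
  have 1: "\<exists>p\<in>Pk k. (\<forall>x\<in>T. w x = p x) \<and> (T \<in> bt \<longrightarrow> (\<forall>x\<in>skin \<Omega> \<T> T. w x = p x))" if "T \<in> \<T>" for T
    using polD[OF p(1) that] assms(2) by (intro bexI[of _ "pol w T"]) auto
  have 2: "w P = 0" if T: "T \<in> bt" and N: "N \<in> division_points k (edge_e \<T> T)" and n: "nearest_intersection (frontier \<Omega>) (vertex_O \<T> T) N P" for T N P
  proof -
    obtain j where j: "j \<in> {1..k-1}" "N = M T j" using N unfolding division_points_eq[OF T] by blast
    have "P = PP T j" using n PP(2)[OF T j(1)] unfolding labD(5)[OF T] j(2) by blast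
    then show ?thesis using assms(2)[OF T PP(1)[OF T j(1)]] assms(3)[OF T j(1)] by simp
  qed
  show ?thesis unfolding Wh_def using 1 2 p(2) assms(4,5) by blast
qed

lemma Wh_lin: assumes "w1 \<in> Wh k \<Omega> \<T>" "w2 \<in> Wh k \<Omega> \<T>" shows "(\<lambda>x. a * w1 x + c * w2 x) \<in> Wh k \<Omega> \<T>"
proof -
  note g = good_lin[OF WhD(1)[OF assms(1)] WhD(1)[OF assms(2)], of a c]
  have p: "pw w1" "pw w2" "pw (\<lambda>x. a * w1 x + c * w2 x)" using g WhD(1)[OF assms(1)] WhD(1)[OF assms(2)] unfolding good_def by auto
  have pe: "pol (\<lambda>x. a * w1 x + c * w2 x) T = (\<lambda>x. a * pol w1 T x + c * pol w2 T x)" if T: "T \<in> \<T>" for T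
    by (rule pol_unique[OF p(3) T]) (use polD[OF p(1) T] polD[OF p(2) T] in \<open>auto intro!: Pk_add Pk_scale\<close>)
  show ?thesis
  proof (rule WhI[OF g])
    show "a * w1 x + c * w2 x = pol (\<lambda>x. a * w1 x + c * w2 x) T x" if "T \<in> bt" "x \<in> skin \<Omega> \<T> T" for T x
      using WhD(2)[OF assms(1) that] WhD(2)[OF assms(2) that] pe[OF bt(1)[OF that(1)]] by simp
    show "pol (\<lambda>x. a * w1 x + c * w2 x) T (PP T j) = 0" if "T \<in> bt" "j \<in> {1..k-1}" for T j
      using WhD(4)[OF assms(1) that] WhD(4)[OF assms(2) that] pe[OF bt(1)[OF that(1)]] by simp
    show "a * w1 x + c * w2 x = 0" if "x \<notin> U" "x \<notin> (\<Union>T\<in>bt. skin \<Omega> \<T> T)" for x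
      using WhD(5)[OF assms(1) that] WhD(5)[OF assms(2) that] by simp
    show "a * w1 v + c * w2 v = 0" if "v \<in> mesh_vertices \<T>" "v \<in> frontier U" for v
      using WhD(6)[OF assms(1) that] WhD(6)[OF assms(2) that] by simp
  qed
qed

lemma Vh_lin: assumes "v1 \<in> Vh k \<T>" "v2 \<in> Vh k \<T>" shows "(\<lambda>x. a * v1 x + c * v2 x) \<in> Vh k \<T>"
proof -
  have p: "pw (\<lambda>x. a * v1 x + c * v2 x)" by (rule pw_diff_grad(1)[OF Vh_props(1)[OF assms(1)] Vh_props(1)[OF assms(2)]])
  then show ?thesis using assms unfolding Vh_def pw_def by (auto intro!: continuous_intros)
qed

text \<open>The indicator cuts off the bubbles, which as polynomials do not vanish off their
  triangle; continuity across edges survives by \<open>bub_other\<close>.\<close>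

definition bubs :: "((real^2) set \<Rightarrow> nat \<Rightarrow> real) \<Rightarrow> real^2 \<Rightarrow> real" where
  "bubs d x = (\<Sum>T\<in>bt. indicator T x * (\<Sum>i\<le>k-2. d T i * bb T i x))"

lemma bubs_Pk: "T \<in> bt \<Longrightarrow> (\<lambda>x. \<Sum>i\<le>k-2. d T i * bb T i x) \<in> Pk k"
  unfolding bb_def by (intro Pk_sum Pk_scale bub_Pk k2) auto

lemma bubs_eq: assumes "T \<in> \<T>" "x \<in> T"
  shows "bubs d x = (if T \<in> bt then \<Sum>i\<le>k-2. d T i * bb T i x else 0)"
proof -
  have "indicator T' x * (\<Sum>i\<le>k-2. d T' i * bb T' i x) = (if T' = T then \<Sum>i\<le>k-2. d T i * bb T i x else 0)" if T': "T' \<in> bt" for T'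
  proof (cases "T' = T \<or> x \<notin> T'")
    case True then show ?thesis using assms(2) by auto
  next
    case False
    then have "bb T' i x = 0" for i unfolding bb_def using bub_other[OF lab[OF T'] assms(1)] assms(2) by blast
    then show ?thesis using False by simp
  qed
  then have "bubs d x = (\<Sum>T'\<in>bt. if T' = T then \<Sum>i\<le>k-2. d T i * bb T i x else 0)" unfolding bubs_def by (intro sum.cong) auto
  then show ?thesis using bt(2) by (simp add: sum.delta)
qed

lemma bubs_good: "good (bubs d)" "T \<in> bt \<Longrightarrow> pol (bubs d) T = (\<lambda>x. \<Sum>i\<le>k-2. d T i * bb T i x)" "T \<in> \<T> \<Longrightarrow> T \<notin> bt \<Longrightarrow> pol (bubs d) T = (\<lambda>x. 0)"
proof -
  have p: "(\<lambda>x. if T \<in> bt then \<Sum>i\<le>k-2. d T i * bb T i x else 0) \<in> Pk k" for T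
    using bubs_Pk[of T d] Pk_const[of 0 k] by (cases "T \<in> bt") auto
  have pw: "pw (bubs d)" unfolding pw_def
  proof
    fix T assume T: "T \<in> \<T>"
    show "\<exists>p\<in>Pk k. \<forall>x\<in>T. bubs d x = p x" by (rule bexI[OF _ p[of T]]) (simp add: bubs_eq[OF T])
  qed
  have "continuous_on U (bubs d)"
  proof (rule continuous_on_closed_Union[of \<T> "\<lambda>T. T", simplified])
    show "finite \<T>" by (rule U(6))
    fix T assume T: "T \<in> \<T>"
    show "closed T" by (rule T_props(2)[OF T])
    show "continuous_on T (bubs d)"
      by (rule continuous_on_eq[OF Pk_continuous[OF p[of T]]]) (simp add: bubs_eq[OF T])
  qed
  then show "good (bubs d)" unfolding good_def using pw by blast
  show "T \<in> bt \<Longrightarrow> pol (bubs d) T = (\<lambda>x. \<Sum>i\<le>k-2. d T i * bb T i x)"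
    by (rule pol_unique[OF pw bt(1) bubs_Pk]) (simp_all add: bubs_eq[OF bt(1)])
  show "T \<in> \<T> \<Longrightarrow> T \<notin> bt \<Longrightarrow> pol (bubs d) T = (\<lambda>x. 0)"
    by (rule pol_unique[OF pw _ Pk_const]) (auto simp: bubs_eq)
qed

text \<open>A boundary point that is not a vertex is interior to an edge of its triangle. That edge
  then lies in the boundary as a whole, so it is the labelled one.\<close>

lemma frontier_cases:
  assumes x: "x \<in> frontier U"
  shows "(x \<in> mesh_vertices \<T>) \<or> (\<exists>T\<in>bt. \<exists>s. x \<in> T \<and> x = lA T + s *\<^sub>R (lB T - lA T))"
proof -
  have xU: "x \<in> U" using x U(2) by (simp add: frontier_def)
  then obtain T where T: "T \<in> \<T>" "x \<in> T" by blast
  obtain A B' C p q where t: "tri A B' C p q T" using tri_of[OF T(1)] by blast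
  have ni: "x \<notin> interior T" using x T interior_mono[of T U] by (auto simp: frontier_def)
  show ?thesis
  proof (cases "x \<in> {A, B', C}")
    case True
    then have "x extreme_point_of T" using tri_extreme[OF t] by blast
    then show ?thesis using T(1) unfolding mesh_vertices_def by blast
  next
    case False
    then have ne: "x \<noteq> A" "x \<noteq> B'" "x \<noteq> C" by auto
    obtain A' B'' C' p' q' where t': "tri A' B'' C' p' q' T" and c: "q' \<bullet> (x - A') = 0" "0 < p' \<bullet> (x - A')" "p' \<bullet> (x - A') < 1"
      using tri_boundary_point[OF t T(2) ni ne] .
    define s where "s = p' \<bullet> (x - A')"
    have xe: "A' + s *\<^sub>R (B'' - A') = x" using triD(5)[OF t', of x] c(1) by (simp add: s_def)
    have s01: "0 < s" "s < 1" using c by (auto simp: s_def)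
    have "closed_segment A' B'' \<subseteq> frontier U"
      by (rule tmesh_edge_frontier_whole[OF tm T(1) t' s01]) (simp add: xe x)
    then have be: "boundary_edge \<T> T (closed_segment A' B'')" unfolding boundary_edge_def using tri_edge_of[OF t'] by blast
    then have Tb: "T \<in> bt" unfolding boundary_triangles_def using T(1) by blast
    have "boundary_edge \<T> T (closed_segment (lA T) (lB T))"
      unfolding boundary_edge_def using tri_edge_of[OF labD(2)[OF Tb]] labD(3)[OF Tb] by blast
    then have "closed_segment A' B'' = closed_segment (lA T) (lB T)" using fitted_meshD(6)[OF fm T(1)] be by blast
    moreover have "x \<in> closed_segment A' B''" using tri_edge_point(2)[OF t' s01] rel_interior_subset xe by blast
    ultimately have "x \<in> closed_segment (lA T) (lB T)" by blast
    then obtain u where "x = (1 - u) *\<^sub>R lA T + u *\<^sub>R lB T" unfolding closed_segment_def by blast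
    then have "x = lA T + u *\<^sub>R (lB T - lA T)" by (simp add: algebra_simps)
    then show ?thesis using Tb T(2) by blast
  qed
qed

text \<open>Subtracting its bubble part on the boundary edges turns a trial function into a test function.\<close>

lemma Wh_to_Vh:
  assumes w: "w \<in> Wh k \<Omega> \<T>"
  shows "\<exists>v\<in>Vh k \<T>. en (\<lambda>x. 1 * w x + (-1) * v x) \<le> \<theta> * en w \<and> (\<forall>T\<in>\<T>. T \<notin> bt \<longrightarrow> (\<forall>x\<in>T. v x = w x))"
proof -
  note W = WhD[OF w]
  have pw: "pw w" and cw: "continuous_on U w" using W(1) good_def by auto
  define good_r where "good_r T r \<longleftrightarrow> (\<forall>s. pol w T (lA T + s *\<^sub>R (lB T - lA T)) = (\<Sum>i\<le>k-2. r i * bb T i (lA T + s *\<^sub>R (lB T - lA T)))) \<and>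
        (LINT x|lebesgue. indicator T x * (norm (grad (\<lambda>x. \<Sum>i\<le>k-2. r i * bb T i x) x))\<^sup>2) \<le> \<theta> * ET w T" for T r
  have "\<exists>r. good_r T r" if T: "T \<in> bt" for T
    unfolding good_r_def bb_def ET_def
  proof (rule corr[OF lab[OF T] polD(1)[OF pw bt(1)[OF T]]])
    show "pol w T (lA T) = 0" "pol w T (lB T) = 0" using W(3)[OF T] by auto
    fix j P assume j: "j \<in> {1..k-1}" and n: "nearest_intersection (frontier \<Omega>) (lC T) (lA T + (real j / real k) *\<^sub>R (lB T - lA T)) P"
    have "P = PP T j" using PP(2)[OF T j] n unfolding M_def by blast
    then show "pol w T P = 0" using W(4)[OF T j] by simp
  qed
  then have "\<forall>T\<in>bt. \<exists>r. good_r T r" by blast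
  from bchoice[OF this] obtain d where d0: "\<forall>T\<in>bt. good_r T (d T)" by (elim exE) (rule that)
  have d: "pol w T (lA T + s *\<^sub>R (lB T - lA T)) = (\<Sum>i\<le>k-2. d T i * bb T i (lA T + s *\<^sub>R (lB T - lA T)))"
    "(LINT x|lebesgue. indicator T x * (norm (grad (\<lambda>x. \<Sum>i\<le>k-2. d T i * bb T i x) x))\<^sup>2) \<le> \<theta> * ET w T" if "T \<in> bt" for T s
    using bspec[OF d0 that] unfolding good_r_def by auto
  define Q where "Q = bubs d"
  have gQ: "good Q" unfolding Q_def by (rule bubs_good)
  have pQ: "pw Q" "continuous_on U Q" using gQ good_def by auto
  \<comment> \<open>Setting \<open>v\<close> to zero off the mesh gives the representative required
    by \<open>Vh\<close> and discards the values of \<open>w\<close> on the skins.\<close>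
  define v where "v = (\<lambda>x. if x \<in> U then 1 * w x + (-1) * Q x else 0)"
  have g: "good (\<lambda>x. 1 * w x + (-1) * Q x)" by (rule good_lin[OF W(1) gQ])
  have vz: "v x = 0" if x: "x \<in> frontier U" for x
  proof -
    have xU: "x \<in> U" using x U(2) by (simp add: frontier_def)
    consider "x \<in> mesh_vertices \<T>" | T s where "T \<in> bt" "x \<in> T" "x = lA T + s *\<^sub>R (lB T - lA T)" using frontier_cases[OF x] by blast
    then show ?thesis
    proof cases
      case 2
      have "w x = (\<Sum>i\<le>k-2. d T i * bb T i x)" using polD(2)[OF pw bt(1)[OF 2(1)] 2(2)] d(1)[OF 2(1), of s] 2(3) by simp
      then show ?thesis using bubs_eq[OF bt(1)[OF 2(1)] 2(2), of d] 2(1) by (simp add: v_def Q_def)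
    next
      case 1
      have "w x = 0" by (rule W(6)[OF 1 x])
      moreover have "Q x = 0"
      proof -
        obtain T where T: "T \<in> \<T>" "x extreme_point_of T" using 1 unfolding mesh_vertices_def by blast
        have xT: "x \<in> T" using T(2) by (simp add: extreme_point_of_def)
        show ?thesis
        proof (cases "T \<in> bt")
          case True
          note t = labD(2)[OF True]
          have "x \<in> {lA T, lB T, lC T}" using tri_extreme[OF t] T(2) by blast
          then have "bb T i x = 0" for i unfolding bb_def bub_def using triD(1-4)[OF t] by auto
          then show ?thesis using bubs_eq[OF T(1) xT, of d] by (simp add: Q_def)
        next
          case False then show ?thesis using bubs_eq[OF T(1) xT, of d] by (simp add: Q_def)
        qed
      qed
      ultimately show ?thesis by (simp add: v_def)
    qed
  qed
  have vV: "v \<in> Vh k \<T>"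
  proof -
    have "continuous_on U v" by (rule continuous_on_eq[of U "\<lambda>x. 1 * w x + (-1) * Q x"]) (use g good_def v_def in auto)
    moreover have "\<exists>p\<in>Pk k. \<forall>x\<in>T. v x = p x" if T: "T \<in> \<T>" for T
    proof (rule bexI[of _ "pol (\<lambda>x. 1 * w x + (-1) * Q x) T"])
      have g': "pw (\<lambda>x. 1 * w x + (-1) * Q x)" using g good_def by blast
      show "pol (\<lambda>x. 1 * w x + (-1) * Q x) T \<in> Pk k" by (rule polD(1)[OF g' T])
      show "\<forall>x\<in>T. v x = pol (\<lambda>x. 1 * w x + (-1) * Q x) T x" using polD(2)[OF g' T] T unfolding v_def by auto
    qed
    ultimately show ?thesis unfolding Vh_def using vz by (auto simp: v_def)
  qed
  have e1: "en (\<lambda>x. 1 * w x + (-1) * v x) = en Q"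
    unfolding en_def
  proof (rule integral_cong_AE)
    have pv: "pw (\<lambda>x. 1 * w x + (-1) * v x)" by (rule pw_diff_grad(1)[OF pw Vh_props(1)[OF vV]])
    show "(\<lambda>x. indicator U x * (norm (grad (\<lambda>x. 1 * w x + (-1) * v x) x))\<^sup>2) \<in> borel_measurable lebesgue" using en_integrable[OF pv] by blast
    show "(\<lambda>x. indicator U x * (norm (grad Q x))\<^sup>2) \<in> borel_measurable lebesgue" using en_integrable[OF pQ(1)] by blast
    have "AE x in lebesgue. x \<in> U \<longrightarrow> grad (\<lambda>x. 1 * w x + (-1) * v x) x = grad Q x" by (rule grad_cong_U) (simp add: v_def)
    then show "AE x in lebesgue. indicator U x * (norm (grad (\<lambda>x. 1 * w x + (-1) * v x) x))\<^sup>2 = indicator U x * (norm (grad Q x))\<^sup>2"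
      by eventually_elim (auto simp: indicator_def)
  qed
  have "ET Q T \<le> \<theta> * ET w T" if T: "T \<in> \<T>" for T
  proof (cases "T \<in> bt")
    case True
    show ?thesis using d(2)[OF True] unfolding Q_def ET_def[of "bubs d"] bubs_good(2)[OF True] .
  next
    case False
    have "grad (\<lambda>x. 0) y = 0" for y by (rule grad_eq) (simp add: )
    then have "ET Q T = 0" unfolding Q_def ET_def bubs_good(3)[OF T False] by simp
    then show ?thesis using \<theta>(1) ET_nonneg[of w T] by simp
  qed
  then have "en Q \<le> \<theta> * en w" unfolding en_sum[OF pQ(1)] en_sum[OF pw] sum_distrib_left by (intro sum_mono)
  moreover have "v x = w x" if "T \<in> \<T>" "T \<notin> bt" "x \<in> T" for T x
    using bubs_eq[OF that(1,3), of d] that unfolding v_def Q_def by auto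
  ultimately show ?thesis using vV unfolding e1[symmetric] by blast
qed

lemma en_add_le: assumes "pw w" "pw v" shows "en (\<lambda>x. a * w x + c * v x) \<le> 2 * a\<^sup>2 * en w + 2 * c\<^sup>2 * en v"
proof -
  have "en (\<lambda>x. a * w x + c * v x) \<le> (LINT x|lebesgue. 2 * a\<^sup>2 * (indicator U x * (norm (grad w x))\<^sup>2) + 2 * c\<^sup>2 * (indicator U x * (norm (grad v x))\<^sup>2))"
    unfolding en_def
  proof (rule integral_mono_AE)
    show "integrable lebesgue (\<lambda>x. indicator U x * (norm (grad (\<lambda>x. a * w x + c * v x) x))\<^sup>2)" by (rule en_integrable[OF pw_diff_grad(1)[OF assms]])
    show "integrable lebesgue (\<lambda>x. 2 * a\<^sup>2 * (indicator U x * (norm (grad w x))\<^sup>2) + 2 * c\<^sup>2 * (indicator U x * (norm (grad v x))\<^sup>2))"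
      using en_integrable[OF assms(1)] en_integrable[OF assms(2)] by simp
    show "AE x in lebesgue. indicator U x * (norm (grad (\<lambda>x. a * w x + c * v x) x))\<^sup>2 \<le> 2 * a\<^sup>2 * (indicator U x * (norm (grad w x))\<^sup>2) + 2 * c\<^sup>2 * (indicator U x * (norm (grad v x))\<^sup>2)"
      using pw_diff_grad(2)[OF assms, of a c]
    proof eventually_elim
      case (elim x)
      have "(norm (a *\<^sub>R y + c *\<^sub>R z))\<^sup>2 \<le> 2 * a\<^sup>2 * (norm y)\<^sup>2 + 2 * c\<^sup>2 * (norm z)\<^sup>2" for y z :: "real^2"
      proof -
        have "(norm (a *\<^sub>R y + c *\<^sub>R z))\<^sup>2 \<le> (\<bar>a\<bar> * norm y + \<bar>c\<bar> * norm z)\<^sup>2"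
          using norm_triangle_ineq[of "a *\<^sub>R y" "c *\<^sub>R z"] by (intro power_mono) auto
        also have "\<dots> \<le> 2 * (\<bar>a\<bar> * norm y)\<^sup>2 + 2 * (\<bar>c\<bar> * norm z)\<^sup>2"
          using sum_squares_bound[of "\<bar>a\<bar> * norm y" "\<bar>c\<bar> * norm z"] by (simp add: power2_sum)
        finally show ?thesis by (simp add: power_mult_distrib)
      qed
      then show ?case using elim by (cases "x \<in> U") auto
    qed
  qed
  also have "\<dots> = 2 * a\<^sup>2 * en w + 2 * c\<^sup>2 * en v" unfolding en_def using en_integrable[OF assms(1)] en_integrable[OF assms(2)] by simp
  finally show ?thesis .
qed

text \<open>The energy of \<open>w\<close> is at most twice that of \<open>w - v\<close> plus twice
  that of \<open>v\<close>; as \<theta> \<le> 1/4, half of the left side absorbs the first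
  term.\<close>

lemma Wh_Vh_en:
  assumes w: "w \<in> Wh k \<Omega> \<T>" and v: "v \<in> Vh k \<T>" and le: "en (\<lambda>x. 1 * w x + (-1) * v x) \<le> \<theta> * en w"
  shows "en v \<ge> en w / 4"
proof -
  have p: "pw w" "pw v" using WhD(1)[OF w] Vh_props(1)[OF v] good_def by auto
  note pz = pw_diff_grad(1)[OF p, of 1 "-1"]
  have "en (\<lambda>x. 1 * (1 * w x + (-1) * v x) + 1 * v x) \<le> 2 * 1\<^sup>2 * en (\<lambda>x. 1 * w x + (-1) * v x) + 2 * 1\<^sup>2 * en v" by (rule en_add_le[OF pz p(2)])
  then have "en w \<le> 2 * en (\<lambda>x. 1 * w x + (-1) * v x) + 2 * en v" by simp
  moreover have "\<theta> * en w \<le> 1 / 4 * en w" by (rule mult_right_mono[OF \<theta>(2) en_nonneg])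
  ultimately show ?thesis using le by linarith
qed

text \<open>The test function attached to \<open>w\<close> has zero energy, hence vanishes, and it
  equals \<open>w\<close> on triangles without boundary edge. On a boundary triangle the polynomial
  is constant and zero at \<open>lA T\<close>, and the skin carries the same polynomial.\<close>

lemma Wh_en_pos: assumes w: "w \<in> Wh k \<Omega> \<T>" and z: "en w = 0" shows "w x = 0"
proof -
  note W = WhD[OF w]
  have pw: "pw w" using W(1) good_def by auto
  obtain v where v: "v \<in> Vh k \<T>" "en (\<lambda>x. 1 * w x + (-1) * v x) \<le> \<theta> * en w" "\<forall>T\<in>\<T>. T \<notin> bt \<longrightarrow> (\<forall>x\<in>T. v x = w x)"
    using Wh_to_Vh[OF w] by (elim bexE conjE) (rule that)
  have pv: "pw v" by (rule Vh_props(1)[OF v(1)])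
  have "en (\<lambda>x. 1 * w x + (-1) * (1 * w x + (-1) * v x)) \<le> 2 * 1\<^sup>2 * en w + 2 * (-1)\<^sup>2 * en (\<lambda>x. 1 * w x + (-1) * v x)"
    by (rule en_add_le[OF pw pw_diff_grad(1)[OF pw pv]])
  then have "en v \<le> 0" using v(2) z by simp
  then have v0: "v x = 0" for x using Vh_en_zero[OF v(1)] en_nonneg[of v] by simp
  have "(\<Sum>T\<in>\<T>. ET w T) = 0" using z en_sum[OF pw] by simp
  then have E0: "ET w T = 0" if "T \<in> \<T>" for T using sum_nonneg_eq_0_iff[OF U(6), of "ET w"] ET_nonneg that by blast
  have b0: "pol w T y = 0" if T: "T \<in> bt" for T y
    using ET_zero_const[OF pw bt(1)[OF T] E0[OF bt(1)[OF T]], of y "lA T"] W(3)[OF T] by simp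
  consider "x \<in> U" | T where "T \<in> bt" "x \<in> skin \<Omega> \<T> T" | "x \<notin> U" "x \<notin> (\<Union>T\<in>bt. skin \<Omega> \<T> T)" by blast
  then show ?thesis
  proof cases
    case 1
    then obtain T where T: "T \<in> \<T>" "x \<in> T" by blast
    then show ?thesis using b0 polD(2)[OF pw T] v(3) T v0 by (cases "T \<in> bt") auto
  next
    case 2 then show ?thesis using b0 W(2)[OF 2] by simp
  next
    case 3 then show ?thesis using W(5) by blast
  qed
qed

text \<open>With D and N the square roots of the energies of \<open>w\<close> and \<open>v\<close>:
  the form on the pair \<open>v\<close>, \<open>v\<close> is at least 3/4 \<nu> N^2, hence at least
  3/8 \<nu> D N because D \<le> 2 N. The difference \<open>w - v\<close> costs at most 1/8 \<nu> D
  N, which leaves 1/4 \<nu> D N.\<close>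

lemma inf_sup:
  assumes w: "w \<in> Wh k \<Omega> \<T>" and pos: "w \<noteq> (\<lambda>_. 0)"
  obtains v where "v \<in> Vh k \<T>" "v \<noteq> (\<lambda>_. 0)" "\<nu> / 4 * (sqrt (en w) * sqrt (en v)) \<le> a_h \<nu> b \<T> w v" "en w > 0" "en v > 0"
proof -
  have g: "good w" by (rule WhD(1)[OF w])
  have ew: "en w > 0" using Wh_en_pos[OF w] pos en_nonneg[of w] by (metis less_le ext)
  obtain v where v: "v \<in> Vh k \<T>" "en (\<lambda>x. 1 * w x + (-1) * v x) \<le> \<theta> * en w" using Wh_to_Vh[OF w] by (elim bexE conjE) (rule that)
  note gv = Vh_good[OF v(1)]
  have ge: "en v \<ge> en w / 4" by (rule Wh_Vh_en[OF w v])
  then have ev: "en v > 0" using ew by linarith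
  define D where "D = sqrt (en w)"
  define N where "N = sqrt (en v)"
  have D0: "D > 0" and N0: "N > 0" and NN: "N * N = en v" using ew ev by (auto simp: D_def N_def)
  have ND: "D / 2 \<le> N"
  proof -
    have "sqrt (en w / 4) \<le> sqrt (en v)" using ge by simp
    then show ?thesis unfolding D_def N_def by (simp add: real_sqrt_divide)
  qed
  let ?z = "\<lambda>x. 1 * w x + (-1) * v x"
  have gz: "good ?z" by (rule good_lin[OF g gv])
  have sz: "sqrt (en ?z) \<le> sqrt \<theta> * D" using real_sqrt_le_mono[OF v(2)] by (simp add: D_def real_sqrt_mult)
  have c0: "0 \<le> \<nu> + 3 * R * B" using \<nu> R0 B0 by simp
  have "\<bar>a_h \<nu> b \<T> ?z v\<bar> \<le> \<nu> * \<bar>gf ?z v\<bar> + \<bar>cf ?z v\<bar>"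
    unfolding a_h_split[OF gz gv] using abs_triangle_ineq[of "\<nu> * gf ?z v" "cf ?z v"] \<nu> by (simp add: abs_mult)
  also have "\<dots> \<le> \<nu> * (sqrt (en ?z) * N) + B * (3 * R) * (sqrt (en ?z) * N)"
    unfolding N_def using gf_bound[OF gz gv] cf_bound[OF gz v(1)] \<nu> by (intro add_mono mult_left_mono) auto
  also have "\<dots> = (\<nu> + 3 * R * B) * (sqrt (en ?z) * N)" by (simp add: algebra_simps)
  also have "\<dots> \<le> (\<nu> + 3 * R * B) * ((sqrt \<theta> * D) * N)" using sz c0 N0 by (intro mult_left_mono mult_right_mono) auto
  also have "\<dots> = ((\<nu> + 3 * R * B) * sqrt \<theta>) * (D * N)" by (simp add: mult_ac)
  also have "\<dots> \<le> \<nu> / 8 * (D * N)" using \<theta>(3) D0 N0 by (intro mult_right_mono) auto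
  finally have z: "\<bar>a_h \<nu> b \<T> ?z v\<bar> \<le> \<nu> / 8 * (D * N)" .
  have gg: "gf v v = en v" unfolding gf_def en_def by (simp add: power2_norm_eq_inner)
  have vv: "a_h \<nu> b \<T> v v \<ge> 3 * \<nu> / 4 * en v"
    unfolding a_h_split[OF gv gv] gg using conv[OF v(1)] by (simp add: field_simps abs_le_iff)
  have "a_h \<nu> b \<T> w v = a_h \<nu> b \<T> ?z v + a_h \<nu> b \<T> v v"
    using a_h_lin1[OF gz gv gv, of 1 1] by simp
  moreover have "3 * \<nu> / 4 * en v \<ge> 3 * \<nu> / 8 * (D * N)"
  proof -
    have "D / 2 * N \<le> N * N" using ND N0 by (intro mult_right_mono) auto
    then have "3 * \<nu> / 4 * (D / 2 * N) \<le> 3 * \<nu> / 4 * en v" unfolding NN[symmetric] using \<nu> by (intro mult_left_mono) auto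
    then show ?thesis by (simp add: mult_ac)
  qed
  moreover have "- (\<nu> / 8 * (D * N)) \<le> a_h \<nu> b \<T> ?z v" using z abs_ge_minus_self[of "a_h \<nu> b \<T> ?z v"] by linarith
  ultimately have "a_h \<nu> b \<T> w v \<ge> 3 * \<nu> / 8 * (D * N) - \<nu> / 8 * (D * N)" using vv by linarith
  then have "a_h \<nu> b \<T> w v \<ge> \<nu> / 4 * (D * N)" by (simp add: algebra_simps)
  moreover have "v \<noteq> (\<lambda>_. 0)"
  proof
    assume v0: "v = (\<lambda>_. 0)"
    have "grad (\<lambda>x. 0) y = 0" for y by (rule grad_eq) simp
    then have "en v = 0" unfolding en_def v0 by simp
    then show False using ev by simp
  qed
  ultimately show ?thesis using that[OF v(1) _ _ ew ev] unfolding D_def N_def by metis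
qed

end

section \<open>Unique solvability\<close>

text \<open>Gaussian elimination, with \<open>i0\<close> as the pivot unknown for the equation
  \<open>j\<close>.\<close>

lemma homogeneous_system:
  fixes a :: "'i \<Rightarrow> 'j \<Rightarrow> real"
  assumes "finite J" "finite I" "card J < card I"
  shows "\<exists>z. (\<exists>i\<in>I. z i \<noteq> 0) \<and> (\<forall>j\<in>J. (\<Sum>i\<in>I. z i * a i j) = 0)"
  using assms
proof (induction J arbitrary: I a rule: finite_induct)
  case empty
  then have "I \<noteq> {}" by auto
  then show ?case by (intro exI[of _ "\<lambda>_. 1"]) auto
next
  case (insert j J)
  show ?case
  proof (cases "\<forall>i\<in>I. a i j = 0")
    case True
    have "card J < card I" using insert by simp
    then obtain z where z: "\<exists>i\<in>I. z i \<noteq> 0" "\<forall>j\<in>J. (\<Sum>i\<in>I. z i * a i j) = 0" using insert.IH[OF insert.prems(1), of a] by blast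
    then show ?thesis using True by (intro exI[of _ z]) auto
  next
    case False
    then obtain i0 where i0: "i0 \<in> I" "a i0 j \<noteq> 0" by blast
    define I' where "I' = I - {i0}"
    have I': "finite I'" "i0 \<notin> I'" "I = insert i0 I'" "card J < card I'" using insert i0 by (auto simp: I'_def)
    obtain z' where z': "\<exists>i\<in>I'. z' i \<noteq> 0" "\<forall>l\<in>J. (\<Sum>i\<in>I'. z' i * (a i l - a i j / a i0 j * a i0 l)) = 0"
      using insert.IH[OF I'(1,4), of "\<lambda>i l. a i l - a i j / a i0 j * a i0 l"] by blast
    define m where "m = - (\<Sum>i\<in>I'. z' i * a i j) / a i0 j"
    define z where "z = z'(i0 := m)"
    have s: "(\<Sum>i\<in>I. z i * a i l) = m * a i0 l + (\<Sum>i\<in>I'. z' i * a i l)" for l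
    proof -
      have "(\<Sum>i\<in>I'. z i * a i l) = (\<Sum>i\<in>I'. z' i * a i l)" using I'(2) by (intro sum.cong) (auto simp: z_def)
      then show ?thesis using I'(1,2) by (simp add: I'(3) z_def)
    qed
    have "(\<Sum>i\<in>I. z i * a i l) = 0" if l: "l \<in> J" for l
    proof -
      have "0 = (\<Sum>i\<in>I'. z' i * a i l) - (\<Sum>i\<in>I'. z' i * a i j) / a i0 j * a i0 l"
        using bspec[OF z'(2) l] by (simp add: right_diff_distrib sum_subtractf sum_divide_distrib sum_distrib_right mult.assoc)
      then show ?thesis unfolding s m_def by simp
    qed
    moreover have "(\<Sum>i\<in>I. z i * a i j) = 0" unfolding s m_def using i0(2) by simp
    moreover have "\<exists>i\<in>I. z i \<noteq> 0" using z'(1) I'(2,3) by (auto simp: z_def)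
    ultimately show ?thesis by (intro exI[of _ z]) auto
  qed
qed

text \<open>The right-hand side becomes one more unknown, \<open>None\<close>, with coefficients
  \<open>- r j\<close>; then there are fewer equations than unknowns, whatever the matrix
  is.\<close>

lemma square_system:
  fixes a :: "'i \<Rightarrow> 'i \<Rightarrow> real"
  assumes "finite J"
  shows "\<exists>z t. (t \<noteq> 0 \<or> (\<exists>i\<in>J. z i \<noteq> 0)) \<and> (\<forall>j\<in>J. (\<Sum>i\<in>J. z i * a i j) = t * r j)"
proof -
  let ?I = "insert None (Some ` J)"
  define A where "A = (\<lambda>i j. case i of None \<Rightarrow> - r j | Some i \<Rightarrow> a i j)"
  have "card J < card ?I" using assms by (simp add: card_image)
  then obtain y where y: "\<exists>i\<in>?I. y i \<noteq> 0" "\<forall>j\<in>J. (\<Sum>i\<in>?I. y i * A i j) = 0"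
    using homogeneous_system[OF assms, of ?I A] assms by blast
  have "(\<Sum>i\<in>?I. y i * A i j) = - y None * r j + (\<Sum>i\<in>J. y (Some i) * a i j)" for j
    using assms by (simp add: sum.reindex A_def)
  then have "\<forall>j\<in>J. (\<Sum>i\<in>J. y (Some i) * a i j) = y None * r j" using y(2) by simp
  then show ?thesis using y(1) by (intro exI[of _ "\<lambda>i. y (Some i)"] exI[of _ "y None"]) auto
qed

text \<open>A maximal independent subset spans. It exists because independent subsets have at most
  \<open>card E\<close> members, by \<open>homogeneous_system\<close>.\<close>

lemma finite_function_basis:
  fixes V :: "('a \<Rightarrow> real) set" and \<phi> :: "'e \<Rightarrow> 'a \<Rightarrow> real"
  assumes E: "finite E" and V: "\<And>v. v \<in> V \<Longrightarrow> \<exists>c. \<forall>x. v x = (\<Sum>e\<in>E. c e * \<phi> e x)"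
  shows "\<exists>B\<subseteq>V. finite B \<and> (\<forall>v\<in>V. \<exists>c. \<forall>x. v x = (\<Sum>f\<in>B. c f * f x)) \<and>
    (\<forall>c. (\<forall>x. (\<Sum>f\<in>B. c f * f x) = 0) \<longrightarrow> (\<forall>f\<in>B. c f = 0))"
proof -
  define ind where "ind B \<longleftrightarrow> (\<forall>c. (\<forall>x. (\<Sum>f\<in>B. c f * f x) = 0) \<longrightarrow> (\<forall>f\<in>B. c f = 0))" for B :: "('a \<Rightarrow> real) set"
  define P where "P B \<longleftrightarrow> B \<subseteq> V \<and> finite B \<and> ind B" for B
  have bound: "card B \<le> card E" if B: "P B" for B
  proof (rule ccontr)
    assume "\<not> ?thesis"
    then have less: "card E < card B" by simp
    have "\<forall>f\<in>B. \<exists>c. \<forall>x. f x = (\<Sum>e\<in>E. c e * \<phi> e x)" using V B unfolding P_def by blast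
    from bchoice[OF this] obtain C where C: "\<And>f x. f \<in> B \<Longrightarrow> f x = (\<Sum>e\<in>E. C f e * \<phi> e x)" by blast
    obtain z where z: "\<exists>f\<in>B. z f \<noteq> 0" "\<forall>e\<in>E. (\<Sum>f\<in>B. z f * C f e) = 0"
      using homogeneous_system[OF E _ less, of C] B P_def by blast
    have "(\<Sum>f\<in>B. z f * f x) = 0" for x
    proof -
      have "(\<Sum>f\<in>B. z f * f x) = (\<Sum>f\<in>B. \<Sum>e\<in>E. z f * C f e * \<phi> e x)"
        by (intro sum.cong refl) (simp add: C sum_distrib_left mult.assoc)
      also have "\<dots> = (\<Sum>e\<in>E. (\<Sum>f\<in>B. z f * C f e) * \<phi> e x)"
        by (subst sum.swap) (simp add: sum_distrib_right)
      finally show ?thesis using z(2) by simp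
    qed
    then show False using z(1) B unfolding P_def ind_def by blast
  qed
  have "P {}" unfolding P_def ind_def by simp
  then obtain B where B: "P B" "\<And>B'. P B' \<Longrightarrow> card B' \<le> card B"
    using ex_has_greatest_nat[of P "{}" card "Suc (card E)"] bound by (metis le_imp_less_Suc)
  have fB: "finite B" "B \<subseteq> V" "ind B" using B(1) P_def by auto
  have "\<exists>c. \<forall>x. v x = (\<Sum>f\<in>B. c f * f x)" if v: "v \<in> V" for v
  proof (cases "v \<in> B")
    case True
    have "(\<Sum>f\<in>B. (if f = v then 1 else 0) * f x) = v x" for x
    proof -
      have "(\<Sum>f\<in>B. (if f = v then 1 else 0) * f x) = (\<Sum>f\<in>B. if f = v then v x else 0)" by (intro sum.cong) auto
      then show ?thesis using fB(1) True by simp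
    qed
    then show ?thesis by (intro exI[of _ "\<lambda>f. if f = v then 1 else 0"]) simp
  next
    case False
    have "\<not> P (insert v B)" using B(2)[of "insert v B"] fB(1) False by auto
    then have "\<not> ind (insert v B)" unfolding P_def using fB v by blast
    then obtain c g where c: "\<And>x. (\<Sum>f\<in>insert v B. c f * f x) = 0" "g \<in> insert v B" "c g \<noteq> 0" unfolding ind_def by blast
    have c1: "c v * v x + (\<Sum>f\<in>B. c f * f x) = 0" for x using c(1)[of x] fB(1) False by simp
    have cv: "c v \<noteq> 0"
    proof
      assume "c v = 0"
      then have "\<forall>f\<in>B. c f = 0" using c1 fB(3) unfolding ind_def by simp
      then show False using c(2,3) \<open>c v = 0\<close> by auto
    qed
    have "v x = (\<Sum>f\<in>B. (- c f / c v) * f x)" for x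
    proof -
      have "(\<Sum>f\<in>B. (- c f / c v) * f x) = - (\<Sum>f\<in>B. c f * f x) / c v" by (simp add: sum_divide_distrib sum_negf)
      moreover have "v x = - m / c v" if "c v * v x + m = 0" for m
      proof -
        have "v x * c v = - m" using that by (simp add: eq_neg_iff_add_eq_0 mult.commute)
        then show ?thesis unfolding nonzero_eq_divide_eq[OF cv] .
      qed
      ultimately show ?thesis using c1[of x] by metis
    qed
    then show ?thesis by (intro exI[of _ "\<lambda>f. - c f / c v"]) simp
  qed
  then show ?thesis using fB unfolding ind_def by blast
qed

context fe_geo
begin

lemma Vh_basis:
  obtains \<B> where "\<B> \<subseteq> Vh k \<T>" "finite \<B>" "\<And>v. v \<in> Vh k \<T> \<Longrightarrow> \<exists>c. \<forall>x. v x = (\<Sum>f\<in>\<B>. c f * f x)"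
    "\<And>c f. (\<And>x. (\<Sum>f\<in>\<B>. c f * f x) = 0) \<Longrightarrow> f \<in> \<B> \<Longrightarrow> c f = (0::real)"
proof -
  \<comment> \<open>One fixed triangle for each point of the mesh, so that monomials localised to
    different triangles have disjoint supports.\<close>
  define \<tau> where "\<tau> x = (SOME T. T \<in> \<T> \<and> x \<in> T)" for x
  have \<tau>: "\<tau> x \<in> \<T>" "x \<in> \<tau> x" if "x \<in> U" for x
    using someI_ex[of "\<lambda>T. T \<in> \<T> \<and> x \<in> T"] that unfolding \<tau>_def by auto
  define S where "S = (SIGMA i:{..k}. {..k - i})"
  \<comment> \<open>These localised monomials need not belong to \<open>Vh\<close>; they serve to
    bound the number of independent functions in it.\<close>
  define \<phi> where "\<phi> = (\<lambda>(T, i, j) x. if x \<in> U \<and> \<tau> x = T then (x $ 1) ^ i * (x $ 2) ^ j else (0::real))"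
  have coeffs: "\<exists>c. \<forall>x. v x = (\<Sum>e\<in>\<T> \<times> S. c e * \<phi> e x)" if v: "v \<in> Vh k \<T>" for v
  proof -
    have "\<forall>T\<in>\<T>. \<exists>c. \<forall>x\<in>T. v x = (\<Sum>i\<le>k. \<Sum>j\<le>k-i. c i j * (x $ 1) ^ i * (x $ 2) ^ j)"
    proof
      fix T assume T: "T \<in> \<T>"
      obtain p where p: "p \<in> Pk k" "\<forall>x\<in>T. v x = p x" using v T unfolding Vh_def by blast
      then show "\<exists>c. \<forall>x\<in>T. v x = (\<Sum>i\<le>k. \<Sum>j\<le>k-i. c i j * (x $ 1) ^ i * (x $ 2) ^ j)" unfolding Pk_def by fastforce
    qed
    from bchoice[OF this] obtain C where C: "\<And>T x. T \<in> \<T> \<Longrightarrow> x \<in> T \<Longrightarrow> v x = (\<Sum>i\<le>k. \<Sum>j\<le>k-i. C T i j * (x $ 1) ^ i * (x $ 2) ^ j)" by blast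
    have "v x = (\<Sum>e\<in>\<T> \<times> S. (case e of (T, i, j) \<Rightarrow> C T i j) * \<phi> e x)" for x
    proof -
      have "(\<Sum>e\<in>\<T> \<times> S. (case e of (T, i, j) \<Rightarrow> C T i j) * \<phi> e x) = (\<Sum>T\<in>\<T>. \<Sum>e\<in>S. (case e of (i, j) \<Rightarrow> C T i j) * \<phi> (T, e) x)"
        by (subst sum.cartesian_product) (intro sum.cong, auto)
      also have "\<dots> = (\<Sum>T\<in>\<T>. if T = \<tau> x then (if x \<in> U then v x else 0) else 0)"
      proof (rule sum.cong[OF refl])
        fix T assume T: "T \<in> \<T>"
        show "(\<Sum>e\<in>S. (case e of (i, j) \<Rightarrow> C T i j) * \<phi> (T, e) x) = (if T = \<tau> x then (if x \<in> U then v x else 0) else 0)"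
        proof (cases "x \<in> U \<and> \<tau> x = T")
          case True
          then have xT: "x \<in> T" using \<tau>(2) by blast
          have "(\<Sum>e\<in>S. (case e of (i, j) \<Rightarrow> C T i j) * \<phi> (T, e) x) = (\<Sum>(i, j)\<in>S. C T i j * (x $ 1) ^ i * (x $ 2) ^ j)"
          proof (rule sum.cong[OF refl])
            fix e assume "e \<in> S"
            obtain i j where e: "e = (i, j)" by force
            have "\<phi> (T, e) x = (x $ 1) ^ i * (x $ 2) ^ j" unfolding \<phi>_def e prod.case using True by (rule if_P)
            then show "(case e of (i, j) \<Rightarrow> C T i j) * \<phi> (T, e) x = (case e of (i, j) \<Rightarrow> C T i j * (x $ 1) ^ i * (x $ 2) ^ j)"
              by (simp add: e mult.assoc)
          qed
          also have "\<dots> = v x" unfolding S_def C[OF T xT] by (rule sum.Sigma[symmetric]) auto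
          finally show ?thesis using True by simp
        next
          case False
          then have z: "\<phi> (T, e) x = 0" for e unfolding \<phi>_def by (cases e) (simp only: prod.case if_False)
          have "(if T = \<tau> x then (if x \<in> U then v x else 0) else 0) = 0" using False by presburger
          then show ?thesis unfolding z by simp
        qed
      qed
      also have "\<dots> = (if \<tau> x \<in> \<T> then (if x \<in> U then v x else 0) else 0)" by (rule sum.delta'[OF U(6), of "\<tau> x" "\<lambda>_. if x \<in> U then v x else 0", simplified eq_commute[of "\<tau> x"]])
      also have "\<dots> = v x" using \<tau>(1)[of x] Vh_props(4)[OF v, of x] by (cases "x \<in> U") simp_all
      finally show ?thesis by (rule sym)
    qed
    then show ?thesis by blast
  qed
  have fin: "finite (\<T> \<times> S)" using U(6) unfolding S_def by auto
  have "\<exists>\<B>\<subseteq>Vh k \<T>. finite \<B> \<and> (\<forall>v\<in>Vh k \<T>. \<exists>c. \<forall>x. v x = (\<Sum>f\<in>\<B>. c f * f x)) \<and>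
    (\<forall>c. (\<forall>x. (\<Sum>f\<in>\<B>. c f * f x) = 0) \<longrightarrow> (\<forall>f\<in>\<B>. c f = 0))"
    by (rule finite_function_basis[OF fin]) (rule coeffs)
  then obtain \<B> where B: "\<B> \<subseteq> Vh k \<T>" "finite \<B>" "\<forall>v\<in>Vh k \<T>. \<exists>c. \<forall>x. v x = (\<Sum>f\<in>\<B>. c f * f x)"
    "\<forall>c. (\<forall>x. (\<Sum>f\<in>\<B>. c f * f x) = 0) \<longrightarrow> (\<forall>f\<in>\<B>. c f = 0)"
    by (elim exE conjE) (rule that)
  show ?thesis
  proof (rule that[OF B(1,2)])
    show "\<exists>c. \<forall>x. v x = (\<Sum>f\<in>\<B>. c f * f x)" if "v \<in> Vh k \<T>" for v using B(3) that by blast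
    show "c f = 0" if "\<And>x. (\<Sum>f\<in>\<B>. c f * f x) = 0" "f \<in> \<B>" for c f using B(4) that by blast
  qed
qed

lemma good_zero: "good (\<lambda>x. 0)"
  unfolding good_def pw_def using Pk_const[of 0 k] by auto

lemma good_sum:
  assumes "finite J" "\<And>i. i \<in> J \<Longrightarrow> good (\<phi> i)"
  shows "good (\<lambda>x. \<Sum>i\<in>J. z i * \<phi> i x) \<and> (\<forall>T\<in>\<T>. \<forall>x. pol (\<lambda>x. \<Sum>i\<in>J. z i * \<phi> i x) T x = (\<Sum>i\<in>J. z i * pol (\<phi> i) T x)) \<and>
    (\<forall>v. good v \<longrightarrow> a_h \<nu> b \<T> (\<lambda>x. \<Sum>i\<in>J. z i * \<phi> i x) v = (\<Sum>i\<in>J. z i * a_h \<nu> b \<T> (\<phi> i) v))"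
  using assms
proof (induction J rule: finite_induct)
  case empty
  have "pol (\<lambda>x. 0) T = (\<lambda>x. 0)" if "T \<in> \<T>" for T
    by (rule pol_unique[OF _ that Pk_const]) (use good_zero good_def in auto)
  moreover have "a_h \<nu> b \<T> (\<lambda>x. 0) v = 0" if "good v" for v
    using a_h_lin1[OF good_zero good_zero that, of 0 0] by simp
  ultimately show ?case using good_zero by simp
next
  case (insert i J)
  let ?s = "\<lambda>x. \<Sum>i\<in>J. z i * \<phi> i x"
  have IH: "good ?s" "\<And>T x. T \<in> \<T> \<Longrightarrow> pol ?s T x = (\<Sum>i\<in>J. z i * pol (\<phi> i) T x)"
    "\<And>v. good v \<Longrightarrow> a_h \<nu> b \<T> ?s v = (\<Sum>i\<in>J. z i * a_h \<nu> b \<T> (\<phi> i) v)" using insert by auto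
  have gi: "good (\<phi> i)" using insert by simp
  have e: "(\<lambda>x. \<Sum>i\<in>insert i J. z i * \<phi> i x) = (\<lambda>x. z i * \<phi> i x + 1 * ?s x)" using insert by simp
  have g: "good (\<lambda>x. z i * \<phi> i x + 1 * ?s x)" by (rule good_lin[OF gi IH(1)])
  have p: "pw (\<phi> i)" "pw ?s" "pw (\<lambda>x. z i * \<phi> i x + 1 * ?s x)" using g gi IH(1) good_def by auto
  have "pol (\<lambda>x. z i * \<phi> i x + 1 * ?s x) T = (\<lambda>x. z i * pol (\<phi> i) T x + 1 * pol ?s T x)" if T: "T \<in> \<T>" for T
  proof (rule pol_unique[OF p(3) T])
    show "(\<lambda>x. z i * pol (\<phi> i) T x + 1 * pol ?s T x) \<in> Pk k" by (intro Pk_add Pk_scale polD p T)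
    show "z i * \<phi> i x + 1 * ?s x = z i * pol (\<phi> i) T x + 1 * pol ?s T x" if "x \<in> T" for x
      unfolding polD(2)[OF p(1) T that] polD(2)[OF p(2) T that] ..
  qed
  then show ?case unfolding e using g IH(2,3) insert.hyps a_h_lin1[OF gi IH(1), of _ "z i" 1] by simp
qed

text \<open>Turns a function on the mesh into the representative required by \<open>Wh\<close>. By
  \<open>g2\<close> a point off the mesh lies in at most one skin, so the choice of \<open>T\<close>
  is unambiguous; on the mesh \<open>g1\<close> makes the two descriptions agree.\<close>

definition ext :: "(real^2 \<Rightarrow> real) \<Rightarrow> real^2 \<Rightarrow> real" where
  "ext s x = (if x \<in> U then s x else if \<exists>T\<in>bt. x \<in> skin \<Omega> \<T> T then pol s (SOME T. T \<in> bt \<and> x \<in> skin \<Omega> \<T> T) x else 0)"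

lemma ext_U: "x \<in> U \<Longrightarrow> ext s x = s x" unfolding ext_def by (rule if_P)

lemma ext_skin: assumes "good s" "T \<in> bt" "x \<in> skin \<Omega> \<T> T" shows "ext s x = pol s T x"
proof (cases "x \<in> U")
  case True
  then have "x \<in> T" using g1[OF assms(2)] assms(3) by blast
  then show ?thesis using polD(2)[of s T x] bt(1)[OF assms(2)] assms(1) good_def ext_U[OF True] by simp
next
  case False
  have "(SOME T. T \<in> bt \<and> x \<in> skin \<Omega> \<T> T) = T"
  proof (rule some_equality)
    show "T \<in> bt \<and> x \<in> skin \<Omega> \<T> T" using assms by blast
    fix T' assume T': "T' \<in> bt \<and> x \<in> skin \<Omega> \<T> T'"
    show "T' = T" using g2[of T' T] T' assms(2,3) False by blast
  qed
  moreover have "\<exists>T\<in>bt. x \<in> skin \<Omega> \<T> T" using assms by blast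
  ultimately show ?thesis unfolding ext_def using False by presburger
qed

lemma ext_good: assumes "good s" shows "good (ext s)" "T \<in> \<T> \<Longrightarrow> pol (ext s) T = pol s T"
proof -
  have s: "pw s" "continuous_on U s" using assms good_def by auto
  have e: "ext s x = pol s T x" if "T \<in> \<T>" "x \<in> T" for T x
    using ext_U[of x s] polD(2)[OF s(1) that] that by (metis UnionI)
  have pw: "pw (ext s)" unfolding pw_def using e polD(1)[OF s(1)] by blast
  moreover have "continuous_on U (ext s)" by (rule continuous_on_eq[OF s(2)]) (simp only: ext_U)
  ultimately show "good (ext s)" unfolding good_def by blast
  show "pol (ext s) T = pol s T" if T: "T \<in> \<T>" by (rule pol_unique[OF pw T polD(1)[OF s(1) T] e[OF T]])
qed

lemma Wh_zeroI:
  assumes w: "w \<in> Wh k \<Omega> \<T>" and z: "\<And>v. v \<in> Vh k \<T> \<Longrightarrow> a_h \<nu> b \<T> w v = 0"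
  shows "w = (\<lambda>_. 0)"
proof (rule ccontr)
  assume n: "w \<noteq> (\<lambda>_. 0)"
  obtain v where v: "v \<in> Vh k \<T>" "v \<noteq> (\<lambda>_. 0)" "\<nu> / 4 * (sqrt (en w) * sqrt (en v)) \<le> a_h \<nu> b \<T> w v" "en w > 0" "en v > 0"
    by (rule inf_sup[OF w n])
  have "0 < \<nu> / 4 * (sqrt (en w) * sqrt (en v))" using \<nu> v(4,5) by simp
  then show False using v(3) z[OF v(1)] by simp
qed

text \<open>Divided by s(1 - s), the sum becomes a polynomial in s that vanishes on an
  interval.\<close>

lemma bubble_coeffs_zero:
  assumes T: "T \<in> bt" and z: "\<And>s. 0 < s \<Longrightarrow> s < 1 \<Longrightarrow> (\<Sum>i\<le>k-2. c i * bb T i (lA T + s *\<^sub>R (lB T - lA T))) = 0" and i: "i \<le> k - 2"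
  shows "c i = 0"
proof (rule ccontr)
  assume "c i \<noteq> 0"
  then have "finite {s. (\<Sum>i\<le>k-2. c i * s ^ i) = 0}" by (rule polyfun_roots_finite[OF _ i])
  moreover have "{0<..<1::real} \<subseteq> {s. (\<Sum>i\<le>k-2. c i * s ^ i) = 0}"
  proof
    fix s :: real assume s: "s \<in> {0<..<1}"
    have "(\<Sum>i\<le>k-2. c i * bb T i (lA T + s *\<^sub>R (lB T - lA T))) = (\<Sum>i\<le>k-2. (s * (1 - s)) * (c i * s ^ i))"
      unfolding bb_def bub_edge(1)[OF labD(2)[OF T]] by (intro sum.cong) auto
    also have "\<dots> = (s * (1 - s)) * (\<Sum>i\<le>k-2. c i * s ^ i)" by (simp only: sum_distrib_left)
    finally show "s \<in> {s. (\<Sum>i\<le>k-2. c i * s ^ i) = 0}" using z[of s] s by simp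
  qed
  ultimately have "finite {0<..<1::real}" by (rule finite_subset[rotated])
  then show False using infinite_Ioo[of 0 "1::real"] by simp
qed

lemma solvable:
  assumes Flin: "\<And>v1 v2 a c. v1 \<in> Vh k \<T> \<Longrightarrow> v2 \<in> Vh k \<T> \<Longrightarrow> F (\<lambda>x. a * v1 x + c * v2 x) = a * F v1 + c * F v2"
  shows "\<exists>!u. u \<in> Wh k \<Omega> \<T> \<and> (\<forall>v\<in>Vh k \<T>. a_h \<nu> b \<T> u v = F v)"
proof -
  obtain \<B> where B: "\<B> \<subseteq> Vh k \<T>" "finite \<B>" "\<And>v. v \<in> Vh k \<T> \<Longrightarrow> \<exists>c. \<forall>x. v x = (\<Sum>f\<in>\<B>. c f * f x)"
    "\<And>c f. (\<And>x. (\<Sum>f\<in>\<B>. c f * f x) = 0) \<Longrightarrow> f \<in> \<B> \<Longrightarrow> c f = (0::real)" by (rule Vh_basis) blast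
  have span: "G v = 0" if v: "v \<in> Vh k \<T>" and Glin: "\<And>v1 v2 a c. v1 \<in> Vh k \<T> \<Longrightarrow> v2 \<in> Vh k \<T> \<Longrightarrow> G (\<lambda>x. a * v1 x + c * v2 x) = a * G v1 + c * G v2"
    and G0: "\<And>f. f \<in> \<B> \<Longrightarrow> G f = (0::real)" for G :: "(real^2 \<Rightarrow> real) \<Rightarrow> real" and v
  proof -
    have zV: "(\<lambda>x. 0) \<in> Vh k \<T>" using Vh_lin[OF v v, of 0 0] by simp
    obtain c where c: "\<And>x. v x = (\<Sum>f\<in>\<B>. c f * f x)" using B(3)[OF v] by blast
    have "(\<lambda>x. \<Sum>f\<in>S. c f * f x) \<in> Vh k \<T> \<and> G (\<lambda>x. \<Sum>f\<in>S. c f * f x) = 0" if "finite S" "S \<subseteq> \<B>" for S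
      using that
    proof (induction S rule: finite_induct)
      case empty
      then show ?case using zV Glin[OF zV zV, of 0 0] by simp
    next
      case (insert f S)
      have fV: "f \<in> Vh k \<T>" "G f = 0" using insert.prems B(1) G0 by auto
      let ?s = "\<lambda>x. \<Sum>f\<in>S. c f * f x"
      have IH: "?s \<in> Vh k \<T>" "G ?s = 0" using insert by auto
      have e: "(\<lambda>x. \<Sum>f\<in>insert f S. c f * f x) = (\<lambda>x. c f * f x + 1 * ?s x)" using insert.hyps by simp
      show ?case unfolding e using Vh_lin[OF fV(1) IH(1), of "c f" 1] Glin[OF fV(1) IH(1), of "c f" 1] fV(2) IH(2) by simp
    qed
    then have "G (\<lambda>x. \<Sum>f\<in>\<B>. c f * f x) = 0" using B(2) by blast
    then show ?thesis unfolding c[symmetric] .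
  qed
  define K where "K = bt \<times> {..k-2}"
  have fK: "finite K" unfolding K_def using bt(2) by simp
  \<comment> \<open>One index set for unknowns and equations: a basis function of \<open>Vh\<close>
    goes with its test equation, a bubble with a node condition on the same triangle.\<close>
  define J where "J = \<B> <+> K"
  have fJ: "finite J" unfolding J_def using B(2) fK by simp
  define \<psi> where "\<psi> = (\<lambda>(T, i). bubs (\<lambda>T' i'. if T' = T \<and> i' = i then 1 else 0))"
  define \<phi> where "\<phi> = case_sum (\<lambda>f. f) \<psi>"
  have g\<phi>: "good (\<phi> i)" if "i \<in> J" for i
    using that B(1) Vh_good bubs_good(1) unfolding J_def \<phi>_def \<psi>_def by (auto split: prod.split)
  \<comment> \<open>Bubbles are numbered from 0 to \<open>k - 2\<close> and nodes from 1 to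
    \<open>k - 1\<close>, hence \<open>Suc l\<close>.\<close>
  define a where "a i j = (case j of Inl f \<Rightarrow> a_h \<nu> b \<T> (\<phi> i) f | Inr (T, l) \<Rightarrow> pol (\<phi> i) T (PP T (Suc l)))" for i j
  define r where "r j = (case j of Inl f \<Rightarrow> F f | Inr _ \<Rightarrow> 0)" for j :: "(real^2 \<Rightarrow> real) + ((real^2) set \<times> nat)"
  obtain z t where zt: "t \<noteq> 0 \<or> (\<exists>i\<in>J. z i \<noteq> 0)" "\<forall>j\<in>J. (\<Sum>i\<in>J. z i * a i j) = t * r j"
    using square_system[OF fJ, of a r] by (elim exE conjE) (rule that)
  define s where "s = (\<lambda>x. \<Sum>i\<in>J. z i * \<phi> i x)"
  have s: "good s" "\<And>T x. T \<in> \<T> \<Longrightarrow> pol s T x = (\<Sum>i\<in>J. z i * pol (\<phi> i) T x)"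
    "\<And>v. good v \<Longrightarrow> a_h \<nu> b \<T> s v = (\<Sum>i\<in>J. z i * a_h \<nu> b \<T> (\<phi> i) v)"
    using good_sum[OF fJ g\<phi>, where z=z] unfolding s_def by auto
  have \<psi>_at: "\<psi> (T', i) x = (if T' = T then bb T i x else 0)" if "T \<in> bt" "x \<in> T" "i \<le> k - 2" for T T' i x
  proof -
    have "\<psi> (T', i) x = (\<Sum>i'\<le>k-2. (if T = T' \<and> i' = i then 1 else 0) * bb T i' x)"
      unfolding \<psi>_def prod.case bubs_eq[OF bt(1)[OF that(1)] that(2)] using that(1) by simp
    also have "\<dots> = (\<Sum>i'\<le>k-2. if i' = i then (if T' = T then bb T i x else 0) else 0)" by (intro sum.cong) auto
    finally show ?thesis using that(3) by simp
  qed
  have s_split: "s x = (\<Sum>f\<in>\<B>. z (Inl f) * f x) + (\<Sum>q\<in>K. z (Inr q) * \<psi> q x)" for x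
    unfolding s_def J_def using B(2) fK by (simp add: sum.Plus \<phi>_def)
  have s_bt: "(\<Sum>q\<in>K. z (Inr q) * \<psi> q x) = (\<Sum>i\<le>k-2. z (Inr (T, i)) * bb T i x)" if "T \<in> bt" "x \<in> T" for T x
  proof -
    have "(\<Sum>q\<in>K. z (Inr q) * \<psi> q x) = (\<Sum>T'\<in>bt. \<Sum>i\<le>k-2. z (Inr (T', i)) * \<psi> (T', i) x)"
      unfolding K_def by (subst sum.cartesian_product) (intro sum.cong, auto)
    also have "\<dots> = (\<Sum>T'\<in>bt. if T' = T then (\<Sum>i\<le>k-2. z (Inr (T, i)) * bb T i x) else 0)"
      by (intro sum.cong refl) (simp add: \<psi>_at[OF that])
    finally show ?thesis using bt(2) that(1) by simp
  qed
  \<comment> \<open>On the boundary of the mesh only the bubbles contribute to \<open>s\<close>;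
    this isolates their coefficients below.\<close>
  have sumB0: "(\<Sum>f\<in>\<B>. z (Inl f) * f x) = 0" if x: "x \<in> frontier U \<or> x \<notin> U" for x
  proof (rule sum.neutral, rule ballI)
    fix f assume "f \<in> \<B>"
    then have f: "f \<in> Vh k \<T>" using B(1) by blast
    have "f x = 0" using x Vh_props(3)[OF f, of x] Vh_props(4)[OF f, of x] by argo
    then show "z (Inl f) * f x = 0" by simp
  qed
  define u where "u = ext s"
  have gu: "good u" unfolding u_def by (rule ext_good(1)[OF s(1)])
  have uW: "u \<in> Wh k \<Omega> \<T>"
  proof (rule WhI[OF gu])
    show "u x = pol u T x" if "T \<in> bt" "x \<in> skin \<Omega> \<T> T" for T x
      unfolding u_def ext_good(2)[OF s(1) bt(1)[OF that(1)]] by (rule ext_skin[OF s(1) that])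
    show "pol u T (PP T j) = 0" if T: "T \<in> bt" and j: "j \<in> {1..k-1}" for T j
    proof -
      have m: "Inr (T, j - 1) \<in> J" and jj: "Suc (j - 1) = j" using T j unfolding J_def K_def by auto
      have "(\<Sum>i\<in>J. z i * pol (\<phi> i) T (PP T j)) = 0" using bspec[OF zt(2) m] jj by (simp add: a_def r_def)
      then show ?thesis unfolding u_def ext_good(2)[OF s(1) bt(1)[OF T]] s(2)[OF bt(1)[OF T]] .
    qed
    show "u x = 0" if "x \<notin> U" "x \<notin> (\<Union>T\<in>bt. skin \<Omega> \<T> T)" for x
    proof -
      have n: "\<not> (\<exists>T\<in>bt. x \<in> skin \<Omega> \<T> T)" using that(2) by blast
      show ?thesis unfolding u_def ext_def if_not_P[OF that(1)] if_not_P[OF n] ..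
    qed
    show "u v = 0" if v: "v \<in> mesh_vertices \<T>" "v \<in> frontier U" for v
    proof -
      have vU: "v \<in> U" using v(2) U(2) by (simp add: frontier_def)
      obtain T0 where T0: "T0 \<in> \<T>" "v extreme_point_of T0" using v(1) unfolding mesh_vertices_def by blast
      have vT0: "v \<in> T0" using T0(2) by (simp add: extreme_point_of_def)
      have b0: "bubs d v = 0" for d
      proof (cases "T0 \<in> bt")
        case True
        note t = labD(2)[OF True]
        have "v \<in> {lA T0, lB T0, lC T0}" using tri_extreme[OF t] T0(2) by blast
        then have "bb T0 i v = 0" for i unfolding bb_def bub_def using triD(1-4)[OF t] by auto
        then show ?thesis using bubs_eq[OF T0(1) vT0, of d] by simp
      next
        case False then show ?thesis using bubs_eq[OF T0(1) vT0, of d] by simp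
      qed
      have "\<psi> q v = 0" for q unfolding \<psi>_def using b0 by (cases q) simp
      then have "s v = 0" unfolding s_split sumB0[OF disjI1[OF v(2)]] by simp
      then show ?thesis unfolding u_def ext_U[OF vU] .
    qed
  qed
  have us: "a_h \<nu> b \<T> u v = a_h \<nu> b \<T> s v" if "good v" for v
    by (rule a_h_cong_U[OF gu s(1) that]) (simp only: u_def ext_U)
  have eq: "a_h \<nu> b \<T> u v = t * F v" if v: "v \<in> Vh k \<T>" for v
  proof -
    have "a_h \<nu> b \<T> u v - t * F v = 0"
    proof (rule span[OF v])
      fix v1 v2 a c assume v12: "v1 \<in> Vh k \<T>" "v2 \<in> Vh k \<T>"
      show "a_h \<nu> b \<T> u (\<lambda>x. a * v1 x + c * v2 x) - t * F (\<lambda>x. a * v1 x + c * v2 x) =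
        a * (a_h \<nu> b \<T> u v1 - t * F v1) + c * (a_h \<nu> b \<T> u v2 - t * F v2)"
        unfolding Flin[OF v12] a_h_lin2[OF gu Vh_good[OF v12(1)] Vh_good[OF v12(2)]] by (simp add: algebra_simps)
    next
      fix f assume f: "f \<in> \<B>"
      have m: "Inl f \<in> J" using f unfolding J_def by blast
      have gf': "good f" using B(1) f Vh_good by blast
      show "a_h \<nu> b \<T> u f - t * F f = 0"
        using bspec[OF zt(2) m] unfolding us[OF gf'] s(3)[OF gf'] by (simp add: a_def r_def)
    qed
    then show ?thesis by simp
  qed
  \<comment> \<open>For t = 0 the inf-sup condition makes \<open>u\<close> the zero function.
    Restriction to the boundary edges then kills the bubble coefficients, and independence of the
    basis kills the others, against non-triviality.\<close>
  have t0: "t \<noteq> 0"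
  proof
    assume t: "t = 0"
    have u0: "u = (\<lambda>_. 0)" by (rule Wh_zeroI[OF uW]) (simp add: eq t)
    have s0: "s x = 0" if "x \<in> U" for x using ext_U[OF that, of s] fun_cong[OF u0, of x] unfolding u_def by simp
    have zr: "z (Inr (T, i)) = 0" if T: "T \<in> bt" and i: "i \<le> k - 2" for T i
    proof (rule bubble_coeffs_zero[OF T _ i, of "\<lambda>i. z (Inr (T, i))"])
      fix l :: real assume l: "0 < l" "l < 1"
      define x where "x = lA T + l *\<^sub>R (lB T - lA T)"
      have xT: "x \<in> T" unfolding x_def by (rule tri_edge_point(1)[OF labD(2)[OF T] l])
      have xU: "x \<in> U" using xT bt(1)[OF T] by blast
      have xf: "x \<in> frontier U" using tri_edge_point(2)[OF labD(2)[OF T] l] rel_interior_subset labD(3)[OF T] unfolding x_def by blast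
      show "(\<Sum>i\<le>k-2. z (Inr (T, i)) * bb T i (lA T + l *\<^sub>R (lB T - lA T))) = 0"
        using s0[OF xU] unfolding s_split s_bt[OF T xT] sumB0[OF disjI1[OF xf]] unfolding x_def by simp
    qed
    have zrK: "z (Inr q) = 0" if "q \<in> K" for q using that zr unfolding K_def by auto
    have "(\<Sum>f\<in>\<B>. z (Inl f) * f x) = 0" for x
    proof (cases "x \<in> U")
      case True
      then show ?thesis using s0[OF True] zrK unfolding s_split by simp
    next
      case False
      show ?thesis by (rule sumB0[OF disjI2[OF False]])
    qed
    then have "z (Inl f) = 0" if "f \<in> \<B>" for f using B(4)[of "\<lambda>f. z (Inl f)"] that by blast
    then show False using zt(1) t zrK unfolding J_def by auto
  qed
  \<comment> \<open>Division by t, with a zero summand added so that the lemmas on linear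
    combinations of two functions apply.\<close>
  define u' where "u' = (\<lambda>x. (1 / t) * u x + 0 * u x)"
  have "u' \<in> Wh k \<Omega> \<T>" unfolding u'_def by (rule Wh_lin[OF uW uW])
  moreover have "a_h \<nu> b \<T> u' v = F v" if v: "v \<in> Vh k \<T>" for v
    unfolding u'_def a_h_lin1[OF gu gu Vh_good[OF v]] eq[OF v] using t0 by simp
  moreover have "u1 = u2" if u1: "u1 \<in> Wh k \<Omega> \<T>" "\<forall>v\<in>Vh k \<T>. a_h \<nu> b \<T> u1 v = F v" and u2: "u2 \<in> Wh k \<Omega> \<T>" "\<forall>v\<in>Vh k \<T>. a_h \<nu> b \<T> u2 v = F v" for u1 u2
  proof -
    have "(\<lambda>x. 1 * u1 x + (-1) * u2 x) = (\<lambda>_. 0)"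
    proof (rule Wh_zeroI[OF Wh_lin[OF u1(1) u2(1)]])
      fix v assume v: "v \<in> Vh k \<T>"
      show "a_h \<nu> b \<T> (\<lambda>x. 1 * u1 x + (-1) * u2 x) v = 0"
        unfolding a_h_lin1[OF WhD(1)[OF u1(1)] WhD(1)[OF u2(1)] Vh_good[OF v]] using u1(2) u2(2) v by simp
    qed
    then show ?thesis by (simp add: fun_eq_iff)
  qed
  ultimately show ?thesis by blast
qed

text \<open>Linearity of the integral needs \<open>f * v\<close> integrable: \<open>v\<close> is
  bounded, and |f| \<le> f^2 + 1 on the bounded mesh.\<close>

lemma F_h_linear:
  assumes f: "L2_on (\<Omega> \<union> U) f" and v: "v1 \<in> Vh k \<T>" "v2 \<in> Vh k \<T>"
  shows "F_h f \<T> (\<lambda>x. a * v1 x + c * v2 x) = a * F_h f \<T> v1 + c * F_h f \<T> v2"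
proof -
  have S: "\<Omega> \<union> U \<in> sets lebesgue" using \<Omega>_open U(4) by auto
  have fm: "f \<in> borel_measurable (lebesgue_on (\<Omega> \<union> U))" and f2: "integrable (lebesgue_on (\<Omega> \<union> U)) (\<lambda>x. (f x)\<^sup>2)" using f unfolding L2_on_def by auto
  have fm': "(\<lambda>x. indicator (\<Omega> \<union> U) x * f x) \<in> borel_measurable lebesgue"
    using fm S by (simp add: borel_measurable_restrict_space_iff)
  have f2': "integrable lebesgue (\<lambda>x. indicator (\<Omega> \<union> U) x * (f x)\<^sup>2)"
    using f2 S by (simp add: integrable_restrict_space)
  have i: "integrable lebesgue (\<lambda>x. indicator U x * (f x * v x))" if v: "v \<in> Vh k \<T>" for v
  proof -
    obtain M where M: "M \<ge> 0" "\<And>x. x \<in> U \<Longrightarrow> \<bar>v x\<bar> \<le> M" using cont_bound[OF Vh_props(2)[OF v]] by blast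
    have iU: "integrable lebesgue (\<lambda>x. indicator U x :: real)" using U(5) by (intro integrable_real_indicator) (auto simp: fmeasurable_def)
    show ?thesis
    proof (rule Bochner_Integration.integrable_bound)
      show "integrable lebesgue (\<lambda>x. M * (indicator (\<Omega> \<union> U) x * (f x)\<^sup>2 + indicator U x))" using f2' iU by simp
      have ie: "indicator U x * (f x * v x) = (indicator (\<Omega> \<union> U) x * f x) * (indicator U x * v x)" for x
        by (auto simp: indicator_def)
      show "(\<lambda>x. indicator U x * (f x * v x)) \<in> borel_measurable lebesgue"
        unfolding ie by (rule borel_measurable_times[OF fm' cont_measurable[OF Vh_props(2)[OF v]]])
      show "AE x in lebesgue. norm (indicator U x * (f x * v x)) \<le> norm (M * (indicator (\<Omega> \<union> U) x * (f x)\<^sup>2 + indicator U x))"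
      proof (rule AE_I2)
        fix x
        have "\<bar>f x\<bar> \<le> (f x)\<^sup>2 + 1"
        proof -
          have "0 \<le> (\<bar>f x\<bar> - 1)\<^sup>2" by simp
          then have "2 * \<bar>f x\<bar> \<le> (f x)\<^sup>2 + 1" by (simp add: power2_diff)
          then show ?thesis using abs_ge_zero[of "f x"] by linarith
        qed
        then have "\<bar>f x\<bar> * \<bar>v x\<bar> \<le> ((f x)\<^sup>2 + 1) * M" if "x \<in> U" using M(2)[OF that] by (intro mult_mono) auto
        then show "norm (indicator U x * (f x * v x)) \<le> norm (M * (indicator (\<Omega> \<union> U) x * (f x)\<^sup>2 + indicator U x))"
          using M(1) by (cases "x \<in> U") (auto simp: abs_mult mult.commute indicator_def)
      qed
    qed
  qed
  have e: "F_h f \<T> v = (LINT x|lebesgue. indicator U x * (f x * v x))" for v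
    unfolding F_h_def using U(4) by (simp add: integral_restrict_space)
  have "F_h f \<T> (\<lambda>x. a * v1 x + c * v2 x) = (LINT x|lebesgue. a * (indicator U x * (f x * v1 x)) + c * (indicator U x * (f x * v2 x)))"
    unfolding e by (rule Bochner_Integration.integral_cong) (simp_all add: algebra_simps)
  then show ?thesis unfolding e using i[OF v(1)] i[OF v(2)] by simp
qed

end

section \<open>The theorem\<close>

lemma fitted_vertices:
  assumes fm: "fitted_mesh \<Omega> \<T>" and T: "T \<in> \<T>" and t: "tri A B C p q T"
  shows "A \<in> closure \<Omega>" "B \<in> closure \<Omega>" "C \<in> closure \<Omega>"
proof -
  have "v \<in> closure \<Omega>" if "v \<in> {A, B, C}" for v
  proof -
    have "v \<in> mesh_vertices \<T>" unfolding mesh_vertices_def using tri_extreme[OF t] T that by blast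
    then show ?thesis using fitted_meshD(4,5)[OF fm] by (auto simp: closure_Un_frontier)
  qed
  then show "A \<in> closure \<Omega>" "B \<in> closure \<Omega>" "C \<in> closure \<Omega>" by auto
qed

theorem proposition2p2:
  fixes k :: nat and \<nu> :: real
    and \<Omega> :: "(real^2) set" and b :: "real^2 \<Rightarrow> real^2"
    and \<F> :: "(real^2) set set set"
  assumes "k \<ge> 2" and "\<nu> > 0"
    and "smooth_domain (k - 1) \<Omega>"
    and "Ck_on (k - 1) b \<Omega>" and "\<forall>x\<in>\<Omega>. divergence b x = 0" and "Linf_on UNIV b"
    and "\<forall>\<T>\<in>\<F>. fitted_mesh \<Omega> \<T>" and "uniformly_regular \<F>"
  shows "\<exists>h0>0. \<exists>\<alpha>>0. \<forall>\<T>\<in>\<F>. mesh_size \<T> < h0 \<longrightarrow>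
           (\<forall>f. Hm_on (k - 1) \<Omega> f \<and> L2_on (\<Omega> \<union> \<Union>\<T>) f \<longrightarrow>
              (\<exists>!u. u \<in> Wh k \<Omega> \<T> \<and> (\<forall>v\<in>Vh k \<T>. a_h \<nu> b \<T> u v = F_h f \<T> v))) \<and>
           (\<forall>w\<in>Wh k \<Omega> \<T> - {\<lambda>_. 0}.
              (SUP v\<in>Vh k \<T> - {\<lambda>_. 0}.
                 ereal (a_h \<nu> b \<T> w v / (norm_0h \<T> (grad w) * norm_0h \<T> (grad v)))) \<ge> ereal \<alpha>)"
proof -
  note k2 = assms(1) and \<nu> = assms(2) and sd = assms(3)
  have m: "k - 1 \<ge> 1" and kr: "real k > 0" using k2 by auto
  have \<Omega>: "open \<Omega>" "bounded \<Omega>" using sd unfolding smooth_domain_def by auto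
  obtain \<sigma> where \<sigma>: "\<sigma> > 0" "\<And>\<T> T. \<T> \<in> \<F> \<Longrightarrow> T \<in> \<T> \<Longrightarrow> diameter T \<le> \<sigma> * inscribed_diameter T"
    using assms(8) unfolding uniformly_regular_def by blast
  define \<kappa> where "\<kappa> = 1 / (4 * \<sigma>)"
  have \<kappa>: "\<kappa> > 0" using \<sigma>(1) by (simp add: \<kappa>_def)
  have bm: "b \<in> borel_measurable lebesgue" and "\<exists>B. AE x in lebesgue. norm (b x) \<le> B"
    using assms(6) unfolding Linf_on_def lebesgue_on_UNIV_eq by auto
  then obtain B' where B': "AE x in lebesgue. norm (b x) \<le> B'" by blast
  define B where "B = max B' 0"
  have B0: "B \<ge> 0" by (simp add: B_def)
  have bB: "AE x in lebesgue. norm (b x) \<le> B" using B' by eventually_elim (simp add: B_def)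
  \<comment> \<open>All mesh vertices lie in the closure of \<Omega>, so one disc contains every
    mesh and the Poincare constant is uniform.\<close>
  have "bounded (closure \<Omega>)" by (rule bounded_closure[OF \<Omega>(2)])
  then obtain R where R0: "R > 0" and R: "closure \<Omega> \<subseteq> cball 0 R"
    unfolding bounded_pos by (auto simp: subset_iff)
  \<comment> \<open>Chosen so that the perturbation bound in \<open>inf_sup\<close> is exactly an
    eighth of \<nu> when \<theta> = q^2.\<close>
  define q where "q = \<nu> / (8 * (\<nu> + 3 * R * B))"
  have c0: "\<nu> + 3 * R * B \<ge> \<nu>" using R0 B0 by simp
  have cp: "\<nu> + 3 * R * B > 0" using c0 \<nu> by linarith
  have q0: "q > 0" using cp \<nu> by (simp add: q_def)
  have q1: "q \<le> 1 / 8" using cp c0 \<nu> by (simp add: q_def field_simps)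
  have qc: "(\<nu> + 3 * R * B) * q = \<nu> / 8" using cp by (simp add: q_def field_simps)
  define \<theta> where "\<theta> = q\<^sup>2"
  have \<theta>: "0 \<le> \<theta>" "\<theta> \<le> 1 / 4" "(\<nu> + 3 * R * B) * sqrt \<theta> \<le> \<nu> / 8"
  proof -
    show "0 \<le> \<theta>" by (simp add: \<theta>_def)
    have "q\<^sup>2 \<le> (1 / 2)\<^sup>2" using q0 q1 by (intro power_mono) auto
    then show "\<theta> \<le> 1 / 4" by (simp add: \<theta>_def power2_eq_square)
    show "(\<nu> + 3 * R * B) * sqrt \<theta> \<le> \<nu> / 8" using qc q0 by (simp add: \<theta>_def)
  qed
  obtain C where C0: "C \<ge> 0" and C: "\<forall>A B O' p q T d \<eta> f. tri A B O' p q T \<and> d > 0 \<and> (\<exists>c. cball c (\<kappa> * d) \<subseteq> T) \<and>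
      (\<forall>x\<in>T. \<forall>y\<in>T. norm (x - y) \<le> d) \<and> f \<in> Pk k \<and> f A = 0 \<and> f B = 0 \<and> 0 \<le> \<eta> \<and> \<eta> \<le> 1 \<and>
      (\<forall>j\<in>{1..k - 1}. \<exists>P. f P = 0 \<and> dist (A + (real j / real k) *\<^sub>R (B - A)) P \<le> \<eta> * d) \<longrightarrow>
    (\<exists>r. (\<forall>s. f (A + s *\<^sub>R (B - A)) = (\<Sum>i\<le>k - 2. r i * bub A p q i (A + s *\<^sub>R (B - A)))) \<and>
      (LINT x|lebesgue. indicator T x * (norm (grad (\<lambda>x. \<Sum>i\<le>k - 2. r i * bub A p q i x) x))\<^sup>2)
        \<le> C * \<eta>\<^sup>2 * (LINT x|lebesgue. indicator T x * (norm (grad f x))\<^sup>2))"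
    using bubble_correction[OF k2 \<kappa>] by (elim exE conjE) (rule that)
  \<comment> \<open>Yields C \<eta>^2 \<le> q^2, since C \<le> (C + 1)^2. It depends on \<nu>,
    \<open>R\<close>, \<open>B\<close>, \<open>k\<close> and \<kappa> only, so it can be handed to
    \<open>boundary_geometry\<close> before any mesh is chosen.\<close>
  define \<eta> where "\<eta> = q / (C + 1)"
  have \<eta>: "\<eta> > 0" "\<eta> \<le> 1" "C * \<eta>\<^sup>2 \<le> \<theta>"
  proof -
    show "\<eta> > 0" using q0 C0 by (simp add: \<eta>_def)
    have "q / (C + 1) \<le> q / 1" using q0 C0 by (intro divide_left_mono) auto
    then show "\<eta> \<le> 1" using q1 by (simp add: \<eta>_def)
    have "C * \<eta>\<^sup>2 = (C / (C + 1)\<^sup>2) * q\<^sup>2" by (simp add: \<eta>_def power_divide)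
    moreover have "C / (C + 1)\<^sup>2 \<le> 1"
    proof -
      have "C \<le> (C + 1)\<^sup>2" using C0 by (simp add: power2_sum)
      then show ?thesis by (rule divide_le_eq_1_pos[THEN iffD2, rotated]) (use C0 in simp)
    qed
    ultimately show "C * \<eta>\<^sup>2 \<le> \<theta>" using mult_right_mono[of "C / (C + 1)\<^sup>2" 1 "q\<^sup>2"] by (simp add: \<theta>_def)
  qed
  obtain h1 where h1: "h1 > 0" "\<forall>\<T>. fitted_mesh \<Omega> \<T> \<and> mesh_geom \<Omega> \<T> \<kappa> (mesh_size \<T>) \<and> mesh_size \<T> < h1 \<longrightarrow>
    (\<forall>T\<in>boundary_triangles \<T>. skin \<Omega> \<T> T \<inter> \<Union>\<T> \<subseteq> T) \<and>
    (\<forall>T\<in>boundary_triangles \<T>. \<forall>T'\<in>boundary_triangles \<T>. T \<noteq> T' \<longrightarrow> skin \<Omega> \<T> T \<inter> skin \<Omega> \<T> T' \<subseteq> \<Union>\<T>) \<and>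
    (\<forall>T A B C p q lam. labelled \<T> T A B C p q \<and> 1 / real k \<le> lam \<and> lam \<le> 1 - 1 / real k \<longrightarrow>
      (\<exists>P\<in>skin \<Omega> \<T> T. (\<forall>Q. nearest_intersection (frontier \<Omega>) C (A + lam *\<^sub>R (B - A)) Q \<longleftrightarrow> Q = P) \<and>
         dist (A + lam *\<^sub>R (B - A)) P \<le> \<eta> * diameter T))"
    using boundary_geometry[OF sd m \<kappa> kr \<eta>(1)] by (elim exE conjE) (rule that)
  have \<nu>4: "\<nu> / 4 > 0" using \<nu> by simp
  obtain h2 where h2: "h2 > 0" "\<forall>v. tame v \<and> (\<forall>x. v x \<noteq> 0 \<longrightarrow> (\<exists>y\<in>closure \<Omega>. dist x y \<le> h2)) \<longrightarrow>
      \<bar>LINT x|lebesgue. (b x \<bullet> grad v x) * v x\<bar> \<le> \<nu> / 4 * (LINT x|lebesgue. (norm (grad v x))\<^sup>2)"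
    using convection_form_small[OF sd m assms(4,5) bm bB \<nu>4] by (elim exE conjE) (rule that)
  show ?thesis
  \<comment> \<open>\<open>h1\<close> makes the bubble correction small and \<open>h2\<close> the
    convection form on \<open>Vh\<close>; like \<nu>/4, neither depends on the mesh.\<close>
  proof (rule exI[of _ "min h1 h2"], rule conjI[rotated], rule exI[of _ "\<nu> / 4"], intro conjI ballI allI impI \<nu>4)
    fix \<T> assume \<T>: "\<T> \<in> \<F>" and "mesh_size \<T> < min h1 h2"
    then have small: "mesh_size \<T> < h1" "mesh_size \<T> < h2" by auto
    have fm: "fitted_mesh \<Omega> \<T>" using assms(7) \<T> by blast
    have mg: "mesh_geom \<Omega> \<T> \<kappa> (mesh_size \<T>)" unfolding \<kappa>_def by (rule fitted_mesh_geom[OF fm \<Omega>(1) \<sigma>(1) \<sigma>(2)[OF \<T>]])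
    have UR: "\<Union>\<T> \<subseteq> cball 0 R"
    proof
      fix x assume "x \<in> \<Union>\<T>"
      then obtain T where T: "T \<in> \<T>" "x \<in> T" by blast
      obtain A B C p q where t: "tri A B C p q T" using tmeshD(2)[OF mesh_geom.tm[OF mg] T(1)] by blast
      have "convex hull {A, B, C} \<subseteq> cball 0 R" by (rule hull_minimal) (use fitted_vertices[OF fm T(1) t] R in auto)
      then show "x \<in> cball 0 R" using T(2) triD(6)[OF t] by blast
    qed
    interpret fe_form \<Omega> \<T> \<kappa> "mesh_size \<T>" k \<nu> b B R
      by (rule fe_form.intro[OF fe_mesh.intro[OF mg fe_mesh_axioms.intro[OF fm k2]] fe_form_axioms.intro[OF \<nu> bm bB B0 R0 UR]])
    note bg = mp[OF spec[OF h1(2)] conjI[OF fm conjI[OF mg small(1)]]]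
    note bg1 = conjunct1[OF bg] and bg2 = conjunct1[OF conjunct2[OF bg]] and bg3 = conjunct2[OF conjunct2[OF bg]]
    interpret fe_geo \<Omega> \<T> \<kappa> "mesh_size \<T>" k \<nu> b B R \<theta>
    proof
      show "skin \<Omega> \<T> T \<inter> \<Union>\<T> \<subseteq> T" if "T \<in> boundary_triangles \<T>" for T by (rule bspec[OF bg1 that])
      show "skin \<Omega> \<T> T \<inter> skin \<Omega> \<T> T' \<subseteq> \<Union>\<T>" if "T \<in> boundary_triangles \<T>" "T' \<in> boundary_triangles \<T>" "T \<noteq> T'" for T T'
        by (rule mp[OF bspec[OF bspec[OF bg2 that(1)] that(2)] that(3)])
      have node: "\<exists>P\<in>skin \<Omega> \<T> T. (\<forall>Q. nearest_intersection (frontier \<Omega>) C (A + (real j / real k) *\<^sub>R (B' - A)) Q \<longleftrightarrow> Q = P) \<and>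
         dist (A + (real j / real k) *\<^sub>R (B' - A)) P \<le> \<eta> * diameter T" if "labelled \<T> T A B' C p q" "j \<in> {1..k-1}" for T A B' C p q j
        by (rule bg3[rule_format, OF conjI[OF that(1) conjI[OF division_ratio(1,2)[OF k2 that(2)]]]])
      show "\<exists>P\<in>skin \<Omega> \<T> T. \<forall>Q. nearest_intersection (frontier \<Omega>) C (A + (real j / real k) *\<^sub>R (B' - A)) Q \<longleftrightarrow> Q = P"
        if "labelled \<T> T A B' C p q" "j \<in> {1..k-1}" for T A B' C p q j
        using node[OF that] by (elim bexE conjE) (rule bexI)
      show "0 \<le> \<theta>" "\<theta> \<le> 1 / 4" "(\<nu> + 3 * R * B) * sqrt \<theta> \<le> \<nu> / 8" by (rule \<theta>)+
      show "\<exists>r. (\<forall>s. f (A + s *\<^sub>R (B' - A)) = (\<Sum>i\<le>k-2. r i * bub A p q i (A + s *\<^sub>R (B' - A)))) \<and>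
        (LINT x|lebesgue. indicator T x * (norm (grad (\<lambda>x. \<Sum>i\<le>k-2. r i * bub A p q i x) x))\<^sup>2)
          \<le> \<theta> * (LINT x|lebesgue. indicator T x * (norm (grad f x))\<^sup>2)"
        if l: "labelled \<T> T A B' C' p q" and f: "f \<in> Pk k" "f A = 0" "f B' = 0"
          and z: "\<And>j P. j \<in> {1..k-1} \<Longrightarrow> P \<in> skin \<Omega> \<T> T \<Longrightarrow> nearest_intersection (frontier \<Omega>) C' (A + (real j / real k) *\<^sub>R (B' - A)) P \<Longrightarrow> f P = 0"
        for T A B' C' p q f
      proof -
        note lD = labelledD(1,2)[OF l]
        have nodes: "\<forall>j\<in>{1..k - 1}. \<exists>P. f P = 0 \<and> dist (A + (real j / real k) *\<^sub>R (B' - A)) P \<le> \<eta> * diameter T"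
        proof
          fix j assume j: "j \<in> {1..k-1}"
          obtain P where P: "P \<in> skin \<Omega> \<T> T" "\<forall>Q. nearest_intersection (frontier \<Omega>) C' (A + (real j / real k) *\<^sub>R (B' - A)) Q \<longleftrightarrow> Q = P"
            "dist (A + (real j / real k) *\<^sub>R (B' - A)) P \<le> \<eta> * diameter T" using node[OF l j] by (elim bexE conjE) (rule that)
          have "f P = 0" by (rule z[OF j P(1)]) (use P(2) in blast)
          then show "\<exists>P. f P = 0 \<and> dist (A + (real j / real k) *\<^sub>R (B' - A)) P \<le> \<eta> * diameter T" using P(3) by blast
        qed
        have diam: "\<forall>x\<in>T. \<forall>y\<in>T. norm (x - y) \<le> diameter T" using diam_dist[OF lD(1)] by blast
        have "tri A B' C' p q T \<and> diameter T > 0 \<and> (\<exists>c. cball c (\<kappa> * diameter T) \<subseteq> T) \<and>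
          (\<forall>x\<in>T. \<forall>y\<in>T. norm (x - y) \<le> diameter T) \<and> f \<in> Pk k \<and> f A = 0 \<and> f B' = 0 \<and> 0 \<le> \<eta> \<and> \<eta> \<le> 1 \<and>
          (\<forall>j\<in>{1..k - 1}. \<exists>P. f P = 0 \<and> dist (A + (real j / real k) *\<^sub>R (B' - A)) P \<le> \<eta> * diameter T)"
          using lD(2) diam_pos[OF lD(1)] shape[OF lD(1)] diam f \<eta>(1,2) nodes by (intro conjI) (assumption | erule less_imp_le)+
        from mp[OF C[THEN spec, THEN spec, THEN spec, THEN spec, THEN spec, THEN spec, THEN spec, THEN spec, THEN spec] this] have "\<exists>r. (\<forall>s. f (A + s *\<^sub>R (B' - A)) = (\<Sum>i\<le>k-2. r i * bub A p q i (A + s *\<^sub>R (B' - A)))) \<and>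
          (LINT x|lebesgue. indicator T x * (norm (grad (\<lambda>x. \<Sum>i\<le>k-2. r i * bub A p q i x) x))\<^sup>2)
          \<le> C * \<eta>\<^sup>2 * (LINT x|lebesgue. indicator T x * (norm (grad f x))\<^sup>2)" .
        then obtain r where r: "\<forall>s. f (A + s *\<^sub>R (B' - A)) = (\<Sum>i\<le>k-2. r i * bub A p q i (A + s *\<^sub>R (B' - A)))"
          "(LINT x|lebesgue. indicator T x * (norm (grad (\<lambda>x. \<Sum>i\<le>k-2. r i * bub A p q i x) x))\<^sup>2)
          \<le> C * \<eta>\<^sup>2 * (LINT x|lebesgue. indicator T x * (norm (grad f x))\<^sup>2)" by (elim exE conjE) (rule that)
        have "0 \<le> (LINT x|lebesgue. indicator T x * (norm (grad f x))\<^sup>2)"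
          by (intro Bochner_Integration.integral_nonneg) simp
        from mult_right_mono[OF \<eta>(3) this] r show ?thesis by (intro exI[of _ r] conjI) (assumption | erule order_trans)+
      qed
      show "\<bar>cf v v\<bar> \<le> \<nu> / 4 * en v" if v: "v \<in> Vh k \<T>" for v
      proof -
        \<comment> \<open>A test function lives on the mesh, every point of which is within one
          diameter of a vertex and hence of the closure of \<Omega>.\<close>
        have "\<exists>y\<in>closure \<Omega>. dist x y \<le> h2" if "v x \<noteq> 0" for x
        proof -
          have "x \<in> \<Union>\<T>" using Vh_props(4)[OF v] that by blast
          then obtain T where T: "T \<in> \<T>" "x \<in> T" by blast
          obtain A B C p q where t: "tri A B C p q T" using tmeshD(2)[OF tm T(1)] by blast
          have "dist x A \<le> diameter T" unfolding dist_norm by (rule diam_dist[OF T]) (use tri_vertices_mem[OF t] in blast)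
          also have "\<dots> \<le> h2" using size[OF T(1)] small(2) by linarith
          finally show ?thesis using fitted_vertices(1)[OF fm T(1) t] by blast
        qed
        then have "\<bar>LINT x|lebesgue. (b x \<bullet> grad v x) * v x\<bar> \<le> \<nu> / 4 * (LINT x|lebesgue. (norm (grad v x))\<^sup>2)"
          using h2(2) Vh_tame[OF v] by blast
        moreover have "cf v v = (LINT x|lebesgue. (b x \<bullet> grad v x) * v x)"
          unfolding cf_def
        proof (rule Bochner_Integration.integral_cong[OF refl])
          show "indicator (\<Union>\<T>) x * ((b x \<bullet> grad v x) * v x) = (b x \<bullet> grad v x) * v x" for x
          proof (cases "x \<in> \<Union>\<T>")
            case False
            then have "v x = 0" by (rule Vh_props(4)[OF v])
            then show ?thesis by simp
          qed simp
        qed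
        ultimately show ?thesis unfolding Vh_en[OF v] by simp
      qed
    qed
    show "\<exists>!u. u \<in> Wh k \<Omega> \<T> \<and> (\<forall>v\<in>Vh k \<T>. a_h \<nu> b \<T> u v = F_h f \<T> v)"
      if "Hm_on (k - 1) \<Omega> f \<and> L2_on (\<Omega> \<union> \<Union>\<T>) f" for f
      by (rule solvable, rule F_h_linear) (use that in blast)
    fix w assume "w \<in> Wh k \<Omega> \<T> - {\<lambda>_. 0}"
    then have w: "w \<in> Wh k \<Omega> \<T>" "w \<noteq> (\<lambda>_. 0)" by auto
    obtain v where v: "v \<in> Vh k \<T>" "v \<noteq> (\<lambda>_. 0)" "\<nu> / 4 * (sqrt (en w) * sqrt (en v)) \<le> a_h \<nu> b \<T> w v" "en w > 0" "en v > 0"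
      by (rule inf_sup[OF w])
    have "\<nu> / 4 \<le> a_h \<nu> b \<T> w v / (norm_0h \<T> (grad w) * norm_0h \<T> (grad v))"
      unfolding norm_0h_en using v(3-5) by (simp add: pos_le_divide_eq)
    then show "ereal (\<nu> / 4) \<le> (SUP v\<in>Vh k \<T> - {\<lambda>_. 0}. ereal (a_h \<nu> b \<T> w v / (norm_0h \<T> (grad w) * norm_0h \<T> (grad v))))"
      using v(1,2) by (intro SUP_upper2[of v]) auto
  qed (use h1(1) h2(1) in simp)
qed

end
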